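(* Let $\tau$ be a partition of $n$ and let $c$ be a real number not of the form $r/m$ with $r,m$ coprime integers and $2\le m\le n$. Then there is a polynomial $p(t;c,\tau)$ in $t$, depending on $c$ and $\tau$, such that $$ch_s(M_c(\tau))=\frac{p(t;c,\tau)}{(1-t)^n}.$$
   Context: $\mathbb{H}_c$ ($n\ge2$) is the rational Cherednik algebra for $W=S_n$, $\mathfrak h=\mathbb{C}^n$: it is generated by $\mathbb{C}S_n$ and $x_1,\dots,x_n,y_1,\dots,y_n$, where the $x_i$ commute, the $y_i$ commute, $wx_iw^{-1}=x_{w(i)}$, $wy_iw^{-1}=y_{w(i)}$, $y_ix_j-x_jy_i=c\,s_{ij}$ for $i\ne j$, and $y_ix_i-x_iy_i=1-c\sum_{j\neq i}s_{ij}$ ($s_{ij}$ the transposition). For a partition $\tau$ of $n$, viewed as an irreducible representation of $S_n$ ($(n)$ trivial, $(1^n)$ sign), $M_c(\tau)$ is the $\mathbb{H}_c$-module induced from $\tau$ on which all $y_i$ act by $0$; as a vector space it is $\mathbb{C}[x_1,\dots,x_n]\otimes\tau$, graded by polynomial degree. It has a nondegenerate contravariant Hermitian form $\langle\cdot,\cdot\rangle$ ($S_n$-invariant, with $\langle x_iu,v\rangle=\langle u,y_iv\rangle$), unique up to scaling, normalized to be positive definite on $\tau$ in degree $0$. The signature character is the formal power series $ch_s(M_c(\tau))=\sum_{m\ge0}t^m s_m$, where $s_m$ is the number of positive minus the number of negative eigenvalues of the form on the degree $m$ part. *)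

theory Defs
  imports
    "HOL-Library.Function_Algebras"
    "HOL-Combinatorics.Permutations"
    "HOL-Computational_Algebra.Polynomial_FPS"
    "Jordan_Normal_Form.Char_Poly"
begin

section \<open>Partitions and Specht modules\<close>

definition is_partition :: "nat \<Rightarrow> nat list \<Rightarrow> bool" where
  "is_partition n \<tau> \<longleftrightarrow> sorted_wrt (\<ge>) \<tau> \<and> (\<forall>k\<in>set \<tau>. 0 < k) \<and> sum_list \<tau> = n"

definition cells :: "nat list \<Rightarrow> (nat \<times> nat) set" where
  "cells \<tau> = {(i, j). i < length \<tau> \<and> j < \<tau> ! i}"

definition tableau :: "nat \<Rightarrow> nat list \<Rightarrow> (nat \<times> nat \<Rightarrow> nat) \<Rightarrow> bool" where
  "tableau n \<tau> T \<longleftrightarrow> bij_betw T (cells \<tau>) {1..n}"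

text \<open>
  The tabloid of a tableau \<open>T\<close> (its class up to permutations within the rows) is encoded by the
  function that sends an entry \<open>k \<in> {1..n}\<close> to the index of its row; it is \<open>0\<close> outside \<open>{1..n}\<close>.
  A vector of the tabloid module is a function on such row functions, and the vector
  attached to the single tabloid \<open>r\<close> is the indicator function of \<open>r\<close>.
\<close>

type_synonym tabvec = "(nat \<Rightarrow> nat) \<Rightarrow> complex"

definition tabloid :: "nat \<Rightarrow> nat list \<Rightarrow> (nat \<times> nat \<Rightarrow> nat) \<Rightarrow> nat \<Rightarrow> nat" where
  "tabloid n \<tau> T k = (if k \<in> {1..n} then fst (inv_into (cells \<tau>) T k) else 0)"

definition column_stabilizer ::
  "nat \<Rightarrow> nat list \<Rightarrow> (nat \<times> nat \<Rightarrow> nat) \<Rightarrow> (nat \<Rightarrow> nat) set" where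
  "column_stabilizer n \<tau> T =
     {\<sigma>. \<sigma> permutes {1..n} \<and>
         (\<forall>k\<in>{1..n}. snd (inv_into (cells \<tau>) T (\<sigma> k)) = snd (inv_into (cells \<tau>) T k))}"

text \<open>
  A permutation \<open>w\<close> moves the tabloid with row function \<open>r\<close> to the one with row function
  \<open>r \<circ> inv w\<close>; by linear extension, \<open>(w f) r = f (r \<circ> w)\<close>.
\<close>

definition tab_act :: "(nat \<Rightarrow> nat) \<Rightarrow> tabvec \<Rightarrow> tabvec" where
  "tab_act w f = (\<lambda>r. f (r \<circ> w))"

definition tab_scale :: "complex \<Rightarrow> tabvec \<Rightarrow> tabvec" where
  "tab_scale a f = (\<lambda>r. a * f r)"

definition polytabloid :: "nat \<Rightarrow> nat list \<Rightarrow> (nat \<times> nat \<Rightarrow> nat) \<Rightarrow> tabvec" where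
  "polytabloid n \<tau> T =
     (\<lambda>r. \<Sum>\<sigma>\<in>column_stabilizer n \<tau> T.
        of_int (sign \<sigma>) * (if r = tabloid n \<tau> T \<circ> inv_into UNIV \<sigma> then 1 else 0))"

text \<open>
  The irreducible representation of \<open>S\<^sub>n\<close> attached to \<open>\<tau>\<close>; with James' conventions \<open>[n]\<close> gives the
  trivial representation and \<open>[1, \<dots>, 1]\<close> the sign representation.
\<close>

definition specht :: "nat \<Rightarrow> nat list \<Rightarrow> tabvec set" where
  "specht n \<tau> = Modules.module.span tab_scale {polytabloid n \<tau> T | T. tableau n \<tau> T}"


section \<open>Modules over the rational Cherednik algebra\<close>

text \<open>
  As the algebra is given by generators and relations, a module over it is a complex vector space
  with operators that satisfy the relations. \<open>Wop\<close> matters only at permutations of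
  \<open>{1..n}\<close>, and \<open>Xop\<close>, \<open>Yop\<close> only at indices in \<open>{1..n}\<close>.
\<close>

record 'm hc_struct =
  scl :: "complex \<Rightarrow> 'm \<Rightarrow> 'm"
  Wop :: "(nat \<Rightarrow> nat) \<Rightarrow> 'm \<Rightarrow> 'm"
  Xop :: "nat \<Rightarrow> 'm \<Rightarrow> 'm"
  Yop :: "nat \<Rightarrow> 'm \<Rightarrow> 'm"

definition cherednik_module :: "nat \<Rightarrow> real \<Rightarrow> 'm::ab_group_add hc_struct \<Rightarrow> bool" where
  "cherednik_module n c M \<longleftrightarrow>
     vector_space (scl M) \<and>
     (\<forall>w. w permutes {1..n} \<longrightarrow> Vector_Spaces.linear (scl M) (scl M) (Wop M w)) \<and>
     (\<forall>i\<in>{1..n}. Vector_Spaces.linear (scl M) (scl M) (Xop M i)) \<and>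
     (\<forall>i\<in>{1..n}. Vector_Spaces.linear (scl M) (scl M) (Yop M i)) \<and>
     (\<forall>u. Wop M id u = u) \<and>
     (\<forall>v w u. v permutes {1..n} \<longrightarrow> w permutes {1..n} \<longrightarrow>
        Wop M (v \<circ> w) u = Wop M v (Wop M w u)) \<and>
     (\<forall>i\<in>{1..n}. \<forall>j\<in>{1..n}. \<forall>u. Xop M i (Xop M j u) = Xop M j (Xop M i u)) \<and>
     (\<forall>i\<in>{1..n}. \<forall>j\<in>{1..n}. \<forall>u. Yop M i (Yop M j u) = Yop M j (Yop M i u)) \<and>
     (\<forall>w. w permutes {1..n} \<longrightarrow>
        (\<forall>i\<in>{1..n}. \<forall>u. Wop M w (Xop M i (Wop M (inv_into UNIV w) u)) = Xop M (w i) u)) \<and>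
     (\<forall>w. w permutes {1..n} \<longrightarrow>
        (\<forall>i\<in>{1..n}. \<forall>u. Wop M w (Yop M i (Wop M (inv_into UNIV w) u)) = Yop M (w i) u)) \<and>
     (\<forall>i\<in>{1..n}. \<forall>j\<in>{1..n}. i \<noteq> j \<longrightarrow>
        (\<forall>u. Yop M i (Xop M j u) - Xop M j (Yop M i u) =
             scl M (of_real c) (Wop M (transpose i j) u))) \<and>
     (\<forall>i\<in>{1..n}. \<forall>u. Yop M i (Xop M i u) - Xop M i (Yop M i u) =
        u - scl M (of_real c) (\<Sum>j\<in>{1..n} - {i}. Wop M (transpose i j) u))"


section \<open>The standard module\<close>

definition exponents :: "nat \<Rightarrow> (nat \<Rightarrow> nat) set" where
  "exponents n = {a. \<forall>i. i \<notin> {1..n} \<longrightarrow> a i = 0}"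

text \<open>The action of the monomial \<open>x\<^sub>1 ^ a 1 \<cdot> \<dots> \<cdot> x\<^sub>n ^ a n\<close>.\<close>

definition x_monomial :: "nat \<Rightarrow> 'm hc_struct \<Rightarrow> (nat \<Rightarrow> nat) \<Rightarrow> 'm \<Rightarrow> 'm" where
  "x_monomial n M a u = foldr (\<lambda>i. Xop M i ^^ a i) [1..<n + 1] u"

text \<open>
  \<open>\<complex>[x\<^sub>1, \<dots>, x\<^sub>n] \<otimes> \<tau>\<close>, as polynomials with coefficients in the Specht module:
  \<open>F\<close> stands for the sum of \<open>x\<^sup>a \<otimes> F a\<close> over all exponents \<open>a\<close>.
\<close>

definition poly_tensor :: "nat \<Rightarrow> nat list \<Rightarrow> ((nat \<Rightarrow> nat) \<Rightarrow> tabvec) set" where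
  "poly_tensor n \<tau> =
     {F. finite {a. F a \<noteq> 0} \<and> (\<forall>a. F a \<in> specht n \<tau>) \<and> (\<forall>a. a \<notin> exponents n \<longrightarrow> F a = 0)}"

definition tensor_map ::
  "nat \<Rightarrow> 'm::ab_group_add hc_struct \<Rightarrow> (tabvec \<Rightarrow> 'm) \<Rightarrow> ((nat \<Rightarrow> nat) \<Rightarrow> tabvec) \<Rightarrow> 'm" where
  "tensor_map n M \<iota> F = (\<Sum>a | F a \<noteq> 0. x_monomial n M a (\<iota> (F a)))"

definition equivariant_y_null ::
  "nat \<Rightarrow> nat list \<Rightarrow> 'm::ab_group_add hc_struct \<Rightarrow> (tabvec \<Rightarrow> 'm) \<Rightarrow> bool" where
  "equivariant_y_null n \<tau> M \<iota> \<longleftrightarrow>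
     (\<forall>u\<in>specht n \<tau>. \<forall>v\<in>specht n \<tau>. \<iota> (u + v) = \<iota> u + \<iota> v) \<and>
     (\<forall>a. \<forall>v\<in>specht n \<tau>. \<iota> (tab_scale a v) = scl M a (\<iota> v)) \<and>
     (\<forall>w. w permutes {1..n} \<longrightarrow> (\<forall>v\<in>specht n \<tau>. Wop M w (\<iota> v) = \<iota> (tab_act w v))) \<and>
     (\<forall>i\<in>{1..n}. \<forall>v\<in>specht n \<tau>. Yop M i (\<iota> v) = 0)"

text \<open>
  \<open>(M, \<iota>)\<close> is the standard module \<open>M\<^sub>c(\<tau>)\<close> with its embedded copy \<open>\<iota>\<close> of \<open>\<tau>\<close>: as a vector space,
  \<open>M\<close> is \<open>\<complex>[x\<^sub>1, \<dots>, x\<^sub>n] \<otimes> \<tau>\<close> with the \<open>x\<^sub>i\<close> acting by multiplication, and the \<open>y\<^sub>i\<close> kill \<open>1 \<otimes> \<tau>\<close>.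
  Theorem \<open>standard_module_universal\<close> below shows that it is the module induced from \<open>\<tau>\<close>, so it is
  unique up to unique isomorphism.
\<close>

definition standard_module ::
  "nat \<Rightarrow> real \<Rightarrow> nat list \<Rightarrow> 'm::ab_group_add hc_struct \<Rightarrow> (tabvec \<Rightarrow> 'm) \<Rightarrow> bool" where
  "standard_module n c \<tau> M \<iota> \<longleftrightarrow>
     cherednik_module n c M \<and> equivariant_y_null n \<tau> M \<iota> \<and>
     bij_betw (tensor_map n M \<iota>) (poly_tensor n \<tau>) UNIV"

definition degree_part ::
  "nat \<Rightarrow> nat list \<Rightarrow> 'm::ab_group_add hc_struct \<Rightarrow> (tabvec \<Rightarrow> 'm) \<Rightarrow> nat \<Rightarrow> 'm set" where
  "degree_part n \<tau> M \<iota> m =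
     tensor_map n M \<iota> ` {F \<in> poly_tensor n \<tau>. \<forall>a. F a \<noteq> 0 \<longrightarrow> (\<Sum>i\<in>{1..n}. a i) = m}"


subsection \<open>Universal property of the standard module\<close>

definition hc_hom ::
  "nat \<Rightarrow> 'm::ab_group_add hc_struct \<Rightarrow> 'k::ab_group_add hc_struct \<Rightarrow> ('m \<Rightarrow> 'k) \<Rightarrow> bool" where
  "hc_hom n M N h \<longleftrightarrow>
     Vector_Spaces.linear (scl M) (scl N) h \<and>
     (\<forall>w. w permutes {1..n} \<longrightarrow> (\<forall>u. h (Wop M w u) = Wop N w (h u))) \<and>
     (\<forall>i\<in>{1..n}. \<forall>u. h (Xop M i u) = Xop N i (h u)) \<and>
     (\<forall>i\<in>{1..n}. \<forall>u. h (Yop M i u) = Yop N i (h u))"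

lemma vector_space_tab_scale: "vector_space tab_scale"
  by unfold_locales (auto simp: tab_scale_def fun_eq_iff algebra_simps)

lemma
  shows specht_zero: "0 \<in> specht n \<tau>"
    and specht_add: "\<And>u v. u \<in> specht n \<tau> \<Longrightarrow> v \<in> specht n \<tau> \<Longrightarrow> u + v \<in> specht n \<tau>"
    and specht_scale: "\<And>a u. u \<in> specht n \<tau> \<Longrightarrow> tab_scale a u \<in> specht n \<tau>"
proof -
  interpret T: vector_space tab_scale by (rule vector_space_tab_scale)
  show "0 \<in> specht n \<tau>"
    unfolding specht_def by (rule T.span_zero)
  show "u + v \<in> specht n \<tau>" if "u \<in> specht n \<tau>" "v \<in> specht n \<tau>" for u v
    using that unfolding specht_def by (rule T.span_add)
  show "tab_scale a u \<in> specht n \<tau>" if "u \<in> specht n \<tau>" for a u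
    using that unfolding specht_def by (rule T.span_scale)
qed

lemma linear_add:
  assumes "Vector_Spaces.linear s t f"
  shows "f (u + v) = f u + f v"
proof -
  interpret Vector_Spaces.linear s t f by (rule assms)
  show ?thesis by (rule add)
qed

lemma linear_scl:
  assumes "Vector_Spaces.linear s t f"
  shows "f (s a v) = t a (f v)"
proof -
  interpret Vector_Spaces.linear s t f by (rule assms)
  show ?thesis by (rule scale)
qed

lemma linear_null:
  assumes "Vector_Spaces.linear s t f"
  shows "f 0 = 0"
proof -
  interpret Vector_Spaces.linear s t f by (rule assms)
  show ?thesis by (rule zero)
qed

lemma linear_setsum:
  assumes "Vector_Spaces.linear s t f"
  shows "f (sum g A) = (\<Sum>x\<in>A. f (g x))"
proof -
  interpret Vector_Spaces.linear s t f by (rule assms)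
  show ?thesis by (rule sum)
qed

lemma linear_minus:
  assumes "Vector_Spaces.linear s t f"
  shows "f (u - v) = f u - f v"
proof -
  interpret Vector_Spaces.linear s t f by (rule assms)
  show ?thesis by (rule diff)
qed

lemma linearI':
  assumes "vector_space s" "vector_space t"
    and "\<And>u v. f (u + v) = f u + f v" "\<And>a v. f (s a v) = t a (f v)"
  shows "Vector_Spaces.linear s t f"
proof -
  show ?thesis
    unfolding Vector_Spaces.linear_iff using assms by blast
qed

lemma upt_subset: "set [1..<n + 1] \<subseteq> {1..n}"
  by auto

lemma cherednik_moduleD:
  assumes "cherednik_module n c M"
  shows "vector_space (scl M)"
    and "\<And>w. w permutes {1..n} \<Longrightarrow> Vector_Spaces.linear (scl M) (scl M) (Wop M w)"
    and "\<And>i. i \<in> {1..n} \<Longrightarrow> Vector_Spaces.linear (scl M) (scl M) (Xop M i)"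
    and "\<And>i. i \<in> {1..n} \<Longrightarrow> Vector_Spaces.linear (scl M) (scl M) (Yop M i)"
    and "\<And>u. Wop M id u = u"
    and "\<And>v w u. v permutes {1..n} \<Longrightarrow> w permutes {1..n} \<Longrightarrow>
           Wop M (v \<circ> w) u = Wop M v (Wop M w u)"
    and "\<And>i j u. i \<in> {1..n} \<Longrightarrow> j \<in> {1..n} \<Longrightarrow> Xop M i (Xop M j u) = Xop M j (Xop M i u)"
    and "\<And>w i u. w permutes {1..n} \<Longrightarrow> i \<in> {1..n} \<Longrightarrow>
           Wop M w (Xop M i (Wop M (inv_into UNIV w) u)) = Xop M (w i) u"
    and "\<And>i j u. i \<in> {1..n} \<Longrightarrow> j \<in> {1..n} \<Longrightarrow> i \<noteq> j \<Longrightarrow>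
           Yop M i (Xop M j u) - Xop M j (Yop M i u) =
           scl M (of_real c) (Wop M (transpose i j) u)"
    and "\<And>i u. i \<in> {1..n} \<Longrightarrow> Yop M i (Xop M i u) - Xop M i (Yop M i u) =
           u - scl M (of_real c) (\<Sum>j\<in>{1..n} - {i}. Wop M (transpose i j) u)"
proof -
  note D = assms[unfolded cherednik_module_def]
  note D1 = D[THEN conjunct1] and E1 = D[THEN conjunct2]
  note D2 = E1[THEN conjunct1] and E2 = E1[THEN conjunct2]
  note D3 = E2[THEN conjunct1] and E3 = E2[THEN conjunct2]
  note D4 = E3[THEN conjunct1] and E4 = E3[THEN conjunct2]
  note D5 = E4[THEN conjunct1] and E5 = E4[THEN conjunct2]
  note D6 = E5[THEN conjunct1] and E6 = E5[THEN conjunct2]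
  note D7 = E6[THEN conjunct1] and E7 = E6[THEN conjunct2, THEN conjunct2]
  note D8 = E7[THEN conjunct1] and E8 = E7[THEN conjunct2, THEN conjunct2]
  note D9 = E8[THEN conjunct1] and D10 = E8[THEN conjunct2]
  show "vector_space (scl M)"
    by (rule D1)
  show "Vector_Spaces.linear (scl M) (scl M) (Wop M w)" if "w permutes {1..n}" for w
    by (rule D2[rule_format, OF that])
  show "Vector_Spaces.linear (scl M) (scl M) (Xop M i)" if "i \<in> {1..n}" for i
    by (rule D3[rule_format, OF that])
  show "Vector_Spaces.linear (scl M) (scl M) (Yop M i)" if "i \<in> {1..n}" for i
    by (rule D4[rule_format, OF that])
  show "Wop M id u = u" for u
    by (rule D5[rule_format])
  show "Wop M (v \<circ> w) u = Wop M v (Wop M w u)"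
    if "v permutes {1..n}" "w permutes {1..n}" for v w u
    by (rule D6[rule_format, OF that])
  show "Xop M i (Xop M j u) = Xop M j (Xop M i u)" if "i \<in> {1..n}" "j \<in> {1..n}" for i j u
    by (rule D7[rule_format, OF that])
  show "Wop M w (Xop M i (Wop M (inv_into UNIV w) u)) = Xop M (w i) u"
    if "w permutes {1..n}" "i \<in> {1..n}" for w i u
    by (rule D8[rule_format, OF that])
  show "Yop M i (Xop M j u) - Xop M j (Yop M i u) =
      scl M (of_real c) (Wop M (transpose i j) u)"
    if "i \<in> {1..n}" "j \<in> {1..n}" "i \<noteq> j" for i j u
    by (rule D9[rule_format, OF that])
  show "Yop M i (Xop M i u) - Xop M i (Yop M i u) =
      u - scl M (of_real c) (\<Sum>j\<in>{1..n} - {i}. Wop M (transpose i j) u)"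
    if "i \<in> {1..n}" for i u
    by (rule D10[rule_format, OF that])
qed

lemma equivariant_y_nullD:
  assumes "equivariant_y_null n \<tau> M \<iota>"
  shows "\<And>u v. u \<in> specht n \<tau> \<Longrightarrow> v \<in> specht n \<tau> \<Longrightarrow> \<iota> (u + v) = \<iota> u + \<iota> v"
    and "\<And>a v. v \<in> specht n \<tau> \<Longrightarrow> \<iota> (tab_scale a v) = scl M a (\<iota> v)"
    and "\<And>w v. w permutes {1..n} \<Longrightarrow> v \<in> specht n \<tau> \<Longrightarrow> Wop M w (\<iota> v) = \<iota> (tab_act w v)"
    and "\<And>i v. i \<in> {1..n} \<Longrightarrow> v \<in> specht n \<tau> \<Longrightarrow> Yop M i (\<iota> v) = 0"
  using assms by (simp_all add: equivariant_y_null_def)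

lemma x_monomial_add:
  assumes "cherednik_module n c M"
  shows "x_monomial n M a (u + v) = x_monomial n M a u + x_monomial n M a v"
proof -
  have X: "Xop M i (u + v) = Xop M i u + Xop M i v" if "i \<in> {1..n}" for i u v
    by (rule linear_add[OF cherednik_moduleD(3)[OF assms that]])
  have P: "(Xop M i ^^ k) (u + v) = (Xop M i ^^ k) u + (Xop M i ^^ k) v" if "i \<in> {1..n}" for i k u v
    by (induction k) (use X[OF that] in auto)
  have "foldr (\<lambda>i. Xop M i ^^ a i) is (u + v) =
        foldr (\<lambda>i. Xop M i ^^ a i) is u + foldr (\<lambda>i. Xop M i ^^ a i) is v"
    if "set is \<subseteq> {1..n}" for "is"
    using that by (induction "is") (use P in auto)
  from this[OF upt_subset] show ?thesis
    unfolding x_monomial_def .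
qed

lemma x_monomial_scl:
  assumes "cherednik_module n c M"
  shows "x_monomial n M a (scl M k v) = scl M k (x_monomial n M a v)"
proof -
  have X: "Xop M i (scl M k v) = scl M k (Xop M i v)" if "i \<in> {1..n}" for i v
    by (rule linear_scl[OF cherednik_moduleD(3)[OF assms that]])
  have P: "(Xop M i ^^ m) (scl M k v) = scl M k ((Xop M i ^^ m) v)" if "i \<in> {1..n}" for i m v
    by (induction m) (use X[OF that] in auto)
  have "foldr (\<lambda>i. Xop M i ^^ a i) is (scl M k v) = scl M k (foldr (\<lambda>i. Xop M i ^^ a i) is v)"
    if "set is \<subseteq> {1..n}" for "is"
    using that by (induction "is") (use P in auto)
  from this[OF upt_subset] show ?thesis
    unfolding x_monomial_def .
qed

lemma x_monomial_hom:
  assumes "\<And>i u. i \<in> {1..n} \<Longrightarrow> h (Xop M i u) = Xop N i (h u)"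
  shows "h (x_monomial n M a u) = x_monomial n N a (h u)"
proof -
  have P: "h ((Xop M i ^^ k) u) = (Xop N i ^^ k) (h u)" if "i \<in> {1..n}" for i k u
    by (induction k) (use assms[OF that] in auto)
  have "h (foldr (\<lambda>i. Xop M i ^^ a i) is u) = foldr (\<lambda>i. Xop N i ^^ a i) is (h u)"
    if "set is \<subseteq> {1..n}" for "is"
    using that by (induction "is") (use P in auto)
  from this[OF upt_subset] show ?thesis
    unfolding x_monomial_def .
qed

lemma x_monomial_zero_exponent: "x_monomial n M (\<lambda>_. 0) u = u"
proof -
  have "foldr (\<lambda>i. Xop M i ^^ 0) is u = u" for "is"
    by (induction "is") auto
  then show ?thesis
    unfolding x_monomial_def .
qed

lemma x_monomial_Suc:
  assumes "cherednik_module n c M" "i \<in> {1..n}"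
  shows "Xop M i (x_monomial n M a u) = x_monomial n M (a(i := Suc (a i))) u"
proof -
  let ?b = "a(i := Suc (a i))"
  have X: "Xop M i (Xop M j u) = Xop M j (Xop M i u)" if "j \<in> {1..n}" for j u
    by (rule cherednik_moduleD(7)[OF assms that])
  have P: "Xop M i ((Xop M j ^^ k) u) = (Xop M j ^^ k) (Xop M i u)" if "j \<in> {1..n}" for j k u
    by (induction k) (use X[OF that] in auto)
  have N: "foldr (\<lambda>j. Xop M j ^^ ?b j) is u = foldr (\<lambda>j. Xop M j ^^ a j) is u"
    if "i \<notin> set is" for "is" u
    using that by (induction "is") auto
  have "Xop M i (foldr (\<lambda>j. Xop M j ^^ a j) is u) = foldr (\<lambda>j. Xop M j ^^ ?b j) is u"
    if "set is \<subseteq> {1..n}" "distinct is" "i \<in> set is" for "is"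
    using that
  proof (induction "is")
    case (Cons j js)
    show ?case
    proof (cases "j = i")
      case True
      then show ?thesis
        using Cons.prems N[of js] by simp
    next
      case False
      then show ?thesis
        using Cons P[of j] by simp
    qed
  qed simp
  moreover have "i \<in> set [1..<n + 1]"
    using assms(2) by auto
  ultimately show ?thesis
    unfolding x_monomial_def using upt_subset distinct_upt by blast
qed

lemma tensor_map_superset:
  assumes "cherednik_module n c M" "equivariant_y_null n \<tau> M \<iota>"
    and "finite A" "{a. F a \<noteq> 0} \<subseteq> A"
  shows "tensor_map n M \<iota> F = (\<Sum>a\<in>A. x_monomial n M a (\<iota> (F a)))"
proof -
  interpret M: vector_space "scl M"
    by (rule cherednik_moduleD(1)[OF assms(1)])
  have "\<iota> 0 = \<iota> 0 + \<iota> 0"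
    using equivariant_y_nullD(1)[OF assms(2) specht_zero specht_zero] by simp
  then have "\<iota> 0 = 0" by simp
  moreover have "x_monomial n M a 0 = 0" for a
    using x_monomial_add[OF assms(1), of a 0 0] by simp
  ultimately show ?thesis
    unfolding tensor_map_def using assms(3,4) by (intro sum.mono_neutral_left) auto
qed

lemma tensor_map_add:
  assumes "cherednik_module n c M" "equivariant_y_null n \<tau> M \<iota>"
    and "F \<in> poly_tensor n \<tau>" "G \<in> poly_tensor n \<tau>"
  shows "tensor_map n M \<iota> (F + G) = tensor_map n M \<iota> F + tensor_map n M \<iota> G"
proof -
  let ?A = "{a. F a \<noteq> 0} \<union> {a. G a \<noteq> 0}"
  have fin: "finite ?A"
    using assms(3,4) unfolding poly_tensor_def by auto
  have "\<iota> (F a + G a) = \<iota> (F a) + \<iota> (G a)" for a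
    using assms(3,4) by (intro equivariant_y_nullD(1)[OF assms(2)]) (auto simp: poly_tensor_def)
  then have "tensor_map n M \<iota> (F + G) =
      (\<Sum>a\<in>?A. x_monomial n M a (\<iota> (F a)) + x_monomial n M a (\<iota> (G a)))"
    by (subst tensor_map_superset[OF assms(1,2) fin])
       (auto simp: x_monomial_add[OF assms(1)])
  also have "\<dots> = tensor_map n M \<iota> F + tensor_map n M \<iota> G"
    by (subst (1 2) tensor_map_superset[OF assms(1,2) fin]) (auto simp: sum.distrib)
  finally show ?thesis .
qed

lemma tensor_map_scale:
  assumes "cherednik_module n c M" "equivariant_y_null n \<tau> M \<iota>" "F \<in> poly_tensor n \<tau>"
  shows "tensor_map n M \<iota> (\<lambda>a. tab_scale k (F a)) = scl M k (tensor_map n M \<iota> F)"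
proof -
  interpret T: vector_space tab_scale by (rule vector_space_tab_scale)
  interpret M: vector_space "scl M"
    by (rule cherednik_moduleD(1)[OF assms(1)])
  let ?A = "{a. F a \<noteq> 0}"
  have fin: "finite ?A"
    using assms(3) unfolding poly_tensor_def by auto
  have "\<iota> (tab_scale k (F a)) = scl M k (\<iota> (F a))" for a
    using assms(3) by (intro equivariant_y_nullD(2)[OF assms(2)]) (auto simp: poly_tensor_def)
  then show ?thesis
    by (subst (1 2) tensor_map_superset[OF assms(1,2) fin])
       (auto simp: x_monomial_scl[OF assms(1)] M.scale_sum_right)
qed

lemma poly_tensor_closed:
  shows "F \<in> poly_tensor n \<tau> \<Longrightarrow> G \<in> poly_tensor n \<tau> \<Longrightarrow> F + G \<in> poly_tensor n \<tau>"
    and "F \<in> poly_tensor n \<tau> \<Longrightarrow> (\<lambda>a. tab_scale k (F a)) \<in> poly_tensor n \<tau>"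
    and "v \<in> specht n \<tau> \<Longrightarrow> a \<in> exponents n \<Longrightarrow> (\<lambda>b. if b = a then v else 0) \<in> poly_tensor n \<tau>"
proof -
  interpret T: vector_space tab_scale by (rule vector_space_tab_scale)
  {
    assume F: "F \<in> poly_tensor n \<tau>" and G: "G \<in> poly_tensor n \<tau>"
    have "finite ({a. F a \<noteq> 0} \<union> {a. G a \<noteq> 0})"
      using F G by (auto simp: poly_tensor_def)
    then have "finite {a. (F + G) a \<noteq> 0}"
      by (rule rev_finite_subset) auto
    then show "F + G \<in> poly_tensor n \<tau>"
      using F G by (auto simp: poly_tensor_def specht_add)
  next
    assume F: "F \<in> poly_tensor n \<tau>"
    have "finite {a. F a \<noteq> 0}"
      using F by (auto simp: poly_tensor_def)
    then have "finite {a. tab_scale k (F a) \<noteq> 0}"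
      by (rule rev_finite_subset) auto
    then show "(\<lambda>a. tab_scale k (F a)) \<in> poly_tensor n \<tau>"
      using F by (auto simp: poly_tensor_def specht_scale)
  next
    assume "v \<in> specht n \<tau>" "a \<in> exponents n"
    then show "(\<lambda>b. if b = a then v else 0) \<in> poly_tensor n \<tau>"
      by (auto simp: poly_tensor_def specht_zero)
  }
qed

lemma tensor_map_single:
  assumes "cherednik_module n c M" "equivariant_y_null n \<tau> M \<iota>"
  shows "tensor_map n M \<iota> (\<lambda>b. if b = a then v else 0) = x_monomial n M a (\<iota> v)"
  by (subst tensor_map_superset[OF assms, of "{a}"]) auto

lemma W_mult:
  assumes "cherednik_module n c M" "w permutes {1..n}" "i \<in> {1..n}"
  shows "Wop M w (Xop M i u) = Xop M (w i) (Wop M w u)"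
proof -
  have "Wop M (inv_into UNIV w) (Wop M w u) = Wop M (inv_into UNIV w \<circ> w) u"
    by (rule cherednik_moduleD(6)[OF assms(1) permutes_inv[OF assms(2)] assms(2), symmetric])
  also have "\<dots> = u"
    by (simp only: permutes_inv_o(2)[OF assms(2)] cherednik_moduleD(5)[OF assms(1)])
  finally have "Wop M (inv_into UNIV w) (Wop M w u) = u" .
  moreover have "Wop M w (Xop M i (Wop M (inv_into UNIV w) (Wop M w u))) =
      Xop M (w i) (Wop M w u)"
    by (rule cherednik_moduleD(8)[OF assms])
  ultimately show ?thesis by simp
qed

lemma standard_module_induct:
  assumes "standard_module n c \<tau> M \<iota>"
    and zero: "P 0" and add: "\<And>u v. P u \<Longrightarrow> P v \<Longrightarrow> P (u + v)"
    and gen: "\<And>v. v \<in> specht n \<tau> \<Longrightarrow> P (\<iota> v)"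
    and X: "\<And>i u. i \<in> {1..n} \<Longrightarrow> P u \<Longrightarrow> P (Xop M i u)"
  shows "P u"
proof -
  obtain F where F: "F \<in> poly_tensor n \<tau>" "u = tensor_map n M \<iota> F"
    using assms(1) unfolding standard_module_def bij_betw_def by blast
  have pow: "P ((Xop M i ^^ k) u)" if "i \<in> {1..n}" "P u" for i k u
    by (induction k) (use that X in auto)
  have "P (foldr (\<lambda>i. Xop M i ^^ a i) is u)" if "set is \<subseteq> {1..n}" "P u" for a "is" u
    using that by (induction "is") (use pow in auto)
  from this[OF upt_subset] have mon: "P (x_monomial n M a u)" if "P u" for a u
    unfolding x_monomial_def using that .
  have sum: "P (\<Sum>a\<in>A. g a)" if "finite A" "\<And>a. a \<in> A \<Longrightarrow> P (g a)" for A and g :: "(nat \<Rightarrow> nat) \<Rightarrow> 'a"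
    using that by (induction A rule: finite_induct) (use zero add in auto)
  show ?thesis
    unfolding F(2) tensor_map_def
    by (rule sum) (use F(1) mon gen in \<open>auto simp: poly_tensor_def\<close>)
qed

lemma YX_distinct:
  assumes "cherednik_module n c K" "i \<in> {1..n}" "j \<in> {1..n}" "i \<noteq> j"
  shows "Yop K i (Xop K j u) = Xop K j (Yop K i u) + scl K (of_real c) (Wop K (transpose i j) u)"
proof -
  from cherednik_moduleD(9)[OF assms] show ?thesis by (metis add.commute diff_add_cancel)
qed

lemma YX_equal:
  assumes "cherednik_module n c K" "i \<in> {1..n}"
  shows "Yop K i (Xop K i u) = Xop K i (Yop K i u) +
    (u - scl K (of_real c) (\<Sum>j\<in>{1..n} - {i}. Wop K (transpose i j) u))"
proof -
  from cherednik_moduleD(10)[OF assms] show ?thesis by (metis add.commute diff_add_cancel)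
qed

lemma inv_into_tableau:
  assumes T: "tableau n \<tau> T" and w: "w permutes {1..n}" and k: "k \<in> {1..n}"
  shows "inv_into (cells \<tau>) (w \<circ> T) k = inv_into (cells \<tau>) T (inv_into UNIV w k)"
proof -
  have bij: "bij_betw T (cells \<tau>) {1..n}"
    using T by (simp add: tableau_def)
  have "inv_into UNIV w k \<in> {1..n}"
    using permutes_in_image[OF permutes_inv[OF w]] k by simp
  then obtain p where p: "p \<in> cells \<tau>" "T p = inv_into UNIV w k"
    using bij by (metis bij_betw_imp_surj_on imageE)
  have "inj_on (w \<circ> T) (cells \<tau>)"
    using bij permutes_inj[OF w] by (intro comp_inj_on) (auto simp: bij_betw_def inj_on_def)
  moreover have "(w \<circ> T) p = k"
    using p permutes_inverses(1)[OF w] by simp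
  moreover have "inj_on T (cells \<tau>)"
    using bij by (simp add: bij_betw_def)
  ultimately show ?thesis
    using p by (metis inv_into_f_f)
qed

lemma tab_act_polytabloid:
  assumes T: "tableau n \<tau> T" and w: "w permutes {1..n}"
  shows "tab_act w (polytabloid n \<tau> T) = polytabloid n \<tau> (w \<circ> T)"
proof
  fix r :: "nat \<Rightarrow> nat"
  define v where "v = inv_into UNIV w"
  have v: "v permutes {1..n}"
    unfolding v_def by (rule permutes_inv[OF w])
  have wv: "w (v k) = k" "v (w k) = k" for k
    using permutes_inverses[OF w] by (auto simp: v_def)
  have wv': "w \<circ> v = id" "v \<circ> w = id"
    using wv by (auto simp: fun_eq_iff)
  have in_w: "w k \<in> {1..n} \<longleftrightarrow> k \<in> {1..n}" "v k \<in> {1..n} \<longleftrightarrow> k \<in> {1..n}" for k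
    using permutes_in_image[OF w] permutes_in_image[OF v] by auto
  have inv_T: "inv_into (cells \<tau>) (w \<circ> T) k = inv_into (cells \<tau>) T (v k)" if "k \<in> {1..n}" for k
    unfolding v_def by (rule inv_into_tableau[OF T w that])
  have tb: "tabloid n \<tau> (w \<circ> T) = tabloid n \<tau> T \<circ> v"
    using inv_T in_w by (auto simp: tabloid_def fun_eq_iff)
  have col: "w \<circ> \<sigma> \<circ> v \<in> column_stabilizer n \<tau> (w \<circ> T)"
    if "\<sigma> \<in> column_stabilizer n \<tau> T" for \<sigma>
  proof -
    have \<sigma>: "\<sigma> permutes {1..n}"
      "\<And>k. k \<in> {1..n} \<Longrightarrow> snd (inv_into (cells \<tau>) T (\<sigma> k)) = snd (inv_into (cells \<tau>) T k)"
      using that by (auto simp: column_stabilizer_def)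
    have "snd (inv_into (cells \<tau>) (w \<circ> T) ((w \<circ> \<sigma> \<circ> v) k)) = snd (inv_into (cells \<tau>) (w \<circ> T) k)"
      if k: "k \<in> {1..n}" for k
    proof -
      have "v k \<in> {1..n}" "\<sigma> (v k) \<in> {1..n}" "w (\<sigma> (v k)) \<in> {1..n}"
        using k in_w permutes_in_image[OF \<sigma>(1)] by simp_all
      then show ?thesis
        using \<sigma>(2) inv_T k wv by simp
    qed
    moreover have "w \<circ> \<sigma> \<circ> v permutes {1..n}"
      using v \<sigma>(1) w by (intro permutes_compose)
    ultimately show ?thesis
      by (simp add: column_stabilizer_def)
  qed
  have col': "v \<circ> \<sigma> \<circ> w \<in> column_stabilizer n \<tau> T"
    if "\<sigma> \<in> column_stabilizer n \<tau> (w \<circ> T)" for \<sigma>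
  proof -
    have \<sigma>: "\<sigma> permutes {1..n}"
      "\<And>k. k \<in> {1..n} \<Longrightarrow>
        snd (inv_into (cells \<tau>) (w \<circ> T) (\<sigma> k)) = snd (inv_into (cells \<tau>) (w \<circ> T) k)"
      using that by (auto simp: column_stabilizer_def)
    have "snd (inv_into (cells \<tau>) T ((v \<circ> \<sigma> \<circ> w) k)) = snd (inv_into (cells \<tau>) T k)"
      if k: "k \<in> {1..n}" for k
    proof -
      have "w k \<in> {1..n}" "\<sigma> (w k) \<in> {1..n}"
        using k in_w permutes_in_image[OF \<sigma>(1)] by simp_all
      then show ?thesis
        using \<sigma>(2)[of "w k"] inv_T wv by simp
    qed
    moreover have "v \<circ> \<sigma> \<circ> w permutes {1..n}"
      using v \<sigma>(1) w by (intro permutes_compose)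
    ultimately show ?thesis
      by (simp add: column_stabilizer_def)
  qed
  have sgn: "sign (w \<circ> \<sigma> \<circ> v) = sign \<sigma>" if "\<sigma> permutes {1..n}" for \<sigma>
  proof -
    have p: "permutation w" "permutation \<sigma>" "permutation v"
      using w v that permutation_permutes by blast+
    have "sign v = sign w"
      unfolding v_def by (rule sign_inverse[OF p(1)])
    moreover have "sign (w \<circ> \<sigma> \<circ> v) = sign w * sign \<sigma> * sign v"
      using p by (simp only: sign_compose permutation_compose)
    moreover have "sign w * sign w = 1"
      by (simp add: sign_def)
    ultimately show ?thesis by simp
  qed
  have tab_eq: "r \<circ> w = tabloid n \<tau> T \<circ> inv_into UNIV \<sigma> \<longleftrightarrow>
      r = tabloid n \<tau> (w \<circ> T) \<circ> inv_into UNIV (w \<circ> \<sigma> \<circ> v)" if "\<sigma> permutes {1..n}" for \<sigma>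
  proof -
    have "inv_into UNIV (w \<circ> \<sigma> \<circ> v) = w \<circ> inv_into UNIV \<sigma> \<circ> v"
      using permutes_inverses[OF that] wv by (intro inv_unique_comp) (auto simp: fun_eq_iff)
    then have e: "tabloid n \<tau> (w \<circ> T) \<circ> inv_into UNIV (w \<circ> \<sigma> \<circ> v) =
        tabloid n \<tau> T \<circ> inv_into UNIV \<sigma> \<circ> v"
      unfolding tb using wv by (auto simp: fun_eq_iff)
    show ?thesis
      unfolding e using wv by (auto simp: fun_eq_iff) metis+
  qed
  have "tab_act w (polytabloid n \<tau> T) r = (\<Sum>\<sigma>\<in>column_stabilizer n \<tau> T.
      of_int (sign \<sigma>) * (if r \<circ> w = tabloid n \<tau> T \<circ> inv_into UNIV \<sigma> then 1 else 0))"
    by (simp add: tab_act_def polytabloid_def)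
  also have "\<dots> = polytabloid n \<tau> (w \<circ> T) r"
    unfolding polytabloid_def
  proof (rule sum.reindex_bij_witness[where i = "\<lambda>\<sigma>. v \<circ> \<sigma> \<circ> w" and j = "\<lambda>\<sigma>. w \<circ> \<sigma> \<circ> v"])
    fix \<sigma> assume \<sigma>: "\<sigma> \<in> column_stabilizer n \<tau> T"
    then have "\<sigma> permutes {1..n}"
      by (simp add: column_stabilizer_def)
    then show "of_int (sign (w \<circ> \<sigma> \<circ> v)) *
        (if r = tabloid n \<tau> (w \<circ> T) \<circ> inv_into UNIV (w \<circ> \<sigma> \<circ> v) then 1 else 0) =
        of_int (sign \<sigma>) * (if r \<circ> w = tabloid n \<tau> T \<circ> inv_into UNIV \<sigma> then 1 else (0::complex))"
      by (simp only: sgn tab_eq)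
    show "w \<circ> \<sigma> \<circ> v \<in> column_stabilizer n \<tau> (w \<circ> T)"
      by (rule col[OF \<sigma>])
  qed (auto simp: fun_eq_iff wv intro: col')
  finally show "tab_act w (polytabloid n \<tau> T) r = polytabloid n \<tau> (w \<circ> T) r" .
qed

lemma specht_act:
  assumes w: "w permutes {1..n}" and v: "v \<in> specht n \<tau>"
  shows "tab_act w v \<in> specht n \<tau>"
proof -
  interpret T: vector_space tab_scale by (rule vector_space_tab_scale)
  show ?thesis
    using v unfolding specht_def
  proof (induction rule: T.span_induct_alt)
    case base
    have "tab_act w 0 = 0"
      by (auto simp: tab_act_def fun_eq_iff)
    then show ?case by (simp only: T.span_zero)
  next
    case (step k x y)
    then obtain T where T: "x = polytabloid n \<tau> T" "tableau n \<tau> T"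
      by blast
    have "tableau n \<tau> (w \<circ> T)"
      using T(2) permutes_imp_bij[OF w] unfolding tableau_def by (rule bij_betw_trans)
    then have "tab_act w x \<in> T.span {polytabloid n \<tau> T | T. tableau n \<tau> T}"
      unfolding T(1) tab_act_polytabloid[OF T(2) w] by (intro T.span_base) blast
    moreover have "tab_act w (tab_scale k x + y) = tab_scale k (tab_act w x) + tab_act w y"
      by (auto simp: tab_act_def tab_scale_def fun_eq_iff)
    ultimately show ?case
      using step by (simp only: T.span_add T.span_scale)
  qed
qed

text \<open>
  \<open>M\<^sub>c(\<tau>)\<close> is induced from \<open>\<tau>\<close>: every \<open>S\<^sub>n\<close>-map from \<open>\<tau>\<close> to a Cherednik module whose values are
  killed by all \<open>y\<^sub>i\<close> extends uniquely.
\<close>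

theorem standard_module_universal:
  fixes M :: "'m::ab_group_add hc_struct" and N :: "'k::ab_group_add hc_struct"
  assumes M: "standard_module n c \<tau> M \<iota>"
    and N: "cherednik_module n c N" "equivariant_y_null n \<tau> N f"
  shows "\<exists>!h. hc_hom n M N h \<and> (\<forall>v\<in>specht n \<tau>. h (\<iota> v) = f v)"
proof (rule ex_ex1I)
  have cM: "cherednik_module n c M" and eM: "equivariant_y_null n \<tau> M \<iota>"
    and bij: "bij_betw (tensor_map n M \<iota>) (poly_tensor n \<tau>) UNIV"
    using M unfolding standard_module_def by auto
  have vM: "vector_space (scl M)" and vN: "vector_space (scl N)"
    by (rule cherednik_moduleD(1)[OF cM], rule cherednik_moduleD(1)[OF N(1)])
  define g where "g = the_inv_into (poly_tensor n \<tau>) (tensor_map n M \<iota>)"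
  define h where "h u = tensor_map n N f (g u)" for u
  have inj: "inj_on (tensor_map n M \<iota>) (poly_tensor n \<tau>)"
    using bij by (simp add: bij_betw_def)
  have g: "g u \<in> poly_tensor n \<tau>" "tensor_map n M \<iota> (g u) = u" for u
    using bij unfolding g_def
    by (auto intro!: the_inv_into_into[OF inj] f_the_inv_into_f[OF inj] simp: bij_betw_def)
  have g_eq: "g (tensor_map n M \<iota> F) = F" if "F \<in> poly_tensor n \<tau>" for F
    unfolding g_def by (rule the_inv_into_f_f[OF inj that])
  have h_add: "h (u + v) = h u + h v" for u v
  proof -
    have "g (u + v) = g u + g v"
      using g_eq[of "g u + g v"] g poly_tensor_closed(1) tensor_map_add[OF cM eM] by metis
    then show ?thesis
      unfolding h_def using tensor_map_add[OF N] g(1) by metis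
  qed
  have h_scl: "h (scl M k u) = scl N k (h u)" for k u
  proof -
    have "g (scl M k u) = (\<lambda>a. tab_scale k (g u a))"
      using g_eq[of "\<lambda>a. tab_scale k (g u a)"] g poly_tensor_closed(2)
        tensor_map_scale[OF cM eM] by metis
    then show ?thesis
      unfolding h_def using tensor_map_scale[OF N] g(1) by metis
  qed
  have lin: "Vector_Spaces.linear (scl M) (scl N) h"
    using vM vN h_add h_scl by (rule linearI')
  have h_mon: "h (x_monomial n M a (\<iota> v)) = x_monomial n N a (f v)"
    if "a \<in> exponents n" "v \<in> specht n \<tau>" for a v
    using g_eq[OF poly_tensor_closed(3)[OF that(2,1)]]
    unfolding h_def tensor_map_single[OF cM eM] by (simp add: tensor_map_single[OF N])
  have h_gen: "h (\<iota> v) = f v" if "v \<in> specht n \<tau>" for v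
    using h_mon[of "\<lambda>_. 0", OF _ that] by (simp add: exponents_def x_monomial_zero_exponent)
  have linX: "Vector_Spaces.linear (scl M) (scl M) (Xop M i)"
             "Vector_Spaces.linear (scl N) (scl N) (Xop N i)"
             "Vector_Spaces.linear (scl M) (scl M) (Yop M i)"
             "Vector_Spaces.linear (scl N) (scl N) (Yop N i)" if "i \<in> {1..n}" for i
    using that by (auto intro: cherednik_moduleD(3,4)[OF cM] cherednik_moduleD(3,4)[OF N(1)])
  have linW: "Vector_Spaces.linear (scl M) (scl M) (Wop M w)"
             "Vector_Spaces.linear (scl N) (scl N) (Wop N w)" if "w permutes {1..n}" for w
    using that by (auto intro: cherednik_moduleD(2)[OF cM] cherednik_moduleD(2)[OF N(1)])
  have hX: "h (Xop M i u) = Xop N i (h u)" if i: "i \<in> {1..n}" for i u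
  proof -
    let ?F = "g u" and ?A = "{a. g u a \<noteq> 0}"
    have F: "?F a \<in> specht n \<tau>" "a \<in> ?A \<Longrightarrow> a \<in> exponents n"
      "a \<in> ?A \<Longrightarrow> a(i := Suc (a i)) \<in> exponents n" for a
      using g(1)[of u] i by (auto simp: poly_tensor_def exponents_def)
    have "h (Xop M i u) = h (Xop M i (tensor_map n M \<iota> ?F))"
      by (simp add: g(2))
    also have "\<dots> = (\<Sum>a\<in>?A. h (x_monomial n M (a(i := Suc (a i))) (\<iota> (?F a))))"
      unfolding tensor_map_def
      by (simp add: linear_setsum[OF linX(1)[OF i]] linear_setsum[OF lin] x_monomial_Suc[OF cM i])
    also have "\<dots> = (\<Sum>a\<in>?A. x_monomial n N (a(i := Suc (a i))) (f (?F a)))"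
      by (rule sum.cong) (use h_mon F in auto)
    also have "\<dots> = Xop N i (tensor_map n N f ?F)"
      unfolding tensor_map_def
      by (simp add: linear_setsum[OF linX(2)[OF i]] x_monomial_Suc[OF N(1) i])
    finally show ?thesis
      by (simp add: h_def)
  qed
  have hW: "\<forall>w. w permutes {1..n} \<longrightarrow> h (Wop M w u) = Wop N w (h u)" for u
  proof (induction u rule: standard_module_induct[OF M])
    case (3 v)
    have "tab_act w v \<in> specht n \<tau>" if "w permutes {1..n}" for w
      using that 3 by (rule specht_act)
    then show ?case
      using 3 h_gen equivariant_y_nullD(3)[OF eM] equivariant_y_nullD(3)[OF N(2)] by simp
  next
    case (4 i u)
    then show ?case
      using hX W_mult[OF cM] W_mult[OF N(1)] permutes_in_image[of _ "{1..n}"] by simp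
  qed (auto simp: linear_null[OF lin] linear_null[OF linW(1)] linear_null[OF linW(2)]
        linear_add[OF linW(1)] linear_add[OF linW(2)] h_add)
  have swap: "transpose i j permutes {1..n}" if "i \<in> {1..n}" "j \<in> {1..n}" for i j
    using that by (rule permutes_swap_id)
  have hY: "\<forall>i\<in>{1..n}. h (Yop M i u) = Yop N i (h u)" for u
  proof (induction u rule: standard_module_induct[OF M])
    case (3 v)
    then show ?case
      using h_gen linear_null[OF lin] equivariant_y_nullD(4)[OF eM] equivariant_y_nullD(4)[OF N(2)]
      by simp
  next
    case (4 j u)
    show ?case
    proof
      fix i assume i: "i \<in> {1..n}"
      show "h (Yop M i (Xop M j u)) = Yop N i (h (Xop M j u))"
      proof (cases "i = j")
        case False
        show ?thesis
          using 4 i False swap[OF i 4(1)]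
          by (simp add: YX_distinct[OF cM] YX_distinct[OF N(1)] hW hX h_scl h_add)
      next
        case True
        have "h (\<Sum>j\<in>{1..n} - {i}. Wop M (transpose i j) u) =
            (\<Sum>j\<in>{1..n} - {i}. Wop N (transpose i j) (h u))"
          unfolding linear_setsum[OF lin] by (rule sum.cong) (use hW swap[OF i] in auto)
        then show ?thesis
          using 4(2) i True hX[OF i] YX_equal[OF cM i, of u] YX_equal[OF N(1) i, of "h u"]
          by (simp add: h_add h_scl linear_minus[OF lin])
      qed
    qed
  qed (auto simp: linear_null[OF lin] linear_null[OF linX(3)] linear_null[OF linX(4)]
        linear_add[OF linX(3)] linear_add[OF linX(4)] h_add)
  show "\<exists>h. hc_hom n M N h \<and> (\<forall>v\<in>specht n \<tau>. h (\<iota> v) = f v)"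
    using lin hX hW hY h_gen unfolding hc_hom_def by blast
next
  fix h h'
  assume h: "hc_hom n M N h \<and> (\<forall>v\<in>specht n \<tau>. h (\<iota> v) = f v)"
    and h': "hc_hom n M N h' \<and> (\<forall>v\<in>specht n \<tau>. h' (\<iota> v) = f v)"
  then have lin: "Vector_Spaces.linear (scl M) (scl N) h" "Vector_Spaces.linear (scl M) (scl N) h'"
    unfolding hc_hom_def by auto
  have "h u = h' u" for u
  proof (induction u rule: standard_module_induct[OF M])
    case (4 i u)
    then show ?case
      using h h' unfolding hc_hom_def by metis
  qed (use h h' in \<open>auto simp: linear_null[OF lin(1)] linear_null[OF lin(2)]
        linear_add[OF lin(1)] linear_add[OF lin(2)]\<close>)
  then show "h = h'" by blast
qed


section \<open>The contravariant form and its signature character\<close>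

definition contravariant_form ::
  "nat \<Rightarrow> nat list \<Rightarrow> 'm::ab_group_add hc_struct \<Rightarrow> (tabvec \<Rightarrow> 'm) \<Rightarrow> ('m \<Rightarrow> 'm \<Rightarrow> complex) \<Rightarrow> bool"
where
  "contravariant_form n \<tau> M \<iota> B \<longleftrightarrow>
     (\<forall>v. Vector_Spaces.linear (scl M) (*) (\<lambda>u. B u v)) \<and>
     (\<forall>u v. B v u = cnj (B u v)) \<and>
     (\<forall>w. w permutes {1..n} \<longrightarrow> (\<forall>u v. B (Wop M w u) (Wop M w v) = B u v)) \<and>
     (\<forall>i\<in>{1..n}. \<forall>u v. B (Xop M i u) v = B u (Yop M i v)) \<and>
     (\<forall>u. (\<forall>v. B u v = 0) \<longrightarrow> u = 0) \<and>
     (\<forall>v\<in>specht n \<tau>. v \<noteq> 0 \<longrightarrow> 0 < Re (B (\<iota> v) (\<iota> v)))"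

text \<open>
  Eigenvalues are counted with multiplicity, as roots of the characteristic polynomial. Here they
  are used for Hermitian matrices only, whose eigenvalues are real.
\<close>

definition matrix_signature :: "complex mat \<Rightarrow> int" where
  "matrix_signature A =
     (\<Sum>l | 0 < l \<and> eigenvalue A (complex_of_real l). int (order (complex_of_real l) (char_poly A)))
   - (\<Sum>l | l < 0 \<and> eigenvalue A (complex_of_real l). int (order (complex_of_real l) (char_poly A)))"

definition gram_matrix :: "('m \<Rightarrow> 'm \<Rightarrow> complex) \<Rightarrow> 'm list \<Rightarrow> complex mat" where
  "gram_matrix B bs = mat (length bs) (length bs) (\<lambda>(i, j). B (bs ! i) (bs ! j))"

definition basis_list ::
  "(complex \<Rightarrow> 'm::ab_group_add \<Rightarrow> 'm) \<Rightarrow> 'm set \<Rightarrow> 'm list \<Rightarrow> bool" where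
  "basis_list s V bs \<longleftrightarrow>
     distinct bs \<and> \<not> Modules.module.dependent s (set bs) \<and> Modules.module.span s (set bs) = V"

text \<open>By Sylvester's law of inertia the choice of basis is irrelevant.\<close>

definition form_signature ::
  "(complex \<Rightarrow> 'm::ab_group_add \<Rightarrow> 'm) \<Rightarrow> ('m \<Rightarrow> 'm \<Rightarrow> complex) \<Rightarrow> 'm set \<Rightarrow> int" where
  "form_signature s B V = matrix_signature (gram_matrix B (SOME bs. basis_list s V bs))"

definition signature_character ::
  "nat \<Rightarrow> nat list \<Rightarrow> 'm::ab_group_add hc_struct \<Rightarrow> (tabvec \<Rightarrow> 'm) \<Rightarrow>
   ('m \<Rightarrow> 'm \<Rightarrow> complex) \<Rightarrow> real fps" where
  "signature_character n \<tau> M \<iota> B =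
     Abs_fps (\<lambda>m. of_int (form_signature (scl M) B (degree_part n \<tau> M \<iota> m)))"

end

theory Submission
  imports Defs
begin

text \<open>
  The parameter moves from \<open>0\<close>, where the form is explicit, to \<open>c\<close>. In each degree the form depends
  polynomially on the parameter. The Euler operator \<open>2 \<Sum> x\<^sub>i y\<^sub>i - c \<Sum> s\<^sub>i\<^sub>j\<close> (sum over ordered pairs)
  acts through the degree and through the class sum of transpositions on the bottom layer, and the
  class sum has finitely many eigenvalues. Hence the form degenerates only at finitely many walls,
  the same for all degrees, and signatures are constant in between. At a wall the signatures on both
  sides are alternating sums of the signatures of the layers of the Jantzen filtration. A layer
  carries a contravariant form, and splitting off the submodule generated by its lowest degree,
  repeatedly, writes its signature as a finite sum of shifted signatures of standard modules at the
  wall. The quotient by the radical is determined by the signatures on the near side of the wall; for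
  all other layers the shifts are positive, so the class sum eigenvalues involved drop strictly
  (times \<open>c\<close>) and the recursion ends. All operations preserve the class of sequences whose generating
  function is a polynomial divided by \<open>(1 - t) ^ n\<close>.
\<close>

section \<open>Signatures of Hermitian forms of finite rank\<close>

text \<open>The induction ranges over all matrix representations of \<open>S\<^sub>n\<close> with a
  nondegenerate invariant Hermitian form, irreducible or not, definite or not: the lowest degree of
  a Jantzen layer is of this kind, and no classification of irreducibles enters. All that is
  remembered of a representation is a list of roots annihilating its class sum. A layer whose lowest
  degree is \<open>d\<close> satisfies \<open>c z' = c z - 2 d\<close> with \<open>z\<close> an old
  and \<open>z'\<close> a new root, both in the fixed finite set \<open>central_roots n\<close>.
  This one equation confines the walls and bounds the degrees in which pieces of a layer can start.
  At a wall the near-side alternating sum has a single unknown term, the one of index 0, and is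
  solved for it.

  The obstacle is that subquotients are degenerate and obey the relations only up to radicals; so
  bases, intertwiners and isometries are all tested inside the form.

  The polynomial must serve every module and form. Two positive invariant forms on the Specht module
  are joined by a segment, along which nondegeneracy persists because being killed by all
  \<open>y\<^sub>i\<close> does not refer to the form.\<close>

lemma homogeneous_system_solution:
  fixes A :: "'i \<Rightarrow> 'j \<Rightarrow> 'f::field"
  assumes "finite J" "finite I" "card J < card I"
  shows "\<exists>q. (\<exists>i\<in>I. q i \<noteq> 0) \<and> (\<forall>j\<in>J. (\<Sum>i\<in>I. q i * A i j) = 0)"
  using assms
proof (induction J arbitrary: I A rule: finite_induct)
  case empty
  then obtain i where "i \<in> I" by fastforce
  then show ?case by (intro exI[of _ "\<lambda>_. 1"]) auto
next
  case (insert j J)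
  show ?case
  proof (cases "\<forall>i\<in>I. A i j = 0")
    case True
    from insert have "card J < card I" by simp
    from insert.IH[OF insert.prems(1) this, of A] True show ?thesis by auto
  next
    case False
    then obtain i0 where i0: "i0 \<in> I" "A i0 j \<noteq> 0" by blast
    \<comment> \<open>Elimination: subtracting multiples of row \<open>i0\<close> clears column
      \<open>j\<close>, and the weight \<open>- s\<close> of row \<open>i0\<close> in
      \<open>q'\<close> restores equation \<open>j\<close>.\<close>
    let ?A = "\<lambda>i j'. A i j' - A i j / A i0 j * A i0 j'"
    have "card J < card (I - {i0})"
      using insert i0 by simp
    from insert.IH[OF _ this, of ?A] insert.prems obtain q where
      q: "\<exists>i\<in>I - {i0}. q i \<noteq> 0" "\<And>j'. j' \<in> J \<Longrightarrow> (\<Sum>i\<in>I - {i0}. q i * ?A i j') = 0"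
      by auto
    define s where "s = (\<Sum>i\<in>I - {i0}. q i * A i j) / A i0 j"
    define q' where "q' = q(i0 := - s)"
    have split: "(\<Sum>i\<in>I. q' i * A i j') = (\<Sum>i\<in>I - {i0}. q i * A i j') - s * A i0 j'" for j'
    proof -
      have "(\<Sum>i\<in>I. q' i * A i j') = q' i0 * A i0 j' + (\<Sum>i\<in>I - {i0}. q' i * A i j')"
        using i0 insert.prems by (simp add: sum.remove)
      also have "(\<Sum>i\<in>I - {i0}. q' i * A i j') = (\<Sum>i\<in>I - {i0}. q i * A i j')"
        by (rule sum.cong) (auto simp: q'_def)
      finally show ?thesis by (simp add: q'_def)
    qed
    have "(\<Sum>i\<in>I. q' i * A i j) = 0"
      unfolding split s_def using i0 by simp
    moreover have "(\<Sum>i\<in>I. q' i * A i j') = 0" if "j' \<in> J" for j'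
    proof -
      have "0 = (\<Sum>i\<in>I - {i0}. q i * A i j') - (\<Sum>i\<in>I - {i0}. q i * A i j) / A i0 j * A i0 j'"
        using q(2)[OF that]
        by (simp add: algebra_simps sum_subtractf sum_divide_distrib sum_distrib_left sum_distrib_right)
      then show ?thesis unfolding split s_def by simp
    qed
    moreover have "\<exists>i\<in>I. q' i \<noteq> 0"
      using q(1) by (auto simp: q'_def)
    ultimately show ?thesis by (intro exI[of _ q']) auto
  qed
qed

text \<open>Diagonal values of a Hermitian form are real numbers of type complex, so their sign is
  read from the real part.\<close>

definition sign_re :: "complex \<Rightarrow> int" where
  "sign_re z = (if 0 < Re z then 1 else if Re z < 0 then - 1 else 0)"

lemma sign_re_zero [simp]: "sign_re 0 = 0"
  by (simp add: sign_re_def)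

lemma sum_sign_re:
  assumes "finite I"
  shows "(\<Sum>i\<in>I. sign_re (f i)) = int (card {i\<in>I. 0 < Re (f i)}) - int (card {i\<in>I. Re (f i) < 0})"
proof -
  have "(\<Sum>i\<in>I. sign_re (f i)) =
      (\<Sum>i\<in>I. (if 0 < Re (f i) then 1 else 0) - (if Re (f i) < 0 then 1 else 0))"
    by (rule sum.cong) (auto simp: sign_re_def)
  then show ?thesis
    using assms by (simp add: sum_subtractf sum.If_cases Int_def)
qed

text \<open>
  Forms are only required to behave well on a subspace \<open>N\<close> and may be degenerate there. All
  finiteness is imposed modulo the radical, so that quotient spaces are never formed.
\<close>

locale complex_space = vector_space scale
  for scale :: "complex \<Rightarrow> 'v::ab_group_add \<Rightarrow> 'v"
begin

definition hermitian_on :: "'v set \<Rightarrow> ('v \<Rightarrow> 'v \<Rightarrow> complex) \<Rightarrow> bool" where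
  "hermitian_on N h \<longleftrightarrow> subspace N \<and>
     (\<forall>u\<in>N. \<forall>v\<in>N. \<forall>w\<in>N. h (u + v) w = h u w + h v w) \<and>
     (\<forall>a. \<forall>u\<in>N. \<forall>v\<in>N. h (scale a u) v = a * h u v) \<and>
     (\<forall>u\<in>N. \<forall>v\<in>N. h v u = cnj (h u v))"

text \<open>Says that \<open>N\<close> modulo the radical of \<open>h\<close> has dimension at most
  \<open>r\<close>: any \<open>r + 1\<close> vectors have a nontrivial combination in the
  radical.\<close>

definition finite_rank :: "'v set \<Rightarrow> ('v \<Rightarrow> 'v \<Rightarrow> complex) \<Rightarrow> nat \<Rightarrow> bool" where
  "finite_rank N h r \<longleftrightarrow>
     (\<forall>b. (\<forall>i\<le>r. b i \<in> N) \<longrightarrow>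
       (\<exists>q. (\<exists>i\<le>r. q i \<noteq> 0) \<and> (\<forall>v\<in>N. h (\<Sum>i\<le>r. scale (q i) (b i)) v = 0)))"

text \<open>An orthogonal family that spans \<open>N\<close> modulo the radical. Isotropic members
  are allowed; they lie in the radical and count 0 in the signature.\<close>

definition orthogonal_family ::
  "'v set \<Rightarrow> ('v \<Rightarrow> 'v \<Rightarrow> complex) \<Rightarrow> 'i set \<Rightarrow> ('i \<Rightarrow> 'v) \<Rightarrow> bool" where
  "orthogonal_family N h I b \<longleftrightarrow> finite I \<and> (\<forall>i\<in>I. b i \<in> N) \<and>
     (\<forall>i\<in>I. \<forall>j\<in>I. i \<noteq> j \<longrightarrow> h (b i) (b j) = 0) \<and>
     (\<forall>u\<in>N. \<exists>q. \<forall>v\<in>N. h (u - (\<Sum>i\<in>I. scale (q i) (b i))) v = 0)"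

text \<open>The index set consists of naturals because a definition cannot quantify over a type that
  its constant does not mention; \<open>has_signatureI\<close> admits any index type.\<close>

definition has_signature :: "'v set \<Rightarrow> ('v \<Rightarrow> 'v \<Rightarrow> complex) \<Rightarrow> int \<Rightarrow> bool" where
  "has_signature N h s \<longleftrightarrow>
     (\<exists>(I :: nat set) b. orthogonal_family N h I b \<and> s = (\<Sum>i\<in>I. sign_re (h (b i) (b i))))"

definition signature :: "'v set \<Rightarrow> ('v \<Rightarrow> 'v \<Rightarrow> complex) \<Rightarrow> int" where
  "signature N h = (THE s. has_signature N h s)"

context
  fixes N h
  assumes h: "hermitian_on N h"
begin

lemma hermitian_subspace: "subspace N"
  and hermitian_add_left: "u \<in> N \<Longrightarrow> v \<in> N \<Longrightarrow> w \<in> N \<Longrightarrow> h (u + v) w = h u w + h v w"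
  and hermitian_scale_left: "u \<in> N \<Longrightarrow> v \<in> N \<Longrightarrow> h (scale a u) v = a * h u v"
  and hermitian_sym: "u \<in> N \<Longrightarrow> v \<in> N \<Longrightarrow> h v u = cnj (h u v)"
  using h unfolding hermitian_on_def by blast+

lemmas hermitian_mem = subspace_0[OF hermitian_subspace] subspace_add[OF hermitian_subspace]
  subspace_scale[OF hermitian_subspace] subspace_diff[OF hermitian_subspace]
  subspace_sum[OF hermitian_subspace]

lemma hermitian_zero_left: "v \<in> N \<Longrightarrow> h 0 v = 0"
  using hermitian_scale_left[of 0 v 0] hermitian_mem(1) by simp

lemma hermitian_diff_left:
  assumes "u \<in> N" "v \<in> N" "w \<in> N"
  shows "h (u - v) w = h u w - h v w"
proof -
  have e: "u - v = u + scale (- 1) v" by simp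
  show ?thesis
    unfolding e using assms hermitian_add_left[of u "scale (-1) v" w] hermitian_scale_left[of v w "-1"]
      hermitian_mem(3)[of v "-1"] by simp
qed

lemma hermitian_sum_left:
  assumes "\<And>i. i \<in> I \<Longrightarrow> f i \<in> N" "v \<in> N"
  shows "h (\<Sum>i\<in>I. f i) v = (\<Sum>i\<in>I. h (f i) v)"
  using assms(1)
proof (induction I rule: infinite_finite_induct)
  case (insert i I)
  then show ?case
    using hermitian_add_left[of "f i" "sum f I" v] hermitian_mem(5)[of I f] assms(2) by simp
qed (use assms(2) hermitian_zero_left in auto)

lemma hermitian_combination_left:
  assumes "\<And>i. i \<in> I \<Longrightarrow> b i \<in> N" "v \<in> N"
  shows "h (\<Sum>i\<in>I. scale (q i) (b i)) v = (\<Sum>i\<in>I. q i * h (b i) v)"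
proof -
  have "h (\<Sum>i\<in>I. scale (q i) (b i)) v = (\<Sum>i\<in>I. h (scale (q i) (b i)) v)"
    using assms hermitian_mem(3) by (intro hermitian_sum_left) auto
  also have "\<dots> = (\<Sum>i\<in>I. q i * h (b i) v)"
    by (rule sum.cong) (use assms hermitian_scale_left in auto)
  finally show ?thesis .
qed

lemma hermitian_add_right:
  assumes "u \<in> N" "v \<in> N" "w \<in> N"
  shows "h w (u + v) = h w u + h w v"
  using assms hermitian_sym[of "u + v" w] hermitian_sym[of u w] hermitian_sym[of v w]
    hermitian_add_left[of u v w] hermitian_mem(2) by simp

lemma hermitian_scale_right:
  assumes "u \<in> N" "v \<in> N"
  shows "h v (scale a u) = cnj a * h v u"
  using assms hermitian_sym[of "scale a u" v] hermitian_sym[of u v] hermitian_scale_left[of u v a]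
    hermitian_mem(3) by simp

lemma hermitian_diff_right:
  assumes "u \<in> N" "v \<in> N" "w \<in> N"
  shows "h w (u - v) = h w u - h w v"
  using assms hermitian_sym[of "u - v" w] hermitian_sym[of u w] hermitian_sym[of v w]
    hermitian_diff_left[of u v w] hermitian_mem(4) by simp

lemma hermitian_combination_right:
  assumes "\<And>i. i \<in> I \<Longrightarrow> b i \<in> N" "v \<in> N"
  shows "h v (\<Sum>i\<in>I. scale (q i) (b i)) = (\<Sum>i\<in>I. cnj (q i) * h v (b i))"
proof -
  have m: "(\<Sum>i\<in>I. scale (q i) (b i)) \<in> N"
    using assms hermitian_mem(3) by (intro hermitian_mem(5)) auto
  show ?thesis
    using hermitian_sym[OF m assms(2)] hermitian_combination_left[OF assms, where q = q]
      assms(1) hermitian_sym[OF _ assms(2)] by (auto intro!: sum.cong)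
qed

lemma hermitian_radical_right: "u \<in> N \<Longrightarrow> v \<in> N \<Longrightarrow> h u v = 0 \<Longrightarrow> h v u = 0"
  using hermitian_sym[of u v] by simp

text \<open>Polarization: the norm of \<open>u + v\<close> yields the real part of
  \<open>h u v\<close>, that of \<open>u + \<i> v\<close> the imaginary part.\<close>

lemma hermitian_zero_if_diagonal_zero:
  assumes "\<And>u. u \<in> N \<Longrightarrow> h u u = 0" "u \<in> N" "v \<in> N"
  shows "h u v = 0"
proof -
  have iv: "scale \<i> v \<in> N" using assms hermitian_mem(3) by blast
  have e: "h u w + h w u = 0" if "w \<in> N" for w
  proof -
    have "h (u + w) (u + w) = h u u + h u w + h w u + h w w"
      using assms(2) that hermitian_mem(2) by (simp add: hermitian_add_left hermitian_add_right)
    moreover have "u + w \<in> N" using assms(2) that hermitian_mem(2) by blast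
    ultimately show ?thesis using assms(1,2) that by simp
  qed
  have "h u v + cnj (h u v) = 0" using e[OF assms(3)] hermitian_sym[OF assms(2,3)] by simp
  moreover have "- \<i> * h u v + \<i> * cnj (h u v) = 0"
    using e[OF iv] hermitian_sym[OF assms(2,3)] assms
    by (simp add: hermitian_scale_left hermitian_scale_right)
  ultimately show ?thesis by (simp add: complex_eq_iff)
qed

lemma hermitian_on_subset: "subspace P \<Longrightarrow> P \<subseteq> N \<Longrightarrow> hermitian_on P h"
  using h unfolding hermitian_on_def subset_iff by blast

lemma orthogonal_familyD:
  assumes "orthogonal_family N h I b"
  shows "finite I" "\<And>i. i \<in> I \<Longrightarrow> b i \<in> N"
    "\<And>i j. i \<in> I \<Longrightarrow> j \<in> I \<Longrightarrow> i \<noteq> j \<Longrightarrow> h (b i) (b j) = 0"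
    "\<And>u. u \<in> N \<Longrightarrow> \<exists>q. \<forall>v\<in>N. h u v = (\<Sum>i\<in>I. q i * h (b i) v)"
proof -
  show b: "finite I" "\<And>i. i \<in> I \<Longrightarrow> b i \<in> N"
    "\<And>i j. i \<in> I \<Longrightarrow> j \<in> I \<Longrightarrow> i \<noteq> j \<Longrightarrow> h (b i) (b j) = 0"
    using assms unfolding orthogonal_family_def by auto
  fix u assume u: "u \<in> N"
  then obtain q where q: "\<And>v. v \<in> N \<Longrightarrow> h (u - (\<Sum>i\<in>I. scale (q i) (b i))) v = 0"
    using assms unfolding orthogonal_family_def by blast
  have m: "(\<Sum>i\<in>I. scale (q i) (b i)) \<in> N"
    using b(2) hermitian_mem(3) by (intro hermitian_mem(5)) auto
  have "h u v = (\<Sum>i\<in>I. q i * h (b i) v)" if "v \<in> N" for v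
    using q[OF that] hermitian_diff_left[OF u m that] hermitian_combination_left[OF b(2) that, where q = q]
    by simp
  then show "\<exists>q. \<forall>v\<in>N. h u v = (\<Sum>i\<in>I. q i * h (b i) v)" by blast
qed

lemma orthogonal_familyI:
  assumes b: "finite I" "\<And>i. i \<in> I \<Longrightarrow> b i \<in> N"
    "\<And>i j. i \<in> I \<Longrightarrow> j \<in> I \<Longrightarrow> i \<noteq> j \<Longrightarrow> h (b i) (b j) = 0"
    and "\<And>u. u \<in> N \<Longrightarrow> \<exists>q. \<forall>v\<in>N. h u v = (\<Sum>i\<in>I. q i * h (b i) v)"
  shows "orthogonal_family N h I b"
proof -
  have "\<exists>q. \<forall>v\<in>N. h (u - (\<Sum>i\<in>I. scale (q i) (b i))) v = 0" if u: "u \<in> N" for u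
  proof -
    obtain q where q: "\<And>v. v \<in> N \<Longrightarrow> h u v = (\<Sum>i\<in>I. q i * h (b i) v)"
      using assms(4)[OF u] by blast
    have m: "(\<Sum>i\<in>I. scale (q i) (b i)) \<in> N"
      using b(2) hermitian_mem(3) by (intro hermitian_mem(5)) auto
    have "h (u - (\<Sum>i\<in>I. scale (q i) (b i))) v = 0" if "v \<in> N" for v
      using q[OF that] hermitian_diff_left[OF u m that] hermitian_combination_left[OF b(2) that, where q = q]
      by simp
    then show ?thesis by blast
  qed
  then show ?thesis unfolding orthogonal_family_def using b by blast
qed

lemma orthogonal_family_norm:
  assumes b: "orthogonal_family N h I b"
  shows "h (\<Sum>i\<in>I. scale (q i) (b i)) (\<Sum>i\<in>I. scale (q i) (b i)) =
     (\<Sum>i\<in>I. of_real ((cmod (q i))\<^sup>2) * h (b i) (b i))"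
proof -
  note D = orthogonal_familyD[OF b]
  have m: "(\<Sum>i\<in>I. scale (q i) (b i)) \<in> N"
    using D(2) hermitian_mem(3) by (intro hermitian_mem(5)) auto
  have "h (\<Sum>i\<in>I. scale (q i) (b i)) (\<Sum>i\<in>I. scale (q i) (b i)) =
     (\<Sum>i\<in>I. q i * (\<Sum>j\<in>I. cnj (q j) * h (b i) (b j)))"
    using hermitian_combination_left[OF D(2) m, where q = q] hermitian_combination_right[OF D(2) D(2), where q = q]
    by simp
  also have "\<dots> = (\<Sum>i\<in>I. q i * (\<Sum>j\<in>{i}. cnj (q j) * h (b i) (b j)))"
    using D(1,3) by (intro sum.cong arg_cong2[where f = "(*)"] sum.mono_neutral_right) auto
  also have "\<dots> = (\<Sum>i\<in>I. of_real ((cmod (q i))\<^sup>2) * h (b i) (b i))"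
    by (rule sum.cong) (auto simp: complex_norm_square mult.assoc simp del: of_real_power)
  finally show ?thesis .
qed

text \<open>Sylvester's argument. With more positive members in \<open>b\<close> than in
  \<open>d\<close>, some nontrivial combination of the positive \<open>b i\<close> is orthogonal to
  all positive \<open>d j\<close>. Its norm is positive when computed from \<open>b\<close> and at
  most 0 when computed from \<open>d\<close>.\<close>

lemma positive_count_le:
  assumes b: "orthogonal_family N h I b" and d: "orthogonal_family N h J d"
  shows "card {i\<in>I. 0 < Re (h (b i) (b i))} \<le> card {j\<in>J. 0 < Re (h (d j) (d j))}"
proof (rule ccontr)
  let ?I = "{i\<in>I. 0 < Re (h (b i) (b i))}" and ?J = "{j\<in>J. 0 < Re (h (d j) (d j))}"
  note B = orthogonal_familyD[OF b] and D = orthogonal_familyD[OF d]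
  assume "\<not> card ?I \<le> card ?J"
  then have "card ?J < card ?I" by simp
  then obtain q where q: "\<exists>i\<in>?I. q i \<noteq> 0" "\<And>j. j \<in> ?J \<Longrightarrow> (\<Sum>i\<in>?I. q i * h (b i) (d j)) = 0"
    using homogeneous_system_solution[of ?J ?I "\<lambda>i j. h (b i) (d j)"] B(1) D(1) by auto
  define q' where "q' i = (if i \<in> ?I then q i else 0)" for i
  define u where "u = (\<Sum>i\<in>I. scale (q' i) (b i))"
  have u: "u \<in> N"
    unfolding u_def using B(2) hermitian_mem(3) by (intro hermitian_mem(5)) auto
  have "(\<Sum>i\<in>I. q' i * h (b i) v) = (\<Sum>i\<in>?I. q i * h (b i) v)" for v
    using B(1) by (intro sum.mono_neutral_cong_right) (auto simp: q'_def)
  then have ud: "h u (d j) = 0" if "j \<in> ?J" for j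
    using q(2)[OF that] that B(2) D(2) unfolding u_def
    by (subst hermitian_combination_left) auto
  have "Re (h u u) = (\<Sum>i\<in>I. (cmod (q' i))\<^sup>2 * Re (h (b i) (b i)))"
    unfolding u_def orthogonal_family_norm[OF b] by simp
  moreover have "0 < (\<Sum>i\<in>I. (cmod (q' i))\<^sup>2 * Re (h (b i) (b i)))"
  proof -
    obtain i where i: "i \<in> ?I" "q i \<noteq> 0" using q(1) by blast
    show ?thesis
      using i B(1) by (intro sum_pos2[of I i]) (auto simp: q'_def)
  qed
  ultimately have pos: "0 < Re (h u u)" by simp
  obtain p where p: "\<And>v. v \<in> N \<Longrightarrow> h (u - (\<Sum>j\<in>J. scale (p j) (d j))) v = 0"
    using d u unfolding orthogonal_family_def by blast
  define w where "w = (\<Sum>j\<in>J. scale (p j) (d j))"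
  have w: "w \<in> N"
    unfolding w_def using D(2) hermitian_mem(3) by (intro hermitian_mem(5)) auto
  have uw: "h u v = h w v" if "v \<in> N" for v
    using p[OF that] hermitian_diff_left[OF u w that] by (simp add: w_def)
  have "h u u = h w w"
    using uw[OF u] uw[OF w] hermitian_sym[OF u w] hermitian_sym[OF w w] by metis
  have wd: "h w (d j) = p j * h (d j) (d j)" if "j \<in> J" for j
  proof -
    have "h w (d j) = (\<Sum>i\<in>J. p i * h (d i) (d j))"
      unfolding w_def using D(2) that by (subst hermitian_combination_left) auto
    also have "\<dots> = (\<Sum>i\<in>{j}. p i * h (d i) (d j))"
      using D(1,3) that by (intro sum.mono_neutral_right) auto
    finally show ?thesis by simp
  qed
  have "p j = 0" if "j \<in> ?J" for j
    using wd[of j] ud[OF that] uw[of "d j"] that D(2) by auto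
  then have "(cmod (p j))\<^sup>2 * Re (h (d j) (d j)) \<le> 0" if "j \<in> J" for j
    using that by (cases "0 < Re (h (d j) (d j))") (auto intro: mult_nonneg_nonpos)
  then have "Re (h w w) \<le> 0"
    unfolding w_def orthogonal_family_norm[OF d] by (auto intro!: sum_nonpos)
  then show False using pos \<open>h u u = h w w\<close> by simp
qed

end

text \<open>Negating the form turns negative members into positive ones, so
  \<open>positive_count_le\<close> also compares the negative counts.\<close>

lemma hermitian_on_uminus:
  assumes "hermitian_on N h"
  shows "hermitian_on N (\<lambda>u v. - h u v)"
proof -
  note D = assms[unfolded hermitian_on_def]
  note add = D[THEN conjunct2, THEN conjunct1] and sc = D[THEN conjunct2, THEN conjunct2, THEN conjunct1]
    and sym = D[THEN conjunct2, THEN conjunct2, THEN conjunct2]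
  have "- h (u + v) w = - h u w + - h v w" if "u \<in> N" "v \<in> N" "w \<in> N" for u v w
    using add that by simp
  moreover have "- h (scale a u) v = a * - h u v" if "u \<in> N" "v \<in> N" for a u v
    using sc that by simp
  moreover have "- h v u = cnj (- h u v)" if "u \<in> N" "v \<in> N" for u v
    using sym that by (metis complex_cnj_minus)
  ultimately show ?thesis
    using D unfolding hermitian_on_def by blast
qed

lemma orthogonal_family_uminus:
  "orthogonal_family N h I b \<Longrightarrow> orthogonal_family N (\<lambda>u v. - h u v) I b"
  unfolding orthogonal_family_def by auto

lemma signature_count_unique:
  assumes "hermitian_on N h" "orthogonal_family N h I b" "orthogonal_family N h J d"
  shows "(\<Sum>i\<in>I. sign_re (h (b i) (b i))) = (\<Sum>j\<in>J. sign_re (h (d j) (d j)))"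
proof -
  have "card {i\<in>I. 0 < Re (h (b i) (b i))} = card {j\<in>J. 0 < Re (h (d j) (d j))}"
    using positive_count_le[OF assms] positive_count_le[OF assms(1,3,2)] by simp
  moreover have "card {i\<in>I. Re (h (b i) (b i)) < 0} = card {j\<in>J. Re (h (d j) (d j)) < 0}"
    using positive_count_le[OF hermitian_on_uminus orthogonal_family_uminus orthogonal_family_uminus, OF assms]
      positive_count_le[OF hermitian_on_uminus orthogonal_family_uminus orthogonal_family_uminus, OF assms(1,3,2)]
    by simp
  moreover have "finite I" "finite J"
    using assms unfolding orthogonal_family_def by auto
  ultimately show ?thesis by (simp add: sum_sign_re)
qed

lemma has_signature_unique:
  "hermitian_on N h \<Longrightarrow> has_signature N h s \<Longrightarrow> has_signature N h s' \<Longrightarrow> s = s'"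
  unfolding has_signature_def using signature_count_unique by blast

lemma signature_eq: "hermitian_on N h \<Longrightarrow> has_signature N h s \<Longrightarrow> signature N h = s"
  unfolding signature_def using has_signature_unique by (intro the_equality) auto

lemma orthogonal_family_reindex:
  assumes "orthogonal_family N h I b" "bij_betw f J I"
  shows "orthogonal_family N h J (b \<circ> f)"
proof -
  have fJ: "f j \<in> I" if "j \<in> J" for j using assms(2) that bij_betwE by blast
  have "\<exists>q. \<forall>v\<in>N. h (u - (\<Sum>i\<in>J. scale (q i) ((b \<circ> f) i))) v = 0" if u: "u \<in> N" for u
  proof -
    obtain q where q: "\<forall>v\<in>N. h (u - (\<Sum>i\<in>I. scale (q i) (b i))) v = 0"
      using assms(1) u unfolding orthogonal_family_def by blast
    have "(\<Sum>i\<in>J. scale ((q \<circ> f) i) ((b \<circ> f) i)) = (\<Sum>i\<in>I. scale (q i) (b i))"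
      using sum.reindex_bij_betw[OF assms(2), of "\<lambda>i. scale (q i) (b i)"] by simp
    then show ?thesis using q by (intro exI[of _ "q \<circ> f"]) simp
  qed
  moreover have "finite J" using assms bij_betw_finite unfolding orthogonal_family_def by blast
  moreover have "f i \<noteq> f j" if "i \<in> J" "j \<in> J" "i \<noteq> j" for i j
    using assms(2) that unfolding bij_betw_def inj_on_def by blast
  ultimately show ?thesis using assms(1) fJ unfolding orthogonal_family_def by auto
qed

lemma has_signatureI:
  assumes "orthogonal_family N h I b"
  shows "has_signature N h (\<Sum>i\<in>I. sign_re (h (b i) (b i)))"
proof -
  have "finite I" using assms unfolding orthogonal_family_def by blast
  then obtain f where f: "bij_betw f {0..<card I} I" using ex_bij_betw_nat_finite by blast
  show ?thesis
    unfolding has_signature_def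
    using orthogonal_family_reindex[OF assms f]
      sum.reindex_bij_betw[OF f, of "\<lambda>i. sign_re (h (b i) (b i))"]
    by (intro exI[of _ "{0..<card I}"] exI[of _ "b \<circ> f"]) simp
qed

lemma finite_rank_subset:
  assumes "finite_rank N h r" "P \<subseteq> N"
  shows "finite_rank P h r"
  unfolding finite_rank_def
proof (intro allI impI)
  fix b :: "nat \<Rightarrow> 'v" assume "\<forall>i\<le>r. b i \<in> P"
  then have "\<forall>i\<le>r. b i \<in> N" using assms(2) by blast
  then obtain q where "\<exists>i\<le>r. q i \<noteq> 0" "\<forall>v\<in>N. h (\<Sum>i\<le>r. scale (q i) (b i)) v = 0"
    using assms(1) unfolding finite_rank_def by blast
  then show "\<exists>q. (\<exists>i\<le>r. q i \<noteq> 0) \<and> (\<forall>v\<in>P. h (\<Sum>i\<le>r. scale (q i) (b i)) v = 0)"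
    using assms(2) by blast
qed

lemma finite_rank_if_spanned:
  assumes h: "hermitian_on N h" and I: "finite I" "\<And>i. i \<in> I \<Longrightarrow> b i \<in> N"
    and sp: "\<And>u. u \<in> N \<Longrightarrow> \<exists>q. \<forall>v\<in>N. h u v = (\<Sum>i\<in>I. q i * h (b i) v)"
  shows "finite_rank N h (card I)"
  unfolding finite_rank_def
proof (intro allI impI)
  fix d :: "nat \<Rightarrow> 'v" assume d: "\<forall>i\<le>card I. d i \<in> N"
  obtain A where A: "\<And>k v. k \<le> card I \<Longrightarrow> v \<in> N \<Longrightarrow> h (d k) v = (\<Sum>i\<in>I. A k i * h (b i) v)"
  proof -
    have "\<forall>k. \<exists>A. k \<le> card I \<longrightarrow> (\<forall>v\<in>N. h (d k) v = (\<Sum>i\<in>I. A i * h (b i) v))"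
      using sp d by blast
    from choice[OF this] show ?thesis using that by blast
  qed
  obtain q where q: "\<exists>k\<in>{..card I}. q k \<noteq> 0" "\<And>i. i \<in> I \<Longrightarrow> (\<Sum>k\<in>{..card I}. q k * A k i) = 0"
    using homogeneous_system_solution[of I "{..card I}" A] I by auto
  have "h (\<Sum>k\<le>card I. scale (q k) (d k)) v = 0" if v: "v \<in> N" for v
  proof -
    have "h (\<Sum>k\<le>card I. scale (q k) (d k)) v = (\<Sum>k\<le>card I. q k * h (d k) v)"
      using d v by (intro hermitian_combination_left[OF h]) auto
    also have "\<dots> = (\<Sum>k\<le>card I. \<Sum>i\<in>I. q k * A k i * h (b i) v)"
      using A v by (intro sum.cong) (auto simp: sum_distrib_left mult.assoc)
    also have "\<dots> = (\<Sum>i\<in>I. (\<Sum>k\<le>card I. q k * A k i) * h (b i) v)"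
      by (subst sum.swap) (simp add: sum_distrib_right)
    also have "\<dots> = 0" using q(2) by simp
    finally show ?thesis .
  qed
  then show "\<exists>q. (\<exists>i\<le>card I. q i \<noteq> 0) \<and> (\<forall>v\<in>N. h (\<Sum>i\<le>card I. scale (q i) (d i)) v = 0)"
    using q(1) by auto
qed

lemma orthogonal_family_finite_rank:
  assumes "hermitian_on N h" "orthogonal_family N h I b"
  shows "finite_rank N h (card I)"
  using orthogonal_familyD[OF assms] finite_rank_if_spanned[OF assms(1)] by blast

section \<open>Orthogonal complements and additivity of the signature\<close>

definition perp :: "'v set \<Rightarrow> ('v \<Rightarrow> 'v \<Rightarrow> complex) \<Rightarrow> 'v set \<Rightarrow> 'v set" where
  "perp N h K = {u \<in> N. \<forall>v\<in>K. h u v = 0}"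

lemma subspace_perp:
  assumes h: "hermitian_on N h" and "K \<subseteq> N"
  shows "subspace (perp N h K)"
  using assms hermitian_mem(1-3)[OF h]
  by (auto simp: perp_def subspace_def hermitian_zero_left[OF h] hermitian_add_left[OF h]
      hermitian_scale_left[OF h] subset_iff)

lemma hermitian_on_perp:
  assumes h: "hermitian_on N h" and "K \<subseteq> N"
  shows "hermitian_on (perp N h K) h"
  using hermitian_on_subset[OF h subspace_perp[OF assms]] by (auto simp: perp_def)

text \<open>Both arguments are projected: the expansion in \<open>b\<close> is available only for
  vectors of the complement of \<open>v\<close>, and only when tested there, so \<open>u\<close> and
  \<open>w\<close> both lose their component along \<open>v\<close>.\<close>

lemma orthogonal_family_insert:
  assumes h: "hermitian_on N h" and v: "v \<in> N" "h v v \<noteq> 0"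
    and b: "orthogonal_family (perp N h {v}) h I b" and i: "i \<notin> I"
  shows "orthogonal_family N h (insert i I) (b(i := v))"
proof -
  have sub: "perp N h {v} \<subseteq> N" by (auto simp: perp_def)
  have hp: "hermitian_on (perp N h {v}) h"
    using v by (intro hermitian_on_perp[OF h]) auto
  note B = orthogonal_familyD[OF hp b]
  have bv: "h (b j) v = 0" "h v (b j) = 0" "b j \<in> N" if "j \<in> I" for j
    using B(2)[OF that] v(1) hermitian_radical_right[OF h, of "b j" v] by (auto simp: perp_def)
  show ?thesis
  proof (rule orthogonal_familyI[OF h])
    fix u assume u: "u \<in> N"
    define a where "a = h u v / h v v"
    define u' where "u' = u - scale a v"
    have u': "u' \<in> perp N h {v}"
      using u v hermitian_mem(3,4)[OF h]
      by (simp add: u'_def perp_def hermitian_diff_left[OF h] hermitian_scale_left[OF h] a_def)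
    then obtain q where q: "\<And>w. w \<in> perp N h {v} \<Longrightarrow> h u' w = (\<Sum>j\<in>I. q j * h (b j) w)"
      using B(4) by blast
    have "h u w = (\<Sum>j\<in>insert i I. (q(i := a)) j * h ((b(i := v)) j) w)" if w: "w \<in> N" for w
    proof -
      define e where "e = h w v / h v v"
      define w' where "w' = w - scale e v"
      have w': "w' \<in> perp N h {v}"
        using w v hermitian_mem(3,4)[OF h]
        by (simp add: w'_def perp_def hermitian_diff_left[OF h] hermitian_scale_left[OF h] e_def)
      have ww: "w = w' + scale e v" by (simp add: w'_def)
      have N: "w' \<in> N" "u' \<in> N" "scale e v \<in> N" "scale a v \<in> N"
        using w' u' sub v hermitian_mem(3)[OF h] by auto
      have zero: "h z w = h z w'" if "z \<in> perp N h {v}" for z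
        using that N v by (auto simp: ww hermitian_add_right[OF h] hermitian_scale_right[OF h] perp_def)
      have "h u w = h u' w + a * h v w"
        using N u v w hermitian_add_left[OF h, of u' "scale a v" w]
        by (simp add: u'_def hermitian_scale_left[OF h])
      also have "h u' w = (\<Sum>j\<in>I. q j * h (b j) w)"
        using zero[OF u'] q[OF w'] zero B(2) by simp
      also have "\<dots> + a * h v w = (\<Sum>j\<in>insert i I. (q(i := a)) j * h ((b(i := v)) j) w)"
        using B(1) i by (simp add: sum.insert) (intro sum.cong, auto)
      finally show ?thesis .
    qed
    then show "\<exists>q. \<forall>w\<in>N. h u w = (\<Sum>j\<in>insert i I. q j * h ((b(i := v)) j) w)" by blast
  qed (use B(1,3) bv v i in \<open>auto split: if_splits\<close>)
qed

text \<open>A combination of complement vectors and \<open>v\<close> that lies in the radical has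
  coefficient 0 at \<open>v\<close>, as pairing it with \<open>v\<close> shows; so appending
  \<open>v\<close> to \<open>r + 1\<close> vectors of the complement yields a relation among those
  alone.\<close>

lemma finite_rank_perp:
  assumes h: "hermitian_on N h" and v: "v \<in> N" "h v v \<noteq> 0" and r: "finite_rank N h (Suc r)"
  shows "finite_rank (perp N h {v}) h r"
  unfolding finite_rank_def
proof (intro allI impI)
  fix d :: "nat \<Rightarrow> 'v" assume d: "\<forall>i\<le>r. d i \<in> perp N h {v}"
  define d' where "d' = d(Suc r := v)"
  have "\<forall>i\<le>Suc r. d' i \<in> N" using d v by (auto simp: d'_def perp_def le_Suc_eq)
  then obtain q where q: "\<exists>i\<le>Suc r. q i \<noteq> 0" "\<And>w. w \<in> N \<Longrightarrow> h (\<Sum>i\<le>Suc r. scale (q i) (d' i)) w = 0"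
    using r unfolding finite_rank_def by blast
  have dN: "d i \<in> N" if "i \<le> r" for i using d that by (auto simp: perp_def)
  have s: "(\<Sum>i\<le>Suc r. scale (q i) (d' i)) = (\<Sum>i\<le>r. scale (q i) (d i)) + scale (q (Suc r)) v"
    by (simp add: d'_def)
  have m: "(\<Sum>i\<le>r. scale (q i) (d i)) \<in> N" "scale (q (Suc r)) v \<in> N"
    using dN v hermitian_mem(3)[OF h] by (auto intro!: hermitian_mem(5)[OF h])
  have "h (\<Sum>i\<le>r. scale (q i) (d i)) v = (\<Sum>i\<le>r. q i * h (d i) v)"
    using dN v by (intro hermitian_combination_left[OF h]) auto
  also have "\<dots> = 0" using d by (auto simp: perp_def)
  finally have "q (Suc r) * h v v = 0"
    using q(2)[OF v(1)] m v unfolding s by (simp add: hermitian_add_left[OF h] hermitian_scale_left[OF h])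
  then have q0: "q (Suc r) = 0" using v by simp
  then have "\<exists>i\<le>r. q i \<noteq> 0" using q(1) by (metis le_Suc_eq)
  moreover have "h (\<Sum>i\<le>r. scale (q i) (d i)) w = 0" if "w \<in> perp N h {v}" for w
    using q(2)[of w] that unfolding s q0 by (simp add: perp_def)
  ultimately show "\<exists>q. (\<exists>i\<le>r. q i \<noteq> 0) \<and> (\<forall>w\<in>perp N h {v}. h (\<Sum>i\<le>r. scale (q i) (d i)) w = 0)"
    by blast
qed

text \<open>Each vector of nonzero norm that is split off lowers the rank; when none is left,
  polarization makes the form 0 and the empty family suffices. All norms are nonzero, so
  \<open>bottom_rep\<close> can divide by them.\<close>

lemma orthogonal_family_exists:
  assumes "hermitian_on N h" "finite_rank N h r"
  shows "\<exists>(I :: nat set) b. orthogonal_family N h I b \<and> (\<forall>i\<in>I. h (b i) (b i) \<noteq> 0)"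
  using assms
proof (induction r arbitrary: N)
  case 0
  have "h u u = 0" if u: "u \<in> N" for u
  proof -
    obtain q where q: "q (0::nat) \<noteq> 0" "h (scale (q 0) u) u = 0"
      using 0(2)[unfolded finite_rank_def, rule_format, of "\<lambda>_. u"] u by auto
    then show ?thesis using hermitian_scale_left[OF 0(1) u u] by simp
  qed
  then have "orthogonal_family N h ({} :: nat set) b" for b
    by (intro orthogonal_familyI[OF 0(1)]) (auto intro: hermitian_zero_if_diagonal_zero[OF 0(1)])
  then show ?case by blast
next
  case (Suc r)
  show ?case
  proof (cases "\<forall>u\<in>N. h u u = 0")
    case True
    then have "orthogonal_family N h ({} :: nat set) b" for b
      by (intro orthogonal_familyI[OF Suc(2)]) (auto intro: hermitian_zero_if_diagonal_zero[OF Suc(2)])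
    then show ?thesis by blast
  next
    case False
    then obtain v where v: "v \<in> N" "h v v \<noteq> 0" by blast
    have hp: "hermitian_on (perp N h {v}) h"
      using v by (intro hermitian_on_perp[OF Suc(2)]) auto
    obtain I :: "nat set" and b where
      b: "orthogonal_family (perp N h {v}) h I b" "\<forall>i\<in>I. h (b i) (b i) \<noteq> 0"
      using Suc.IH[OF hp finite_rank_perp[OF Suc(2) v Suc(3)]] by blast
    have "finite I" using b unfolding orthogonal_family_def by blast
    then obtain i where i: "i \<notin> I" using ex_new_if_finite infinite_UNIV_nat by blast
    have "\<forall>j\<in>insert i I. h ((b(i := v)) j) ((b(i := v)) j) \<noteq> 0"
      using b(2) v by auto
    then show ?thesis
      using orthogonal_family_insert[OF Suc(2) v b(1) i] by blast
  qed
qed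

text \<open>The delicate case is an isotropic \<open>v\<close> outside the radical. It spans a
  hyperbolic plane with a partner \<open>t\<close>; the plane has signature 0, and in the complement
  of \<open>v\<close> only \<open>v\<close> remains of it, as a radical vector.\<close>

lemma signature_perp_single:
  assumes h: "hermitian_on N h" and r: "finite_rank N h r" and v: "v \<in> N"
  shows "signature N h = sign_re (h v v) + signature (perp N h {v}) h"
proof -
  have sub: "perp N h K \<subseteq> N" for K by (auto simp: perp_def)
  have hp: "hermitian_on (perp N h {v}) h"
    using v by (intro hermitian_on_perp[OF h]) auto
  consider "h v v \<noteq> 0" | "h v v = 0" "\<forall>u\<in>N. h u v = 0" | s where "h v v = 0" "s \<in> N" "h s v \<noteq> 0"
    by blast
  then show ?thesis
  proof cases
    case 1
    obtain I :: "nat set" and b where b: "orthogonal_family (perp N h {v}) h I b"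
      using orthogonal_family_exists[OF hp finite_rank_subset[OF r sub]] by blast
    have fin: "finite I" using b unfolding orthogonal_family_def by blast
    then obtain i where i: "i \<notin> I" using ex_new_if_finite infinite_UNIV_nat by blast
    have "signature N h = (\<Sum>j\<in>insert i I. sign_re (h ((b(i := v)) j) ((b(i := v)) j)))"
      by (rule signature_eq[OF h has_signatureI[OF orthogonal_family_insert[OF h v 1 b i]]])
    also have "\<dots> = sign_re (h v v) + (\<Sum>j\<in>I. sign_re (h (b j) (b j)))"
      using fin i by (simp add: sum.insert) (intro sum.cong, auto)
    also have "(\<Sum>j\<in>I. sign_re (h (b j) (b j))) = signature (perp N h {v}) h"
      by (rule signature_eq[OF hp has_signatureI[OF b], symmetric])
    finally show ?thesis .
  next
    case 2
    then have "perp N h {v} = N" by (auto simp: perp_def)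
    then show ?thesis using 2 by simp
  next
    case 3
    define s1 where "s1 = scale (1 / h s v) s"
    have s1: "s1 \<in> N" "h s1 v = 1"
      using 3 v hermitian_mem(3)[OF h] by (auto simp: s1_def hermitian_scale_left[OF h])
    \<comment> \<open>Subtracting half of the real number \<open>h s1 s1\<close> times
      \<open>v\<close> makes the partner isotropic and keeps its pairing 1 with
      \<open>v\<close>.\<close>
    define t where "t = s1 - scale (h s1 s1 / 2) v"
    have t: "t \<in> N" "h t v = 1"
      using s1 3 v hermitian_mem(3,4)[OF h]
      by (auto simp: t_def hermitian_diff_left[OF h] hermitian_scale_left[OF h])
    have vs: "h v s1 = 1" using hermitian_sym[OF h s1(1) v] s1 by simp
    have tt: "h t t = 0"
    proof -
      have "cnj (h s1 s1) = h s1 s1" by (rule hermitian_sym[OF h s1(1) s1(1), symmetric])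
      then show ?thesis
        using s1 3(1) v vs hermitian_mem(3,4)[OF h] unfolding t_def
        by (simp add: hermitian_diff_left[OF h] hermitian_diff_right[OF h]
            hermitian_scale_left[OF h] hermitian_scale_right[OF h])
    qed
    have vt: "h v t = 1" using hermitian_sym[OF h t(1) v] t by simp
    define P where "P = perp N h {v, t}"
    have hP: "hermitian_on P h"
      unfolding P_def using v t by (intro hermitian_on_perp[OF h]) auto
    obtain I :: "nat set" and b where b: "orthogonal_family P h I b"
      using orthogonal_family_exists[OF hP] finite_rank_subset[OF r sub] unfolding P_def by blast
    note B = orthogonal_familyD[OF hP b]
    have bv: "h (b j) v = 0" "h (b j) t = 0" "h v (b j) = 0" "h t (b j) = 0" "b j \<in> N" if "j \<in> I" for j
      using B(2)[OF that] v t hermitian_radical_right[OF h] unfolding P_def perp_def by auto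
    obtain i where "i \<notin> I"
      using ex_new_if_finite[OF infinite_UNIV_nat B(1)] by blast
    moreover obtain k where "k \<notin> insert i I"
      using ex_new_if_finite[OF infinite_UNIV_nat, of "insert i I"] B(1) by auto
    ultimately have ik: "i \<notin> I" "k \<notin> insert i I" by auto
    \<comment> \<open>The orthogonal basis of the hyperbolic plane, with norms 2 and -2, whose signs
      cancel.\<close>
    define x y where "x = v + t" and "y = v - t"
    have xy: "x \<in> N" "y \<in> N" using v t hermitian_mem[OF h] by (auto simp: x_def y_def)
    have hxy: "h x x = 2" "h y y = - 2" "h x y = 0" "h y x = 0"
      using v t tt vt 3(1) unfolding x_def y_def
      by (simp_all add: hermitian_add_left[OF h] hermitian_add_right[OF h] hermitian_diff_left[OF h]
          hermitian_diff_right[OF h] hermitian_mem(2,4)[OF h])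
    have bxy: "h (b j) x = 0" "h (b j) y = 0" "h x (b j) = 0" "h y (b j) = 0" if "j \<in> I" for j
      using bv[OF that] v t unfolding x_def y_def
      by (simp_all add: hermitian_add_left[OF h] hermitian_add_right[OF h] hermitian_diff_left[OF h]
          hermitian_diff_right[OF h])
    have comp: "h u w = (\<Sum>j\<in>I. q j * h (b j) w) + h u t * h v w + h u v * h t w"
      if u: "u \<in> N" and w: "w \<in> N"
        and q: "\<And>z. z \<in> P \<Longrightarrow> h (u - scale (h u t) v - scale (h u v) t) z = (\<Sum>j\<in>I. q j * h (b j) z)"
      for u w q
    proof -
      let ?p = "\<lambda>u. u - scale (h u t) v - scale (h u v) t"
      have pN: "scale (h u t) v \<in> N" "scale (h u v) t \<in> N" "?p u \<in> N" if "u \<in> N" for u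
        using that v t hermitian_mem[OF h] by auto
      have pP: "?p u \<in> P" if "u \<in> N" for u
        using that v t tt vt 3(1) pN[OF that] hermitian_mem[OF h]
        by (auto simp: P_def perp_def hermitian_diff_left[OF h] hermitian_scale_left[OF h])
      have e: "h z w = h z (?p w)" if "z \<in> P" for z
      proof -
        have "z \<in> N" "h z v = 0" "h z t = 0" using that by (auto simp: P_def perp_def)
        then show ?thesis
          using w v t pN[OF w] hermitian_mem[OF h]
          by (simp add: hermitian_diff_right[OF h] hermitian_scale_right[OF h])
      qed
      have "h (?p u) w = (\<Sum>j\<in>I. q j * h (b j) w)"
        using e[OF pP[OF u]] q[OF pP[OF w]] e B(2) by simp
      then show ?thesis
        using u v t w pN[OF u] hermitian_mem[OF h]
        by (simp add: hermitian_diff_left[OF h] hermitian_add_left[OF h] hermitian_scale_left[OF h] algebra_simps)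
    qed
    have pr: "\<exists>q. \<forall>z\<in>P. h (u - scale (h u t) v - scale (h u v) t) z = (\<Sum>j\<in>I. q j * h (b j) z)"
      if u: "u \<in> N" for u
    proof (rule B(4))
      show "u - scale (h u t) v - scale (h u v) t \<in> P"
        using u v t tt vt 3(1) hermitian_mem[OF h]
        by (auto simp: P_def perp_def hermitian_diff_left[OF h] hermitian_scale_left[OF h])
    qed
    let ?b = "b(i := x, k := y)" and ?I = "insert k (insert i I)"
    have "orthogonal_family N h ?I ?b"
    proof (rule orthogonal_familyI[OF h])
      fix u assume u: "u \<in> N"
      obtain q where q: "\<And>z. z \<in> P \<Longrightarrow> h (u - scale (h u t) v - scale (h u v) t) z = (\<Sum>j\<in>I. q j * h (b j) z)"
        using pr[OF u] by blast
      let ?q = "q(i := (h u t + h u v) / 2, k := (h u t - h u v) / 2)"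
      have "h u w = (\<Sum>j\<in>?I. ?q j * h (?b j) w)" if w: "w \<in> N" for w
      proof -
        have "(\<Sum>j\<in>?I. ?q j * h (?b j) w) =
            (h u t - h u v) / 2 * h y w + ((h u t + h u v) / 2 * h x w + (\<Sum>j\<in>I. ?q j * h (?b j) w))"
          using B(1) ik by (simp add: sum.insert)
        also have "(\<Sum>j\<in>I. ?q j * h (?b j) w) = (\<Sum>j\<in>I. q j * h (b j) w)"
          using ik by (intro sum.cong) auto
        also have "h y w = h v w - h t w" using v t w unfolding y_def by (simp add: hermitian_diff_left[OF h])
        also have "h x w = h v w + h t w" using v t w unfolding x_def by (simp add: hermitian_add_left[OF h])
        also have "(h u t - h u v) / 2 * (h v w - h t w) +
            ((h u t + h u v) / 2 * (h v w + h t w) + (\<Sum>j\<in>I. q j * h (b j) w)) = h u w"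
          using comp[OF u w, of q] q by (simp add: field_simps)
        finally show ?thesis by (rule sym)
      qed
      then show "\<exists>q. \<forall>w\<in>N. h u w = (\<Sum>j\<in>?I. q j * h (?b j) w)" by blast
    qed (use B(1,3) bv bxy hxy xy ik in \<open>auto split: if_splits\<close>)
    then have "signature N h = (\<Sum>j\<in>?I. sign_re (h (?b j) (?b j)))"
      by (intro signature_eq[OF h has_signatureI])
    also have "\<dots> = (\<Sum>j\<in>I. sign_re (h (?b j) (?b j)))"
      using B(1) ik by (simp add: sum.insert hxy sign_re_def)
    also have "\<dots> = (\<Sum>j\<in>I. sign_re (h (b j) (b j)))"
      using ik by (intro sum.cong) auto
    finally have s1: "signature N h = (\<Sum>j\<in>I. sign_re (h (b j) (b j)))" .
    let ?b' = "b(i := v)" and ?I' = "insert i I"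
    have vp: "v \<in> perp N h {v}" using v 3 by (simp add: perp_def)
    have "orthogonal_family (perp N h {v}) h ?I' ?b'"
    proof (rule orthogonal_familyI[OF hp])
      fix u assume u': "u \<in> perp N h {v}"
      then have u: "u \<in> N" "h u v = 0" by (auto simp: perp_def)
      obtain q where q: "\<And>z. z \<in> P \<Longrightarrow> h (u - scale (h u t) v - scale (h u v) t) z = (\<Sum>j\<in>I. q j * h (b j) z)"
        using pr[OF u(1)] by blast
      have "h u w = (\<Sum>j\<in>?I'. (q(i := h u t)) j * h (?b' j) w)" if "w \<in> perp N h {v}" for w
      proof -
        have w: "w \<in> N" using that by (auto simp: perp_def)
        have "(\<Sum>j\<in>I. (q(i := h u t)) j * h (?b' j) w) = (\<Sum>j\<in>I. q j * h (b j) w)"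
          using ik by (intro sum.cong) auto
        then show ?thesis
          using comp[OF u(1) w, of q] q B(1) ik u(2) by (simp add: sum.insert)
      qed
      then show "\<exists>q. \<forall>w\<in>perp N h {v}. h u w = (\<Sum>j\<in>?I'. q j * h (?b' j) w)" by blast
    qed (use B(1,3) bv vp ik in \<open>auto simp: perp_def split: if_splits\<close>)
    then have "signature (perp N h {v}) h = (\<Sum>j\<in>?I'. sign_re (h (?b' j) (?b' j)))"
      by (intro signature_eq[OF hp has_signatureI])
    also have "\<dots> = (\<Sum>j\<in>I. sign_re (h (?b' j) (?b' j)))"
      using B(1) ik 3 by (simp add: sum.insert)
    also have "\<dots> = (\<Sum>j\<in>I. sign_re (h (b j) (b j)))"
      using ik by (intro sum.cong) auto
    finally show ?thesis using s1 3 by simp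
  qed
qed

lemma signature_perp_family:
  assumes "finite I" "hermitian_on N h" "finite_rank N h r" "\<And>i. i \<in> I \<Longrightarrow> b i \<in> N"
    "\<And>i j. i \<in> I \<Longrightarrow> j \<in> I \<Longrightarrow> i \<noteq> j \<Longrightarrow> h (b i) (b j) = 0"
  shows "signature N h = (\<Sum>i\<in>I. sign_re (h (b i) (b i))) + signature (perp N h (b ` I)) h"
  using assms
proof (induction I arbitrary: N rule: finite_induct)
  case empty
  then show ?case by (simp add: perp_def)
next
  case (insert i I)
  let ?N = "perp N h {b i}"
  have hp: "hermitian_on ?N h"
    using insert.prems by (intro hermitian_on_perp) auto
  have "signature N h = sign_re (h (b i) (b i)) + signature ?N h"
    using insert.prems by (intro signature_perp_single) auto
  also have "signature ?N h = (\<Sum>i\<in>I. sign_re (h (b i) (b i))) + signature (perp ?N h (b ` I)) h"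
    using insert.prems insert.hyps
    by (intro insert.IH hp finite_rank_subset[OF insert.prems(2)]) (auto simp: perp_def)
  also have "perp ?N h (b ` I) = perp N h (b ` insert i I)" by (auto simp: perp_def)
  finally show ?case using insert.hyps by simp
qed

text \<open>If no finite set suffices, one picks \<open>k j\<close> in \<open>K\<close> and
  \<open>u j\<close> in \<open>N\<close> with \<open>h (u j) (k j)\<close> nonzero but
  \<open>u j\<close> orthogonal to the earlier \<open>k i\<close>. This triangular system
  contradicts the rank bound for \<open>r + 1\<close> vectors.\<close>

lemma finite_perp:
  assumes h: "hermitian_on N h" and r: "finite_rank N h r" and K: "K \<subseteq> N"
  shows "\<exists>S. finite S \<and> S \<subseteq> K \<and> perp N h S = perp N h K"
proof (rule ccontr)
  assume no: "\<not> ?thesis"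
  have "\<exists>k u. \<forall>j<m. k j \<in> K \<and> u j \<in> N \<and> h (u j) (k j) \<noteq> 0 \<and> (\<forall>i<j. h (u j) (k i) = 0)" for m :: nat
  proof (induction m)
    case (Suc m)
    then obtain k u where
      ku: "\<forall>j<m. k j \<in> K \<and> u j \<in> N \<and> h (u j) (k j) \<noteq> 0 \<and> (\<forall>i<j. h (u j) (k i) = 0)"
      by blast
    then have "k ` {..<m} \<subseteq> K" by auto
    then have "perp N h (k ` {..<m}) \<noteq> perp N h K" "perp N h K \<subseteq> perp N h (k ` {..<m})"
      using no by (blast, auto simp: perp_def)
    then obtain x where x: "x \<in> perp N h (k ` {..<m})" "x \<notin> perp N h K" by blast
    then obtain y where y: "y \<in> K" "h x y \<noteq> 0" by (auto simp: perp_def)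
    show ?case
      using ku x y by (intro exI[of _ "k(m := y)"] exI[of _ "u(m := x)"]) (auto simp: perp_def less_Suc_eq)
  qed auto
  from this[of "Suc r"] obtain k u where
    ku: "\<And>j. j \<le> r \<Longrightarrow> k j \<in> K \<and> u j \<in> N \<and> h (u j) (k j) \<noteq> 0 \<and> (\<forall>i<j. h (u j) (k i) = 0)"
    by (auto simp: less_Suc_eq_le)
  then have "\<forall>i\<le>r. k i \<in> N" using K by blast
  then obtain q where q: "\<exists>i\<le>r. q i \<noteq> 0" "\<And>v. v \<in> N \<Longrightarrow> h (\<Sum>i\<le>r. scale (q i) (k i)) v = 0"
    using r unfolding finite_rank_def by blast
  \<comment> \<open>The last index with nonzero coefficient: pairing the relation with
    \<open>u j\<close> leaves just this term.\<close>
  define j where "j = Max {i. i \<le> r \<and> q i \<noteq> 0}"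
  have fin: "finite {i. i \<le> r \<and> q i \<noteq> 0}" by simp
  have "j \<in> {i. i \<le> r \<and> q i \<noteq> 0}"
    unfolding j_def using q(1) by (intro Max_in) auto
  then have j: "j \<le> r" "q j \<noteq> 0" by auto
  have late: "q i = 0" if "i \<le> r" "j < i" for i
    using that Max_ge[OF fin, of i] unfolding j_def[symmetric] by auto
  have kN: "k i \<in> N" if "i \<le> r" for i using ku[OF that] K by blast
  have uN: "u j \<in> N" using ku[OF j(1)] by blast
  have m: "(\<Sum>i\<le>r. scale (q i) (k i)) \<in> N"
    using kN hermitian_mem(3)[OF h] by (intro hermitian_mem(5)[OF h]) auto
  have "h (u j) (\<Sum>i\<le>r. scale (q i) (k i)) = (\<Sum>i\<le>r. cnj (q i) * h (u j) (k i))"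
    using kN uN by (intro hermitian_combination_right[OF h]) auto
  also have "\<dots> = (\<Sum>i\<in>{j}. cnj (q i) * h (u j) (k i))"
    using ku[OF j(1)] late j(1) by (intro sum.mono_neutral_right) (auto simp: nat_neq_iff)
  finally have "h (u j) (\<Sum>i\<le>r. scale (q i) (k i)) \<noteq> 0" using ku[OF j(1)] j by simp
  moreover have "h (u j) (\<Sum>i\<le>r. scale (q i) (k i)) = 0"
    using hermitian_radical_right[OF h m uN] q(2)[OF uN] by simp
  ultimately show False by simp
qed

text \<open>\<open>K\<close> and its orthogonal complement may meet outside the radical of \<open>N\<close>.\<close>

lemma signature_perp:
  assumes h: "hermitian_on N h" and r: "finite_rank N h r" and K: "subspace K" "K \<subseteq> N"
  shows "signature N h = signature K h + signature (perp N h K) h"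
proof -
  have hK: "hermitian_on K h" by (rule hermitian_on_subset[OF h K])
  obtain I :: "nat set" and b where b: "orthogonal_family K h I b"
    using orthogonal_family_exists[OF hK finite_rank_subset[OF r K(2)]] by blast
  note B = orthogonal_familyD[OF hK b]
  have bN: "b i \<in> N" if "i \<in> I" for i using B(2)[OF that] K by blast
  have PK: "perp K h K \<subseteq> N" using K by (auto simp: perp_def)
  \<comment> \<open>\<open>b\<close> spans \<open>K\<close> only modulo the radical of
    \<open>K\<close>, which may pair nontrivially with \<open>N\<close>. Finitely many vectors
    \<open>S\<close> of that radical are added; being orthogonal to \<open>K\<close>, they
    contribute 0 to the signature, and together with \<open>b\<close> they cut out the complement of
    \<open>K\<close>.\<close>
  obtain S where S: "finite S" "S \<subseteq> perp K h K" "perp N h S = perp N h (perp K h K)"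
    using finite_perp[OF h r PK] by metis
  let ?f = "case_sum b id" and ?I = "Inl ` I \<union> Inr ` S"
  have fin: "finite ?I" using B(1) S(1) by simp
  have SK: "x \<in> K" "\<And>k. k \<in> K \<Longrightarrow> h x k = 0" "\<And>k. k \<in> K \<Longrightarrow> h k x = 0" if "x \<in> S" for x
    using that S(2) hermitian_radical_right[OF hK, of x] by (auto simp: perp_def)
  have "signature N h = (\<Sum>i\<in>?I. sign_re (h (?f i) (?f i))) + signature (perp N h (?f ` ?I)) h"
    using bN SK K B(2) by (intro signature_perp_family[OF fin h r]) (auto, use B(3) in blast)
  also have "(\<Sum>i\<in>?I. sign_re (h (?f i) (?f i))) =
      (\<Sum>i\<in>Inl ` I. sign_re (h (?f i) (?f i))) + (\<Sum>i\<in>Inr ` S. sign_re (h (?f i) (?f i)))"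
    using B(1) S(1) by (intro sum.union_disjoint) auto
  also have "(\<Sum>i\<in>Inr ` S. sign_re (h (?f i) (?f i))) = 0"
    using SK by (intro sum.neutral) auto
  also have "(\<Sum>i\<in>Inl ` I. sign_re (h (?f i) (?f i))) = signature K h"
    using signature_eq[OF hK has_signatureI[OF b]] by (simp add: sum.reindex)
  also have "perp N h (?f ` ?I) = perp N h K"
  proof
    show "perp N h (?f ` ?I) \<subseteq> perp N h K"
    proof
      fix u assume u: "u \<in> perp N h (?f ` ?I)"
      then have "u \<in> perp N h S" and ub: "h u (b i) = 0" if "i \<in> I" for i
        using that by (auto simp: perp_def image_Un image_image)
      have u: "u \<in> N" "u \<in> perp N h (perp K h K)"
        using u S(3) by (auto simp: perp_def image_Un image_image)
      have "h u k = 0" if k: "k \<in> K" for k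
      proof -
        obtain q where q: "\<And>v. v \<in> K \<Longrightarrow> h (k - (\<Sum>i\<in>I. scale (q i) (b i))) v = 0"
          using b k unfolding orthogonal_family_def by blast
        have m: "(\<Sum>i\<in>I. scale (q i) (b i)) \<in> K"
          using B(2) hermitian_mem(3)[OF hK] by (intro hermitian_mem(5)[OF hK]) auto
        have "k - (\<Sum>i\<in>I. scale (q i) (b i)) \<in> perp K h K"
          using q m k hermitian_mem(4)[OF hK] by (simp add: perp_def)
        then have "h u (k - (\<Sum>i\<in>I. scale (q i) (b i))) = 0" using u(2) by (simp add: perp_def)
        moreover have "h u (\<Sum>i\<in>I. scale (q i) (b i)) = (\<Sum>i\<in>I. cnj (q i) * h u (b i))"
          using bN u by (intro hermitian_combination_right[OF h]) auto
        ultimately show ?thesis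
          using ub m k K u(1) by (auto simp: hermitian_diff_right[OF h] subset_iff)
      qed
      then show "u \<in> perp N h K" using u by (simp add: perp_def)
    qed
    show "perp N h K \<subseteq> perp N h (?f ` ?I)"
      using B(2) SK by (auto simp: perp_def)
  qed
  finally show ?thesis by simp
qed

lemma signature_zero:
  assumes "hermitian_on N h" "\<And>u v. u \<in> N \<Longrightarrow> v \<in> N \<Longrightarrow> h u v = 0"
  shows "signature N h = 0"
proof -
  have "orthogonal_family N h ({} :: nat set) b" for b
    by (intro orthogonal_familyI[OF assms(1)]) (use assms in auto)
  from signature_eq[OF assms(1) has_signatureI[OF this]] show ?thesis by simp
qed

end

text \<open>The image of an orthogonal family is again one. As \<open>f\<close> has to be onto
  merely modulo the radical of \<open>N'\<close>, the two spaces may differ by radical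
  vectors.\<close>

lemma signature_isometry:
  assumes "complex_space s1" "complex_space s2"
    and h: "complex_space.hermitian_on s1 N h" and h': "complex_space.hermitian_on s2 N' h'"
    and r: "complex_space.finite_rank s1 N h r"
    and f: "\<And>u. u \<in> N \<Longrightarrow> f u \<in> N'" "\<And>u v. u \<in> N \<Longrightarrow> v \<in> N \<Longrightarrow> h' (f u) (f v) = h u v"
    and onto: "\<And>w. w \<in> N' \<Longrightarrow> \<exists>u\<in>N. \<forall>v\<in>N'. h' w v = h' (f u) v"
  shows "complex_space.signature s2 N' h' = complex_space.signature s1 N h"
proof -
  interpret A: complex_space s1 by fact
  interpret B: complex_space s2 by fact
  obtain I :: "nat set" and b where b: "A.orthogonal_family N h I b"
    using A.orthogonal_family_exists[OF h r] by blast
  note D = A.orthogonal_familyD[OF h b]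
  have "B.orthogonal_family N' h' I (f \<circ> b)"
  proof (rule B.orthogonal_familyI[OF h'])
    fix w assume "w \<in> N'"
    then obtain u where u: "u \<in> N" "\<And>v. v \<in> N' \<Longrightarrow> h' w v = h' (f u) v" using onto by blast
    then obtain q where q: "\<And>v. v \<in> N \<Longrightarrow> h u v = (\<Sum>i\<in>I. q i * h (b i) v)" using D(4) by blast
    have "h' w v = (\<Sum>i\<in>I. q i * h' ((f \<circ> b) i) v)" if v: "v \<in> N'" for v
    proof -
      obtain v0 where v0: "v0 \<in> N" "\<And>z. z \<in> N' \<Longrightarrow> h' v z = h' (f v0) z" using onto v by blast
      have e: "h' (f x) v = h x v0" if x: "x \<in> N" for x
        using v0 f x v B.hermitian_sym[OF h', of v "f x"] B.hermitian_sym[OF h', of "f v0" "f x"] by simp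
      show ?thesis using u(2)[OF v] e[OF u(1)] q[OF v0(1)] e D(2) by simp
    qed
    then show "\<exists>q. \<forall>v\<in>N'. h' w v = (\<Sum>i\<in>I. q i * h' ((f \<circ> b) i) v)" by blast
  qed (use D f in auto)
  then have "B.signature N' h' = (\<Sum>i\<in>I. sign_re (h' ((f \<circ> b) i) ((f \<circ> b) i)))"
    by (intro B.signature_eq[OF h'] B.has_signatureI)
  also have "\<dots> = (\<Sum>i\<in>I. sign_re (h (b i) (b i)))"
    using D(2) f by simp
  also have "\<dots> = A.signature N h"
    by (rule A.signature_eq[OF h A.has_signatureI[OF b], symmetric])
  finally show ?thesis .
qed

section \<open>Hermitian matrices of polynomials\<close>

abbreviation cnj_poly :: "complex poly \<Rightarrow> complex poly" where
  "cnj_poly \<equiv> map_poly cnj"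

lemma cnj_poly_simps [simp]:
  "cnj_poly (p + q) = cnj_poly p + cnj_poly q"
  "cnj_poly (p * q) = cnj_poly p * cnj_poly q"
  "cnj_poly (cnj_poly p) = p"
  "cnj_poly (Polynomial.smult a p) = Polynomial.smult (cnj a) (cnj_poly p)"
  by (simp_all add: poly_eq_iff coeff_map_poly coeff_mult)

lemma cnj_poly_sum: "cnj_poly (sum f A) = (\<Sum>x\<in>A. cnj_poly (f x))"
  by (induction A rule: infinite_finite_induct) auto

lemma poly_cnj_poly_real: "poly (cnj_poly p) (of_real x) = cnj (poly p (of_real x))"
  by simp

lemma X_power_dvd_iff: "([:0, 1:] :: complex poly) ^ k dvd p \<longleftrightarrow> (\<forall>i<k. coeff p i = 0)"
proof -
  have "monom (1::complex) k dvd p \<longleftrightarrow> (\<forall>i<k. coeff p i = 0)"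
    by (rule monom_1_dvd_iff')
  then show ?thesis by (simp add: monom_altdef)
qed

lemma coeff_X_power_mult: "coeff ([:0, 1:] ^ k * (q :: complex poly)) k = poly q 0"
proof -
  have "coeff (monom 1 k * q) (0 + k) = coeff q 0" by (simp only: coeff_monom_mult mult_1) simp
  then show ?thesis by (simp add: monom_altdef poly_0_coeff_0)
qed

definition supported_on :: "'i set \<Rightarrow> ('i \<Rightarrow> 'r::zero) set" where
  "supported_on I = {u. \<forall>i. i \<notin> I \<longrightarrow> u i = 0}"

definition unit_vector :: "'i \<Rightarrow> 'i \<Rightarrow> 'r::zero_neq_one" where
  "unit_vector i j = (if j = i then 1 else 0)"

definition scale_fun :: "complex \<Rightarrow> ('i \<Rightarrow> complex) \<Rightarrow> 'i \<Rightarrow> complex" where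
  "scale_fun a u = (\<lambda>i. a * u i)"

definition scale_poly :: "complex \<Rightarrow> ('i \<Rightarrow> complex poly) \<Rightarrow> 'i \<Rightarrow> complex poly" where
  "scale_poly a u = (\<lambda>i. Polynomial.smult a (u i))"

lemma complex_space_scale_fun: "complex_space scale_fun"
  by unfold_locales (auto simp: scale_fun_def fun_eq_iff algebra_simps)

lemma complex_space_scale_poly: "complex_space scale_poly"
  by unfold_locales (auto simp: scale_poly_def fun_eq_iff smult_add_right smult_add_left)

interpretation fun_space: complex_space scale_fun by (rule complex_space_scale_fun)
interpretation poly_space: complex_space scale_poly by (rule complex_space_scale_poly)

definition eval_vector :: "complex \<Rightarrow> ('i \<Rightarrow> complex poly) \<Rightarrow> 'i \<Rightarrow> complex" where
  "eval_vector x u = (\<lambda>i. poly (u i) x)"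

text \<open>The conjugation \<open>cj\<close> is a parameter so that one formula serves complex
  entries (\<open>cnj\<close>) and polynomial entries (\<open>cnj_poly\<close>). Conjugating
  coefficients commutes with evaluation at real points.\<close>

definition matrix_form ::
  "'i set \<Rightarrow> ('r \<Rightarrow> 'r) \<Rightarrow> ('i \<Rightarrow> 'i \<Rightarrow> 'r::comm_ring_1) \<Rightarrow> ('i \<Rightarrow> 'r) \<Rightarrow> ('i \<Rightarrow> 'r) \<Rightarrow> 'r" where
  "matrix_form I cj G u v = (\<Sum>i\<in>I. \<Sum>j\<in>I. u i * G i j * cj (v j))"

lemma eval_matrix_form:
  "poly (matrix_form I cnj_poly G u v) (of_real x) =
   matrix_form I cnj (\<lambda>i j. poly (G i j) (of_real x)) (eval_vector (of_real x) u) (eval_vector (of_real x) v)"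
  by (simp add: matrix_form_def eval_vector_def poly_sum poly_cnj_poly_real)

definition eval_form where
  "eval_form I G x = matrix_form I cnj (\<lambda>i j. poly (G i j) (complex_of_real x))"

lemma hermitian_on_matrix_form:
  assumes "\<And>i j. i \<in> I \<Longrightarrow> j \<in> I \<Longrightarrow> G j i = cnj (G i j)"
  shows "fun_space.hermitian_on (supported_on I) (matrix_form I cnj G)"
proof -
  have "matrix_form I cnj G v u = cnj (matrix_form I cnj G u v)" for u v
  proof -
    have e: "v i * G i j * cnj (u j) = cnj (u j * G j i * cnj (v i))" if "i \<in> I" "j \<in> I" for i j
      using assms[OF that] by simp
    have "matrix_form I cnj G v u = (\<Sum>j\<in>I. \<Sum>i\<in>I. v i * G i j * cnj (u j))"
      unfolding matrix_form_def by (rule sum.swap)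
    also have "\<dots> = (\<Sum>j\<in>I. \<Sum>i\<in>I. cnj (u j * G j i * cnj (v i)))"
      using e by (intro sum.cong refl)
    finally show ?thesis by (simp add: matrix_form_def)
  qed
  moreover have "fun_space.subspace (supported_on I)"
    by (auto simp: fun_space.subspace_def supported_on_def scale_fun_def)
  moreover have "matrix_form I cnj G (u + v) w = matrix_form I cnj G u w + matrix_form I cnj G v w"
      "matrix_form I cnj G (scale_fun a u) w = a * matrix_form I cnj G u w" for a u v w
    by (simp_all add: matrix_form_def scale_fun_def algebra_simps sum.distrib sum_distrib_left)
  ultimately show ?thesis
    unfolding fun_space.hermitian_on_def by blast
qed

text \<open>The submodule generated over the polynomial ring, not a complex span.\<close>

definition poly_span :: "('j \<Rightarrow> 'i \<Rightarrow> complex poly) \<Rightarrow> 'j set \<Rightarrow> ('i \<Rightarrow> complex poly) set" where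
  "poly_span x J = {v. \<exists>c. \<forall>p. v p = (\<Sum>j\<in>J. c j * x j p)}"

lemma poly_spanI: "(\<And>p. v p = (\<Sum>j\<in>J. c j * x j p)) \<Longrightarrow> v \<in> poly_span x J"
  unfolding poly_span_def by blast

lemma poly_span_base:
  assumes "finite J" "j \<in> J"
  shows "x j \<in> poly_span x J"
proof (rule poly_spanI)
  fix p
  have "(\<Sum>k\<in>J. (if k = j then 1 else 0) * x k p) = (\<Sum>k\<in>J. if k = j then x k p else 0)"
    by (rule sum.cong) auto
  then show "x j p = (\<Sum>k\<in>J. (if k = j then 1 else 0) * x k p)"
    using assms by simp
qed

lemma poly_span_lincomb:
  assumes "u \<in> poly_span x J" "v \<in> poly_span x J"
  shows "(\<lambda>p. a * u p + b * v p) \<in> poly_span x J"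
proof -
  obtain c d where "\<And>p. u p = (\<Sum>j\<in>J. c j * x j p)" "\<And>p. v p = (\<Sum>j\<in>J. d j * x j p)"
    using assms unfolding poly_span_def by blast
  then show ?thesis
    by (intro poly_spanI[where c = "\<lambda>j. a * c j + b * d j"])
      (simp add: sum.distrib sum_distrib_left algebra_simps)
qed

lemma poly_span_sum:
  assumes "finite K" "\<And>k. k \<in> K \<Longrightarrow> y k \<in> poly_span x J"
  shows "(\<lambda>p. \<Sum>k\<in>K. c k * y k p) \<in> poly_span x J"
  using assms
proof (induction K rule: finite_induct)
  case empty
  show ?case by (rule poly_spanI[where c = "\<lambda>_. 0"]) simp
next
  case (insert k K)
  then have "(\<lambda>p. c k * y k p + 1 * (\<Sum>k\<in>K. c k * y k p)) \<in> poly_span x J"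
    by (intro poly_span_lincomb) auto
  then show ?case using insert by simp
qed

lemma poly_span_trans:
  assumes "finite K" "v \<in> poly_span y K" "\<And>k. k \<in> K \<Longrightarrow> y k \<in> poly_span x J"
  shows "v \<in> poly_span x J"
proof -
  obtain c where "\<And>p. v p = (\<Sum>k\<in>K. c k * y k p)" using assms(2) unfolding poly_span_def by blast
  then have "v = (\<lambda>p. \<Sum>k\<in>K. c k * y k p)" by auto
  then show ?thesis using poly_span_sum[OF assms(1,3)] by simp
qed

locale poly_hermitian =
  fixes I :: "'i set" and G :: "'i \<Rightarrow> 'i \<Rightarrow> complex poly"
  assumes finite_index: "finite I"
    and G_sym: "\<And>i j. i \<in> I \<Longrightarrow> j \<in> I \<Longrightarrow> G j i = cnj_poly (G i j)"
begin

abbreviation g where "g \<equiv> matrix_form I cnj_poly G"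

lemma g_add_left: "g (\<lambda>p. u p + v p) w = g u w + g v w"
  and g_scale_left: "g (\<lambda>p. a * u p) w = a * g u w"
  by (simp_all add: matrix_form_def algebra_simps sum.distrib sum_distrib_left)

lemma g_sym: "g v u = cnj_poly (g u v)"
proof -
  have e: "v i * G i j * cnj_poly (u j) = cnj_poly (u j * G j i * cnj_poly (v i))" if "i \<in> I" "j \<in> I" for i j
    using G_sym[OF that] by (simp add: mult_ac)
  have "g v u = (\<Sum>j\<in>I. \<Sum>i\<in>I. v i * G i j * cnj_poly (u j))"
    unfolding matrix_form_def by (rule sum.swap)
  also have "\<dots> = (\<Sum>j\<in>I. \<Sum>i\<in>I. cnj_poly (u j * G j i * cnj_poly (v i)))"
    using e by (intro sum.cong refl)
  finally show ?thesis by (simp add: matrix_form_def cnj_poly_sum)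
qed

lemma g_zero_left: "(\<And>p. u p = 0) \<Longrightarrow> g u w = 0"
  by (simp add: matrix_form_def)

lemma g_lincomb_left: "g (\<lambda>p. a * u p + b * v p) w = a * g u w + b * g v w"
  using g_add_left[of "\<lambda>p. a * u p" "\<lambda>p. b * v p"] by (simp add: g_scale_left)

lemma g_lincomb_right:
  "g w (\<lambda>p. a * u p + b * v p) = cnj_poly a * g w u + cnj_poly b * g w v"
  using g_lincomb_left[of a u b v w] g_sym[of w "\<lambda>p. a * u p + b * v p"] g_sym[of w u] g_sym[of w v] by simp

lemma g_sum_left: "g (\<lambda>p. \<Sum>j\<in>J. c j * x j p) w = (\<Sum>j\<in>J. c j * g (x j) w)"
proof (induction J rule: infinite_finite_induct)
  case (insert j J)
  then show ?case using g_lincomb_left[of "c j" "x j" 1 "\<lambda>p. \<Sum>j\<in>J. c j * x j p" w] by simp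
qed (auto intro: g_zero_left)

lemma g_span_zero:
  assumes "v \<in> poly_span x J" "\<And>j. j \<in> J \<Longrightarrow> g (x j) w = 0"
  shows "g v w = 0"
proof -
  obtain c where "\<And>p. v p = (\<Sum>j\<in>J. c j * x j p)" using assms(1) unfolding poly_span_def by blast
  then have "v = (\<lambda>p. \<Sum>j\<in>J. c j * x j p)" by auto
  then show ?thesis using assms(2) by (simp add: g_sum_left)
qed

text \<open>
  Among the Gram entries of minimal order at \<open>0\<close>, a diagonal one can be produced by replacing
  \<open>x i\<close> by \<open>x i + \<omega> x j\<close>.
\<close>

lemma pivot:
  assumes J: "finite J" and ab: "a \<in> J" "b \<in> J" "g (x a) (x b) \<noteq> 0"
  shows "\<exists>k. \<exists>i\<in>J. \<exists>j\<in>J. \<exists>w U. (w \<noteq> 0 \<longrightarrow> i \<noteq> j) \<and>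
    (\<forall>a\<in>J. \<forall>b\<in>J. [:0, 1:] ^ k dvd g (x a) (x b)) \<and>
    g (\<lambda>p. x i p + [:w:] * x j p) (\<lambda>p. x i p + [:w:] * x j p) = [:0, 1:] ^ k * U \<and> poly U 0 \<noteq> 0"
proof -
  let ?P = "\<lambda>k. \<exists>a\<in>J. \<exists>b\<in>J. coeff (g (x a) (x b)) k \<noteq> 0"
  obtain k0 where "?P k0" using ab by (metis leading_coeff_0_iff)
  define k where "k = (LEAST k. ?P k)"
  have k: "?P k" unfolding k_def by (rule LeastI) fact
  have below: "coeff (g (x a) (x b)) l = 0" if "a \<in> J" "b \<in> J" "l < k" for a b l
    using not_less_Least[of l ?P] that unfolding k_def by blast
  have dvd: "[:0, 1:] ^ k dvd g (x a) (x b)" if "a \<in> J" "b \<in> J" for a b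
    unfolding X_power_dvd_iff using below that by blast
  have co: "coeff (g (x b) (x a)) l = cnj (coeff (g (x a) (x b)) l)" for a b l
    using g_sym[of "x b" "x a"] by (simp add: coeff_map_poly)
  let ?p = "\<lambda>i j w. (\<lambda>p. x i p + [:w:] * x j p)"
  have norm: "g (?p i j w) (?p i j w) = g (x i) (x i) + Polynomial.smult (cnj w) (g (x i) (x j)) +
      Polynomial.smult w (g (x j) (x i)) + Polynomial.smult (w * cnj w) (g (x j) (x j))" for i j w
  proof -
    have cw: "cnj_poly [:w:] = [:cnj w:]" by (cases "w = 0") (simp_all add: map_poly_pCons)
    have e: "?p i j w = (\<lambda>p. 1 * x i p + [:w:] * x j p)" by simp
    show ?thesis
      unfolding e g_lincomb_left g_lincomb_right cw by (simp add: smult_add_right)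
  qed
  have fin: ?thesis if ij: "i \<in> J" "j \<in> J" "w \<noteq> 0 \<Longrightarrow> i \<noteq> j"
    and c: "coeff (g (?p i j w) (?p i j w)) k \<noteq> 0" for i j w
  proof -
    have "[:0, 1:] ^ k dvd g (?p i j w) (?p i j w)"
      unfolding norm using dvd ij by (intro dvd_add dvd_smult)
    then obtain U where U: "g (?p i j w) (?p i j w) = [:0, 1:] ^ k * U" by (elim dvdE)
    have "poly U 0 \<noteq> 0" using c unfolding U coeff_X_power_mult .
    with U show ?thesis using ij dvd by blast
  qed
  show ?thesis
  proof (cases "\<exists>i\<in>J. coeff (g (x i) (x i)) k \<noteq> 0")
    case True
    then obtain i where "i \<in> J" "coeff (g (x i) (x i)) k \<noteq> 0" by blast
    then show ?thesis using fin[of i i 0] by (simp add: norm)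
  next
    case False
    obtain i j where ij: "i \<in> J" "j \<in> J" "coeff (g (x i) (x j)) k \<noteq> 0" using k by blast
    define z where "z = coeff (g (x i) (x j)) k"
    have ne: "i \<noteq> j" using ij False by blast
    \<comment> \<open>This is twice the real part of \<open>cnj w * z\<close>: it is nonzero for
      \<open>w = 1\<close> unless \<open>z\<close> is imaginary, and then for
      \<open>w = \<i>\<close>.\<close>
    have c: "coeff (g (?p i j w) (?p i j w)) k = cnj w * z + w * cnj z" for w
      unfolding norm using False ij co[of j i k] by (simp add: z_def)
    show ?thesis
    proof (cases "Re z = 0")
      case True
      then have "coeff (g (?p i j \<i>) (?p i j \<i>)) k \<noteq> 0"
        unfolding c using ij(3) by (auto simp: z_def complex_eq_iff)
      then show ?thesis using fin[of i j \<i>] ij ne by blast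
    next
      case False
      then have "coeff (g (?p i j 1) (?p i j 1)) k \<noteq> 0"
        unfolding c by (auto simp: complex_eq_iff)
      then show ?thesis using fin[of i j 1] ij ne by blast
    qed
  qed
qed

text \<open>Gram-Schmidt over the polynomials localized at 0. The pivot has minimal order
  \<open>k\<close>, so \<open>[:0, 1:] ^ k\<close> divides all other entries; the remaining factor
  \<open>U\<close> is a unit at 0, and vectors are multiplied by it where one would divide. This
  accounts for the factors \<open>f\<close>.\<close>

lemma orthogonalize:
  assumes "finite J"
  shows "\<exists>b. (\<forall>j\<in>J. b j \<in> poly_span x J) \<and> (\<forall>i\<in>J. \<forall>j\<in>J. i \<noteq> j \<longrightarrow> g (b i) (b j) = 0) \<and>
    (\<forall>j\<in>J. \<exists>f. poly f 0 \<noteq> 0 \<and> (\<lambda>p. f * x j p) \<in> poly_span b J)"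
  using assms
proof (induction "card J" arbitrary: J x)
  case 0
  then show ?case by simp
next
  case (Suc m)
  show ?case
  proof (cases "\<forall>a\<in>J. \<forall>b\<in>J. g (x a) (x b) = 0")
    case True
    have "poly 1 0 \<noteq> (0::complex)" by simp
    moreover have "(\<lambda>p. 1 * x j p) \<in> poly_span x J" if "j \<in> J" for j
      using poly_span_base[OF Suc(3) that, of x] by simp
    ultimately show ?thesis using True poly_span_base[OF Suc(3)] by (intro exI[of _ x]) blast
  next
    case False
    then obtain a0 b0 where "a0 \<in> J" "b0 \<in> J" "g (x a0) (x b0) \<noteq> 0" by blast
    from pivot[OF Suc(3) this]
    obtain k i j w U where ij: "i \<in> J" "j \<in> J" "w \<noteq> 0 \<Longrightarrow> i \<noteq> j"
      and dvd: "\<And>a b. a \<in> J \<Longrightarrow> b \<in> J \<Longrightarrow> [:0, 1:] ^ k dvd g (x a) (x b)"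
      and U: "g (\<lambda>p. x i p + [:w:] * x j p) (\<lambda>p. x i p + [:w:] * x j p) = [:0, 1:] ^ k * U" "poly U 0 \<noteq> 0"
      by blast
    define y where "y = (\<lambda>p. x i p + [:w:] * x j p)"
    note Uy = U(1)[folded y_def]
    have y1: "y = (\<lambda>p. 1 * x i p + [:w:] * x j p)" by (simp add: y_def)
    have yspan: "y \<in> poly_span x J"
      unfolding y1 using ij poly_span_base[OF Suc(3)] by (intro poly_span_lincomb) auto
    have "[:0, 1:] ^ k dvd g (x l) y" if "l \<in> J" for l
      unfolding y1 g_lincomb_right using dvd that ij by (intro dvd_add dvd_mult)
    then have "\<forall>l. \<exists>t. l \<in> J \<longrightarrow> g (x l) y = [:0, 1:] ^ k * t"
      by (metis dvdE)
    from choice[OF this] obtain T where T: "\<And>l. l \<in> J \<Longrightarrow> g (x l) y = [:0, 1:] ^ k * T l"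
      by blast
    \<comment> \<open>\<open>U\<close> times the component of \<open>x l\<close> orthogonal to
      \<open>y\<close>; the factor keeps the coefficients polynomial.\<close>
    define z where "z l = (\<lambda>p. U * x l p + (- T l) * y p)" for l
    have zy: "g (z l) y = 0" if "l \<in> J" for l
      unfolding z_def g_lincomb_left using T[OF that] Uy by simp
    have zspan: "z l \<in> poly_span x J" if "l \<in> J" for l
      unfolding z_def using yspan poly_span_base[OF Suc(3) that] by (intro poly_span_lincomb)
    let ?J = "J - {i}"
    have fJ: "finite ?J" using Suc(3) by simp
    have "m = card ?J" using Suc ij by simp
    from Suc(1)[OF this fJ, of z] obtain b where B: "(\<forall>j\<in>?J. b j \<in> poly_span z ?J) \<and>
        (\<forall>i\<in>?J. \<forall>j\<in>?J. i \<noteq> j \<longrightarrow> g (b i) (b j) = 0) \<and>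
        (\<forall>j\<in>?J. \<exists>f. poly f 0 \<noteq> 0 \<and> (\<lambda>p. f * z j p) \<in> poly_span b ?J)" ..
    have b: "\<And>l. l \<in> ?J \<Longrightarrow> b l \<in> poly_span z ?J"
      "\<And>i j. i \<in> ?J \<Longrightarrow> j \<in> ?J \<Longrightarrow> i \<noteq> j \<Longrightarrow> g (b i) (b j) = 0"
      "\<And>l. l \<in> ?J \<Longrightarrow> \<exists>f. poly f 0 \<noteq> 0 \<and> (\<lambda>p. f * z l p) \<in> poly_span b ?J"
      by (rule B[THEN conjunct1, rule_format], assumption,
        rule B[THEN conjunct2, THEN conjunct1, rule_format], assumption+,
        rule B[THEN conjunct2, THEN conjunct2, rule_format])
    have by0: "g (b l) y = 0" if "l \<in> ?J" for l
      using b(1)[OF that] zy by (rule g_span_zero) auto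
    have yb0: "g y (b l) = 0" if "l \<in> ?J" for l
      using g_sym[of y "b l"] by0[OF that] by simp
    define b' where "b' = b(i := y)"
    have bi: "b' i = y" "\<And>l. l \<noteq> i \<Longrightarrow> b' l = b l" by (auto simp: b'_def)
    have yb': "y \<in> poly_span b' J" using poly_span_base[OF Suc(3) ij(1), of b'] bi by simp
    have main: "\<exists>f. poly f 0 \<noteq> 0 \<and> (\<lambda>p. f * x l p) \<in> poly_span b' J" if l: "l \<in> ?J" for l
    proof -
      obtain f where f: "poly f 0 \<noteq> 0" "(\<lambda>p. f * z l p) \<in> poly_span b ?J" using b(3)[OF l] by blast
      have "(\<lambda>p. f * z l p) \<in> poly_span b' J"
      proof (rule poly_span_trans[OF fJ f(2)])
        fix j assume "j \<in> ?J"
        then show "b j \<in> poly_span b' J" using poly_span_base[OF Suc(3), of j b'] bi(2)[of j] by auto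
      qed
      from poly_span_lincomb[OF this yb', of 1 "f * T l"]
      have "(\<lambda>p. (f * U) * x l p) \<in> poly_span b' J" by (simp add: z_def algebra_simps)
      then show ?thesis using f(1) U(2) by (intro exI[of _ "f * U"]) simp
    qed
    have "\<exists>f. poly f 0 \<noteq> 0 \<and> (\<lambda>p. f * x l p) \<in> poly_span b' J" if l: "l \<in> J" for l
    proof (cases "l = i")
      case False
      then show ?thesis using main l by blast
    next
      case True
      show ?thesis
      proof (cases "w = 0")
        case True
        then have "(\<lambda>p. 1 * x l p) = y" using \<open>l = i\<close> by (simp add: y_def)
        then show ?thesis using yb' by (intro exI[of _ 1]) simp
      next
        case False
        then have "j \<in> ?J" using ij by auto
        then obtain f where f: "poly f 0 \<noteq> 0" "(\<lambda>p. f * x j p) \<in> poly_span b' J" using main by blast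
        \<comment> \<open>\<open>x i\<close> was replaced by \<open>y\<close>; it is recovered as
          \<open>y - w x j\<close>.\<close>
        from poly_span_lincomb[OF yb' f(2), of f "- [:w:]"]
        have "(\<lambda>p. f * x l p) \<in> poly_span b' J" using \<open>l = i\<close> by (simp add: y_def algebra_simps)
        then show ?thesis using f(1) by blast
      qed
    qed
    moreover have "b' l \<in> poly_span x J" if "l \<in> J" for l
    proof (cases "l = i")
      case True
      then show ?thesis using yspan bi by simp
    next
      case False
      then show ?thesis
        using b(1)[of l] that bi(2)[OF False] poly_span_trans[OF fJ, of "b l" z] zspan by auto
    qed
    moreover have "g (b' l) (b' m) = 0" if "l \<in> J" "m \<in> J" "l \<noteq> m" for l m
      using that b(2)[of l m] by0 yb0 bi by (metis Diff_iff singletonD)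
    ultimately show ?thesis by (intro exI[of _ b'] conjI ballI impI)
  qed
qed

end

lemma sum_fun_apply: "(\<Sum>a\<in>A. f a) x = (\<Sum>a\<in>A. f a x)"
  by (induction A rule: infinite_finite_induct) auto

lemma eventually_sign_re_poly:
  fixes q :: "complex poly"
  assumes "Re (poly q 0) \<noteq> 0"
  shows "\<exists>d>0. \<forall>e. \<bar>e\<bar> < d \<longrightarrow> sign_re (poly q (complex_of_real e)) = sign_re (poly q 0)"
proof -
  have "isCont (\<lambda>e. poly q (complex_of_real e)) 0"
    by (intro continuous_intros)
  then have "(\<lambda>e. poly q (complex_of_real e)) \<midarrow>0\<rightarrow> poly q 0"
    by (simp add: isCont_def)
  from LIM_D[OF this, of "\<bar>Re (poly q 0)\<bar>"] assms obtain d where d: "d > 0"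
    "\<And>e. e \<noteq> 0 \<Longrightarrow> \<bar>e\<bar> < d \<Longrightarrow> cmod (poly q (complex_of_real e) - poly q 0) < \<bar>Re (poly q 0)\<bar>"
    by auto
  have "sign_re (poly q (complex_of_real e)) = sign_re (poly q 0)" if "\<bar>e\<bar> < d" for e
  proof (cases "e = 0")
    case False
    have "\<bar>Re (poly q (complex_of_real e)) - Re (poly q 0)\<bar> < \<bar>Re (poly q 0)\<bar>"
      using d(2)[OF False that] abs_Re_le_cmod[of "poly q (complex_of_real e) - poly q 0"] by simp
    then show ?thesis by (auto simp: sign_re_def)
  qed simp
  then show ?thesis using d(1) by blast
qed

lemma eventually_poly_nonzero:
  fixes f :: "complex poly"
  assumes "poly f 0 \<noteq> 0"
  shows "\<exists>d>0. \<forall>e. \<bar>e\<bar> < d \<longrightarrow> poly f (complex_of_real e) \<noteq> 0"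
proof -
  \<comment> \<open>Multiplication by the conjugate of the value at 0 makes this value a positive
    real, so constancy of the sign near 0 shows that \<open>f\<close> has no zero there.\<close>
  have c0: "Re (poly (Polynomial.smult (cnj (poly f 0)) f) 0) \<noteq> 0"
    using assms by (simp add: complex_eq_iff add_nonneg_eq_0_iff flip: power2_eq_square)
  from eventually_sign_re_poly[OF this] obtain d where d: "d > 0"
    "\<And>e. \<bar>e\<bar> < d \<Longrightarrow> sign_re (cnj (poly f 0) * poly f (complex_of_real e)) = sign_re (cnj (poly f 0) * poly f 0)"
    by auto
  have "sign_re (cnj (poly f 0) * poly f 0) \<noteq> 0" using c0 by (simp add: sign_re_def)
  then have "poly f (complex_of_real e) \<noteq> 0" if "\<bar>e\<bar> < d" for e
    using d(2)[OF that] by auto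
  then show ?thesis using d(1) by blast
qed

lemma sign_re_scale:
  assumes "e \<noteq> 0"
  shows "sign_re (complex_of_real e * z) = (if e < 0 then - 1 else 1) * sign_re z"
  using assms by (auto simp: sign_re_def zero_less_mult_iff mult_less_0_iff)

lemma sign_re_X_power:
  assumes "e \<noteq> 0"
  shows "sign_re (poly ([:0, 1:] ^ k * q) (complex_of_real e)) =
    (if e < 0 then - 1 else 1) ^ k * sign_re (poly q (complex_of_real e))"
proof (induction k)
  case (Suc k)
  have "poly ([:0, 1:] ^ Suc k * q) (complex_of_real e) =
      complex_of_real e * poly ([:0, 1:] ^ k * q) (complex_of_real e)"
    by simp
  then show ?case using Suc sign_re_scale[OF assms] by simp
qed simp

text \<open>\<open>f\<close> is a unit in the local ring at 0.\<close>

lemma X_power_dvd_mult_cancel: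
  fixes f p :: "complex poly"
  assumes "poly f 0 \<noteq> 0" "[:0, 1:] ^ k dvd f * p"
  shows "[:0, 1:] ^ k dvd p"
proof (cases "p = 0")
  case False
  have "f \<noteq> 0" using assms(1) by auto
  then have "order 0 (f * p) = order 0 p"
    using False assms(1) order_root[of f 0] by (simp add: order_mult)
  then show ?thesis
    using assms(2) order_divides[of 0 k "f * p"] order_divides[of 0 k p] \<open>f \<noteq> 0\<close> False by simp
qed simp

lemma coeff_mult_X_dvd:
  fixes f p :: "complex poly"
  assumes "[:0, 1:] ^ k dvd p"
  shows "coeff (f * p) k = poly f 0 * coeff p k"
proof -
  obtain r where r: "p = [:0, 1:] ^ k * r" using assms by (elim dvdE)
  have e: "f * p = [:0, 1:] ^ k * (f * r)" by (simp add: r mult_ac)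
  show ?thesis unfolding e unfolding r coeff_X_power_mult by simp
qed

lemma X_power_dvd_cnj: "[:0, 1:] ^ k dvd p \<Longrightarrow> [:0, 1:] ^ k dvd cnj_poly p"
  unfolding X_power_dvd_iff by (simp add: coeff_map_poly)

section \<open>The Jantzen filtration of a polynomial family of Hermitian forms\<close>

context poly_hermitian
begin

text \<open>The steps of the filtration are kept as sets of polynomial vectors; the usual steps
  consist of their values at 0. \<open>jantzen_form_eval_zero\<close> shows that the form of a layer
  depends on these values only.\<close>

definition jantzen :: "nat \<Rightarrow> ('i \<Rightarrow> complex poly) set" where
  "jantzen k = {u \<in> supported_on I. \<forall>v\<in>supported_on I. [:0, 1:] ^ k dvd g u v}"

definition jantzen_form :: "nat \<Rightarrow> ('i \<Rightarrow> complex poly) \<Rightarrow> ('i \<Rightarrow> complex poly) \<Rightarrow> complex" where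
  "jantzen_form k u v = coeff (g u v) k"

lemma hermitian_on_jantzen: "poly_space.hermitian_on (jantzen k) (jantzen_form k)"
proof -
  have p: "(u + v) = (\<lambda>p. u p + v p)" "scale_poly a u = (\<lambda>p. [:a:] * u p)" for u v :: "'i \<Rightarrow> complex poly" and a
    by (auto simp: scale_poly_def)
  have "poly_space.subspace (jantzen k)"
    unfolding poly_space.subspace_def jantzen_def
    by (auto simp: p g_add_left g_scale_left supported_on_def g_zero_left simp del: mult_pCons_left)
  moreover have "jantzen_form k (u + v) w = jantzen_form k u w + jantzen_form k v w"
     "jantzen_form k (scale_poly a u) w = a * jantzen_form k u w"
     "jantzen_form k v u = cnj (jantzen_form k u v)" for u v w a
    using g_sym[of v u] arg_cong[OF g_scale_left[of "[:a:]" u w], of "\<lambda>p. coeff p k"]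
    by (simp_all add: jantzen_form_def p g_add_left coeff_map_poly)
  ultimately show ?thesis
    unfolding poly_space.hermitian_on_def by blast
qed

text \<open>\<open>u\<close> is the variable times some \<open>r\<close>. Although \<open>r\<close>
  may lie outside the filtration step, \<open>v\<close> is inside, so \<open>g r v\<close> already
  has order at least \<open>k\<close> and \<open>g u v\<close> order at least
  \<open>k + 1\<close>.\<close>

lemma jantzen_form_eval_zero:
  assumes u: "u \<in> jantzen k" "eval_vector 0 u = 0" and v: "v \<in> jantzen k"
  shows "jantzen_form k u v = 0"
proof -
  have "\<forall>p. \<exists>r. u p = [:0, 1:] * r"
    using u(2) by (metis dvdE eval_vector_def poly_eq_0_iff_dvd zero_fun_apply minus_zero)
  from choice[OF this] obtain r where r: "\<And>p. u p = [:0, 1:] * r p" by blast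
  have "u = (\<lambda>p. [:0, 1:] * r p)" using r by auto
  then have e: "g u v = [:0, 1:] * g r v" by (simp only: g_scale_left)
  have "r \<in> supported_on I"
    using u(1) r by (auto simp: jantzen_def supported_on_def)
  then have "[:0, 1:] ^ k dvd g v r" using v by (auto simp: jantzen_def)
  then have "[:0, 1:] ^ k dvd g r v" using X_power_dvd_cnj g_sym[of r v] by simp
  then have "[:0, 1:] ^ Suc k dvd g u v"
    unfolding e power_Suc by (rule mult_dvd_mono[OF dvd_refl])
  then show ?thesis unfolding X_power_dvd_iff jantzen_form_def by simp
qed

text \<open>Coordinates with respect to \<open>b\<close> exist after multiplication by a single
  \<open>f\<close>, the product of the factors found for the unit vectors.\<close>

lemma diagonalization:
  obtains b f where "\<And>i. i \<in> I \<Longrightarrow> b i \<in> supported_on I"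
    "\<And>i j. i \<in> I \<Longrightarrow> j \<in> I \<Longrightarrow> i \<noteq> j \<Longrightarrow> g (b i) (b j) = 0"
    "poly f 0 \<noteq> 0" "\<And>u. u \<in> supported_on I \<Longrightarrow> (\<lambda>p. f * u p) \<in> poly_span b I"
proof -
  from orthogonalize[OF finite_index, of unit_vector] obtain b where
    B: "(\<forall>j\<in>I. b j \<in> poly_span unit_vector I) \<and> (\<forall>i\<in>I. \<forall>j\<in>I. i \<noteq> j \<longrightarrow> g (b i) (b j) = 0) \<and>
      (\<forall>j\<in>I. \<exists>f. poly f 0 \<noteq> 0 \<and> (\<lambda>p. f * unit_vector j p) \<in> poly_span b I)" ..
  then have "\<forall>j. \<exists>f. j \<in> I \<longrightarrow> poly f 0 \<noteq> 0 \<and> (\<lambda>p. f * unit_vector j p) \<in> poly_span b I"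
    by blast
  from choice[OF this] obtain F where
    F: "\<And>j. j \<in> I \<Longrightarrow> poly (F j) 0 \<noteq> 0 \<and> (\<lambda>p. F j * unit_vector j p) \<in> poly_span b I" by blast
  define f where "f = (\<Prod>j\<in>I. F j)"
  have sp: "(\<lambda>p. f * u p) \<in> poly_span b I" if u: "u \<in> supported_on I" for u
  proof -
    have "f * u p = (\<Sum>j\<in>I. (u j * (\<Prod>l\<in>I - {j}. F l)) * (F j * unit_vector j p))" for p
    proof -
      have "(\<Sum>j\<in>I. (u j * (\<Prod>l\<in>I - {j}. F l)) * (F j * unit_vector j p)) =
          (\<Sum>j\<in>I. if p = j then f * u p else 0)"
        using finite_index by (intro sum.cong) (auto simp: unit_vector_def f_def prod.remove)
      also have "\<dots> = f * u p"
        using finite_index u by (auto simp: supported_on_def)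
      finally show ?thesis by simp
    qed
    then have "(\<lambda>p. f * u p) \<in> poly_span (\<lambda>j p. F j * unit_vector j p) I" by (rule poly_spanI)
    then show ?thesis
      by (rule poly_span_trans[OF finite_index]) (use F in auto)
  qed
  have "b i \<in> supported_on I" if "i \<in> I" for i
  proof -
    have "b i \<in> poly_span unit_vector I" using B that by blast
    then obtain c where "\<And>p. b i p = (\<Sum>j\<in>I. c j * unit_vector j p)" unfolding poly_span_def by blast
    then show ?thesis by (auto simp: supported_on_def unit_vector_def intro!: sum.neutral)
  qed
  moreover have "poly f 0 \<noteq> 0"
    using F finite_index by (auto simp: f_def poly_prod)
  moreover have "g (b i) (b j) = 0" if "i \<in> I" "j \<in> I" "i \<noteq> j" for i j
    using B[THEN conjunct2, THEN conjunct1] that by blast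
  ultimately show thesis by (intro that[of b f] sp)
qed

text \<open>Write \<open>f * u\<close> as the sum of the \<open>c i * b i\<close>. For
  \<open>u\<close> in step \<open>k\<close>, pairing with \<open>b i\<close> shows that
  \<open>c i\<close> times the norm of \<open>b i\<close> has order at least \<open>k\<close>; if
  the norm alone has not, \<open>c i\<close> vanishes at 0. Hence only members whose norm has order
  at least \<open>k\<close> survive in coefficient \<open>k\<close>.\<close>

lemma orthogonal_family_jantzen:
  assumes b: "\<And>i. i \<in> I \<Longrightarrow> b i \<in> supported_on I"
    "\<And>i j. i \<in> I \<Longrightarrow> j \<in> I \<Longrightarrow> i \<noteq> j \<Longrightarrow> g (b i) (b j) = 0"
    and f: "poly f 0 \<noteq> 0" "\<And>u. u \<in> supported_on I \<Longrightarrow> (\<lambda>p. f * u p) \<in> poly_span b I"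
  shows "poly_space.orthogonal_family (jantzen k) (jantzen_form k) {i\<in>I. [:0, 1:] ^ k dvd g (b i) (b i)} b"
proof (rule poly_space.orthogonal_familyI[OF hermitian_on_jantzen])
  let ?I = "{i\<in>I. [:0, 1:] ^ k dvd g (b i) (b i)}"
  have exp: "\<exists>c. (\<forall>w. f * g u w = (\<Sum>i\<in>I. c i * g (b i) w)) \<and> (\<forall>i\<in>I. f * g u (b i) = c i * g (b i) (b i))"
    if u: "u \<in> supported_on I" for u
  proof -
    obtain c where c: "\<And>p. f * u p = (\<Sum>i\<in>I. c i * b i p)"
      using f(2)[OF u] unfolding poly_span_def by blast
    then have fu: "(\<lambda>p. f * u p) = (\<lambda>p. \<Sum>i\<in>I. c i * b i p)" by auto
    have e: "f * g u w = (\<Sum>i\<in>I. c i * g (b i) w)" for w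
    proof -
      have "f * g u w = g (\<lambda>p. f * u p) w" by (rule g_scale_left[symmetric])
      also have "\<dots> = (\<Sum>i\<in>I. c i * g (b i) w)" unfolding fu by (rule g_sum_left)
      finally show ?thesis .
    qed
    moreover have "f * g u (b i) = c i * g (b i) (b i)" if i: "i \<in> I" for i
    proof -
      have "(\<Sum>j\<in>I. c j * g (b j) (b i)) = (\<Sum>j\<in>{i}. c j * g (b j) (b i))"
        using finite_index b(2) i by (intro sum.mono_neutral_right) auto
      then show ?thesis by (simp add: e)
    qed
    ultimately show ?thesis by blast
  qed
  show "finite ?I" using finite_index by simp
  show "b i \<in> jantzen k" if i: "i \<in> ?I" for i
  proof -
    have "[:0, 1:] ^ k dvd g (b i) v" if v: "v \<in> supported_on I" for v
    proof -
      obtain c where "f * g v (b i) = c i * g (b i) (b i)" using exp[OF v] i by blast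
      then have "[:0, 1:] ^ k dvd f * g v (b i)" using i by simp
      then have "[:0, 1:] ^ k dvd g v (b i)" by (rule X_power_dvd_mult_cancel[OF f(1)])
      then show ?thesis using X_power_dvd_cnj g_sym[of "b i" v] by simp
    qed
    then show ?thesis using b(1) i by (simp add: jantzen_def)
  qed
  show "jantzen_form k (b i) (b j) = 0" if "i \<in> ?I" "j \<in> ?I" "i \<noteq> j" for i j
    using that b(2) by (simp add: jantzen_form_def)
  show "\<exists>q. \<forall>v\<in>jantzen k. jantzen_form k u v = (\<Sum>i\<in>?I. q i * jantzen_form k (b i) v)"
    if u: "u \<in> jantzen k" for u
  proof -
    have us: "u \<in> supported_on I" using u by (simp add: jantzen_def)
    obtain c where c: "\<And>w. f * g u w = (\<Sum>i\<in>I. c i * g (b i) w)"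
      "\<And>i. i \<in> I \<Longrightarrow> f * g u (b i) = c i * g (b i) (b i)" using exp[OF us] by blast
    have c0: "poly (c i) 0 = 0" if i: "i \<in> I - ?I" for i
    proof (rule ccontr)
      assume "poly (c i) 0 \<noteq> 0"
      moreover have "[:0, 1:] ^ k dvd c i * g (b i) (b i)"
        using u i b(1) c(2)[of i, symmetric] by (simp add: jantzen_def)
      ultimately have "[:0, 1:] ^ k dvd g (b i) (b i)" by (rule X_power_dvd_mult_cancel)
      then show False using i by simp
    qed
    have "jantzen_form k u v = (\<Sum>i\<in>?I. poly (c i) 0 / poly f 0 * jantzen_form k (b i) v)"
      if v: "v \<in> jantzen k" for v
    proof -
      have "[:0, 1:] ^ k dvd g u v" using u v by (simp add: jantzen_def)
      then have "poly f 0 * jantzen_form k u v = coeff (f * g u v) k"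
        unfolding jantzen_form_def by (rule coeff_mult_X_dvd[symmetric])
      also have "\<dots> = (\<Sum>i\<in>I. coeff (c i * g (b i) v) k)"
        unfolding c(1) by (simp add: coeff_sum)
      also have "\<dots> = (\<Sum>i\<in>I. poly (c i) 0 * jantzen_form k (b i) v)"
      proof (rule sum.cong[OF refl])
        fix i assume "i \<in> I"
        then have "[:0, 1:] ^ k dvd g v (b i)" using v b(1) by (simp add: jantzen_def)
        then have "[:0, 1:] ^ k dvd g (b i) v" using X_power_dvd_cnj g_sym[of "b i" v] by simp
        then show "coeff (c i * g (b i) v) k = poly (c i) 0 * jantzen_form k (b i) v"
          unfolding jantzen_form_def by (rule coeff_mult_X_dvd)
      qed
      also have "\<dots> = (\<Sum>i\<in>?I. poly (c i) 0 * jantzen_form k (b i) v)"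
        using c0 finite_index by (intro sum.mono_neutral_right) auto
      finally show ?thesis using f(1) by (simp add: field_simps sum_distrib_left flip: sum_divide_distrib)
    qed
    then show ?thesis by (intro exI[of _ "\<lambda>i. poly (c i) 0 / poly f 0"] ballI)
  qed
qed

lemma hermitian_on_eval: "fun_space.hermitian_on (supported_on I) (eval_form I G x)"
  unfolding eval_form_def
proof (rule hermitian_on_matrix_form)
  fix i j assume ij: "i \<in> I" "j \<in> I"
  show "poly (G j i) (complex_of_real x) = cnj (poly (G i j) (complex_of_real x))"
    unfolding G_sym[OF ij] by simp
qed

lemma orthogonal_family_eval:
  assumes b: "\<And>i. i \<in> I \<Longrightarrow> b i \<in> supported_on I"
    "\<And>i j. i \<in> I \<Longrightarrow> j \<in> I \<Longrightarrow> i \<noteq> j \<Longrightarrow> g (b i) (b j) = 0"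
    and f: "poly f (of_real x) \<noteq> 0" "\<And>u. u \<in> supported_on I \<Longrightarrow> (\<lambda>p. f * u p) \<in> poly_span b I"
  shows "fun_space.orthogonal_family (supported_on I) (eval_form I G x) I (\<lambda>i. eval_vector (of_real x) (b i))"
  unfolding fun_space.orthogonal_family_def
proof (intro conjI ballI impI)
  show "eval_form I G x (eval_vector (of_real x) (b i)) (eval_vector (of_real x) (b j)) = 0"
    if "i \<in> I" "j \<in> I" "i \<noteq> j" for i j
    using b(2)[OF that] eval_matrix_form[of I G "b i" "b j" x] by (simp add: eval_form_def)
  show "eval_vector (of_real x) (b i) \<in> supported_on I" if "i \<in> I" for i
    using b(1)[OF that] by (simp add: supported_on_def eval_vector_def)
  fix u :: "'i \<Rightarrow> complex" assume u: "u \<in> supported_on I"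
  let ?v = "\<lambda>i. [:u i:]"
  have "?v \<in> supported_on I" using u by (simp add: supported_on_def)
  from f(2)[OF this] obtain c where c: "\<And>p. f * [:u p:] = (\<Sum>i\<in>I. c i * b i p)"
    unfolding poly_span_def by blast
  have "poly f (of_real x) * u p = (\<Sum>i\<in>I. poly (c i) (of_real x) * poly (b i p) (of_real x))" for p
    using arg_cong[OF c[of p], of "\<lambda>q. poly q (of_real x)"] by (simp add: poly_sum mult.commute)
  then have "u p = (\<Sum>i\<in>I. poly (c i) (of_real x) / poly f (of_real x) * poly (b i p) (of_real x))" for p
    using f(1) by (simp add: field_simps flip: sum_divide_distrib)
  then have "u = (\<Sum>i\<in>I. scale_fun (poly (c i) (of_real x) / poly f (of_real x)) (eval_vector (of_real x) (b i)))"
    by (auto simp: fun_eq_iff scale_fun_def eval_vector_def sum_fun_apply)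
  then have "eval_form I G x (u - (\<Sum>i\<in>I. scale_fun (poly (c i) (of_real x) / poly f (of_real x))
      (eval_vector (of_real x) (b i)))) v = 0" for v
    by (simp add: eval_form_def matrix_form_def)
  then show "\<exists>q. \<forall>v\<in>supported_on I. eval_form I G x
      (u - (\<Sum>i\<in>I. scale_fun (q i) (eval_vector (of_real x) (b i)))) v = 0"
    by (intro exI[of _ "\<lambda>i. poly (c i) (of_real x) / poly f (of_real x)"] ballI)
qed (rule finite_index)

abbreviation signature_at :: "real \<Rightarrow> int" where
  "signature_at x \<equiv> fun_space.signature (supported_on I) (eval_form I G x)"

abbreviation jantzen_signature :: "nat \<Rightarrow> int" where
  "jantzen_signature k \<equiv> poly_space.signature (jantzen k) (jantzen_form k)"

lemma finite_rank_jantzen: "\<exists>r. poly_space.finite_rank (jantzen k) (jantzen_form k) r"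
proof -
  obtain b f where b: "\<And>i. i \<in> I \<Longrightarrow> b i \<in> supported_on I"
    "\<And>i j. i \<in> I \<Longrightarrow> j \<in> I \<Longrightarrow> i \<noteq> j \<Longrightarrow> g (b i) (b j) = 0"
    and f: "poly f 0 \<noteq> 0" "\<And>u. u \<in> supported_on I \<Longrightarrow> (\<lambda>p. f * u p) \<in> poly_span b I"
    using diagonalization by blast
  have O: "poly_space.orthogonal_family (jantzen k) (jantzen_form k) {i\<in>I. [:0, 1:] ^ k dvd g (b i) (b i)} b"
    by (rule orthogonal_family_jantzen[OF b f])
  show ?thesis
    by (rule exI, rule poly_space.orthogonal_family_finite_rank[OF hermitian_on_jantzen O])
qed

text \<open>In the diagonal basis a nonzero norm is \<open>[:0, 1:] ^ o' i * U\<close> with the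
  value of \<open>U\<close> at 0 real and nonzero. The sign of this value is its contribution to
  layer \<open>o' i\<close>, and to no other; near 0 the sign of the norm is that sign times the
  power \<open>o' i\<close> of the sign of the argument.\<close>

lemma jantzen_sum_formula:
  "\<exists>d>0. \<exists>K. (\<forall>e. e \<noteq> 0 \<longrightarrow> \<bar>e\<bar> < d \<longrightarrow>
        signature_at e = (\<Sum>k\<le>K. (if e < 0 then - 1 else 1) ^ k * jantzen_signature k)) \<and>
     signature_at 0 = jantzen_signature 0 \<and>
     (\<forall>k>K. \<forall>u\<in>jantzen k. \<forall>v\<in>jantzen k. jantzen_form k u v = 0)"
proof -
  obtain b f where b: "\<And>i. i \<in> I \<Longrightarrow> b i \<in> supported_on I"
    "\<And>i j. i \<in> I \<Longrightarrow> j \<in> I \<Longrightarrow> i \<noteq> j \<Longrightarrow> g (b i) (b j) = 0"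
    and f: "poly f 0 \<noteq> 0" "\<And>u. u \<in> supported_on I \<Longrightarrow> (\<lambda>p. f * u p) \<in> poly_span b I"
    using diagonalization by blast
  define N where "N i = g (b i) (b i)" for i
  \<comment> \<open>An arbitrary number when \<open>N i = 0\<close>; such members are excluded by a
    guard wherever \<open>o' i\<close> determines a sign.\<close>
  define o' where "o' i = order 0 (N i)" for i
  define K where "K = Max (insert 0 (o' ` I))"
  have oK: "o' i \<le> K" if "i \<in> I" for i
    unfolding K_def using finite_index that by (intro Max_ge) auto
  have real: "cnj_poly (N i) = N i" for i using g_sym[of "b i" "b i"] by (simp add: N_def)
  have dec: "\<exists>U. N i = [:0, 1:] ^ o' i * U \<and> poly U 0 = coeff (N i) (o' i) \<and> Re (poly U 0) \<noteq> 0"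
    if Ni: "N i \<noteq> 0" for i
  proof -
    obtain U where U: "N i = [:- 0, 1:] ^ o' i * U" "\<not> [:- 0, 1:] dvd U"
      using order_decomp[OF Ni, of 0] unfolding o'_def by blast
    have "poly U 0 \<noteq> 0" using U(2) by (simp add: poly_eq_0_iff_dvd)
    moreover have c: "coeff (N i) (o' i) = poly U 0" unfolding U(1) using coeff_X_power_mult by simp
    moreover have "Im (coeff (N i) (o' i)) = 0"
      using arg_cong[OF real[of i], of "\<lambda>p. Im (coeff p (o' i))"] by (simp add: coeff_map_poly)
    ultimately show ?thesis using U by (intro exI[of _ U]) (auto simp: complex_eq_iff)
  qed
  have jsig: "jantzen_signature k = (\<Sum>i\<in>I. if N i \<noteq> 0 \<and> o' i = k then sign_re (coeff (N i) k) else 0)" for k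
  proof -
    have "jantzen_signature k = (\<Sum>i\<in>{i\<in>I. [:0, 1:] ^ k dvd N i}. sign_re (coeff (N i) k))"
    proof -
      have O: "poly_space.orthogonal_family (jantzen k) (jantzen_form k) {i\<in>I. [:0, 1:] ^ k dvd g (b i) (b i)} b"
        by (rule orthogonal_family_jantzen[OF b f])
      show ?thesis
        using poly_space.signature_eq[OF hermitian_on_jantzen poly_space.has_signatureI[OF O]]
        by (simp add: jantzen_form_def N_def)
    qed
    also have "\<dots> = (\<Sum>i\<in>I. if [:0, 1:] ^ k dvd N i then sign_re (coeff (N i) k) else 0)"
      using finite_index by (simp add: sum.inter_filter)
    also have "\<dots> = (\<Sum>i\<in>I. if N i \<noteq> 0 \<and> o' i = k then sign_re (coeff (N i) k) else 0)"
    proof (rule sum.cong[OF refl])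
      fix i
      have "N i \<noteq> 0 \<Longrightarrow> [:0, 1:] ^ k dvd N i \<longleftrightarrow> k \<le> o' i"
        using order_divides[of 0 k "N i"] by (simp add: o'_def)
      moreover have "N i \<noteq> 0 \<Longrightarrow> k < o' i \<Longrightarrow> coeff (N i) k = 0"
        using dec[of i] X_power_dvd_iff[of "o' i" "N i"] by auto
      ultimately show "(if [:0, 1:] ^ k dvd N i then sign_re (coeff (N i) k) else 0) =
          (if N i \<noteq> 0 \<and> o' i = k then sign_re (coeff (N i) k) else 0)"
        by (cases "N i = 0") (auto simp: le_less)
    qed
    finally show ?thesis .
  qed
  have esig: "signature_at e = (\<Sum>i\<in>I. sign_re (poly (N i) (of_real e)))" if "poly f (of_real e) \<noteq> 0" for e
  proof -
    have O: "fun_space.orthogonal_family (supported_on I) (eval_form I G e) I (\<lambda>i. eval_vector (of_real e) (b i))"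
      by (rule orthogonal_family_eval[OF b that f(2)])
    show ?thesis
      using fun_space.signature_eq[OF hermitian_on_eval fun_space.has_signatureI[OF O]]
      by (simp add: eval_form_def N_def eval_matrix_form)
  qed
  have "\<exists>d>0. \<forall>i\<in>I. \<forall>e. e \<noteq> 0 \<longrightarrow> \<bar>e\<bar> < d \<longrightarrow> sign_re (poly (N i) (of_real e)) =
      (if N i \<noteq> 0 then (if e < 0 then - 1 else 1) ^ o' i * sign_re (coeff (N i) (o' i)) else 0)"
    using finite_index
  proof (induction I rule: finite_induct)
    case empty
    show ?case by (intro exI[of _ 1]) simp
  next
    case (insert i J)
    then obtain d where d: "d > 0" "\<forall>i\<in>J. \<forall>e. e \<noteq> 0 \<longrightarrow> \<bar>e\<bar> < d \<longrightarrow> sign_re (poly (N i) (of_real e)) =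
      (if N i \<noteq> 0 then (if e < 0 then - 1 else 1) ^ o' i * sign_re (coeff (N i) (o' i)) else 0)"
      by blast
    show ?case
    proof (cases "N i = 0")
      case True
      then show ?thesis using d by (intro exI[of _ d]) auto
    next
      case False
      then obtain U where U: "N i = [:0, 1:] ^ o' i * U" "poly U 0 = coeff (N i) (o' i)" "Re (poly U 0) \<noteq> 0"
        using dec by blast
      obtain d' where d': "d' > 0" "\<And>e. \<bar>e\<bar> < d' \<Longrightarrow> sign_re (poly U (of_real e)) = sign_re (poly U 0)"
        using eventually_sign_re_poly[OF U(3)] by blast
      have "sign_re (poly (N i) (of_real e)) = (if e < 0 then - 1 else 1) ^ o' i * sign_re (coeff (N i) (o' i))"
        if "e \<noteq> 0" "\<bar>e\<bar> < d'" for e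
        using d'(2)[OF that(2)] U(2) sign_re_X_power[OF that(1), of "o' i" U] U(1) by simp
      then show ?thesis using d d' False by (intro exI[of _ "min d d'"]) auto
    qed
  qed
  then obtain d1 where d1: "d1 > 0" "\<And>i e. i \<in> I \<Longrightarrow> e \<noteq> 0 \<Longrightarrow> \<bar>e\<bar> < d1 \<Longrightarrow> sign_re (poly (N i) (of_real e)) =
      (if N i \<noteq> 0 then (if e < 0 then - 1 else 1) ^ o' i * sign_re (coeff (N i) (o' i)) else 0)"
    by blast
  obtain d2 where d2: "d2 > 0" "\<And>e. \<bar>e\<bar> < d2 \<Longrightarrow> poly f (of_real e) \<noteq> 0"
    using eventually_poly_nonzero[OF f(1)] by blast
  have A: "signature_at e = (\<Sum>k\<le>K. (if e < 0 then - 1 else 1) ^ k * jantzen_signature k)"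
    if e: "e \<noteq> 0" "\<bar>e\<bar> < min d1 d2" for e
  proof -
    have "(\<Sum>k\<le>K. (if e < 0 then - 1 else 1) ^ k * jantzen_signature k) =
        (\<Sum>i\<in>I. \<Sum>k\<le>K. if k = o' i then (if N i \<noteq> 0 then (if e < 0 then - 1 else 1) ^ k * sign_re (coeff (N i) k) else 0) else 0)"
      unfolding jsig sum_distrib_left by (subst sum.swap) (intro sum.cong refl, auto)
    also have "\<dots> = (\<Sum>i\<in>I. sign_re (poly (N i) (of_real e)))"
      using oK d1(2) e by (intro sum.cong) auto
    finally show ?thesis using esig d2(2) e by simp
  qed
  have B: "signature_at 0 = jantzen_signature 0"
  proof -
    have "(if N i \<noteq> 0 \<and> o' i = 0 then sign_re (coeff (N i) 0) else 0) = sign_re (poly (N i) 0)" for i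
    proof (cases "N i \<noteq> 0 \<and> o' i \<noteq> 0")
      case True
      then have "poly (N i) 0 = 0" using order_root[of "N i" 0] by (simp add: o'_def)
      then show ?thesis using True by simp
    qed (auto simp: poly_0_coeff_0)
    then show ?thesis using esig[of 0] f(1) by (simp add: jsig)
  qed
  have C: "jantzen_form k u v = 0" if k: "k > K" and uv: "u \<in> jantzen k" "v \<in> jantzen k" for k u v
  proof -
    have O: "poly_space.orthogonal_family (jantzen k) (jantzen_form k) {i\<in>I. [:0, 1:] ^ k dvd g (b i) (b i)} b"
      by (rule orthogonal_family_jantzen[OF b f])
    note D = poly_space.orthogonal_familyD[OF hermitian_on_jantzen O]
    obtain q where q: "\<And>v. v \<in> jantzen k \<Longrightarrow> jantzen_form k u v =
        (\<Sum>i\<in>{i\<in>I. [:0, 1:] ^ k dvd g (b i) (b i)}. q i * jantzen_form k (b i) v)"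
      using D(4)[OF uv(1)] by blast
    obtain p where p: "\<And>w. w \<in> jantzen k \<Longrightarrow> jantzen_form k v w =
        (\<Sum>i\<in>{i\<in>I. [:0, 1:] ^ k dvd g (b i) (b i)}. p i * jantzen_form k (b i) w)"
      using D(4)[OF uv(2)] by blast
    have z: "N i = 0" if "i \<in> {i\<in>I. [:0, 1:] ^ k dvd g (b i) (b i)}" for i
      using that order_divides[of 0 k "N i"] oK[of i] k by (auto simp: N_def o'_def)
    have zz: "jantzen_form k (b i) (b j) = 0" if "i \<in> {i\<in>I. [:0, 1:] ^ k dvd g (b i) (b i)}"
      "j \<in> {i\<in>I. [:0, 1:] ^ k dvd g (b i) (b i)}" for i j
      using D(3)[OF that] z[OF that(1)] by (cases "i = j") (auto simp: jantzen_form_def N_def)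
    have vb: "jantzen_form k v (b i) = 0" if "i \<in> {i\<in>I. [:0, 1:] ^ k dvd g (b i) (b i)}" for i
      unfolding p[OF D(2)[OF that]] by (intro sum.neutral ballI) (simp only: zz[OF _ that] mult_zero_right)
    have bv: "jantzen_form k (b i) v = 0" if "i \<in> {i\<in>I. [:0, 1:] ^ k dvd g (b i) (b i)}" for i
      by (rule poly_space.hermitian_radical_right[OF hermitian_on_jantzen, OF uv(2) D(2)[OF that] vb[OF that]])
    show ?thesis
      unfolding q[OF uv(2)] by (intro sum.neutral ballI) (simp only: bv mult_zero_right)
  qed
  show ?thesis
  proof (intro exI[of _ "min d1 d2"] exI[of _ K] conjI allI impI ballI)
    show "0 < min d1 d2" using d1(1) d2(1) by simp
  qed (fact A B C)+
qed

text \<open>Vectors in a step of positive index have values at 0 in the radical of the form at 0, so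
  these values vanish. Hence all layers but the first are 0, and both sides of 0 carry the signature
  of the first.\<close>

lemma signature_locally_constant:
  assumes nondeg: "\<And>u. u \<in> supported_on I \<Longrightarrow> \<forall>v\<in>supported_on I. eval_form I G 0 u v = 0 \<Longrightarrow> u = 0"
  shows "\<exists>d>0. \<forall>e. \<bar>e\<bar> < d \<longrightarrow> signature_at e = signature_at 0"
proof -
  have z: "jantzen_signature (Suc k) = 0" for k
  proof (rule poly_space.signature_zero[OF hermitian_on_jantzen])
    fix u v assume u: "u \<in> jantzen (Suc k)" and v: "v \<in> jantzen (Suc k)"
    have us: "u \<in> supported_on I" using u by (simp add: jantzen_def)
    have "eval_form I G 0 (eval_vector 0 u) w = 0" if w: "w \<in> supported_on I" for w
    proof -
      let ?w = "\<lambda>i. [:w i:]"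
      have "?w \<in> supported_on I" using w by (simp add: supported_on_def)
      then have "[:0, 1:] ^ Suc k dvd g u ?w" using u by (simp add: jantzen_def)
      then have "poly (g u ?w) 0 = 0" by (auto elim!: dvdE)
      then show ?thesis using eval_matrix_form[of I G u ?w 0] by (simp add: eval_form_def eval_vector_def)
    qed
    then have "eval_vector 0 u = 0"
      using us by (intro nondeg) (auto simp: supported_on_def eval_vector_def)
    then show "jantzen_form (Suc k) u v = 0" by (rule jantzen_form_eval_zero[OF u _ v])
  qed
  obtain d K where d: "d > 0" "\<And>e. e \<noteq> 0 \<Longrightarrow> \<bar>e\<bar> < d \<Longrightarrow>
      signature_at e = (\<Sum>k\<le>K. (if e < 0 then - 1 else 1) ^ k * jantzen_signature k)"
    "signature_at 0 = jantzen_signature 0"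
    using jantzen_sum_formula by blast
  have "(\<Sum>k\<le>K. s ^ k * jantzen_signature k) = jantzen_signature 0" for s :: int
  proof -
    have "(\<Sum>k\<le>K. s ^ k * jantzen_signature k) = (\<Sum>k\<in>{0}. s ^ k * jantzen_signature k)"
    proof (rule sum.mono_neutral_right)
      show "\<forall>k\<in>{..K} - {0}. s ^ k * jantzen_signature k = 0"
      proof
        fix k assume "k \<in> {..K} - {0}"
        then show "s ^ k * jantzen_signature k = 0" using z by (cases k) auto
      qed
    qed auto
    then show ?thesis by simp
  qed
  then show ?thesis using d by (intro exI[of _ d]) metis
qed

end

section \<open>Constancy of the signature along an interval\<close>

lemma eval_form_pcompose:
  "eval_form I (\<lambda>i j. G i j \<circ>\<^sub>p [:complex_of_real s, 1:]) e = eval_form I G (s + e)"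
  by (simp add: eval_form_def poly_pcompose)

lemma cnj_poly_pcompose: "cnj_poly (p \<circ>\<^sub>p q) = cnj_poly p \<circ>\<^sub>p cnj_poly q"
  by (induction p rule: pCons_induct) (auto simp: pcompose_pCons map_poly_pCons)

text \<open>Substituting \<open>s + x\<close> for the variable moves the local statement from 0 to
  any \<open>s\<close>, and Bolzano's principle glues the neighbourhoods.\<close>

lemma signature_constant_on_interval:
  assumes "poly_hermitian I G" "a \<le> b"
    and nondeg: "\<And>x u. a \<le> x \<Longrightarrow> x \<le> b \<Longrightarrow> u \<in> supported_on I \<Longrightarrow>
      \<forall>v\<in>supported_on I. eval_form I G x u v = 0 \<Longrightarrow> u = 0"
  shows "fun_space.signature (supported_on I) (eval_form I G a) =
    fun_space.signature (supported_on I) (eval_form I G b)"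
proof -
  interpret P: poly_hermitian I G by fact
  let ?s = "\<lambda>x. fun_space.signature (supported_on I) (eval_form I G x)"
  let ?Q = "\<lambda>x y. a \<le> x \<and> y \<le> b \<longrightarrow> ?s x = ?s y"
  have "?Q a b"
  proof (rule Bolzano[OF assms(2), of ?Q])
    fix x y z assume "?Q x y" "?Q y z" "x \<le> y" "y \<le> z"
    then show "?Q x z" by simp
  next
    fix s assume s: "a \<le> s" "s \<le> b"
    let ?G = "\<lambda>i j. G i j \<circ>\<^sub>p [:complex_of_real s, 1:]"
    interpret Q: poly_hermitian I ?G
    proof
      fix i j assume ij: "i \<in> I" "j \<in> I"
      show "?G j i = cnj_poly (?G i j)"
        unfolding P.G_sym[OF ij] by (simp add: cnj_poly_pcompose map_poly_pCons)
    qed (rule P.finite_index)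
    have "\<exists>d>0. \<forall>e. \<bar>e\<bar> < d \<longrightarrow> Q.signature_at e = Q.signature_at 0"
      by (rule Q.signature_locally_constant) (use nondeg[OF s] in \<open>auto simp: eval_form_pcompose\<close>)
    then obtain d where d: "d > 0" "\<And>e. \<bar>e\<bar> < d \<Longrightarrow> ?s (s + e) = ?s s"
      by (auto simp: eval_form_pcompose)
    have e: "?s x = ?s s" if "\<bar>x - s\<bar> < d" for x using d(2)[OF that] by simp
    show "\<exists>d>0. \<forall>x y. x \<le> s \<and> s \<le> y \<and> y - x < d \<longrightarrow> ?Q x y"
    proof (intro exI[of _ d] conjI allI impI)
      fix x y assume xy: "x \<le> s \<and> s \<le> y \<and> y - x < d"
      have "?s x = ?s s" by (rule e) (use xy in linarith)
      moreover have "?s y = ?s s" by (rule e) (use xy in linarith)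
      ultimately show "?s x = ?s y" by (rule trans[OF _ sym])
    qed (rule d(1))
  qed
  then show ?thesis by simp
qed

section \<open>Dunkl operators\<close>

text \<open>The coefficient form of
  \<open>D (x\<^sub>i u) = x\<^sub>i D u + s\<^sub>i\<^sub>l u\<close> for the divided difference
  \<open>D\<close>. All exponents are fixed except \<open>r\<close> of \<open>x\<^sub>i\<close> and
  \<open>s\<close> of \<open>x\<^sub>l\<close>; \<open>f\<close> lists the coefficients of
  \<open>u\<close>, \<open>f'\<close> those of \<open>x\<^sub>i u\<close>, and \<open>f s r\<close>
  is the swapped coefficient.\<close>

lemma divided_difference_shift:
  fixes f :: "nat \<Rightarrow> nat \<Rightarrow> 'r::ab_group_add"
  defines "f' \<equiv> \<lambda>p q. if p = 0 then 0 else f (p - 1) q"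
  shows "(\<Sum>t\<le>min r s. f' (r + s + 1 - t) t - f' t (r + s + 1 - t)) =
    (if r = 0 then 0 else \<Sum>t\<le>min (r - 1) s. f (r - 1 + s + 1 - t) t - f t (r - 1 + s + 1 - t)) + f s r"
proof (cases r)
  case 0
  then show ?thesis by (simp add: f'_def)
next
  case (Suc r')
  have 1: "(\<Sum>t\<le>min r s. f' (r + s + 1 - t) t) = (\<Sum>t\<le>min r s. f (r + s - t) t)"
    by (rule sum.cong) (auto simp: f'_def Suc)
  have "(\<Sum>t\<le>min r s. f' t (r + s + 1 - t)) = (\<Sum>t<Suc (min r s). f' t (r + s + 1 - t))"
    by (simp only: lessThan_Suc_atMost)
  also have "\<dots> = f' 0 (r + s + 1 - 0) + (\<Sum>t<min r s. f' (Suc t) (r + s + 1 - Suc t))"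
    by (rule sum.lessThan_Suc_shift)
  finally have 2: "(\<Sum>t\<le>min r s. f' t (r + s + 1 - t)) = (\<Sum>t<min r s. f t (r + s - t))"
    by (simp add: f'_def)
  have 3: "r - 1 + s + 1 = r + s" using Suc by simp
  show ?thesis
  proof (cases "s \<le> r'")
    case True
    then have "min r s = s" "min (r - 1) s = s" using Suc by auto
    moreover have "(\<Sum>t\<le>s. f t (r + s - t)) = (\<Sum>t<s. f t (r + s - t)) + f s r"
      by (simp flip: lessThan_Suc_atMost)
    ultimately show ?thesis
      unfolding sum_subtractf 1 2 3 using Suc by simp
  next
    case False
    then have "min r s = r" "min (r - 1) s = r'" using Suc by auto
    moreover have "(\<Sum>t\<le>r. f (r + s - t) t) = (\<Sum>t\<le>r'. f (r + s - t) t) + f s r"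
      using Suc by simp
    moreover have "(\<Sum>t<r. f t (r + s - t)) = (\<Sum>t\<le>r'. f t (r + s - t))"
      using Suc by (simp add: lessThan_Suc_atMost)
    ultimately show ?thesis
      unfolding sum_subtractf 1 2 3 using Suc by simp
  qed
qed

type_synonym 'r vec_poly = "(nat \<Rightarrow> nat) \<times> nat \<Rightarrow> 'r"

text \<open>
  The value of \<open>u\<close> at \<open>(a, j)\<close> is the coefficient of \<open>x\<^sup>a \<otimes> e\<^sub>j\<close>, where \<open>e\<^sub>0, \<dots>, e\<^sub>k\<^sub>-\<^sub>1\<close> is a basis of
  the representation with matrices \<open>rho w\<close>.
\<close>

definition monomial_indices :: "nat \<Rightarrow> nat \<Rightarrow> nat \<Rightarrow> ((nat \<Rightarrow> nat) \<times> nat) set" where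
  "monomial_indices n k m = {(a, j). a \<in> exponents n \<and> (\<Sum>i\<in>{1..n}. a i) = m \<and> j < k}"

definition mult_x :: "nat \<Rightarrow> 'r::zero vec_poly \<Rightarrow> 'r vec_poly" where
  "mult_x i u = (\<lambda>(a, j). if a i = 0 then 0 else u (a(i := a i - 1), j))"

text \<open>The coefficients of \<open>(u - s\<^sub>i\<^sub>l u) / (x\<^sub>i - x\<^sub>l)\<close>.\<close>

definition div_diff :: "nat \<Rightarrow> nat \<Rightarrow> 'r::comm_ring_1 vec_poly \<Rightarrow> 'r vec_poly" where
  "div_diff i l u = (\<lambda>(a, j). \<Sum>t\<le>min (a i) (a l).
     u (a(i := a i + a l + 1 - t, l := t), j) - u (a(i := t, l := a i + a l + 1 - t), j))"

definition swap_vars :: "nat \<Rightarrow> nat \<Rightarrow> 'r vec_poly \<Rightarrow> 'r vec_poly" where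
  "swap_vars i l u = (\<lambda>(a, j). u (a \<circ> transpose i l, j))"

lemma div_diff_x_same:
  assumes "i \<noteq> l"
  shows "div_diff i l (mult_x i u) p = mult_x i (div_diff i l u) p + swap_vars i l u p"
proof -
  obtain a j where p: "p = (a, j)" by (cases p)
  define f where "f x y = u (a(i := x, l := y), j)" for x y
  have "div_diff i l (mult_x i u) p = (\<Sum>t\<le>min (a i) (a l).
      (if a i + a l + 1 - t = 0 then 0 else f (a i + a l + 1 - t - 1) t) - (if t = 0 then 0 else f (t - 1) (a i + a l + 1 - t)))"
    unfolding p div_diff_def prod.case
    by (intro sum.cong refl) (use assms in \<open>auto simp: mult_x_def f_def fun_upd_twist[of i l]\<close>)
  also have "\<dots> = (if a i = 0 then 0 else \<Sum>t\<le>min (a i - 1) (a l).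
      f (a i - 1 + a l + 1 - t) t - f t (a i - 1 + a l + 1 - t)) + f (a l) (a i)"
    by (rule divided_difference_shift)
  also have "f (a l) (a i) = swap_vars i l u p"
  proof -
    have "a(i := a l, l := a i) = a \<circ> transpose i l"
      using assms by (auto simp: transpose_def fun_eq_iff)
    then show ?thesis by (simp add: f_def swap_vars_def p)
  qed
  also have "(if a i = 0 then 0 else \<Sum>t\<le>min (a i - 1) (a l).
      f (a i - 1 + a l + 1 - t) t - f t (a i - 1 + a l + 1 - t)) = mult_x i (div_diff i l u) p"
    using assms by (simp add: p mult_x_def div_diff_def f_def)
  finally show ?thesis .
qed

lemma div_diff_swap: "i \<noteq> l \<Longrightarrow> div_diff l i u p = - div_diff i l u p"
  by (cases p) (auto simp: div_diff_def sum_negf[symmetric] fun_upd_twist min.commute add.commute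
      intro!: sum.cong)

lemma div_diff_x_other:
  assumes "i \<noteq> l"
  shows "div_diff i l (mult_x l u) p = mult_x l (div_diff i l u) p - swap_vars i l u p"
proof -
  have s: "swap_vars l i u p = swap_vars i l u p" by (simp add: swap_vars_def transpose_commute)
  have "mult_x l (div_diff l i u) p = - mult_x l (div_diff i l u) p"
    using div_diff_swap[OF assms, of u] by (cases p) (simp add: mult_x_def)
  then show ?thesis
    using div_diff_x_same[of l i u p] div_diff_swap[OF assms, of "mult_x l u" p] assms s
    by (simp add: algebra_simps)
qed

lemma div_diff_x_distinct:
  assumes "m \<noteq> i" "m \<noteq> l"
  shows "div_diff i l (mult_x m u) p = mult_x m (div_diff i l u) p"
proof -
  obtain a j where p: "p = (a, j)" by (cases p)
  have e: "a(i := x, l := y, m := a m - Suc 0) = a(m := a m - Suc 0, i := x, l := y)" for x y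
    using assms by (metis fun_upd_twist)
  show ?thesis
    using assms by (auto simp: p div_diff_def mult_x_def e intro!: sum.cong)
qed

lemma finite_exponents_degree: "finite {a \<in> exponents n. (\<Sum>i\<in>{1..n}. a i) = m}"
proof (rule finite_subset)
  show "{a \<in> exponents n. (\<Sum>i\<in>{1..n}. a i) = m} \<subseteq> {a. \<forall>i. (i \<in> {1..n} \<longrightarrow> a i \<in> {..m}) \<and> (i \<notin> {1..n} \<longrightarrow> a i = 0)}"
  proof (intro subsetI CollectI allI conjI impI)
    fix a i assume a: "a \<in> {a \<in> exponents n. (\<Sum>i\<in>{1..n}. a i) = m}" and i: "i \<in> {1..n}"
    have "a i \<le> (\<Sum>i\<in>{1..n}. a i)" using i by (intro member_le_sum) auto
    then show "a i \<in> {..m}" using a by simp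
  qed (auto simp: exponents_def)
qed (intro finite_set_of_finite_funs, auto)

lemma finite_monomial_indices: "finite (monomial_indices n k m)"
proof -
  have "monomial_indices n k m = {a \<in> exponents n. (\<Sum>i\<in>{1..n}. a i) = m} \<times> {..<k}"
    by (auto simp: monomial_indices_def)
  then show ?thesis using finite_exponents_degree by simp
qed

text \<open>The part of \<open>u\<close> whose monomials have \<open>x\<^sub>i\<close> as their first variable, divided by \<open>x\<^sub>i\<close>.\<close>

definition leading_part :: "nat \<Rightarrow> 'r::zero vec_poly \<Rightarrow> 'r vec_poly" where
  "leading_part i u = (\<lambda>(a, j). if \<forall>l\<in>{1..<i}. a l = 0 then u (a(i := a i + 1), j) else 0)"

text \<open>Stated with sums on both sides to avoid subtraction of naturals.\<close>

lemma sum_degree_upd: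
  fixes a :: "nat \<Rightarrow> nat"
  assumes "i \<in> {1..n}"
  shows "(\<Sum>l\<in>{1..n}. (a(i := x)) l) + a i = (\<Sum>l\<in>{1..n}. a l) + (x::nat)"
proof -
  have "(\<Sum>l\<in>{1..n} - {i}. (a(i := x)) l) = (\<Sum>l\<in>{1..n} - {i}. a l)" by (rule sum.cong) auto
  then show ?thesis
    using sum.remove[OF _ assms, of "a(i := x)"] sum.remove[OF _ assms, of a] by simp
qed

section \<open>Homogeneous parts\<close>

context
  fixes n k :: nat
begin

abbreviation hpart :: "nat \<Rightarrow> 'r::zero vec_poly set" where
  "hpart m \<equiv> supported_on (monomial_indices n k m)"

lemma mult_x_hpart:
  assumes "i \<in> {1..n}" "u \<in> hpart m"
  shows "mult_x i u \<in> hpart (Suc m)"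
proof -
  have "mult_x i u (a, j) = 0" if "(a, j) \<notin> monomial_indices n k (Suc m)" for a j
  proof (cases "a i")
    case (Suc b)
    have "(a(i := b), j) \<notin> monomial_indices n k m"
      using that sum_degree_upd[OF assms(1), of a b] Suc assms(1)
      by (auto simp: monomial_indices_def exponents_def)
    then show ?thesis using assms(2) Suc by (simp add: mult_x_def supported_on_def)
  qed (simp add: mult_x_def)
  then show ?thesis by (auto simp: supported_on_def)
qed

lemma leading_part_hpart:
  assumes "i \<in> {1..n}" "u \<in> hpart (Suc m)"
  shows "leading_part i u \<in> hpart m"
proof -
  have "u (a(i := a i + 1), j) = 0" if "(a, j) \<notin> monomial_indices n k m" for a j
  proof -
    have "(a(i := a i + 1), j) \<notin> monomial_indices n k (Suc m)"
      using that sum_degree_upd[OF assms(1), of a "a i + 1"] assms(1)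
      by (auto simp: monomial_indices_def exponents_def split: if_splits)
    then show ?thesis using assms(2) by (simp add: supported_on_def)
  qed
  then show ?thesis by (auto simp: supported_on_def leading_part_def)
qed

text \<open>Each monomial of positive degree is assigned to its first variable, so exactly one
  summand reproduces it.\<close>

lemma hpart_decomposition:
  fixes u :: "'r::comm_monoid_add vec_poly"
  assumes "u \<in> hpart (Suc m)"
  shows "u p = (\<Sum>i\<in>{1..n}. mult_x i (leading_part i u) p)"
proof (cases "p \<in> monomial_indices n k (Suc m)")
  case False
  have "mult_x i (leading_part i u) p = 0" if "i \<in> {1..n}" for i
    using False mult_x_hpart[OF that leading_part_hpart[OF that assms]] unfolding supported_on_def by blast
  moreover have "u p = 0" using False assms unfolding supported_on_def by blast
  ultimately show ?thesis by simp
next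
  case True
  obtain a j where p: "p = (a, j)" by (cases p)
  have "\<exists>i. i \<in> {1..n} \<and> a i \<noteq> 0"
  proof (rule ccontr)
    assume "\<not> ?thesis"
    then have "(\<Sum>i\<in>{1..n}. a i) = 0" by (intro sum.neutral) auto
    then show False using True by (simp add: p monomial_indices_def)
  qed
  then obtain i where i: "i \<in> {1..n}" "a i \<noteq> 0" "\<And>l. l < i \<Longrightarrow> \<not> (l \<in> {1..n} \<and> a l \<noteq> 0)"
    using exists_least_iff[of "\<lambda>i. i \<in> {1..n} \<and> a i \<noteq> 0"] by blast
  have "(\<Sum>l\<in>{1..n}. mult_x l (leading_part l u) p) = (\<Sum>l\<in>{i}. mult_x l (leading_part l u) p)"
  proof (rule sum.mono_neutral_right)
    show "\<forall>l\<in>{1..n} - {i}. mult_x l (leading_part l u) p = 0"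
    proof
      fix l assume l: "l \<in> {1..n} - {i}"
      show "mult_x l (leading_part l u) p = 0"
      proof (cases "l < i")
        case True
        then show ?thesis using i(3)[OF True] l by (simp add: p mult_x_def)
      next
        case False
        then have "i \<in> {1..<l}" using l i(1) by auto
        then show ?thesis using i(2) l by (auto simp: p mult_x_def leading_part_def)
      qed
    qed
  qed (use i in auto)
  also have "\<dots> = u p"
    using i(2,3) i(1) by (auto simp: p mult_x_def leading_part_def)
  finally show ?thesis by simp
qed

end

text \<open>Coefficients lie in an arbitrary commutative ring: complex numbers give a single
  parameter, polynomials the whole family. Rows of \<open>rho\<close> from \<open>k\<close> on are
  0, so the operators never leave the indices below \<open>k\<close>.\<close>

locale dunkl =
  fixes n k :: nat and rho :: "(nat \<Rightarrow> nat) \<Rightarrow> nat \<Rightarrow> nat \<Rightarrow> 'r::comm_ring_1" and c :: 'r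
  assumes rho_zero: "k \<le> j \<Longrightarrow> rho w j l = 0"
    and rho_id: "j < k \<Longrightarrow> l < k \<Longrightarrow> rho id j l = (if j = l then 1 else 0)"
    and rho_comp: "v permutes {1..n} \<Longrightarrow> w permutes {1..n} \<Longrightarrow> j < k \<Longrightarrow> l < k \<Longrightarrow>
      rho (v \<circ> w) j l = (\<Sum>q<k. rho v j q * rho w q l)"
begin

abbreviation V :: "nat \<Rightarrow> 'r vec_poly set" where "V \<equiv> hpart n k"

definition opR :: "(nat \<Rightarrow> nat) \<Rightarrow> 'r vec_poly \<Rightarrow> 'r vec_poly" where
  "opR w u = (\<lambda>(a, j). \<Sum>q<k. rho w j q * u (a, q))"

definition opW :: "(nat \<Rightarrow> nat) \<Rightarrow> 'r vec_poly \<Rightarrow> 'r vec_poly" where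
  "opW w u = (\<lambda>(a, j). \<Sum>q<k. rho w j q * u (a \<circ> w, q))"

text \<open>The Dunkl operator \<open>\<partial>\<^sub>i - c \<Sum>\<^sub>l (1 - s\<^sub>i\<^sub>l)
  / (x\<^sub>i - x\<^sub>l) \<otimes> s\<^sub>i\<^sub>l\<close>, read off coefficientwise.\<close>

definition opY :: "nat \<Rightarrow> 'r vec_poly \<Rightarrow> 'r vec_poly" where
  "opY i u = (\<lambda>(a, j). of_nat (a i + 1) * u (a(i := a i + 1), j) -
     c * (\<Sum>l\<in>{1..n} - {i}. opR (transpose i l) (div_diff i l u) (a, j)))"

text \<open>Ordered pairs are summed, so this is twice the sum of all transpositions; the factor 2
  recurs in \<open>euler\<close>. \<open>opT\<close> is the same sum acting on the coefficient
  representation alone.\<close>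

definition opZ :: "'r vec_poly \<Rightarrow> 'r vec_poly" where
  "opZ u = (\<lambda>p. \<Sum>i\<in>{1..n}. \<Sum>l\<in>{1..n} - {i}. opW (transpose i l) u p)"

definition opT :: "'r vec_poly \<Rightarrow> 'r vec_poly" where
  "opT u = (\<lambda>p. \<Sum>i\<in>{1..n}. \<Sum>l\<in>{1..n} - {i}. opR (transpose i l) u p)"

lemma mult_x_commute: "mult_x i (mult_x l u) = mult_x l (mult_x i u)"
  by (auto simp: mult_x_def fun_eq_iff fun_upd_twist)

lemma x_add: "mult_x i (\<lambda>p. u p + v p) = (\<lambda>p. mult_x i u p + mult_x i v p)"
  and x_diff: "mult_x i (\<lambda>p. u p - v p) = (\<lambda>p. mult_x i u p - mult_x i v p)"
  and x_scale: "mult_x i (\<lambda>p. r * u p) = (\<lambda>p. r * mult_x i u p)"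
  and x_sum: "mult_x i (\<lambda>p. \<Sum>s\<in>S. f s p) = (\<lambda>p. \<Sum>s\<in>S. mult_x i (f s) p)"
  for u v :: "'r vec_poly" and f :: "'s \<Rightarrow> 'r vec_poly"
  by (auto simp: mult_x_def fun_eq_iff)

lemma W_add: "opW w (\<lambda>p. u p + v p) = (\<lambda>p. opW w u p + opW w v p)"
  and W_scale: "opW w (\<lambda>p. r * u p) = (\<lambda>p. r * opW w u p)"
  and W_sum: "opW w (\<lambda>p. \<Sum>s\<in>S. f s p) = (\<lambda>p. \<Sum>s\<in>S. opW w (f s) p)"
  and R_add: "opR w (\<lambda>p. u p + v p) = (\<lambda>p. opR w u p + opR w v p)"
  and R_scale: "opR w (\<lambda>p. r * u p) = (\<lambda>p. r * opR w u p)"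
  and R_sum: "opR w (\<lambda>p. \<Sum>s\<in>S. f s p) = (\<lambda>p. \<Sum>s\<in>S. opR w (f s) p)"
  by (auto simp: opW_def opR_def fun_eq_iff algebra_simps sum.distrib sum_distrib_left sum.swap[of _ S])

lemma div_diff_add: "div_diff i l (\<lambda>p. u p + v p) = (\<lambda>p. div_diff i l u p + div_diff i l v p)"
  and div_diff_scale: "div_diff i l (\<lambda>p. r * u p) = (\<lambda>p. r * div_diff i l u p)"
  for u v :: "'r vec_poly"
  by (auto simp: div_diff_def fun_eq_iff algebra_simps sum.distrib sum_subtractf sum_distrib_left)

lemma Y_add: "opY i (\<lambda>p. u p + v p) = (\<lambda>p. opY i u p + opY i v p)"
  and Y_scale: "opY i (\<lambda>p. r * u p) = (\<lambda>p. r * opY i u p)"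
  by (auto simp: opY_def fun_eq_iff div_diff_add div_diff_scale R_add R_scale algebra_simps sum.distrib
      sum_distrib_left)

lemma Y_zero: "opY i (\<lambda>p. 0) = (\<lambda>p. 0)"
  using Y_scale[of i 0 "\<lambda>p. 0"] by simp

lemma Y_sum: "opY i (\<lambda>p. \<Sum>s\<in>S. f s p) = (\<lambda>p. \<Sum>s\<in>S. opY i (f s) p)"
  by (induction S rule: infinite_finite_induct) (auto simp: Y_zero Y_add)

lemma Y_diff: "opY i (\<lambda>p. u p - v p) = (\<lambda>p. opY i u p - opY i v p)"
  using Y_add[of i u "\<lambda>p. (- 1) * v p"] Y_scale[of i "- 1" v] by simp

lemma W_diff: "opW w (\<lambda>p. u p - v p) = (\<lambda>p. opW w u p - opW w v p)"
  using W_add[of w u "\<lambda>p. (- 1) * v p"] W_scale[of w "- 1" v] by simp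

lemma R_swap: "opR (transpose i l) (swap_vars i l u) = opW (transpose i l) u"
  by (auto simp: opR_def swap_vars_def opW_def)

lemma R_mult_x: "opR w (mult_x i u) = mult_x i (opR w u)"
  by (auto simp: opR_def mult_x_def fun_eq_iff)

lemma T_mult_x: "opT (mult_x i u) = mult_x i (opT u)"
  by (auto simp: opT_def R_mult_x x_sum)

lemma W_comp:
  assumes "v permutes {1..n}" "w permutes {1..n}"
  shows "opW (v \<circ> w) u = opW v (opW w u)"
proof
  fix p :: "(nat \<Rightarrow> nat) \<times> nat"
  obtain a j where p: "p = (a, j)" by (cases p)
  show "opW (v \<circ> w) u p = opW v (opW w u) p"
  proof (cases "j < k")
    case True
    have "opW v (opW w u) p = (\<Sum>q<k. \<Sum>l<k. rho v j q * (rho w q l * u (a \<circ> v \<circ> w, l)))"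
      by (simp add: opW_def p sum_distrib_left)
    also have "\<dots> = (\<Sum>l<k. rho (v \<circ> w) j l * u (a \<circ> v \<circ> w, l))"
      by (subst sum.swap) (simp add: rho_comp[OF assms True] sum_distrib_right mult.assoc)
    finally show ?thesis by (simp add: opW_def p comp_assoc)
  qed (simp add: opW_def p rho_zero)
qed

lemma W_id:
  assumes "u \<in> V m"
  shows "opW id u = u"
proof
  fix p :: "(nat \<Rightarrow> nat) \<times> nat"
  obtain a j where p: "p = (a, j)" by (cases p)
  show "opW id u p = u p"
  proof (cases "j < k")
    case True
    have "(\<Sum>q<k. rho id j q * u (a, q)) = (\<Sum>q<k. if q = j then u (a, q) else 0)"
      using True by (intro sum.cong) (auto simp: rho_id)
    then show ?thesis using True by (simp add: opW_def p)
  next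
    case False
    then show ?thesis using assms by (simp add: opW_def p rho_zero supported_on_def monomial_indices_def)
  qed
qed

lemma W_x:
  assumes "w permutes {1..n}"
  shows "opW w (mult_x i u) = mult_x (w i) (opW w u)"
proof -
  have e: "a(w i := x) \<circ> w = (a \<circ> w)(i := x)" for a :: "nat \<Rightarrow> nat" and x
    using permutes_inj[OF assms] by (auto simp: fun_eq_iff inj_def)
  show ?thesis by (auto simp: opW_def mult_x_def e)
qed

lemma W_hpart:
  assumes w: "w permutes {1..n}" and u: "u \<in> V m"
  shows "opW w u \<in> V m"
proof -
  have "opW w u (a, j) = 0" if "(a, j) \<notin> monomial_indices n k m" for a j
  proof (cases "j < k")
    case True
    have "(a \<circ> w, q) \<notin> monomial_indices n k m" for q
    proof
      assume q: "(a \<circ> w, q) \<in> monomial_indices n k m"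
      have "a i = 0" if "i \<notin> {1..n}" for i
        using q permutes_not_in[OF w that] that by (auto simp: monomial_indices_def exponents_def)
      moreover have "(\<Sum>i\<in>{1..n}. a i) = (\<Sum>i\<in>{1..n}. (a \<circ> w) i)"
        using sum.permute[OF w, of a] by simp
      ultimately show False using q that True by (auto simp: monomial_indices_def exponents_def)
    qed
    then show ?thesis using u by (simp add: opW_def supported_on_def)
  qed (simp add: opW_def rho_zero)
  then show ?thesis by (auto simp: supported_on_def)
qed

lemma W_transpose_hpart: "i \<in> {1..n} \<Longrightarrow> l \<in> {1..n} \<Longrightarrow> u \<in> V m \<Longrightarrow> opW (transpose i l) u \<in> V m"
  by (intro W_hpart permutes_swap_id)

text \<open>Multiplication by \<open>x\<^sub>l\<close> passes through every divided difference
  except the one for \<open>m = l\<close>; the swapped term left there, moved by \<open>opR\<close>,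
  is the full action of the transposition. In \<open>YX_same\<close> every summand leaves such a
  term.\<close>

lemma YX_distinct:
  assumes "i \<noteq> l" "l \<in> {1..n}"
  shows "opY i (mult_x l u) = (\<lambda>p. mult_x l (opY i u) p + c * opW (transpose i l) u p)"
proof
  fix p :: "(nat \<Rightarrow> nat) \<times> nat"
  obtain a j where p: "p = (a, j)" by (cases p)
  have dd: "div_diff i m (mult_x l u) = (\<lambda>p. mult_x l (div_diff i m u) p -
      (if m = l then swap_vars i l u p else 0))" if "m \<in> {1..n} - {i}" for m
    using that assms by (auto simp: div_diff_x_other div_diff_x_distinct fun_eq_iff)
  have "opR (transpose i m) (div_diff i m (mult_x l u)) p = mult_x l (opR (transpose i m) (div_diff i m u)) p -
      (if m = l then opW (transpose i l) u p else 0)" if "m \<in> {1..n} - {i}" for m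
  proof -
    have "opR w (\<lambda>p. v p - v' p) = (\<lambda>p. opR w v p - opR w v' p)" for w v v'
      using R_add[of w v "\<lambda>p. (- 1) * v' p"] R_scale[of w "- 1" v'] by simp
    then show ?thesis
      unfolding dd[OF that] by (cases "m = l") (simp_all add: R_mult_x R_swap)
  qed
  then have "(\<Sum>m\<in>{1..n} - {i}. opR (transpose i m) (div_diff i m (mult_x l u)) p) =
      (\<Sum>m\<in>{1..n} - {i}. mult_x l (opR (transpose i m) (div_diff i m u)) p) - opW (transpose i l) u p"
    using assms by (simp add: sum_subtractf)
  also have "(\<Sum>m\<in>{1..n} - {i}. mult_x l (opR (transpose i m) (div_diff i m u)) p) =
     (if a l = 0 then 0 else \<Sum>m\<in>{1..n} - {i}. opR (transpose i m) (div_diff i m u) (a(l := a l - 1), j))"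
    by (simp add: mult_x_def p)
  finally have E: "(\<Sum>m\<in>{1..n} - {i}. opR (transpose i m) (div_diff i m (mult_x l u)) p) = \<dots> - opW (transpose i l) u p" .
  have "opY i (mult_x l u) p = of_nat (a i + 1) * mult_x l u (a(i := a i + 1), j) -
      c * (\<Sum>m\<in>{1..n} - {i}. opR (transpose i m) (div_diff i m (mult_x l u)) p)"
    by (simp add: opY_def p)
  then show "opY i (mult_x l u) p = mult_x l (opY i u) p + c * opW (transpose i l) u p"
    unfolding E using assms by (cases "a l = 0") (auto simp: opY_def p mult_x_def algebra_simps fun_upd_twist)
qed

lemma YX_same:
  "opY i (mult_x i u) = (\<lambda>p. mult_x i (opY i u) p + (u p - c * (\<Sum>l\<in>{1..n} - {i}. opW (transpose i l) u p)))"
proof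
  fix p :: "(nat \<Rightarrow> nat) \<times> nat"
  obtain a j where p: "p = (a, j)" by (cases p)
  have "opR (transpose i m) (div_diff i m (mult_x i u)) p = mult_x i (opR (transpose i m) (div_diff i m u)) p +
      opW (transpose i m) u p" if "m \<in> {1..n} - {i}" for m
  proof -
    have "div_diff i m (mult_x i u) = (\<lambda>p. mult_x i (div_diff i m u) p + swap_vars i m u p)"
      using that by (auto simp: div_diff_x_same fun_eq_iff)
    then show ?thesis by (simp only: R_add R_swap R_mult_x)
  qed
  then have "(\<Sum>m\<in>{1..n} - {i}. opR (transpose i m) (div_diff i m (mult_x i u)) p) =
      (\<Sum>m\<in>{1..n} - {i}. mult_x i (opR (transpose i m) (div_diff i m u)) p) +
      (\<Sum>m\<in>{1..n} - {i}. opW (transpose i m) u p)"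
    by (simp add: sum.distrib)
  moreover have "(if a i = 0 then 0 else \<Sum>m\<in>{1..n} - {i}. opR (transpose i m) (div_diff i m u) (a(i := a i - 1), j)) =
     (\<Sum>m\<in>{1..n} - {i}. mult_x i (opR (transpose i m) (div_diff i m u)) p)"
    by (simp add: mult_x_def p)
  ultimately show "opY i (mult_x i u) p =
      mult_x i (opY i u) p + (u p - c * (\<Sum>l\<in>{1..n} - {i}. opW (transpose i l) u p))"
    using fun_upd_triv[of a i] by (cases "a i") (auto simp: opY_def p mult_x_def algebra_simps)
qed

lemma transpose_conj:
  assumes "w permutes {1..n}"
  shows "transpose (w i) (w l) \<circ> w = w \<circ> transpose i l"
  using permutes_inj[OF assms] by (auto simp: fun_eq_iff transpose_def inj_def)

lemma W_transpose:
  assumes "w permutes {1..n}" "i \<in> {1..n}" "l \<in> {1..n}"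
  shows "opW w (opW (transpose i l) u) = opW (transpose (w i) (w l)) (opW w u)"
proof -
  have "w i \<in> {1..n}" "w l \<in> {1..n}" using assms permutes_in_image by metis+
  then show ?thesis
    using W_comp[OF assms(1) permutes_swap_id[OF assms(2,3)], of u]
      W_comp[OF permutes_swap_id assms(1), of "w i" "w l" u] transpose_conj[OF assms(1)] by simp
qed

lemma reindex_others:
  assumes w: "w permutes {1..n}" and i: "i \<in> {1..n}"
  shows "(\<Sum>l\<in>{1..n} - {i}. f (w l)) = (\<Sum>l\<in>{1..n} - {w i}. f l)"
proof (rule sum.reindex_bij_betw)
  have "w ` ({1..n} - {i}) = {1..n} - {w i}"
    using permutes_image[OF w] permutes_inj[OF w] by (simp add: image_set_diff)
  then show "bij_betw w ({1..n} - {i}) ({1..n} - {w i})"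
    using permutes_inj[OF w] by (simp add: bij_betw_def inj_on_def inj_def)
qed

lemma Y_hpart_zero:
  assumes "i \<in> {1..n}" "u \<in> V 0"
  shows "opY i u = (\<lambda>p. 0)"
proof
  fix p :: "(nat \<Rightarrow> nat) \<times> nat"
  obtain a j where p: "p = (a, j)" by (cases p)
  have z: "u (b, q) = 0" if "b l \<noteq> 0" "l \<in> {1..n}" for b q l
  proof -
    have "(b, q) \<notin> monomial_indices n k 0" using that by (auto simp: monomial_indices_def)
    then show ?thesis using assms(2) by (simp add: supported_on_def)
  qed
  have "div_diff i l u (a, q) = 0" if "l \<in> {1..n} - {i}" for l q
    unfolding div_diff_def prod.case
  proof (intro sum.neutral ballI)
    fix t assume t: "t \<in> {..min (a i) (a l)}"
    show "u (a(i := a i + a l + 1 - t, l := t), q) - u (a(i := t, l := a i + a l + 1 - t), q) = 0"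
      using z[of "a(i := a i + a l + 1 - t, l := t)" i q] z[of "a(i := t, l := a i + a l + 1 - t)" l q]
        that t assms(1) by auto
  qed
  then show "opY i u p = 0"
    using z[of "a(i := a i + 1)" i j] assms(1) by (simp add: opY_def p opR_def)
qed

lemma Y_hpart:
  assumes i: "i \<in> {1..n}" and u: "u \<in> V (Suc m)"
  shows "opY i u \<in> V m"
proof -
  have dd: "div_diff i l u (a, q) = 0"
    if aq: "(a, q) \<notin> monomial_indices n k m" and "l \<in> {1..n} - {i}" for a q l
    unfolding div_diff_def prod.case
  proof (intro sum.neutral ballI)
    fix t assume t: "t \<in> {..min (a i) (a l)}"
    have "(a(i := x, l := y), q) \<notin> monomial_indices n k (Suc m)" if xy: "x + y = a i + a l + 1" for x y
    proof
      assume q: "(a(i := x, l := y), q) \<in> monomial_indices n k (Suc m)"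
      have li: "l \<in> {1..n}" "l \<noteq> i" using \<open>l \<in> {1..n} - {i}\<close> by auto
      have "(\<Sum>s\<in>{1..n}. a s) = m"
      proof -
        have "(\<Sum>s\<in>{1..n}. (a(i := x, l := y)) s) = Suc m" using q unfolding monomial_indices_def by blast
        moreover have "(a(i := x)) l = a l" using li by simp
        ultimately show ?thesis
          using sum_degree_upd[OF i, of a x] sum_degree_upd[OF li(1), of "a(i := x)" y] xy by linarith
      qed
      moreover have "a \<in> exponents n" using q li i by (auto simp: monomial_indices_def exponents_def)
      ultimately show False using aq q by (auto simp: monomial_indices_def)
    qed
    then show "u (a(i := a i + a l + 1 - t, l := t), q) - u (a(i := t, l := a i + a l + 1 - t), q) = 0"
      using u t by (simp add: supported_on_def)
  qed
  have "opY i u (a, j) = 0" if aj: "(a, j) \<notin> monomial_indices n k m" for a j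
  proof -
    have "(a(i := a i + 1), j) \<notin> monomial_indices n k (Suc m)"
      using aj sum_degree_upd[OF i, of a "a i + 1"] i
      by (auto simp: monomial_indices_def exponents_def split: if_splits)
    then have "u (a(i := a i + 1), j) = 0" using u by (simp add: supported_on_def)
    moreover have "opR (transpose i l) (div_diff i l u) (a, j) = 0" if l: "l \<in> {1..n} - {i}" for l
    proof (cases "j < k")
      case True
      then have "(a, q) \<notin> monomial_indices n k m" if "q < k" for q
        using aj that by (simp add: monomial_indices_def)
      then show ?thesis using dd[OF _ l] by (simp add: opR_def)
    qed (simp add: opR_def rho_zero)
    ultimately show ?thesis by (simp add: opY_def)
  qed
  then show ?thesis by (auto simp: supported_on_def)
qed

text \<open>Vectors of degree \<open>m + 1\<close> are sums of \<open>x\<^sub>i\<close> times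
  vectors of degree \<open>m\<close>, so an identity of operators need only be checked in degree 0
  and against commutators with the \<open>x\<^sub>i\<close>.\<close>

lemma hpart_induct [consumes 1, case_names base add step zero]:
  assumes u: "u \<in> V m"
    and base: "\<And>u. u \<in> V 0 \<Longrightarrow> P 0 u"
    and add: "\<And>m u v. P m u \<Longrightarrow> P m v \<Longrightarrow> P m (\<lambda>p. u p + v p)"
    and step: "\<And>m i u. i \<in> {1..n} \<Longrightarrow> u \<in> V m \<Longrightarrow> P m u \<Longrightarrow> P (Suc m) (mult_x i u)"
    and zero: "\<And>m. P m (\<lambda>p. 0)"
  shows "P m u"
  using u
proof (induction m arbitrary: u)
  case (Suc m)
  have s: "P (Suc m) (\<lambda>p. \<Sum>i\<in>I. mult_x i (leading_part i u) p)" if "finite I" "I \<subseteq> {1..n}" for I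
    using that
  proof (induction I rule: finite_induct)
    case (insert i I)
    then have "P (Suc m) (mult_x i (leading_part i u))"
      using leading_part_hpart[OF _ Suc.prems] Suc.IH by (intro step) auto
    then show ?case using add insert by simp
  qed (simp add: zero)
  have "u = (\<lambda>p. \<Sum>i\<in>{1..n}. mult_x i (leading_part i u) p)"
    using hpart_decomposition[OF Suc.prems] by auto
  then show ?case using s[of "{1..n}"] by simp
qed (rule base)

end

section \<open>Commutation relations and the Euler identity\<close>

context dunkl
begin

text \<open>The commutator of \<open>y\<^sub>i\<close> with \<open>x\<^sub>l\<close>; naming it lets
  the cases \<open>i = l\<close> and \<open>i \<noteq> l\<close> be treated together.\<close>

definition comm :: "nat \<Rightarrow> nat \<Rightarrow> 'r vec_poly \<Rightarrow> 'r vec_poly" where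
  "comm i l u = (\<lambda>p. if i = l then u p - c * (\<Sum>m\<in>{1..n} - {i}. opW (transpose i m) u p)
     else c * opW (transpose i l) u p)"

lemma YX: "l \<in> {1..n} \<Longrightarrow> opY i (mult_x l u) = (\<lambda>p. mult_x l (opY i u) p + comm i l u p)"
  by (cases "i = l") (auto simp: YX_same YX_distinct comm_def)

lemma W_comm:
  assumes w: "w permutes {1..n}" and i: "i \<in> {1..n}" and l: "l \<in> {1..n}"
  shows "opW w (comm i l u) = comm (w i) (w l) (opW w u)"
proof (cases "i = l")
  case True
  have "opW w (comm i i u) = (\<lambda>p. opW w u p - c * (\<Sum>m\<in>{1..n} - {i}. opW w (opW (transpose i m) u) p))"
    by (simp add: comm_def W_diff W_scale W_sum)
  also have "\<dots> = (\<lambda>p. opW w u p - c * (\<Sum>m\<in>{1..n} - {i}. opW (transpose (w i) (w m)) (opW w u) p))"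
    using W_transpose[OF w i] by simp
  also have "\<dots> = comm (w i) (w i) (opW w u)"
  proof
    fix p
    show "opW w u p - c * (\<Sum>m\<in>{1..n} - {i}. opW (transpose (w i) (w m)) (opW w u) p) = comm (w i) (w i) (opW w u) p"
      using reindex_others[OF w i, of "\<lambda>m. opW (transpose (w i) m) (opW w u) p"] by (simp add: comm_def)
  qed
  finally show ?thesis using True by simp
next
  case False
  then have "w i \<noteq> w l" using permutes_inj[OF w] by (auto simp: inj_def)
  then show ?thesis using False W_transpose[OF w i l] by (simp add: comm_def W_scale)
qed

text \<open>Both sides vanish in degree 0 and have corresponding commutators with the
  \<open>x\<^sub>l\<close>, so no conjugate of a divided difference has to be computed.\<close>

lemma W_Y:
  assumes w: "w permutes {1..n}" and i: "i \<in> {1..n}" and u: "u \<in> V m"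
  shows "opW w (opY i u) = opY (w i) (opW w u)"
  using u
proof (induction rule: hpart_induct)
  case (base u)
  have "opW w (\<lambda>p. 0) = (\<lambda>p. 0)" using W_scale[of w 0 "\<lambda>p. 0"] by simp
  moreover have "w i \<in> {1..n}" using i permutes_in_image[OF w] by simp
  ultimately show ?case
    using Y_hpart_zero[OF i base] Y_hpart_zero[OF _ W_hpart[OF w base]] by simp
next
  case (add m u v)
  then show ?case by (simp add: Y_add W_add)
next
  case (step m l u)
  have "w l \<in> {1..n}" using step permutes_in_image[OF w] by simp
  then show ?case
    using step by (simp add: YX W_add W_x[OF w] W_comm[OF w i])
next
  case (zero m)
  have "opW w (\<lambda>p. 0) = (\<lambda>p. 0)" using W_scale[of w 0 "\<lambda>p. 0"] by simp
  then show ?case by (simp add: Y_zero)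
qed

lemma W_transpose_Y:
  assumes "i \<in> {1..n}" "l \<in> {1..n}" "j \<in> {1..n}" "u \<in> V m"
  shows "opW (transpose i l) (opY j u) = opY (transpose i l j) (opW (transpose i l) u)"
  using W_Y[OF permutes_swap_id[OF assms(1,2)] assms(3,4)] .

text \<open>The Jacobi identity: \<open>[[y\<^sub>i, y\<^sub>j], x\<^sub>s] = 0\<close>.\<close>

lemma Y_comm_jacobi:
  assumes ij: "i \<in> {1..n}" "j \<in> {1..n}" "i \<noteq> j" and s: "s \<in> {1..n}" and v: "v \<in> V m"
  shows "comm i s (opY j v) p + opY i (comm j s v) p = comm j s (opY i v) p + opY j (comm i s v) p"
proof -
  have 1: "comm i i (opY j v) p + opY i (comm j i v) p = comm j i (opY i v) p + opY j (comm i i v) p"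
    if ij: "i \<in> {1..n}" "j \<in> {1..n}" "i \<noteq> j" for i j
  proof -
    \<comment> \<open>The transposition of \<open>i\<close> and \<open>l\<close> commutes with
      \<open>y\<^sub>j\<close> except for \<open>l = j\<close>, where it turns
      \<open>y\<^sub>j\<close> into \<open>y\<^sub>i\<close>; this one deviation balances the mixed
      terms.\<close>
    have "(\<Sum>l\<in>{1..n} - {i}. opW (transpose i l) (opY j v) p) =
        (\<Sum>l\<in>{1..n} - {i}. opY j (opW (transpose i l) v) p + (if l = j then
          opY i (opW (transpose i j) v) p - opY j (opW (transpose i j) v) p else 0))"
      using W_transpose_Y[OF ij(1) _ ij(2) v] ij by (intro sum.cong) auto
    also have "\<dots> = (\<Sum>l\<in>{1..n} - {i}. opY j (opW (transpose i l) v) p) +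
        (opY i (opW (transpose i j) v) p - opY j (opW (transpose i j) v) p)"
      using ij by (simp add: sum.distrib)
    finally have e: "(\<Sum>l\<in>{1..n} - {i}. opW (transpose i l) (opY j v) p) = \<dots>" .
    have 2: "opW (transpose j i) (opY i v) = opY j (opW (transpose i j) v)"
      using W_transpose_Y[OF ij(2,1,1) v] by (simp add: transpose_commute)
    have 3: "opY i (comm j i v) p = c * opY i (opW (transpose i j) v) p"
      using ij by (simp add: comm_def Y_scale transpose_commute)
    have 4: "opY j (comm i i v) p = opY j v p - c * (\<Sum>l\<in>{1..n} - {i}. opY j (opW (transpose i l) v) p)"
      by (simp add: comm_def Y_diff Y_scale Y_sum)
    have 5: "comm i i (opY j v) p = opY j v p - c * (\<Sum>l\<in>{1..n} - {i}. opW (transpose i l) (opY j v) p)"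
      by (simp add: comm_def)
    have 6: "comm j i (opY i v) p = c * opY j (opW (transpose i j) v) p"
      using ij 2 by (simp add: comm_def)
    show ?thesis unfolding 3 4 5 6 e by (simp add: algebra_simps)
  qed
  consider "s = i" | "s = j" | "s \<noteq> i" "s \<noteq> j" by blast
  then show ?thesis
  proof cases
    case 1
    then show ?thesis using \<open>\<And>j i. i \<in> {1..n} \<Longrightarrow> j \<in> {1..n} \<Longrightarrow> i \<noteq> j \<Longrightarrow> _\<close>[OF ij] by simp
  next
    case 2
    then show ?thesis using \<open>\<And>j i. i \<in> {1..n} \<Longrightarrow> j \<in> {1..n} \<Longrightarrow> i \<noteq> j \<Longrightarrow> _\<close>[OF ij(2,1)] ij(3) by simp
  next
    case 3
    then have "opW (transpose i s) (opY j v) = opY j (opW (transpose i s) v)"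
      "opW (transpose j s) (opY i v) = opY i (opW (transpose j s) v)"
      using W_transpose_Y[OF ij(1) s ij(2) v] W_transpose_Y[OF ij(2) s ij(1) v] ij(3) by simp_all
    then show ?thesis using 3 by (simp add: comm_def Y_scale)
  qed
qed

text \<open>By the Jacobi identity \<open>[y\<^sub>i, y\<^sub>j]\<close> commutes with all
  \<open>x\<^sub>s\<close>, and it kills degree 0.\<close>

lemma Y_commute:
  assumes "u \<in> V m" "i \<in> {1..n}" "j \<in> {1..n}"
  shows "opY i (opY j u) = opY j (opY i u)"
proof (cases "i = j")
  case False
  show ?thesis
    using assms(1)
  proof (induction rule: hpart_induct)
    case (base u)
    then show ?case using assms(2,3) by (simp add: Y_hpart_zero Y_zero)
  next
    case (add m u v)
    then show ?case by (simp add: Y_add)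
  next
    case (step m l u)
    have e: "opY i (opY j (mult_x l u)) p = mult_x l (opY i (opY j u)) p + (comm i l (opY j u) p + opY i (comm j l u) p)"
      for i j p using step(1) by (simp add: YX Y_add add.assoc)
    show ?case
      using Y_comm_jacobi[OF assms(2,3) False step(1,2)] step(3) by (intro ext) (simp only: e)
  qed (simp add: Y_zero)
qed simp

lemma hpart_zeroD:
  assumes "u \<in> V 0" "u (a, j) \<noteq> 0"
  shows "a = (\<lambda>_. 0)"
proof
  fix i
  have "(a, j) \<in> monomial_indices n k 0" using assms by (auto simp: supported_on_def)
  then show "a i = 0" by (cases "i \<in> {1..n}") (auto simp: monomial_indices_def exponents_def)
qed

text \<open>In degree 0 there are no variables to permute.\<close>

lemma Z_T_base:
  assumes "u \<in> V 0"
  shows "opZ u = opT u"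
proof -
  have "opW w u = opR w u" if w: "w permutes {1..n}" for w
  proof -
    have "u (a \<circ> w, q) = u (a, q)" for a q
    proof (cases "a = (\<lambda>_. 0)")
      case False
      have "a \<circ> w \<noteq> (\<lambda>_. 0)"
      proof
        assume z: "a \<circ> w = (\<lambda>_. 0)"
        have "a i = 0" for i
          using fun_cong[OF z, of "inv_into UNIV w i"] permutes_inverses(1)[OF w] by simp
        then show False using False by auto
      qed
      then show ?thesis using False hpart_zeroD[OF assms] by metis
    qed (simp add: comp_def)
    then show ?thesis by (auto simp: opW_def opR_def)
  qed
  then show ?thesis by (auto simp: opZ_def opT_def fun_eq_iff permutes_swap_id intro!: sum.cong)
qed

lemma Z_add: "opZ (\<lambda>p. u p + v p) = (\<lambda>p. opZ u p + opZ v p)"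
  and T_add: "opT (\<lambda>p. u p + v p) = (\<lambda>p. opT u p + opT v p)"
  by (auto simp: opZ_def opT_def W_add R_add sum.distrib)

text \<open>A transposition fails to commute with \<open>x\<^sub>l\<close> only if it moves
  \<open>l\<close>; each such one occurs in two ordered pairs, whence the factor 2.\<close>

lemma Z_x:
  assumes l: "l \<in> {1..n}"
  shows "opZ (mult_x l u) p = mult_x l (opZ u) p +
    2 * (\<Sum>m\<in>{1..n} - {l}. mult_x m (opW (transpose l m) u) p - mult_x l (opW (transpose l m) u) p)"
proof -
  let ?d = "\<lambda>m. mult_x m (opW (transpose l m) u) p - mult_x l (opW (transpose l m) u) p"
  have e: "opW (transpose i m) (mult_x l u) p = mult_x l (opW (transpose i m) u) p +
      (if i = l then ?d m else 0) + (if m = l then ?d i else 0)"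
    if "i \<in> {1..n}" "m \<in> {1..n} - {i}" for i m
    using that W_x[OF permutes_swap_id[of i "{1..n}" m], of l u] by (auto simp: transpose_commute)
  have "opZ (mult_x l u) p = (\<Sum>i\<in>{1..n}. \<Sum>m\<in>{1..n} - {i}. mult_x l (opW (transpose i m) u) p +
      (if i = l then ?d m else 0) + (if m = l then ?d i else 0))"
    unfolding opZ_def using e by (intro sum.cong refl) auto
  also have "\<dots> = (\<Sum>i\<in>{1..n}. \<Sum>m\<in>{1..n} - {i}. mult_x l (opW (transpose i m) u) p) +
     (\<Sum>i\<in>{1..n}. if i = l then (\<Sum>m\<in>{1..n} - {i}. ?d m) else 0) +
     (\<Sum>i\<in>{1..n}. \<Sum>m\<in>{1..n} - {i}. (if m = l then ?d i else 0))"
  proof -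
    have "(\<Sum>m\<in>{1..n} - {i}. mult_x l (opW (transpose i m) u) p + (if i = l then ?d m else 0) + (if m = l then ?d i else 0)) =
      (\<Sum>m\<in>{1..n} - {i}. mult_x l (opW (transpose i m) u) p) + (if i = l then (\<Sum>m\<in>{1..n} - {i}. ?d m) else 0) +
      (\<Sum>m\<in>{1..n} - {i}. (if m = l then ?d i else 0))" for i
      by (cases "i = l") (simp_all add: sum.distrib sum_subtractf)
    then show ?thesis by (simp only: sum.distrib)
  qed
  also have "(\<Sum>i\<in>{1..n}. if i = l then (\<Sum>m\<in>{1..n} - {i}. ?d m) else 0) = (\<Sum>m\<in>{1..n} - {l}. ?d m)"
    using l by simp
  also have "(\<Sum>i\<in>{1..n}. \<Sum>m\<in>{1..n} - {i}. (if m = l then ?d i else 0)) = (\<Sum>i\<in>{1..n}. if i = l then 0 else ?d i)"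
    using l by (intro sum.cong refl) auto
  also have "\<dots> = (\<Sum>i\<in>{1..n} - {l}. ?d i)"
    by (subst sum.remove[OF _ l]) (auto intro!: sum.cong)
  also have "(\<Sum>i\<in>{1..n}. \<Sum>m\<in>{1..n} - {i}. mult_x l (opW (transpose i m) u) p) = mult_x l (opZ u) p"
    by (simp add: opZ_def x_sum)
  finally show ?thesis by simp
qed

text \<open>The deviations \<open>(x\<^sub>m - x\<^sub>l) s\<^sub>l\<^sub>m\<close> from the
  commutators of the \<open>y\<^sub>i\<close> and from \<open>Z_x\<close> cancel, so the operator on
  the left has commutator \<open>2 x\<^sub>l\<close> with \<open>x\<^sub>l\<close>. In degree 0 it
  is \<open>- c\<close> times the class sum on the coefficients, which commutes with the
  variables.\<close>

lemma euler:
  assumes "u \<in> V m"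
  shows "2 * (\<Sum>i\<in>{1..n}. mult_x i (opY i u) p) - c * opZ u p = of_nat (2 * m) * u p - c * opT u p"
  using assms
proof (induction arbitrary: p rule: hpart_induct)
  case (base u)
  have "mult_x i (opY i u) p = 0" if "i \<in> {1..n}" for i
    using Y_hpart_zero[OF that base] by (cases p) (simp add: mult_x_def)
  then show ?case by (simp add: Z_T_base[OF base])
next
  case (add m u v)
  have "2 * (\<Sum>i\<in>{1..n}. mult_x i (opY i (\<lambda>p. u p + v p)) p) - c * opZ (\<lambda>p. u p + v p) p =
     (2 * (\<Sum>i\<in>{1..n}. mult_x i (opY i u) p) - c * opZ u p) + (2 * (\<Sum>i\<in>{1..n}. mult_x i (opY i v) p) - c * opZ v p)"
    by (simp add: Y_add x_add Z_add sum.distrib algebra_simps)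
  then show ?case unfolding add T_add by (simp add: algebra_simps)
next
  case (step m l u)
  let ?s = "\<lambda>m. opW (transpose l m) u"
  have "mult_x i (comm i l u) p = (if i = l then mult_x l u p - c * (\<Sum>m\<in>{1..n} - {l}. mult_x l (?s m) p)
      else c * mult_x i (?s i) p)" for i
    by (auto simp: comm_def x_diff x_scale x_sum transpose_commute)
  then have "(\<Sum>i\<in>{1..n}. mult_x i (comm i l u) p) =
      (mult_x l u p - c * (\<Sum>m\<in>{1..n} - {l}. mult_x l (?s m) p)) + c * (\<Sum>i\<in>{1..n} - {l}. mult_x i (?s i) p)"
    by (subst sum.remove[OF _ step(1)]) (auto simp: sum_distrib_left intro!: sum.cong)
  then have 1: "(\<Sum>i\<in>{1..n}. mult_x i (opY i (mult_x l u)) p) =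
      mult_x l (\<lambda>p. \<Sum>i\<in>{1..n}. mult_x i (opY i u) p) p + (mult_x l u p +
      c * (\<Sum>m\<in>{1..n} - {l}. mult_x m (?s m) p - mult_x l (?s m) p))"
    using step(1) by (simp add: YX x_add x_sum sum.distrib mult_x_commute[of _ l] sum_subtractf algebra_simps)
  have 2: "mult_x l (\<lambda>p. 2 * (\<Sum>i\<in>{1..n}. mult_x i (opY i u) p) - c * opZ u p) p =
      mult_x l (\<lambda>p. of_nat (2 * m) * u p - c * opT u p) p"
    unfolding step(3) ..
  then have "2 * mult_x l (\<lambda>p. \<Sum>i\<in>{1..n}. mult_x i (opY i u) p) p - c * mult_x l (opZ u) p =
      of_nat (2 * m) * mult_x l u p - c * opT (mult_x l u) p"
    by (simp add: x_diff x_scale T_mult_x)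
  then show ?case
    unfolding 1 Z_x[OF step(1)] by (simp add: algebra_simps)
next
  case (zero m)
  then show ?case
    by (cases p) (simp add: Y_zero opZ_def opT_def opW_def opR_def mult_x_def)
qed

end

section \<open>The contravariant form\<close>

text \<open>\<open>cj\<close> is an abstract involution fixing \<open>c\<close>, instantiated by
  \<open>cnj\<close> and by \<open>cnj_poly\<close>. \<open>beta\<close> is an invariant Hermitian
  form on the coefficients, possibly indefinite.\<close>

locale dunkl_form = dunkl n k rho c
  for n k :: nat and rho :: "(nat \<Rightarrow> nat) \<Rightarrow> nat \<Rightarrow> nat \<Rightarrow> 'r::comm_ring_1" and c :: 'r +
  fixes cj :: "'r \<Rightarrow> 'r" and beta :: "nat \<Rightarrow> nat \<Rightarrow> 'r"
  assumes cj_add: "cj (x + y) = cj x + cj y"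
    and cj_mult: "cj (x * y) = cj x * cj y"
    and cj_cj: "cj (cj x) = x"
    and cj_c: "cj c = c"
    and beta_sym: "j < k \<Longrightarrow> l < k \<Longrightarrow> beta l j = cj (beta j l)"
    and beta_inv: "w permutes {1..n} \<Longrightarrow> j < k \<Longrightarrow> l < k \<Longrightarrow>
      (\<Sum>p<k. \<Sum>q<k. rho w p j * beta p q * cj (rho w q l)) = beta j l"
begin

lemma cj_zero: "cj 0 = 0"
  using cj_add[of 0 0] by simp

lemma cj_sum: "cj (sum f A) = (\<Sum>x\<in>A. cj (f x))"
  by (induction A rule: infinite_finite_induct) (auto simp: cj_add cj_zero)

text \<open>The coefficient vector of \<open>y\<^sup>a v\<close>, removing the variables of
  \<open>a\<close> from the first on; \<open>m\<close> is meant to be the degree of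
  \<open>a\<close>.\<close>

primrec descend :: "nat \<Rightarrow> (nat \<Rightarrow> nat) \<Rightarrow> 'r vec_poly \<Rightarrow> nat \<Rightarrow> 'r" where
  "descend 0 a v = (\<lambda>q. v (a, q))"
| "descend (Suc m) a v = (let l = LEAST l. a l \<noteq> 0 in descend m (a(l := a l - 1)) (opY l v))"

text \<open>Contravariance forces \<open>\<langle>x\<^sup>a e\<^sub>j, v\<rangle> =
  \<langle>e\<^sub>j, y\<^sup>a v\<rangle>\<close>, and the right side lives in degree 0, where
  \<open>beta\<close> is prescribed.\<close>

definition form :: "nat \<Rightarrow> 'r vec_poly \<Rightarrow> 'r vec_poly \<Rightarrow> 'r" where
  "form m u v = (\<Sum>(a, j)\<in>monomial_indices n k m. u (a, j) * (\<Sum>q<k. beta j q * cj (descend m a v q)))"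

lemma descend_add: "descend m a (\<lambda>p. u p + v p) = (\<lambda>q. descend m a u q + descend m a v q)"
  by (induction m arbitrary: a u v) (auto simp: Let_def Y_add)

lemma descend_scale: "descend m a (\<lambda>p. r * v p) = (\<lambda>q. r * descend m a v q)"
  by (induction m arbitrary: a v) (auto simp: Let_def Y_scale)

lemma form_add_left: "form m (\<lambda>p. u p + v p) w = form m u w + form m v w"
  and form_scale_left: "form m (\<lambda>p. r * u p) w = r * form m u w"
  and form_add_right: "form m w (\<lambda>p. u p + v p) = form m w u + form m w v"
  and form_scale_right: "form m w (\<lambda>p. r * u p) = cj r * form m w u"
  by (simp_all add: form_def case_prod_unfold descend_add descend_scale cj_add cj_mult algebra_simps
      sum.distrib sum_distrib_left)

lemma form_zero_left: "form m (\<lambda>p. 0) w = 0"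
  and form_zero_right: "form m w (\<lambda>p. 0) = 0"
  using form_scale_left[of m 0 "\<lambda>p. 0" w] form_scale_right[of m w 0 "\<lambda>p. 0"] cj_zero by simp_all

lemma form_sum_left: "form m (\<lambda>p. \<Sum>s\<in>S. r s * f s p) w = (\<Sum>s\<in>S. r s * form m (f s) w)"
  by (induction S rule: infinite_finite_induct)
     (auto simp: form_add_left form_scale_left form_zero_left)

lemma form_sum_right: "form m w (\<lambda>p. \<Sum>s\<in>S. r s * f s p) = (\<Sum>s\<in>S. cj (r s) * form m w (f s))"
  by (induction S rule: infinite_finite_induct)
     (auto simp: form_add_right form_scale_right form_zero_right)

lemma form_diff_left: "form m (\<lambda>p. u p - v p) w = form m u w - form m v w"
  using form_add_left[of m u "\<lambda>p. (- 1) * v p" w] form_scale_left[of m "- 1" v w] by simp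

lemma form_sum_left': "form m (\<lambda>p. \<Sum>s\<in>S. f s p) w = (\<Sum>s\<in>S. form m (f s) w)"
  by (induction S rule: infinite_finite_induct) (auto simp: form_add_left form_zero_left)

lemma form_sum_right': "form m w (\<lambda>p. \<Sum>s\<in>S. f s p) = (\<Sum>s\<in>S. form m w (f s))"
  by (induction S rule: infinite_finite_induct) (auto simp: form_add_right form_zero_right)

lemma cj_minus_one: "cj (- 1) = - 1"
proof -
  have "cj 1 = 1" using cj_mult[of "cj 1" 1] by (simp add: cj_cj)
  moreover have "cj 1 + cj (- 1) = 0" using cj_add[of 1 "- 1"] cj_zero by simp
  ultimately show ?thesis by (simp add: eq_neg_iff_add_eq_0 add.commute)
qed

lemma form_diff_right: "form m w (\<lambda>p. u p - v p) = form m w u - form m w v"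
  using form_add_right[of m w u "\<lambda>p. (- 1) * v p"] form_scale_right[of m w "- 1" v] cj_minus_one by simp

lemma Least_exponent:
  assumes "a \<in> exponents n" "a i \<noteq> 0"
  shows "(LEAST l. a l \<noteq> 0) \<in> {1..n}" "a (LEAST l. a l \<noteq> 0) \<noteq> 0"
proof -
  show "a (LEAST l. a l \<noteq> 0) \<noteq> 0" using assms(2) by (rule LeastI)
  then show "(LEAST l. a l \<noteq> 0) \<in> {1..n}" using assms(1) by (auto simp: exponents_def)
qed

text \<open>The \<open>y\<^sub>i\<close> commute, so any variable, not just the first, may be
  removed at the start; \<open>form_x_left\<close> depends on this freedom.\<close>

lemma descend_Suc:
  assumes "a \<in> exponents n" "(\<Sum>l\<in>{1..n}. a l) = m" "i \<in> {1..n}" "v \<in> V (Suc m)"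
  shows "descend (Suc m) (a(i := a i + 1)) v = descend m a (opY i v)"
  using assms
proof (induction m arbitrary: a i v)
  case (0 a i v)
  have z: "a l = 0" for l using 0(1,2) by (cases "l \<in> {1..n}") (auto simp: exponents_def)
  have L: "(LEAST l. (a(i := a i + 1)) l \<noteq> 0) = i"
    by (rule Least_equality) (auto simp: z split: if_splits)
  have e: "(a(i := a i + 1))(i := (a(i := a i + 1)) i - 1) = a" by simp
  show ?case unfolding descend.simps Let_def L e ..
next
  case (Suc m a i v)
  let ?b = "a(i := a i + 1)"
  define l where "l = (LEAST l. ?b l \<noteq> 0)"
  have bl: "?b l \<noteq> 0" unfolding l_def by (rule LeastI[of _ i]) simp
  have unf: "descend (Suc (Suc m)) ?b v = descend (Suc m) (?b(l := ?b l - 1)) (opY l v)"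
    unfolding l_def by (simp only: descend.simps Let_def)
  show ?case
  proof (cases "l = i")
    case True
    then have "?b(l := ?b l - 1) = a" by auto
    then show ?thesis unfolding unf using True by simp
  next
    case False
    then have al: "a l \<noteq> 0" using bl by simp
    then have ln: "l \<in> {1..n}" using Suc.prems(1) by (auto simp: exponents_def)
    have least: "(LEAST l. a l \<noteq> 0) = l"
    proof (rule Least_equality)
      show "a l \<noteq> 0" by (rule al)
    next
      fix y assume "a y \<noteq> 0"
      then have "?b y \<noteq> 0" by auto
      then show "l \<le> y" unfolding l_def by (rule Least_le)
    qed
    let ?a = "a(l := a l - 1)"
    have "?a \<in> exponents n" using Suc.prems(1) by (auto simp: exponents_def)
    moreover have "(\<Sum>l\<in>{1..n}. ?a l) = m"
      using sum_degree_upd[OF ln, of a "a l - 1"] Suc.prems(2) al by linarith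
    moreover have Yl: "opY l v \<in> V (Suc m)" by (rule Y_hpart[OF ln Suc.prems(4)])
    ultimately have "descend (Suc m) (?a(i := ?a i + 1)) (opY l v) = descend m ?a (opY i (opY l v))"
      using Suc.prems(3) by (intro Suc.IH)
    also have "opY i (opY l v) = opY l (opY i v)"
      by (rule Y_commute[OF Suc.prems(4) Suc.prems(3) ln])
    also have "descend m ?a (opY l (opY i v)) = descend (Suc m) a (opY i v)"
      by (simp only: descend.simps Let_def least)
    also have "?a(i := ?a i + 1) = ?b(l := ?b l - 1)" using False by (auto simp: fun_eq_iff)
    finally show ?thesis unfolding unf .
  qed
qed

text \<open>Only monomials containing \<open>x\<^sub>i\<close> occur in \<open>mult_x i u\<close>;
  dividing them by \<open>x\<^sub>i\<close> reindexes the sum by degree \<open>m\<close>.\<close>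

lemma form_x_left:
  assumes i: "i \<in> {1..n}" and v: "v \<in> V (Suc m)"
  shows "form (Suc m) (mult_x i u) v = form m u (opY i v)"
proof -
  let ?F = "\<lambda>a j. \<Sum>q<k. beta j q * cj (descend (Suc m) a v q)"
  let ?M = "monomial_indices n k"
  have fin: "finite (?M (Suc m))" by (rule finite_monomial_indices)
  have "form (Suc m) (mult_x i u) v = (\<Sum>p\<in>?M (Suc m). mult_x i u p * ?F (fst p) (snd p))"
    unfolding form_def by (rule sum.cong) auto
  also have "\<dots> = (\<Sum>p\<in>{p\<in>?M (Suc m). fst p i \<noteq> 0}. mult_x i u p * ?F (fst p) (snd p))"
    using fin by (intro sum.mono_neutral_right) (auto simp: mult_x_def split: if_splits simp del: descend.simps)
  also have "\<dots> = (\<Sum>p\<in>?M m. u p * (\<Sum>q<k. beta (snd p) q * cj (descend m (fst p) (opY i v) q)))"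
  proof (rule sum.reindex_bij_witness[where j = "\<lambda>(a, j). (a(i := a i - 1), j)"
        and i = "\<lambda>(a, j). (a(i := a i + 1), j)"])
    fix p assume p: "p \<in> {p\<in>?M (Suc m). fst p i \<noteq> 0}"
    obtain a j where aj: "p = (a, j)" by (cases p)
    let ?a = "a(i := a i - 1)"
    have "(\<Sum>l\<in>{1..n}. a l) = Suc m" using p by (auto simp: aj monomial_indices_def)
    then have "(\<Sum>l\<in>{1..n}. ?a l) = m"
      using sum_degree_upd[OF i, of a "a i - 1"] p by (simp add: aj del: fun_upd_apply)
    moreover have "?a \<in> exponents n" "j < k" using p by (auto simp: aj monomial_indices_def exponents_def)
    ultimately show "(\<lambda>(a, j). (a(i := a i - 1), j)) p \<in> ?M m"
      unfolding aj prod.case monomial_indices_def by blast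
    have e: "?a(i := ?a i + 1) = a" using p by (auto simp: aj)
    then show "(\<lambda>(a, j). (a(i := a i + 1), j)) ((\<lambda>(a, j). (a(i := a i - 1), j)) p) = p" by (simp add: aj)
    have "descend m ?a (opY i v) = descend (Suc m) a v"
      using descend_Suc[OF \<open>?a \<in> exponents n\<close> \<open>(\<Sum>l\<in>{1..n}. ?a l) = m\<close> i v] unfolding e by (simp del: descend.simps fun_upd_apply)
    then show "u ((\<lambda>(a, j). (a(i := a i - 1), j)) p) * (\<Sum>q<k. beta (snd ((\<lambda>(a, j). (a(i := a i - 1), j)) p)) q *
        cj (descend m (fst ((\<lambda>(a, j). (a(i := a i - 1), j)) p)) (opY i v) q)) = mult_x i u p * ?F (fst p) (snd p)"
      using p by (simp add: aj mult_x_def del: descend.simps)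
  next
    fix p assume p: "p \<in> ?M m"
    obtain a j where aj: "p = (a, j)" by (cases p)
    let ?a = "a(i := a i + 1)"
    have "(\<Sum>l\<in>{1..n}. a l) = m" using p by (auto simp: aj monomial_indices_def)
    then have "(\<Sum>l\<in>{1..n}. ?a l) = Suc m"
      using sum_degree_upd[OF i, of a "a i + 1"] by linarith
    moreover have "?a \<in> exponents n" "j < k" using p i by (auto simp: aj monomial_indices_def exponents_def)
    ultimately have "(?a, j) \<in> ?M (Suc m)" unfolding monomial_indices_def by blast
    then show "(\<lambda>(a, j). (a(i := a i + 1), j)) p \<in> {p\<in>?M (Suc m). fst p i \<noteq> 0}" by (simp add: aj)
  qed auto
  also have "\<dots> = form m u (opY i v)" unfolding form_def by (rule sum.cong) auto
  finally show ?thesis .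
qed

lemma monomial_indices_zero: "monomial_indices n k 0 = (\<lambda>j. (\<lambda>_. 0, j)) ` {..<k}"
proof -
  have "a = (\<lambda>_. 0)" if "a \<in> exponents n" "(\<Sum>i\<in>{1..n}. a i) = 0" for a
  proof
    fix i show "a i = 0" using that by (cases "i \<in> {1..n}") (auto simp: exponents_def)
  qed
  then show ?thesis by (auto simp: monomial_indices_def exponents_def)
qed

lemma form_base: "form 0 u v = (\<Sum>j<k. \<Sum>q<k. u (\<lambda>_. 0, j) * beta j q * cj (v (\<lambda>_. 0, q)))"
  unfolding form_def monomial_indices_zero
  by (subst sum.reindex) (auto simp: inj_on_def sum_distrib_left mult.assoc)

lemma form_W:
  assumes w: "w permutes {1..n}" and "u \<in> V m" "v \<in> V m"
  shows "form m (opW w u) (opW w v) = form m u v"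
proof -
  have "\<forall>v\<in>V m. form m (opW w u) (opW w v) = form m u v"
    using assms(2)
  proof (induction rule: hpart_induct)
    case (base u)
    show ?case
    proof
      fix v assume "v \<in> V 0"
      let ?u = "\<lambda>j. u (\<lambda>_. 0, j)" and ?v = "\<lambda>j. v (\<lambda>_. 0, j)"
      have "form 0 (opW w u) (opW w v) =
        (\<Sum>p<k. \<Sum>q<k. (\<Sum>j<k. rho w p j * ?u j) * beta p q * (\<Sum>l<k. cj (rho w q l) * cj (?v l)))"
        by (simp add: form_base opW_def comp_def cj_sum cj_mult)
      also have "\<dots> = (\<Sum>p<k. \<Sum>q<k. \<Sum>j<k. \<Sum>l<k. ?u j * (rho w p j * beta p q * cj (rho w q l)) * cj (?v l))"
        by (simp add: sum_distrib_left sum_distrib_right mult_ac)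
      also have "\<dots> = (\<Sum>p<k. \<Sum>j<k. \<Sum>q<k. \<Sum>l<k. ?u j * (rho w p j * beta p q * cj (rho w q l)) * cj (?v l))"
        by (intro sum.cong refl sum.swap)
      also have "\<dots> = (\<Sum>j<k. \<Sum>p<k. \<Sum>q<k. \<Sum>l<k. ?u j * (rho w p j * beta p q * cj (rho w q l)) * cj (?v l))"
        by (rule sum.swap)
      also have "\<dots> = (\<Sum>j<k. \<Sum>p<k. \<Sum>l<k. \<Sum>q<k. ?u j * (rho w p j * beta p q * cj (rho w q l)) * cj (?v l))"
        by (intro sum.cong refl sum.swap)
      also have "\<dots> = (\<Sum>j<k. \<Sum>l<k. \<Sum>p<k. \<Sum>q<k. ?u j * (rho w p j * beta p q * cj (rho w q l)) * cj (?v l))"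
        by (intro sum.cong refl sum.swap)
      also have "\<dots> = (\<Sum>j<k. \<Sum>l<k. ?u j * beta j l * cj (?v l))"
        by (intro sum.cong refl) (simp add: beta_inv[OF w, symmetric] sum_distrib_left sum_distrib_right)
      finally show "form 0 (opW w u) (opW w v) = form 0 u v" by (simp add: form_base)
    qed
  next
    case (add m u v)
    then show ?case by (simp add: W_add form_add_left)
  next
    case (step m i u)
    show ?case
    proof
      fix v assume v: "v \<in> V (Suc m)"
      have wi: "w i \<in> {1..n}" using step(1) permutes_in_image[OF w] by simp
      have "form (Suc m) (opW w (mult_x i u)) (opW w v) = form m (opW w u) (opW w (opY i v))"
        using form_x_left[OF wi W_hpart[OF w v]] by (simp add: W_x[OF w] W_Y[OF w step(1) v])
      also have "\<dots> = form m u (opY i v)" using step(3) Y_hpart[OF step(1) v] by blast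
      finally show "form (Suc m) (opW w (mult_x i u)) (opW w v) = form (Suc m) (mult_x i u) v"
        using form_x_left[OF step(1) v] by simp
    qed
  next
    case (zero m)
    have "opW w (\<lambda>p. 0) = (\<lambda>p. 0)" using W_scale[of w 0 "\<lambda>p. 0"] by simp
    then show ?case by (simp add: form_zero_left)
  qed
  then show ?thesis using assms(3) by blast
qed

lemma form_transpose:
  assumes "i \<in> {1..n}" "l \<in> {1..n}" "u \<in> V m" "v \<in> V m"
  shows "form m (opW (transpose i l) u) v = form m u (opW (transpose i l) v)"
proof -
  have p: "transpose i l permutes {1..n}" using assms(1,2) by (rule permutes_swap_id)
  have "opW (transpose i l) (opW (transpose i l) v) = v"
    using W_comp[OF p p, of v] W_id[OF assms(4)] by simp
  then show ?thesis using form_W[OF p assms(3) W_hpart[OF p assms(4)]] by simp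
qed

lemma form_comm:
  assumes il: "i \<in> {1..n}" "l \<in> {1..n}" and uv: "u \<in> V m" "v \<in> V m"
  shows "form m (comm i l u) v = form m u (comm l i v)"
proof (cases "i = l")
  case True
  have "form m (comm i i u) v = form m u v - c * (\<Sum>m'\<in>{1..n} - {i}. form m (opW (transpose i m') u) v)"
    by (simp add: comm_def form_diff_left form_scale_left form_sum_left')
  also have "\<dots> = form m u (comm i i v)"
    using form_transpose[OF il(1) _ uv]
    by (simp add: comm_def form_diff_right form_scale_right form_sum_right' cj_c)
  finally show ?thesis using True by simp
next
  case False
  then show ?thesis
    using form_transpose[OF il uv] transpose_commute[of i l]
    by (simp add: comm_def form_scale_left form_scale_right cj_c)
qed

text \<open>The form is built by moving variables away from the left argument, so this mirror image
  is a theorem. Induction on \<open>v\<close> reduces it to \<open>form_comm\<close>: the adjoint of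
  the commutator of \<open>y\<^sub>i\<close> and \<open>x\<^sub>l\<close> is that of
  \<open>y\<^sub>l\<close> and \<open>x\<^sub>i\<close>.\<close>

lemma form_Y_left:
  assumes v: "v \<in> V (Suc m)" and u: "u \<in> V m" and i: "i \<in> {1..n}"
  shows "form m (opY i v) u = form (Suc m) v (mult_x i u)"
proof -
  \<comment> \<open>The degree enters through an equation so that the induction runs over all
    degrees; degree 0 is vacuous.\<close>
  have "\<forall>m' u i. Suc m = Suc m' \<longrightarrow> u \<in> V m' \<longrightarrow> i \<in> {1..n} \<longrightarrow> form m' (opY i v) u = form (Suc m') v (mult_x i u)"
    using v
  proof (induction rule: hpart_induct[where m = "Suc m"])
    case (step m j v)
    have "form m (opY i (mult_x j v)) u = form (Suc m) (mult_x j v) (mult_x i u)"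
      if u: "u \<in> V m" and i: "i \<in> {1..n}" for u i
    proof -
      have "form m (mult_x j (opY i v)) u = form m v (mult_x i (opY j u))"
      proof (cases m)
        case 0
        then have "opY i v = (\<lambda>p. 0)" "opY j u = (\<lambda>p. 0)"
          using step u i by (auto intro: Y_hpart_zero)
        moreover have "mult_x l (\<lambda>p. 0) = (\<lambda>p. 0 :: 'r)" for l by (auto simp: mult_x_def)
        ultimately show ?thesis by (simp add: form_zero_left form_zero_right)
      next
        case (Suc m')
        have Yu: "opY j u \<in> V m'" using Y_hpart[OF step(1)] u Suc by simp
        have "form m (mult_x j (opY i v)) u = form m' (opY i v) (opY j u)"
          using form_x_left[OF step(1), of u m'] u Suc by simp
        also have "\<dots> = form m v (mult_x i (opY j u))"
          using step(3) Suc Yu i by blast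
        finally show ?thesis .
      qed
      then show ?thesis
        using form_x_left[OF step(1) mult_x_hpart[OF i u], of v] form_comm[OF i step(1) step(2) u]
        by (simp add: YX[OF step(1)] YX[OF i] form_add_left form_add_right)
    qed
    then show ?case by auto
  qed (auto simp: Y_add form_add_left Y_zero form_zero_left)
  then show ?thesis using u i by blast
qed

text \<open>The induction moves \<open>x\<^sub>i\<close> across in both orders of the arguments,
  which is where \<open>form_Y_left\<close> is needed.\<close>

lemma form_sym:
  assumes "u \<in> V m" "v \<in> V m"
  shows "form m v u = cj (form m u v)"
proof -
  have "\<forall>v\<in>V m. form m v u = cj (form m u v)"
    using assms(1)
  proof (induction rule: hpart_induct)
    case (base u)
    have "form 0 v u = cj (form 0 u v)" for v
    proof -
      have "form 0 v u = (\<Sum>q<k. \<Sum>j<k. v (\<lambda>_. 0, j) * beta j q * cj (u (\<lambda>_. 0, q)))"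
        unfolding form_base by (rule sum.swap)
      also have "\<dots> = (\<Sum>q<k. \<Sum>j<k. cj (u (\<lambda>_. 0, q) * beta q j * cj (v (\<lambda>_. 0, j))))"
      proof (intro sum.cong refl)
        fix q j assume "q \<in> {..<k}" "j \<in> {..<k}"
        then have "beta j q = cj (beta q j)" by (intro beta_sym) auto
        then show "v (\<lambda>_. 0, j) * beta j q * cj (u (\<lambda>_. 0, q)) = cj (u (\<lambda>_. 0, q) * beta q j * cj (v (\<lambda>_. 0, j)))"
          by (simp add: cj_mult cj_cj mult_ac)
      qed
      finally show ?thesis by (simp add: form_base cj_sum)
    qed
    then show ?case by blast
  next
    case (add m u v)
    then show ?case by (simp add: form_add_left form_add_right cj_add)
  next
    case (step m i u)
    show ?case
    proof
      fix v assume v: "v \<in> V (Suc m)"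
      have "form (Suc m) v (mult_x i u) = form m (opY i v) u"
        using form_Y_left[OF v step(2,1)] by simp
      also have "\<dots> = cj (form m u (opY i v))" using step(3) Y_hpart[OF step(1) v] by blast
      finally show "form (Suc m) v (mult_x i u) = cj (form (Suc m) (mult_x i u) v)"
        using form_x_left[OF step(1) v] by simp
    qed
  qed (auto simp: form_zero_left form_zero_right cj_zero)
  then show ?thesis using assms(2) by blast
qed

lemma unit_vector_hpart: "p \<in> monomial_indices n k m \<Longrightarrow> unit_vector p \<in> V m"
  by (auto simp: supported_on_def unit_vector_def)

lemma hpart_expand:
  assumes "u \<in> V m"
  shows "u = (\<lambda>p. \<Sum>s\<in>monomial_indices n k m. u s * unit_vector s p)"
proof
  fix p
  have "(\<Sum>s\<in>monomial_indices n k m. u s * unit_vector s p) =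
      (\<Sum>s\<in>monomial_indices n k m. if p = s then u s else 0)"
    by (rule sum.cong) (auto simp: unit_vector_def)
  moreover have "u p = 0" if "p \<notin> monomial_indices n k m"
    using assms that unfolding supported_on_def by blast
  ultimately show "u p = (\<Sum>s\<in>monomial_indices n k m. u s * unit_vector s p)"
    using finite_monomial_indices by auto
qed

definition gram :: "nat \<Rightarrow> (nat \<Rightarrow> nat) \<times> nat \<Rightarrow> (nat \<Rightarrow> nat) \<times> nat \<Rightarrow> 'r" where
  "gram m s t = form m (unit_vector s) (unit_vector t)"

lemma form_eq_matrix_form:
  assumes "u \<in> V m" "v \<in> V m"
  shows "form m u v = matrix_form (monomial_indices n k m) cj (gram m) u v"
proof -
  have "form m u v = (\<Sum>s\<in>monomial_indices n k m. u s * form m (unit_vector s) v)"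
    by (subst hpart_expand[OF assms(1)]) (rule form_sum_left)
  also have "\<dots> = (\<Sum>s\<in>monomial_indices n k m. u s * (\<Sum>t\<in>monomial_indices n k m. cj (v t) * gram m s t))"
    unfolding gram_def by (subst hpart_expand[OF assms(2)]) (simp only: form_sum_right)
  finally show ?thesis by (simp add: matrix_form_def sum_distrib_left mult_ac)
qed

lemma gram_sym:
  "s \<in> monomial_indices n k m \<Longrightarrow> t \<in> monomial_indices n k m \<Longrightarrow> gram m t s = cj (gram m s t)"
  unfolding gram_def by (intro form_sym unit_vector_hpart)

end

section \<open>An annihilating polynomial for the sum of transpositions\<close>

text \<open>Left multiplication by the class sum in the group algebra, whose elements are
  coefficient functions; transpositions are their own inverses, so none is inverted.\<close>

definition transposition_convolution ::
  "nat \<Rightarrow> ((nat \<Rightarrow> nat) \<Rightarrow> complex) \<Rightarrow> (nat \<Rightarrow> nat) \<Rightarrow> complex" where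
  "transposition_convolution n f = (\<lambda>w. \<Sum>i\<in>{1..n}. \<Sum>l\<in>{1..n} - {i}. f (transpose i l \<circ> w))"

text \<open>
  The powers of the class sum are linearly dependent in the group algebra, which has dimension \<open>n!\<close>.
\<close>

definition central_roots :: "nat \<Rightarrow> complex list" where
  "central_roots n = (SOME zs. \<exists>N q a. a \<noteq> 0 \<and> Polynomial.smult a (\<Prod>z\<leftarrow>zs. [:- z, 1:]) = (\<Sum>r\<le>N. monom (q r) r) \<and>
     (\<forall>w. w permutes {1..n} \<longrightarrow>
       (\<Sum>r\<le>N. q r * (transposition_convolution n ^^ r) (\<lambda>w. if w = id then 1 else 0) w) = 0))"

lemma central_roots_relation:
  "\<exists>N q a. a \<noteq> 0 \<and> Polynomial.smult a (\<Prod>z\<leftarrow>central_roots n. [:- z, 1:]) = (\<Sum>r\<le>N. monom (q r) r) \<and>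
     (\<forall>w. w permutes {1..n} \<longrightarrow>
       (\<Sum>r\<le>N. q r * (transposition_convolution n ^^ r) (\<lambda>w. if w = id then 1 else 0) w) = 0)"
  unfolding central_roots_def
proof (rule someI_ex)
  let ?A = "\<lambda>r. (transposition_convolution n ^^ r) (\<lambda>w. if w = id then 1 else 0)"
  let ?P = "{w. w permutes {1..n}}"
  have fin: "finite ?P" by (rule finite_permutations) simp
  define N where "N = card ?P"
  obtain q where q: "\<exists>r\<in>{..N}. q r \<noteq> 0" "\<forall>w\<in>?P. (\<Sum>r\<in>{..N}. q r * ?A r w) = 0"
    using homogeneous_system_solution[OF fin, of "{..N}" ?A] by (auto simp: N_def)
  define Q where "Q = (\<Sum>r\<le>N. monom (q r) r)"
  have "coeff Q r = q r" if "r \<le> N" for r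
    using that by (simp add: Q_def coeff_sum)
  then have "Q \<noteq> 0" using q(1) by auto
  obtain zs where "Polynomial.smult (lead_coeff Q) (\<Prod>z\<leftarrow>zs. [:- z, 1:]) = Q"
    using fundamental_theorem_algebra_factorized by blast
  then show "\<exists>zs N q a. a \<noteq> 0 \<and> Polynomial.smult a (\<Prod>z\<leftarrow>zs. [:- z, 1:]) = (\<Sum>r\<le>N. monom (q r) r) \<and>
     (\<forall>w. w permutes {1..n} \<longrightarrow> (\<Sum>r\<le>N. q r * ?A r w) = 0)"
    using q(2) \<open>Q \<noteq> 0\<close> unfolding Q_def
    by (intro exI[of _ zs] exI[of _ N] exI[of _ q] exI[of _ "lead_coeff Q"]) (auto simp: Q_def)
qed

text \<open>The product of the \<open>T - z\<close> over the list, applied to \<open>u\<close>. A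
  list keeps multiplicities, and passing to a divisor is dropping entries.\<close>

definition roots_op :: "(complex \<Rightarrow> 'v::ab_group_add \<Rightarrow> 'v) \<Rightarrow> ('v \<Rightarrow> 'v) \<Rightarrow> complex list \<Rightarrow> 'v \<Rightarrow> 'v" where
  "roots_op s T zs u = foldr (\<lambda>z v. T v - s z v) zs u"

lemma roots_op_simps [simp]:
  "roots_op s T [] u = u" "roots_op s T (z # zs) u = T (roots_op s T zs u) - s z (roots_op s T zs u)"
  by (simp_all add: roots_op_def)

section \<open>Products of linear factors of an operator\<close>

context complex_space
begin

text \<open>Horner evaluation of \<open>Q\<close> at \<open>T\<close>. It links a linear relation
  between powers of \<open>T\<close> with the factorization into linear factors.\<close>

definition poly_op :: "('v \<Rightarrow> 'v) \<Rightarrow> complex poly \<Rightarrow> 'v \<Rightarrow> 'v" where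
  "poly_op T Q u = fold_coeffs (\<lambda>a v. scale a u + T v) Q 0"

context
  fixes T
  assumes T_add: "T (u + v) = T u + T v" and T_scale: "T (scale a u) = scale a (T u)"
begin

lemma T_zero: "T 0 = 0"
  using T_scale[of 0 0] by simp

lemma T_diff: "T (u - v) = T u - T v"
  using T_add[of "u - v" v] by simp

lemma poly_op_pCons: "poly_op T (pCons a Q) u = scale a u + T (poly_op T Q u)"
  by (cases "Q = 0 \<and> a = 0") (auto simp: poly_op_def T_zero)

lemma poly_op_zero: "poly_op T 0 u = 0"
  by (simp add: poly_op_def)

lemma poly_op_add: "poly_op T (P + Q) u = poly_op T P u + poly_op T Q u"
proof (induction P Q rule: poly_induct2)
  case (pCons a p b q)
  then show ?case by (simp add: poly_op_pCons T_add scale_left_distrib)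
qed (simp add: poly_op_zero)

lemma poly_op_smult: "poly_op T (Polynomial.smult a P) u = scale a (poly_op T P u)"
  by (induction P) (auto simp: poly_op_zero poly_op_pCons T_scale scale_right_distrib)

lemma poly_op_linear: "poly_op T ([:- z, 1:] * P) u = T (poly_op T P u) - scale z (poly_op T P u)"
proof -
  have "[:- z, 1:] * P = Polynomial.smult (- z) P + pCons 0 P" by simp
  then show ?thesis by (simp only: poly_op_add poly_op_smult poly_op_pCons) simp
qed

lemma poly_op_prod: "poly_op T (\<Prod>z\<leftarrow>zs. [:- z, 1:]) u = roots_op scale T zs u"
proof (induction zs)
  case Nil
  have "poly_op T [:1:] u = u" by (simp add: poly_op_pCons poly_op_zero T_zero)
  then show ?case by (simp add: one_pCons)
qed (simp del: mult_pCons_left add: poly_op_linear)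

lemma poly_op_monom: "poly_op T (monom a r) u = scale a ((T ^^ r) u)"
  by (induction r) (auto simp: monom_0 monom_Suc poly_op_pCons poly_op_zero T_zero T_scale)

lemma poly_op_sum: "poly_op T (\<Sum>r\<in>A. f r) u = (\<Sum>r\<in>A. poly_op T (f r) u)"
  by (induction A rule: infinite_finite_induct) (auto simp: poly_op_zero poly_op_add)

lemma roots_op_commute: "roots_op scale T zs (T u - scale z u) = T (roots_op scale T zs u) - scale z (roots_op scale T zs u)"
proof (induction zs)
  case (Cons y zs)
  show ?case
    unfolding roots_op_simps Cons.IH
    by (simp add: T_diff T_scale scale_right_diff_distrib scale_left_commute algebra_simps)
qed simp

lemma roots_op_mem:
  assumes "subspace R" "\<And>u. u \<in> R \<Longrightarrow> T u \<in> R" "u \<in> R"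
  shows "roots_op scale T zs u \<in> R"
  using assms by (induction zs) (auto intro: subspace_diff subspace_scale)

text \<open>The difference of \<open>T - z\<close> and \<open>T - y\<close> is the scalar
  \<open>y - z\<close>, invertible for \<open>y \<noteq> z\<close>; so a vector sent into
  \<open>R\<close> by both already lies in \<open>R\<close>.\<close>

lemma roots_op_coprime_single:
  assumes R: "subspace R" "\<And>u. u \<in> R \<Longrightarrow> T u \<in> R"
    and "roots_op scale T zs u \<in> R" "T u - scale z u \<in> R" "z \<notin> set zs"
  shows "u \<in> R"
  using assms(3,5)
proof (induction zs)
  case (Cons y zs)
  have "T (roots_op scale T zs u) - scale z (roots_op scale T zs u) \<in> R"
    using roots_op_mem[OF R assms(4), of zs] by (simp add: roots_op_commute)
  then have "(T (roots_op scale T zs u) - scale z (roots_op scale T zs u)) -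
      (T (roots_op scale T zs u) - scale y (roots_op scale T zs u)) \<in> R"
    using Cons.prems(1) by (intro subspace_diff[OF R(1), of "T (roots_op scale T zs u) - scale z (roots_op scale T zs u)"]) simp_all
  then have "scale (y - z) (roots_op scale T zs u) \<in> R" by (simp add: scale_left_diff_distrib)
  then have "scale (1 / (y - z)) (scale (y - z) (roots_op scale T zs u)) \<in> R" by (rule subspace_scale[OF R(1)])
  moreover have "y - z \<noteq> 0" using Cons.prems(2) by auto
  ultimately have "roots_op scale T zs u \<in> R" by simp
  then show ?case using Cons by simp
qed simp

lemma roots_op_filter:
  assumes R: "subspace R" "\<And>u. u \<in> R \<Longrightarrow> T u \<in> R"
    and "roots_op scale T zs u \<in> R" "roots_op scale T ys u \<in> R"
  shows "roots_op scale T (filter (\<lambda>z. z \<in> set ys) zs) u \<in> R"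
proof -
  have "roots_op scale T (filter (\<lambda>z. z \<in> set ys) zs) v \<in> R"
    if "roots_op scale T zs v \<in> R" "roots_op scale T ys v \<in> R" for v
    using that
  proof (induction zs arbitrary: v)
    case (Cons z zs)
    let ?v = "T v - scale z v"
    show ?case
    proof (cases "z \<in> set ys")
      case True
      have "roots_op scale T zs ?v \<in> R" using Cons.prems(1) by (simp add: roots_op_commute)
      moreover have "roots_op scale T ys ?v \<in> R"
        unfolding roots_op_commute using R Cons.prems(2) by (intro subspace_diff subspace_scale) auto
      ultimately have "roots_op scale T (filter (\<lambda>z. z \<in> set ys) zs) ?v \<in> R" by (rule Cons.IH)
      then show ?thesis using True by (simp add: roots_op_commute)
    next
      case False
      have "T (roots_op scale T zs v) - scale z (roots_op scale T zs v) \<in> R" using Cons.prems(1) by simp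
      moreover have "roots_op scale T ys (roots_op scale T zs v) \<in> R"
      proof -
        have "roots_op scale T ys (roots_op scale T zs v) = roots_op scale T zs (roots_op scale T ys v)"
          by (induction zs) (auto simp: roots_op_commute)
        then show ?thesis using roots_op_mem[OF R Cons.prems(2)] by simp
      qed
      ultimately have "roots_op scale T zs v \<in> R"
        using roots_op_coprime_single[OF R] False by blast
      then show ?thesis using Cons False by simp
    qed
  qed simp
  then show ?thesis using assms(3,4) by blast
qed

end

text \<open>Acting on \<open>u\<close> turns the relation between convolution powers in the group
  algebra into one between powers of \<open>Z\<close>, because \<open>Z\<close> acts on combinations
  of the \<open>W w u\<close> by convolution.\<close>

lemma roots_op_central:
  assumes W: "\<And>w u v. W w (u + v) = W w u + W w v" "\<And>w a u. W w (scale a u) = scale a (W w u)"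
    "\<And>v w u. v permutes {1..n} \<Longrightarrow> w permutes {1..n} \<Longrightarrow> W (v \<circ> w) u = W v (W w u)"
    and Z: "\<And>u. Z u = (\<Sum>i\<in>{1..n}. \<Sum>l\<in>{1..n} - {i}. W (transpose i l) u)"
    and u: "W id u = u"
  shows "roots_op scale Z (central_roots n) u = 0"
proof -
  let ?P = "{w. w permutes {1..n}}"
  let ?C = "transposition_convolution n"
  let ?d = "\<lambda>w. if w = id then 1 else (0::complex)"
  have fin: "finite ?P" by (rule finite_permutations) simp
  have W_sum: "W w (sum f A) = (\<Sum>x\<in>A. W w (f x))" for w A and f :: "(nat \<Rightarrow> nat) \<Rightarrow> 'v"
  proof -
    have "W w 0 = 0" using W(2)[of w 0 0] by simp
    then show ?thesis by (induction A rule: infinite_finite_induct) (auto simp: W(1))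
  qed
  have Z_lin: "Z (u + v) = Z u + Z v" "Z (scale a u) = scale a (Z u)" for u v a
    by (simp_all add: Z W(1,2) sum.distrib scale_sum_right)
  define act where "act f = (\<Sum>w\<in>?P. scale (f w) (W w u))" for f
  have Z_act: "Z (act f) = act (?C f)" for f
  proof -
    have "W (transpose i l) (act f) = (\<Sum>w\<in>?P. scale (f (transpose i l \<circ> w)) (W w u))"
      if il: "i \<in> {1..n}" "l \<in> {1..n} - {i}" for i l
    proof -
      have s: "transpose i l permutes {1..n}" using il by (intro permutes_swap_id) auto
      have "W (transpose i l) (act f) = (\<Sum>w\<in>?P. scale (f w) (W (transpose i l \<circ> w) u))"
        unfolding act_def by (simp add: W_sum W(2) W(3)[OF s])
      also have "\<dots> = (\<Sum>w\<in>?P. scale (f (transpose i l \<circ> w)) (W w u))"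
      proof (rule sum.reindex_bij_witness[where i = "\<lambda>w. transpose i l \<circ> w" and j = "\<lambda>w. transpose i l \<circ> w"])
        fix w assume "w \<in> ?P"
        then show "transpose i l \<circ> w \<in> ?P" using permutes_compose[OF _ s] by blast
        show e: "transpose i l \<circ> (transpose i l \<circ> w) = w" by (simp add: fun_eq_iff)
        show "scale (f (transpose i l \<circ> (transpose i l \<circ> w))) (W (transpose i l \<circ> w) u) =
            scale (f w) (W (transpose i l \<circ> w) u)"
          unfolding e ..
      qed (use permutes_compose[OF _ s] in \<open>auto simp: fun_eq_iff\<close>)
      finally show ?thesis .
    qed
    then have "Z (act f) = (\<Sum>i\<in>{1..n}. \<Sum>l\<in>{1..n} - {i}. \<Sum>w\<in>?P. scale (f (transpose i l \<circ> w)) (W w u))"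
      unfolding Z by (intro sum.cong refl) auto
    also have "\<dots> = (\<Sum>w\<in>?P. \<Sum>i\<in>{1..n}. \<Sum>l\<in>{1..n} - {i}. scale (f (transpose i l \<circ> w)) (W w u))"
      by (simp only: sum.swap[of _ ?P])
    also have "\<dots> = act (?C f)"
      by (simp add: act_def transposition_convolution_def scale_sum_left)
    finally show ?thesis .
  qed
  have "(Z ^^ r) u = act ((?C ^^ r) ?d)" for r
  proof (induction r)
    case 0
    have "act ?d = (\<Sum>w\<in>{id}. scale (?d w) (W w u))"
      unfolding act_def using fin by (intro sum.mono_neutral_right) (auto simp: permutes_id)
    also have "\<dots> = u" using u by simp
    finally show ?case by (simp only: funpow_0)
  qed (simp add: Z_act)
  note pow = this
  obtain N q a where a: "a \<noteq> 0"
    and e: "Polynomial.smult a (\<Prod>z\<leftarrow>central_roots n. [:- z, 1:]) = (\<Sum>r\<le>N. monom (q r) r)"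
    and q: "\<And>w. w permutes {1..n} \<Longrightarrow> (\<Sum>r\<le>N. q r * (?C ^^ r) ?d w) = 0"
    using central_roots_relation by blast
  have "scale a (roots_op scale Z (central_roots n) u) = (\<Sum>r\<le>N. scale (q r) ((Z ^^ r) u))"
    using arg_cong[OF e, of "\<lambda>Q. poly_op Z Q u"] Z_lin
    by (simp add: poly_op_smult poly_op_prod poly_op_sum poly_op_monom)
  also have "\<dots> = (\<Sum>w\<in>?P. scale (\<Sum>r\<le>N. q r * (?C ^^ r) ?d w) (W w u))"
    unfolding pow act_def by (simp add: scale_sum_right scale_sum_left) (rule sum.swap)
  also have "\<dots> = 0" using q by simp
  finally show ?thesis using a by simp
qed

end

section \<open>Graded modules with a contravariant form\<close>

definition rep_sum :: "nat \<Rightarrow> nat \<Rightarrow> ((nat \<Rightarrow> nat) \<Rightarrow> nat \<Rightarrow> nat \<Rightarrow> complex) \<Rightarrow> (nat \<Rightarrow> complex) \<Rightarrow> nat \<Rightarrow> complex" where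
  "rep_sum n k rho e = (\<lambda>j. \<Sum>q<k. (\<Sum>i\<in>{1..n}. \<Sum>l\<in>{1..n} - {i}. rho (transpose i l) j q) * e q)"

text \<open>The parameter 0 is a placeholder: the axioms of \<open>dunkl_form\<close> constrain
  \<open>c\<close> only by \<open>cj c = c\<close>, as \<open>hermitian_rep_dunkl_form\<close>
  exploits. The second clause is nondegeneracy of \<open>beta\<close>, which may be
  indefinite.\<close>

definition hermitian_rep ::
  "nat \<Rightarrow> nat \<Rightarrow> ((nat \<Rightarrow> nat) \<Rightarrow> nat \<Rightarrow> nat \<Rightarrow> complex) \<Rightarrow> (nat \<Rightarrow> nat \<Rightarrow> complex) \<Rightarrow> bool" where
  "hermitian_rep n k rho beta \<longleftrightarrow> dunkl_form n k rho 0 cnj beta \<and>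
     (\<forall>e. (\<forall>l<k. (\<Sum>j<k. e j * beta j l) = 0) \<longrightarrow> (\<forall>j<k. e j = 0))"

definition rep_roots ::
  "nat \<Rightarrow> nat \<Rightarrow> ((nat \<Rightarrow> nat) \<Rightarrow> nat \<Rightarrow> nat \<Rightarrow> complex) \<Rightarrow> complex list \<Rightarrow> bool" where
  "rep_roots n k rho zs \<longleftrightarrow>
     (\<forall>e\<in>supported_on {..<k}. roots_op scale_fun (rep_sum n k rho) zs e = 0)"

lemma hermitian_rep_dunkl_form:
  assumes "hermitian_rep n k rho beta"
  shows "dunkl_form n k rho (complex_of_real c) cnj beta"
proof -
  interpret dunkl_form n k rho 0 cnj beta using assms by (simp add: hermitian_rep_def)
  show ?thesis
    by unfold_locales (auto simp: rho_zero rho_id rho_comp beta_inv intro: beta_sym)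
qed

text \<open>In degree \<open>d\<close> of the original module the Euler operator has roots
  \<open>2 d - c z\<close> with \<open>z\<close> in \<open>zs\<close>; on the lowest degree
  \<open>d\<close> of a subquotient it is \<open>- c\<close> times the class sum. Comparison leaves
  \<open>z - 2 d / c\<close> as roots of the class sum, and only central roots among them can
  matter.\<close>

definition next_roots :: "nat \<Rightarrow> real \<Rightarrow> complex list \<Rightarrow> nat \<Rightarrow> complex list" where
  "next_roots n c zs d = filter (\<lambda>z. z \<in> set (map (\<lambda>z. z - of_nat (2 * d) / of_real c) zs)) (central_roots n)"

definition standard_form where
  "standard_form n c k rho beta m = dunkl_form.form n k rho (complex_of_real c) cnj beta m"

definition standard_signature ::
  "nat \<Rightarrow> real \<Rightarrow> nat \<Rightarrow> ((nat \<Rightarrow> nat) \<Rightarrow> nat \<Rightarrow> nat \<Rightarrow> complex) \<Rightarrow> (nat \<Rightarrow> nat \<Rightarrow> complex) \<Rightarrow> nat \<Rightarrow> int" where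
  "standard_signature n c k rho beta m =
     fun_space.signature (hpart n k m) (standard_form n c k rho beta m)"

lemma hermitian_on_standard:
  assumes "dunkl_form n k rho (complex_of_real c) cnj beta"
  shows "fun_space.hermitian_on (hpart n k m) (standard_form n c k rho beta m)"
proof -
  interpret dunkl_form n k rho "complex_of_real c" cnj beta by fact
  have "fun_space.subspace (hpart n k m)"
    by (auto simp: fun_space.subspace_def supported_on_def scale_fun_def)
  moreover have "form m (u + v) w = form m u w + form m v w" "form m (scale_fun a u) w = a * form m u w" for u v w a
    using form_add_left[of m u v w] form_scale_left[of m a u w] by (simp_all add: plus_fun_def scale_fun_def)
  ultimately show ?thesis
    unfolding fun_space.hermitian_on_def standard_form_def using form_sym by blast
qed

lemma finite_rank_supported_on:
  assumes "finite I" "fun_space.hermitian_on (supported_on I) h"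
  shows "fun_space.finite_rank (supported_on I) h (card I)"
proof (rule fun_space.finite_rank_if_spanned[OF assms(2,1), of unit_vector])
  fix i assume "i \<in> I"
  then show "unit_vector i \<in> supported_on I" by (auto simp: supported_on_def unit_vector_def)
next
  fix u :: "'a \<Rightarrow> complex" assume u: "u \<in> supported_on I"
  have "u = (\<Sum>i\<in>I. scale_fun (u i) (unit_vector i))"
  proof
    fix x
    have "(\<Sum>i\<in>I. scale_fun (u i) (unit_vector i)) x = (\<Sum>i\<in>I. if x = i then u i else 0)"
      unfolding sum_fun_apply by (rule sum.cong) (auto simp: scale_fun_def unit_vector_def)
    then show "u x = (\<Sum>i\<in>I. scale_fun (u i) (unit_vector i)) x"
      using assms(1) u by (auto simp: supported_on_def)
  qed
  then have "h u v = h (\<Sum>i\<in>I. scale_fun (u i) (unit_vector i)) v" for v by simp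
  moreover have "h (\<Sum>i\<in>I. scale_fun (u i) (unit_vector i)) v = (\<Sum>i\<in>I. u i * h (unit_vector i) v)"
    if "v \<in> supported_on I" for v
    using that by (intro fun_space.hermitian_combination_left[OF assms(2)])
      (auto simp: supported_on_def unit_vector_def)
  ultimately show "\<exists>q. \<forall>v\<in>supported_on I. h u v = (\<Sum>i\<in>I. q i * h (unit_vector i) v)"
    by (intro exI[of _ u]) simp
qed

text \<open>
  The commutation relation between \<open>Y\<close> and \<open>X\<close> is only required modulo the radical of the form, so
  that subquotients are covered without forming quotients.
\<close>

locale cherednik_form = complex_space scale
  for scale :: "complex \<Rightarrow> 'v::ab_group_add \<Rightarrow> 'v" +
  fixes n :: nat and c :: real and X Y :: "nat \<Rightarrow> 'v \<Rightarrow> 'v" and W :: "(nat \<Rightarrow> nat) \<Rightarrow> 'v \<Rightarrow> 'v"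
    and N :: "nat \<Rightarrow> 'v set" and h :: "'v \<Rightarrow> 'v \<Rightarrow> complex"
  assumes herm: "hermitian_on (N m) (h :: 'v \<Rightarrow> 'v \<Rightarrow> complex)"
    and rank: "\<exists>r. finite_rank (N m) h r"
    and X_add: "i \<in> {1..n} \<Longrightarrow> X i (u + v) = X i u + X i v"
    and X_scale: "i \<in> {1..n} \<Longrightarrow> X i (scale a u) = scale a (X i u)"
    and Y_add: "i \<in> {1..n} \<Longrightarrow> Y i (u + v) = Y i u + Y i v"
    and Y_scale: "i \<in> {1..n} \<Longrightarrow> Y i (scale a u) = scale a (Y i u)"
    and W_add: "w permutes {1..n} \<Longrightarrow> W w (u + v) = W w u + W w v"
    and W_scale: "w permutes {1..n} \<Longrightarrow> W w (scale a u) = scale a (W w u)"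
    and X_mem: "i \<in> {1..n} \<Longrightarrow> u \<in> N m \<Longrightarrow> X i u \<in> N (Suc m)"
    and Y_mem: "i \<in> {1..n} \<Longrightarrow> u \<in> N (Suc m) \<Longrightarrow> Y i u \<in> N m"
    and Y_bottom: "i \<in> {1..n} \<Longrightarrow> u \<in> N 0 \<Longrightarrow> Y i u = 0"
    and W_mem: "w permutes {1..n} \<Longrightarrow> u \<in> N m \<Longrightarrow> W w u \<in> N m"
    and contra: "i \<in> {1..n} \<Longrightarrow> u \<in> N m \<Longrightarrow> v \<in> N (Suc m) \<Longrightarrow> h (X i u) v = h u (Y i v)"
    and W_inv: "w permutes {1..n} \<Longrightarrow> u \<in> N m \<Longrightarrow> v \<in> N m \<Longrightarrow> h (W w u) (W w v) = h u v"
    and W_comp: "w' permutes {1..n} \<Longrightarrow> w permutes {1..n} \<Longrightarrow> W (w' \<circ> w) u = W w' (W w u)"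
    and W_id: "u \<in> N m \<Longrightarrow> W id u = u"
    and XX: "i \<in> {1..n} \<Longrightarrow> l \<in> {1..n} \<Longrightarrow> X i (X l u) = X l (X i u)"
    and WX: "w permutes {1..n} \<Longrightarrow> i \<in> {1..n} \<Longrightarrow> W w (X i u) = X (w i) (W w u)"
    and YX: "i \<in> {1..n} \<Longrightarrow> l \<in> {1..n} \<Longrightarrow> u \<in> N m \<Longrightarrow> v \<in> N m \<Longrightarrow>
      h (Y i (X l u)) v = h (X l (Y i u)) v + (if i = l
        then h u v - of_real c * (\<Sum>s\<in>{1..n} - {i}. h (W (transpose i s) u) v)
        else of_real c * h (W (transpose i l) u) v)"
begin

lemmas subspace_N = hermitian_subspace[OF herm]
lemmas N_mem = hermitian_mem[OF herm]

lemma X_zero: "i \<in> {1..n} \<Longrightarrow> X i 0 = 0"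
  using X_scale[of i 0 0] by simp

lemma Y_zero: "i \<in> {1..n} \<Longrightarrow> Y i 0 = 0"
  using Y_scale[of i 0 0] by simp

lemma W_zero: "w permutes {1..n} \<Longrightarrow> W w 0 = 0"
  using W_scale[of w 0 0] by simp

lemma W_sum: "w permutes {1..n} \<Longrightarrow> W w (sum f A) = (\<Sum>x\<in>A. W w (f x))"
  by (induction A rule: infinite_finite_induct) (auto simp: W_add W_zero)

lemma X_sum: "i \<in> {1..n} \<Longrightarrow> X i (sum f A) = (\<Sum>x\<in>A. X i (f x))"
  by (induction A rule: infinite_finite_induct) (auto simp: X_add X_zero)

lemma Y_sum: "i \<in> {1..n} \<Longrightarrow> Y i (sum f A) = (\<Sum>x\<in>A. Y i (f x))"
  by (induction A rule: infinite_finite_induct) (auto simp: Y_add Y_zero)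

lemma XY_mem:
  assumes "i \<in> {1..n}" "l \<in> {1..n}" "u \<in> N m"
  shows "X l (Y i u) \<in> N m"
proof (cases m)
  case 0
  then show ?thesis using assms N_mem(1)[of 0] by (simp only: Y_bottom X_zero)
next
  case (Suc m')
  then show ?thesis using X_mem[OF assms(2) Y_mem[OF assms(1)], of u m'] assms(3) by simp
qed

lemma contra': "i \<in> {1..n} \<Longrightarrow> u \<in> N m \<Longrightarrow> v \<in> N (Suc m) \<Longrightarrow> h (Y i v) u = h v (X i u)"
  using contra[of i u m v] hermitian_sym[OF herm, of "X i u" "Suc m" v] hermitian_sym[OF herm, of u m "Y i v"]
    X_mem Y_mem by simp

lemma swap_permutes: "i \<in> {1..n} \<Longrightarrow> l \<in> {1..n} - {i} \<Longrightarrow> transpose i l permutes {1..n}"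
  by (intro permutes_swap_id) auto

lemma W_transpose_adjoint:
  assumes "i \<in> {1..n}" "l \<in> {1..n} - {i}" "u \<in> N m" "v \<in> N m"
  shows "h (W (transpose i l) u) v = h u (W (transpose i l) v)"
proof -
  note p = swap_permutes[OF assms(1,2)]
  have "W (transpose i l) (W (transpose i l) v) = v"
    using W_comp[OF p p, of v] W_id[OF assms(4)] by simp
  then show ?thesis using W_inv[OF p assms(3) W_mem[OF p assms(4)]] by simp
qed

definition Z :: "'v \<Rightarrow> 'v" where
  "Z u = (\<Sum>i\<in>{1..n}. \<Sum>l\<in>{1..n} - {i}. W (transpose i l) u)"

definition eu :: "'v \<Rightarrow> 'v" where
  "eu u = scale 2 (\<Sum>i\<in>{1..n}. X i (Y i u)) - scale (of_real c) (Z u)"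

lemma Z_add: "Z (u + v) = Z u + Z v"
proof -
  have "Z (u + v) = (\<Sum>i\<in>{1..n}. \<Sum>l\<in>{1..n} - {i}. W (transpose i l) u + W (transpose i l) v)"
    unfolding Z_def by (intro sum.cong refl W_add swap_permutes)
  then show ?thesis by (simp only: Z_def sum.distrib)
qed

lemma Z_scale: "Z (scale a u) = scale a (Z u)"
proof -
  have "Z (scale a u) = (\<Sum>i\<in>{1..n}. \<Sum>l\<in>{1..n} - {i}. scale a (W (transpose i l) u))"
    unfolding Z_def by (intro sum.cong refl W_scale swap_permutes)
  then show ?thesis by (simp only: Z_def scale_sum_right)
qed

lemma eu_add: "eu (u + v) = eu u + eu v"
  and eu_scale: "eu (scale a u) = scale a (eu u)"
  by (simp_all add: eu_def X_add X_scale Y_add Y_scale Z_add Z_scale sum.distrib scale_sum_right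
      scale_right_distrib scale_right_diff_distrib mult.commute)

lemma Z_mem: "u \<in> N m \<Longrightarrow> Z u \<in> N m"
  unfolding Z_def by (intro N_mem(5) W_mem swap_permutes)

lemma eu_mem: "u \<in> N m \<Longrightarrow> eu u \<in> N m"
  unfolding eu_def by (intro N_mem(3-5) XY_mem Z_mem)

lemma form_Z:
  assumes "u \<in> N m" "v \<in> N m"
  shows "h (Z u) v = (\<Sum>i\<in>{1..n}. \<Sum>l\<in>{1..n} - {i}. h (W (transpose i l) u) v)"
proof -
  have "h (Z u) v = (\<Sum>i\<in>{1..n}. h (\<Sum>l\<in>{1..n} - {i}. W (transpose i l) u) v)"
    unfolding Z_def
    by (rule hermitian_sum_left[OF herm, of _ _ m]) (intro N_mem(5) W_mem swap_permutes assms, assumption+, rule assms)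
  also have "\<dots> = (\<Sum>i\<in>{1..n}. \<Sum>l\<in>{1..n} - {i}. h (W (transpose i l) u) v)"
    by (intro sum.cong refl hermitian_sum_left[OF herm, of _ _ m] W_mem swap_permutes assms)
  finally show ?thesis .
qed

lemma Z_adjoint:
  assumes uv: "u \<in> N m" "v \<in> N m"
  shows "h (Z u) v = h u (Z v)"
proof -
  have "h (Z u) v = (\<Sum>i\<in>{1..n}. \<Sum>l\<in>{1..n} - {i}. cnj (h (W (transpose i l) v) u))"
    unfolding form_Z[OF uv]
  proof (intro sum.cong refl)
    fix i l assume il: "i \<in> {1..n}" "l \<in> {1..n} - {i}"
    show "h (W (transpose i l) u) v = cnj (h (W (transpose i l) v) u)"
      unfolding W_transpose_adjoint[OF il uv]
      by (rule hermitian_sym[OF herm, OF W_mem[OF swap_permutes[OF il] uv(2)] uv(1)])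
  qed
  also have "\<dots> = cnj (h (Z v) u)"
    unfolding form_Z[OF uv(2,1)] by (simp only: cnj_sum)
  also have "\<dots> = h u (Z v)"
    by (rule hermitian_sym[OF herm, OF Z_mem[OF uv(2)] uv(1), symmetric])
  finally show ?thesis .
qed

definition radical :: "nat \<Rightarrow> 'v set" where
  "radical m = {u \<in> N m. \<forall>v\<in>N m. h u v = 0}"

lemma subspace_radical: "subspace (radical m)"
  unfolding subspace_def radical_def
  by (auto simp: N_mem(1-3) hermitian_zero_left[OF herm] hermitian_add_left[OF herm] hermitian_scale_left[OF herm])

lemma Z_radical: "u \<in> radical m \<Longrightarrow> Z u \<in> radical m"
  using Z_adjoint Z_mem by (auto simp: radical_def)

text \<open>The Euler operator acts on every subquotient and its roots are inherited; so
  \<open>zs\<close> keeps referring to the bottom of the standard module from which the subquotient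
  came.\<close>

definition weights :: "complex list \<Rightarrow> bool" where
  "weights zs \<longleftrightarrow> (\<forall>m. \<forall>u\<in>N m. roots_op scale eu (map (\<lambda>z. of_nat (2 * m) - of_real c * z) zs) u \<in> radical m)"

lemma Z_central_roots: "u \<in> N m \<Longrightarrow> roots_op scale Z (central_roots n) u = 0"
proof -
  assume u: "u \<in> N m"
  \<comment> \<open>\<open>roots_op_central\<close> wants linearity for all functions
    \<open>w\<close>, while the locale provides it for permutations; 0 is a linear default
    elsewhere.\<close>
  let ?W = "\<lambda>w u. if w permutes {1..n} then W w u else 0"
  show ?thesis
  proof (rule roots_op_central[where W = ?W])
    show "?W (v \<circ> w) u = ?W v (?W w u)" if "v permutes {1..n}" "w permutes {1..n}" for v w u
      using that permutes_compose[OF that(2,1)] by (simp add: W_comp)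
    show "Z u = (\<Sum>i\<in>{1..n}. \<Sum>l\<in>{1..n} - {i}. ?W (transpose i l) u)" for u
      unfolding Z_def by (intro sum.cong refl) (simp only: swap_permutes if_True)
    show "?W id u = u" using W_id[OF u] by (simp add: permutes_id)
  qed (auto simp: W_add W_scale)
qed

text \<open>The terms \<open>x\<^sub>i y\<^sub>i\<close> pair through degree \<open>d - 1\<close>,
  where the form is 0.\<close>

lemma eu_bottom:
  assumes low: "\<And>u v. d \<noteq> 0 \<Longrightarrow> u \<in> N (d - 1) \<Longrightarrow> v \<in> N (d - 1) \<Longrightarrow> h u v = 0"
    and uv: "u \<in> N d" "v \<in> N d"
  shows "h (eu u) v = - of_real c * h (Z u) v"
proof -
  have "h (X i (Y i u)) v = 0" if i: "i \<in> {1..n}" for i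
  proof (cases d)
    case 0
    then show ?thesis using uv i by (simp add: Y_bottom X_zero hermitian_zero_left[OF herm])
  next
    case (Suc d')
    then show ?thesis using contra[OF i, of "Y i u" d' v] Y_mem[OF i] low uv by simp
  qed
  then have 0: "h (\<Sum>i\<in>{1..n}. X i (Y i u)) v = 0"
    using uv XY_mem by (subst hermitian_sum_left[OF herm]) auto
  have m: "scale 2 (\<Sum>i\<in>{1..n}. X i (Y i u)) \<in> N d" "scale (of_real c) (Z u) \<in> N d"
    "(\<Sum>i\<in>{1..n}. X i (Y i u)) \<in> N d"
    using uv by (auto intro!: N_mem(3,5) XY_mem Z_mem)
  show ?thesis
    unfolding eu_def hermitian_diff_left[OF herm, OF m(1,2) uv(2)]
      hermitian_scale_left[OF herm, OF m(3) uv(2)] hermitian_scale_left[OF herm, OF Z_mem[OF uv(1)] uv(2)] 0 by simp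
qed

text \<open>Factor by factor, \<open>eu - (2 d - c z)\<close> is \<open>- c\<close> times
  \<open>Z - (z - 2 d / c)\<close> modulo the radical.\<close>

lemma weights_bottom:
  assumes low: "\<And>u v. d \<noteq> 0 \<Longrightarrow> u \<in> N (d - 1) \<Longrightarrow> v \<in> N (d - 1) \<Longrightarrow> h u v = 0"
    and zs: "weights zs" and c: "c \<noteq> 0" and u: "u \<in> N d"
  shows "roots_op scale Z (map (\<lambda>z. z - of_nat (2 * d) / of_real c) zs) u \<in> radical d"
proof -
  let ?E = "\<lambda>zs. roots_op scale eu (map (\<lambda>z. of_nat (2 * d) - of_real c * z) zs) u"
  let ?Z = "\<lambda>zs. roots_op scale Z (map (\<lambda>z. z - of_nat (2 * d) / of_real c) zs) u"
  have m: "?E zs \<in> N d" "?Z zs \<in> N d" for zs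
    using u by (auto intro!: roots_op_mem[of eu] roots_op_mem[of Z] simp: eu_add eu_scale Z_add Z_scale subspace_N eu_mem Z_mem)
  \<comment> \<open>The identities hold only inside the form, so \<open>Z\<close> is moved to the
    second argument and the claim is kept general in \<open>v\<close>.\<close>
  have "h (?E zs) v = (- of_real c) ^ length zs * h (?Z zs) v" if "v \<in> N d" for zs v
    using that
  proof (induction zs arbitrary: v)
    case (Cons z zs)
    have sm: "scale a (?E zs) \<in> N d" "scale a (?Z zs) \<in> N d" for a using m N_mem(3) by blast+
    have "h (?E (z # zs)) v = h (eu (?E zs)) v - (of_nat (2 * d) - of_real c * z) * h (?E zs) v"
      using m Cons.prems sm eu_mem
      by (simp add: hermitian_diff_left[OF herm, of _ d] hermitian_scale_left[OF herm, of _ d])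
    also have "h (eu (?E zs)) v = - of_real c * h (?E zs) (Z v)"
      using eu_bottom[OF low m(1) Cons.prems] Z_adjoint[OF m(1) Cons.prems] by simp
    also have "h (?E zs) (Z v) = (- of_real c) ^ length zs * h (Z (?Z zs)) v"
      using Cons.IH[OF Z_mem[OF Cons.prems]] Z_adjoint[OF m(2) Cons.prems] by simp
    also have "h (?E zs) v = (- of_real c) ^ length zs * h (?Z zs) v" by (rule Cons.IH[OF Cons.prems])
    also have "- of_real c * ((- of_real c) ^ length zs * h (Z (?Z zs)) v) -
        (of_nat (2 * d) - of_real c * z) * ((- of_real c) ^ length zs * h (?Z zs) v) =
        (- of_real c) ^ length (z # zs) * (h (Z (?Z zs)) v - (z - of_nat (2 * d) / of_real c) * h (?Z zs) v)"
      using c by (simp add: field_simps)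
    also have "h (Z (?Z zs)) v - (z - of_nat (2 * d) / of_real c) * h (?Z zs) v = h (?Z (z # zs)) v"
      using m Cons.prems sm Z_mem
      by (simp add: hermitian_diff_left[OF herm, of _ d] hermitian_scale_left[OF herm, of _ d])
    finally show ?case .
  qed simp
  moreover have "h (?E zs) v = 0" if "v \<in> N d" for v
    using zs u that by (auto simp: weights_def radical_def)
  ultimately have "h (?Z zs) v = 0" if "v \<in> N d" for v
    using that c by simp
  then show ?thesis using m by (simp add: radical_def)
qed

text \<open>The roots found through the Euler operator are cut down to central ones, which keeps all
  roots in one finite set throughout the recursion.\<close>

lemma weights_next_roots:
  assumes "\<And>u v. d \<noteq> 0 \<Longrightarrow> u \<in> N (d - 1) \<Longrightarrow> v \<in> N (d - 1) \<Longrightarrow> h u v = 0"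
    and "weights zs" "c \<noteq> 0" "u \<in> N d"
  shows "roots_op scale Z (next_roots n c zs d) u \<in> radical d"
  unfolding next_roots_def
proof (rule roots_op_filter)
  show "roots_op scale Z (central_roots n) u \<in> radical d"
    using Z_central_roots[OF assms(4)] subspace_0[OF subspace_radical] by simp
qed (use weights_bottom[OF assms] in \<open>simp_all add: Z_add Z_scale subspace_radical Z_radical\<close>)

end

section \<open>The submodule generated by the lowest degree\<close>

context cherednik_form
begin

primrec x_product :: "nat \<Rightarrow> (nat \<Rightarrow> nat) \<Rightarrow> 'v \<Rightarrow> 'v" where
  "x_product 0 a u = u"
| "x_product (Suc m) a u = (let l = LEAST l. a l \<noteq> 0 in x_product m (a(l := a l - 1)) (X l u))"

lemma exponents_least:
  assumes "a \<in> exponents n" "(\<Sum>l\<in>{1..n}. a l) = Suc m"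
  defines "l \<equiv> LEAST l. a l \<noteq> 0"
  shows "l \<in> {1..n}" "a(l := a l - 1) \<in> exponents n" "(\<Sum>s\<in>{1..n}. (a(l := a l - 1)) s) = m" "a l \<noteq> 0"
proof -
  have "\<exists>i. a i \<noteq> 0"
  proof (rule ccontr)
    assume "\<not> ?thesis"
    then show False using assms(2) by simp
  qed
  then show al: "a l \<noteq> 0" unfolding l_def by (rule LeastI_ex)
  then show l: "l \<in> {1..n}" using assms(1) by (auto simp: exponents_def)
  show "a(l := a l - 1) \<in> exponents n" using assms(1) by (auto simp: exponents_def)
  show "(\<Sum>s\<in>{1..n}. (a(l := a l - 1)) s) = m"
    using sum_degree_upd[OF l, of a "a l - 1"] assms(2) al by linarith
qed

lemma x_product_X:
  assumes "a \<in> exponents n" "(\<Sum>l\<in>{1..n}. a l) = m" "i \<in> {1..n}"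
  shows "x_product m a (X i u) = X i (x_product m a u)"
  using assms
proof (induction m arbitrary: a u)
  case (Suc m)
  note L = exponents_least[OF Suc.prems(1,2)]
  show ?case
    unfolding x_product.simps Let_def XX[OF L(1) Suc.prems(3)] by (rule Suc.IH[OF L(2,3) Suc.prems(3)])
qed simp

lemma x_product_mem:
  assumes "a \<in> exponents n" "(\<Sum>l\<in>{1..n}. a l) = m" "u \<in> N d"
  shows "x_product m a u \<in> N (d + m)"
  using assms
proof (induction m arbitrary: a u d)
  case (Suc m)
  note L = exponents_least[OF Suc.prems(1,2)]
  show ?case
    unfolding x_product.simps Let_def
    using Suc.IH[OF L(2,3) X_mem[OF L(1) Suc.prems(3)]] by (simp del: fun_upd_apply)
qed simp

lemma x_product_Suc:
  assumes "a \<in> exponents n" "(\<Sum>l\<in>{1..n}. a l) = m" "i \<in> {1..n}"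
  shows "x_product (Suc m) (a(i := a i + 1)) u = X i (x_product m a u)"
proof -
  have "x_product (Suc m) (a(i := a i + 1)) u = x_product m a (X i u)"
    using assms
  proof (induction m arbitrary: a u)
    case (0 a u)
    have z: "a l = 0" for l using 0(1,2) by (cases "l \<in> {1..n}") (auto simp: exponents_def)
    have L: "(LEAST l. (a(i := a i + 1)) l \<noteq> 0) = i"
      by (rule Least_equality) (auto simp: z split: if_splits)
    show ?case unfolding x_product.simps Let_def L ..
  next
    case (Suc m a u)
    let ?b = "a(i := a i + 1)"
    have b: "?b \<in> exponents n" "(\<Sum>l\<in>{1..n}. ?b l) = Suc (Suc m)"
    proof -
      show "?b \<in> exponents n" using Suc.prems by (auto simp: exponents_def)
      show "(\<Sum>l\<in>{1..n}. ?b l) = Suc (Suc m)"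
        using Suc.prems(2) sum_degree_upd[OF Suc.prems(3), of a "a i + 1"] by linarith
    qed
    define l where "l = (LEAST l. ?b l \<noteq> 0)"
    note L = exponents_least[OF b, folded l_def]
    have unf: "x_product (Suc (Suc m)) ?b u = x_product (Suc m) (?b(l := ?b l - 1)) (X l u)"
      unfolding l_def by (simp only: x_product.simps Let_def)
    show ?case
    proof (cases "l = i")
      case True
      then have "?b(l := ?b l - 1) = a" by auto
      then show ?thesis unfolding unf using True by simp
    next
      case False
      then have al: "a l \<noteq> 0" using L(4) by simp
      have least: "(LEAST l. a l \<noteq> 0) = l"
      proof (rule Least_equality)
        show "a l \<noteq> 0" by (rule al)
      next
        fix y assume "a y \<noteq> 0"
        then have "?b y \<noteq> 0" by auto
        then show "l \<le> y" unfolding l_def by (rule Least_le)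
      qed
      note A = exponents_least[OF Suc.prems(1,2), unfolded least]
      let ?a = "a(l := a l - 1)"
      have "x_product (Suc m) (?a(i := ?a i + 1)) (X l u) = x_product m ?a (X i (X l u))"
        by (rule Suc.IH[OF A(2,3) Suc.prems(3)])
      also have "\<dots> = x_product (Suc m) a (X i u)"
        by (simp only: x_product.simps Let_def least XX[OF Suc.prems(3) A(1)])
      also have "?a(i := ?a i + 1) = ?b(l := ?b l - 1)" using False by (auto simp: fun_eq_iff)
      finally show ?thesis unfolding unf .
    qed
  qed
  then show ?thesis using x_product_X[OF assms] by simp
qed

text \<open>The map from the standard module on \<open>k\<close> coefficients to the submodule
  generated by the \<open>b j\<close>; it shifts degrees by that of the \<open>b j\<close>.\<close>

definition extension :: "nat \<Rightarrow> (nat \<Rightarrow> 'v) \<Rightarrow> nat \<Rightarrow> complex vec_poly \<Rightarrow> 'v" where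
  "extension k b m u = (\<Sum>p\<in>monomial_indices n k m. scale (u p) (x_product m (fst p) (b (snd p))))"

lemma extension_add: "extension k b m (\<lambda>p. u p + v p) = extension k b m u + extension k b m v"
  and extension_scale: "extension k b m (\<lambda>p. r * u p) = scale r (extension k b m u)"
  and extension_zero: "extension k b m (\<lambda>p. 0) = 0"
  by (simp_all add: extension_def scale_left_distrib sum.distrib scale_sum_right)

lemma extension_base: "extension k b 0 u = (\<Sum>j<k. scale (u (\<lambda>_. 0, j)) (b j))"
proof -
  have "a = (\<lambda>_. 0)" if "a \<in> exponents n" "(\<Sum>i\<in>{1..n}. a i) = 0" for a
  proof
    fix i show "a i = 0" using that by (cases "i \<in> {1..n}") (auto simp: exponents_def)
  qed
  then have "monomial_indices n k 0 = (\<lambda>j. (\<lambda>_. 0, j)) ` {..<k}"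
    by (auto simp: monomial_indices_def exponents_def)
  then show ?thesis
    unfolding extension_def by (simp add: sum.reindex inj_on_def)
qed

lemma extension_x:
  assumes i: "i \<in> {1..n}"
  shows "extension k b (Suc m) (mult_x i u) = X i (extension k b m u)"
proof -
  let ?M = "monomial_indices n k"
  have fin: "finite (?M (Suc m))" by (rule finite_monomial_indices)
  have "extension k b (Suc m) (mult_x i u) =
      (\<Sum>p\<in>{p\<in>?M (Suc m). fst p i \<noteq> 0}. scale (mult_x i u p) (x_product (Suc m) (fst p) (b (snd p))))"
    unfolding extension_def using fin
    by (intro sum.mono_neutral_right) (auto simp: mult_x_def split: if_splits simp del: x_product.simps)
  also have "\<dots> = (\<Sum>p\<in>?M m. X i (scale (u p) (x_product m (fst p) (b (snd p)))))"
  proof (rule sum.reindex_bij_witness[where j = "\<lambda>(a, j). (a(i := a i - 1), j)"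
        and i = "\<lambda>(a, j). (a(i := a i + 1), j)"])
    fix p assume p: "p \<in> {p\<in>?M (Suc m). fst p i \<noteq> 0}"
    obtain a j where aj: "p = (a, j)" by (cases p)
    let ?a = "a(i := a i - 1)"
    have "(\<Sum>l\<in>{1..n}. a l) = Suc m" using p by (auto simp: aj monomial_indices_def)
    then have s: "(\<Sum>l\<in>{1..n}. ?a l) = m"
      using sum_degree_upd[OF i, of a "a i - 1"] p by (simp add: aj del: fun_upd_apply)
    moreover have e': "?a \<in> exponents n" and "j < k" using p by (auto simp: aj monomial_indices_def exponents_def)
    ultimately show "(\<lambda>(a, j). (a(i := a i - 1), j)) p \<in> ?M m"
      unfolding aj prod.case monomial_indices_def by blast
    have e: "?a(i := ?a i + 1) = a" using p by (auto simp: aj)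
    then show "(\<lambda>(a, j). (a(i := a i + 1), j)) ((\<lambda>(a, j). (a(i := a i - 1), j)) p) = p" by (simp add: aj)
    have "X i (x_product m ?a (b j)) = x_product (Suc m) a (b j)"
      using x_product_Suc[OF e' s i, of "b j"] unfolding e by (simp del: x_product.simps fun_upd_apply)
    then show "X i (scale (u ((\<lambda>(a, j). (a(i := a i - 1), j)) p)) (x_product m (fst ((\<lambda>(a, j). (a(i := a i - 1), j)) p))
        (b (snd ((\<lambda>(a, j). (a(i := a i - 1), j)) p))))) = scale (mult_x i u p) (x_product (Suc m) (fst p) (b (snd p)))"
      using p i by (simp add: aj mult_x_def X_scale del: x_product.simps)
  next
    fix p assume p: "p \<in> ?M m"
    obtain a j where aj: "p = (a, j)" by (cases p)
    let ?a = "a(i := a i + 1)"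
    have "(\<Sum>l\<in>{1..n}. a l) = m" using p by (auto simp: aj monomial_indices_def)
    then have "(\<Sum>l\<in>{1..n}. ?a l) = Suc m"
      using sum_degree_upd[OF i, of a "a i + 1"] by linarith
    moreover have "?a \<in> exponents n" "j < k" using p i by (auto simp: aj monomial_indices_def exponents_def)
    ultimately have "(?a, j) \<in> ?M (Suc m)" unfolding monomial_indices_def by blast
    then show "(\<lambda>(a, j). (a(i := a i + 1), j)) p \<in> {p\<in>?M (Suc m). fst p i \<noteq> 0}" by (simp add: aj)
  qed auto
  finally show ?thesis by (simp only: extension_def X_sum[OF i])
qed

lemma extension_mem:
  assumes "\<And>j. j < k \<Longrightarrow> b j \<in> N d"
  shows "extension k b m u \<in> N (d + m)"
  unfolding extension_def
  by (intro N_mem(5) N_mem(3) x_product_mem) (auto simp: monomial_indices_def intro: assms)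

context
  fixes d k b rho beta
  assumes E: "dunkl_form n k rho (complex_of_real c) cnj beta"
    and b_mem: "j < k \<Longrightarrow> b j \<in> N d"
    and b_form: "j < k \<Longrightarrow> l < k \<Longrightarrow> h (b j) (b l) = beta j l"
    and b_W: "w permutes {1..n} \<Longrightarrow> l < k \<Longrightarrow> v \<in> N d \<Longrightarrow> h (W w (b l)) v = (\<Sum>j<k. rho w j l * h (b j) v)"
    and b_Y: "d \<noteq> 0 \<Longrightarrow> i \<in> {1..n} \<Longrightarrow> j < k \<Longrightarrow> v \<in> N (d - 1) \<Longrightarrow> h (Y i (b j)) v = 0"
begin

interpretation D: dunkl_form n k rho "complex_of_real c" cnj beta by (rule E)

lemma ext_mem: "extension k b m u \<in> N (d + m)"
  using b_mem by (rule extension_mem)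

lemma ext_base_left:
  assumes "v \<in> N d"
  shows "h (extension k b 0 u) v = (\<Sum>j<k. u (\<lambda>_. 0, j) * h (b j) v)"
  unfolding extension_base using b_mem assms by (intro hermitian_combination_left[OF herm]) auto

text \<open>Statements about how \<open>extension\<close> intertwines operators are tested against
  \<open>v\<close>, because the \<open>b j\<close> transform under \<open>rho\<close> only modulo
  the radical; contravariance trades \<open>X\<close> for \<open>Y\<close> on \<open>v\<close>, one
  degree lower.\<close>

lemma ext_W:
  assumes w: "w permutes {1..n}" and u: "u \<in> D.V m" and v: "v \<in> N (d + m)"
  shows "h (W w (extension k b m u)) v = h (extension k b m (D.opW w u)) v"
proof -
  have "\<forall>v\<in>N (d + m). h (W w (extension k b m u)) v = h (extension k b m (D.opW w u)) v"
    using u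
  proof (induction rule: D.hpart_induct)
    case (base u)
    show ?case
    proof
      fix v assume "v \<in> N (d + 0)"
      then have v: "v \<in> N d" by simp
      have "W w (extension k b 0 u) = (\<Sum>j<k. scale (u (\<lambda>_. 0, j)) (W w (b j)))"
        unfolding extension_base by (simp only: W_sum[OF w] W_scale[OF w])
      then have "h (W w (extension k b 0 u)) v = (\<Sum>j<k. u (\<lambda>_. 0, j) * h (W w (b j)) v)"
        using hermitian_combination_left[OF herm, of "{..<k}" "\<lambda>j. W w (b j)" d v] W_mem[OF w b_mem] v by simp
      also have "\<dots> = (\<Sum>j<k. \<Sum>l<k. rho w l j * u (\<lambda>_. 0, j) * h (b l) v)"
        using b_W[OF w _ v] by (intro sum.cong) (auto simp: sum_distrib_left mult_ac)
      also have "\<dots> = (\<Sum>l<k. \<Sum>j<k. rho w l j * u (\<lambda>_. 0, j) * h (b l) v)" by (rule sum.swap)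
      also have "\<dots> = h (extension k b 0 (D.opW w u)) v"
        unfolding ext_base_left[OF v] by (simp add: D.opW_def comp_def sum_distrib_right)
      finally show "h (W w (extension k b 0 u)) v = h (extension k b 0 (D.opW w u)) v" .
    qed
  next
    case (add m u v)
    then show ?case
      using ext_mem[of m] W_mem[OF w, of _ "d + m"]
      by (simp add: D.W_add extension_add W_add[OF w] hermitian_add_left[OF herm, of _ "d + m"])
  next
    case (step m i u)
    have wi: "w i \<in> {1..n}" using step(1) permutes_in_image[OF w] by simp
    show ?case
    proof
      fix v assume v: "v \<in> N (d + Suc m)"
      then have Yv: "Y (w i) v \<in> N (d + m)" using Y_mem[OF wi, of v "d + m"] by simp
      have "h (W w (extension k b (Suc m) (mult_x i u))) v = h (X (w i) (W w (extension k b m u))) v"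
        using step(1) by (simp only: extension_x WX[OF w])
      also have "\<dots> = h (W w (extension k b m u)) (Y (w i) v)"
        using contra[OF wi W_mem[OF w ext_mem]] v by simp
      also have "\<dots> = h (extension k b m (D.opW w u)) (Y (w i) v)" using step(3) Yv by blast
      also have "\<dots> = h (X (w i) (extension k b m (D.opW w u))) v"
        using contra[OF wi ext_mem[of m]] v by simp
      also have "\<dots> = h (extension k b (Suc m) (D.opW w (mult_x i u))) v"
        unfolding D.W_x[OF w] using extension_x[OF wi] by simp
      finally show "h (W w (extension k b (Suc m) (mult_x i u))) v = h (extension k b (Suc m) (D.opW w (mult_x i u))) v" .
    qed
  next
    case (zero m)
    have "D.opW w (\<lambda>p. 0) = (\<lambda>p. 0)" using D.W_scale[of w 0 "\<lambda>p. 0"] by simp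
    then show ?case by (simp add: extension_zero W_zero[OF w])
  qed
  then show ?thesis using v by blast
qed

lemma ext_comm:
  assumes i: "i \<in> {1..n}" and l: "l \<in> {1..n}" and u: "u \<in> D.V m" and v: "v \<in> N (d + m)"
  shows "h (extension k b m (D.comm i l u)) v = (if i = l
      then h (extension k b m u) v - of_real c * (\<Sum>s\<in>{1..n} - {i}. h (W (transpose i s) (extension k b m u)) v)
      else of_real c * h (W (transpose i l) (extension k b m u)) v)"
proof (cases "i = l")
  case True
  have "D.comm i i u = (\<lambda>p. u p + (- of_real c) * (\<Sum>s\<in>{1..n} - {i}. D.opW (transpose i s) u p))"
    by (simp add: D.comm_def)
  moreover have "extension k b m (\<lambda>p. \<Sum>s\<in>S. f s p) = (\<Sum>s\<in>S. extension k b m (f s))"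
    for S and f :: "nat \<Rightarrow> complex vec_poly"
    by (induction S rule: infinite_finite_induct) (auto simp: extension_add extension_zero)
  ultimately have e: "extension k b m (D.comm i i u) = extension k b m u +
      scale (- of_real c) (\<Sum>s\<in>{1..n} - {i}. extension k b m (D.opW (transpose i s) u))"
    by (simp only: extension_add extension_scale)
  have m: "(\<Sum>s\<in>{1..n} - {i}. extension k b m (D.opW (transpose i s) u)) \<in> N (d + m)"
    by (intro N_mem(5) ext_mem)
  have "h (\<Sum>s\<in>{1..n} - {i}. extension k b m (D.opW (transpose i s) u)) v =
      (\<Sum>s\<in>{1..n} - {i}. h (extension k b m (D.opW (transpose i s) u)) v)"
    using v by (intro hermitian_sum_left[OF herm, of _ _ "d + m"] ext_mem)
  also have "\<dots> = (\<Sum>s\<in>{1..n} - {i}. h (W (transpose i s) (extension k b m u)) v)"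
    by (intro sum.cong refl ext_W[symmetric] swap_permutes i u v)
  finally have "h (extension k b m (D.comm i i u)) v =
      h (extension k b m u) v - of_real c * (\<Sum>s\<in>{1..n} - {i}. h (W (transpose i s) (extension k b m u)) v)"
    unfolding e using v m N_mem(3)[OF m] ext_mem
    by (simp only: hermitian_add_left[OF herm, of _ "d + m"] hermitian_scale_left[OF herm, of _ "d + m"]) simp
  then show ?thesis using True by simp
next
  case False
  then have "h (extension k b m (D.comm i l u)) v = of_real c * h (extension k b m (D.opW (transpose i l) u)) v"
    using v ext_mem by (simp add: D.comm_def extension_scale hermitian_scale_left[OF herm, of _ "d + m"])
  then show ?thesis using False ext_W[OF permutes_swap_id[OF i l] u v] by simp
qed

lemma ext_Y:
  assumes i: "i \<in> {1..n}" and u: "u \<in> D.V (Suc m)" and v: "v \<in> N (d + m)"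
  shows "h (Y i (extension k b (Suc m) u)) v = h (extension k b m (D.opY i u)) v"
proof -
  have "\<forall>m' v. Suc m = Suc m' \<longrightarrow> v \<in> N (d + m') \<longrightarrow>
      h (Y i (extension k b (Suc m') u)) v = h (extension k b m' (D.opY i u)) v"
    using u
  proof (induction rule: D.hpart_induct[where m = "Suc m"])
    case (add m u v)
    show ?case
    proof (intro allI impI)
      fix m' w assume m: "m = Suc m'" and w: "w \<in> N (d + m')"
      have "Y i (extension k b (Suc m') x) \<in> N (d + m')" for x
        using Y_mem[OF i, of _ "d + m'"] ext_mem[of "Suc m'"] by simp
      then show "h (Y i (extension k b (Suc m') (\<lambda>p. u p + v p))) w = h (extension k b m' (D.opY i (\<lambda>p. u p + v p))) w"
        using add m w ext_mem[of m']
        by (simp add: extension_add D.Y_add Y_add[OF i] hermitian_add_left[OF herm, of _ "d + m'"])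
    qed
  next
    case (step m l u)
    have "h (Y i (extension k b (Suc m) (mult_x l u))) v = h (extension k b m (D.opY i (mult_x l u))) v"
      if v: "v \<in> N (d + m)" for v
    proof -
      \<comment> \<open>For \<open>m > 0\<close> this is the induction hypothesis. For
        \<open>m = 0\<close> the right side is 0, and so is the left: either \<open>d = 0\<close>
        and \<open>Y\<close> kills the bottom, or \<open>b_Y\<close> makes \<open>Y i (b j)\<close>
        null in degree \<open>d - 1\<close>.\<close>
      have first: "h (X l (Y i (extension k b m u))) v = h (extension k b m (mult_x l (D.opY i u))) v"
      proof (cases m)
        case 0
        have "h (X l (Y i (extension k b 0 u))) v = 0"
        proof (cases d)
          case 0
          then have "Y i (extension k b 0 u) = 0" using ext_mem[of 0 u] Y_bottom[OF i] by simp
          then show ?thesis using step(1) v \<open>m = 0\<close> by (simp add: X_zero hermitian_zero_left[OF herm, of _ d])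
        next
          case (Suc d')
          have Yv: "Y l v \<in> N d'" using Y_mem[OF step(1), of v d'] v Suc \<open>m = 0\<close> by simp
          have Yb: "Y i (b j) \<in> N d'" if "j < k" for j using Y_mem[OF i, of "b j" d'] b_mem[OF that] Suc by simp
          have e: "Y i (extension k b 0 u) = (\<Sum>j<k. scale (u (\<lambda>_. 0, j)) (Y i (b j)))"
            unfolding extension_base by (simp only: Y_sum[OF i] Y_scale[OF i])
          have "Y i (extension k b 0 u) \<in> N d'" using Y_mem[OF i, of "extension k b 0 u" d'] ext_mem[of 0 u] Suc by simp
          then have "h (X l (Y i (extension k b 0 u))) v = h (Y i (extension k b 0 u)) (Y l v)"
            using contra[OF step(1), of "Y i (extension k b 0 u)" d' v] v Suc \<open>m = 0\<close> by simp
          also have "\<dots> = (\<Sum>j<k. u (\<lambda>_. 0, j) * h (Y i (b j)) (Y l v))"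
            unfolding e using Yb Yv by (intro hermitian_combination_left[OF herm, of _ _ d']) auto
          also have "\<dots> = 0" using b_Y[OF _ i] Yv Suc by (intro sum.neutral) auto
          finally show ?thesis .
        qed
        moreover have "D.opY i u = (\<lambda>p. 0)" using D.Y_hpart_zero[OF i] step(2) 0 by simp
        moreover have "mult_x l (\<lambda>p. 0) = (\<lambda>p. 0 :: complex)" by (auto simp: mult_x_def)
        ultimately show ?thesis using 0 v by (simp add: extension_zero hermitian_zero_left[OF herm, of _ d])
      next
        case (Suc m')
        have Yu: "Y i (extension k b m u) \<in> N (d + m')" using Y_mem[OF i, of _ "d + m'"] ext_mem[of m u] Suc by simp
        have Yv: "Y l v \<in> N (d + m')" using Y_mem[OF step(1), of v "d + m'"] v Suc by simp
        have v': "v \<in> N (Suc (d + m'))" using v Suc by simp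
        have "h (X l (Y i (extension k b m u))) v = h (Y i (extension k b m u)) (Y l v)"
          by (rule contra[OF step(1) Yu v'])
        also have "\<dots> = h (extension k b m' (D.opY i u)) (Y l v)" using step(3) Suc Yv by blast
        also have "\<dots> = h (X l (extension k b m' (D.opY i u))) v"
          by (rule contra[OF step(1) ext_mem v', symmetric])
        finally show ?thesis using extension_x[OF step(1), of k b m' "D.opY i u"] Suc by simp
      qed
      have "h (Y i (extension k b (Suc m) (mult_x l u))) v = h (X l (Y i (extension k b m u))) v + h (extension k b m (D.comm i l u)) v"
        unfolding extension_x[OF step(1)] YX[OF i step(1) ext_mem v] ext_comm[OF i step(1) step(2) v] by simp
      then show ?thesis
        using first v ext_mem
        by (simp add: D.YX[OF step(1)] extension_add hermitian_add_left[OF herm, of _ "d + m"])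
    qed
    then show ?case by auto
  qed (auto simp: D.Y_zero extension_zero Y_zero[OF i])
  then show ?thesis using v by blast
qed

text \<open>The submodule generated in the lowest degree thus carries the form of a standard module;
  this holds for any \<open>b\<close> transforming by \<open>rho\<close>, with \<open>beta\<close>
  its Gram matrix.\<close>

lemma ext_form:
  assumes "u \<in> D.V m" "v \<in> D.V m"
  shows "h (extension k b m u) (extension k b m v) = D.form m u v"
proof -
  have "\<forall>v\<in>D.V m. h (extension k b m u) (extension k b m v) = D.form m u v"
    using assms(1)
  proof (induction rule: D.hpart_induct)
    case (base u)
    have "h (extension k b 0 u) (extension k b 0 v) = D.form 0 u v" for v
    proof -
      have v: "extension k b 0 v \<in> N d" using ext_mem[of 0 v] by simp
      have "h (b j) (extension k b 0 v) = (\<Sum>q<k. cnj (v (\<lambda>_. 0, q)) * beta j q)" if "j < k" for j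
        unfolding extension_base using hermitian_combination_right[OF herm, of "{..<k}" b d "b j"] b_mem b_form that by simp
      then show ?thesis
        unfolding ext_base_left[OF v] D.form_base by (simp add: sum_distrib_left mult_ac)
    qed
    then show ?case by blast
  next
    case (add m u v)
    then show ?case
      using ext_mem[of m] by (simp add: extension_add D.form_add_left hermitian_add_left[OF herm, of _ "d + m"])
  next
    case (step m i u)
    show ?case
    proof
      fix v assume v: "v \<in> D.V (Suc m)"
      have ev: "extension k b (Suc m) v \<in> N (Suc (d + m))" using ext_mem[of "Suc m" v] by simp
      have "h (extension k b (Suc m) (mult_x i u)) (extension k b (Suc m) v) =
          h (extension k b m u) (Y i (extension k b (Suc m) v))"
        unfolding extension_x[OF step(1)] by (rule contra[OF step(1) ext_mem ev])
      also have "\<dots> = h (extension k b m u) (extension k b m (D.opY i v))"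
        using ext_Y[OF step(1) v ext_mem[of m u]]
          hermitian_sym[OF herm, OF Y_mem[OF step(1) ev] ext_mem[of m u]]
          hermitian_sym[OF herm, OF ext_mem[of m "D.opY i v"] ext_mem[of m u]] by simp
      also have "\<dots> = D.form m u (D.opY i v)" using step(3) D.Y_hpart[OF step(1) v] by blast
      finally show "h (extension k b (Suc m) (mult_x i u)) (extension k b (Suc m) v) = D.form (Suc m) (mult_x i u) v"
        using D.form_x_left[OF step(1) v] by simp
    qed
  next
    case (zero m)
    then show ?case using ext_mem[of m] by (simp add: extension_zero D.form_zero_left hermitian_zero_left[OF herm, of _ "d + m"])
  qed
  then show ?thesis using assms(2) by blast
qed

lemma subspace_extension: "subspace (extension k b m ` hpart n k m)"
  unfolding subspace_def
proof (intro conjI ballI allI)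
  show "0 \<in> extension k b m ` hpart n k m"
    by (rule image_eqI[of _ _ "\<lambda>p. 0"]) (auto simp: extension_zero supported_on_def)
next
  fix x y assume "x \<in> extension k b m ` hpart n k m" "y \<in> extension k b m ` hpart n k m"
  then obtain u v where "u \<in> hpart n k m" "v \<in> hpart n k m" "x = extension k b m u" "y = extension k b m v" by blast
  then show "x + y \<in> extension k b m ` hpart n k m"
    by (intro image_eqI[of _ _ "\<lambda>p. u p + v p"]) (auto simp: extension_add supported_on_def)
next
  fix r x assume "x \<in> extension k b m ` hpart n k m"
  then obtain u where "u \<in> hpart n k m" "x = extension k b m u" by blast
  then show "scale r x \<in> extension k b m ` hpart n k m"
    by (intro image_eqI[of _ _ "\<lambda>p. r * u p"]) (auto simp: extension_scale supported_on_def)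
qed

lemma signature_extension:
  "signature (extension k b m ` hpart n k m) h = standard_signature n c k rho beta m"
  unfolding standard_signature_def
proof (rule signature_isometry[where f = "extension k b m"])
  show "complex_space (scale_fun :: complex \<Rightarrow> ((nat \<Rightarrow> nat) \<times> nat \<Rightarrow> complex) \<Rightarrow> _)"
    by (rule complex_space_scale_fun)
  show "complex_space scale" by unfold_locales
  show st: "fun_space.hermitian_on (hpart n k m) (standard_form n c k rho beta m)"
    by (rule hermitian_on_standard[OF E])
  show "hermitian_on (extension k b m ` hpart n k m) h"
    using ext_mem by (intro hermitian_on_subset[OF herm subspace_extension, of _ "d + m"]) auto
  show "fun_space.finite_rank (hpart n k m) (standard_form n c k rho beta m) (card (monomial_indices n k m))"
    by (rule finite_rank_supported_on[OF finite_monomial_indices st])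
  show "h (extension k b m u) (extension k b m v) = standard_form n c k rho beta m u v"
    if "u \<in> hpart n k m" "v \<in> hpart n k m" for u v
    using ext_form[OF that] by (simp add: standard_form_def)
qed auto

definition complement :: "nat \<Rightarrow> 'v set" where
  "complement m = (if m < d then N m else perp (N m) h (extension k b (m - d) ` hpart n k (m - d)))"

lemma complement_subset: "complement m \<subseteq> N m"
  by (auto simp: complement_def perp_def)

lemma complementI:
  "u \<in> N m \<Longrightarrow> (\<And>m' v. m = d + m' \<Longrightarrow> v \<in> D.V m' \<Longrightarrow> h u (extension k b m' v) = 0) \<Longrightarrow> u \<in> complement m"
  by (auto simp: complement_def perp_def)

lemma complementD:
  "u \<in> complement (d + m') \<Longrightarrow> v \<in> D.V m' \<Longrightarrow> h u (extension k b m' v) = 0"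
  by (auto simp: complement_def perp_def)

text \<open>Signatures add up even if the generated submodule is degenerate, thanks to the
  generality of \<open>signature_perp\<close>.\<close>

lemma signature_complement:
  "signature (N m) h = signature (complement m) h +
     (if m < d then 0 else standard_signature n c k rho beta (m - d))"
proof (cases "m < d")
  case False
  then have m: "m = d + (m - d)" by simp
  obtain r where r: "finite_rank (N m) h r" using rank by blast
  have "extension k b (m - d) ` hpart n k (m - d) \<subseteq> N m" using ext_mem[of "m - d"] m by auto
  then show ?thesis
    using signature_perp[OF herm r subspace_extension] signature_extension False by (simp add: complement_def)
qed (simp add: complement_def)

text \<open>The generated submodule is stable modulo radicals, hence its complement is stable by
  adjunction. The only exit is \<open>Y\<close> from degree \<open>d\<close> to
  \<open>d - 1\<close>, where the form is 0 by \<open>low\<close>.\<close>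

lemma cherednik_form_complement:
  assumes low: "\<And>u v. d \<noteq> 0 \<Longrightarrow> u \<in> N (d - 1) \<Longrightarrow> v \<in> N (d - 1) \<Longrightarrow> h u v = 0"
  shows "cherednik_form scale n c X Y W complement h"
proof unfold_locales
  fix m
  show "hermitian_on (complement m) h"
  proof (cases "m < d")
    case False
    then show ?thesis
      using ext_mem[of "m - d"] hermitian_on_perp[OF herm, of "extension k b (m - d) ` hpart n k (m - d)" m]
      by (auto simp: complement_def)
  qed (simp add: complement_def herm)
  obtain r where "finite_rank (N m) h r" using rank by blast
  then show "\<exists>r. finite_rank (complement m) h r"
    using finite_rank_subset[OF _ complement_subset] by blast
next
  fix i u m assume i: "i \<in> {1..n}" and u: "u \<in> complement m"
  have uN: "u \<in> N m" using u complement_subset by blast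
  show "X i u \<in> complement (Suc m)"
  proof (rule complementI[OF X_mem[OF i uN]])
    fix m' v assume m: "Suc m = d + m'" and v: "v \<in> D.V m'"
    have ev: "extension k b m' v \<in> N (Suc m)" using ext_mem[of m' v] m by simp
    have "h (X i u) (extension k b m' v) = h u (Y i (extension k b m' v))" by (rule contra[OF i uN ev])
    also have "\<dots> = 0"
    proof (cases m')
      case 0
      then have "d \<noteq> 0" "m = d - 1" using m by auto
      then show ?thesis using low uN Y_mem[OF i ev] by auto
    next
      case (Suc m0)
      then have md: "m = d + m0" using m by simp
      have "h (Y i (extension k b m' v)) u = h (extension k b m0 (D.opY i v)) u"
        using ext_Y[OF i, of v m0 u] v uN md Suc by simp
      then have "h u (Y i (extension k b m' v)) = h u (extension k b m0 (D.opY i v))"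
        using hermitian_sym[OF herm, OF Y_mem[OF i ev] uN]
          hermitian_sym[OF herm, OF ext_mem[of m0 "D.opY i v"], of u] uN md by simp
      then show ?thesis using complementD[of u m0 "D.opY i v"] u md D.Y_hpart[OF i, of v m0] v Suc by simp
    qed
    finally show "h (X i u) (extension k b m' v) = 0" .
  qed
next
  fix i u m assume i: "i \<in> {1..n}" and u: "u \<in> complement (Suc m)"
  have uN: "u \<in> N (Suc m)" using u complement_subset by blast
  show "Y i u \<in> complement m"
  proof (rule complementI[OF Y_mem[OF i uN]])
    fix m' v assume m: "m = d + m'" and v: "v \<in> D.V m'"
    have "h (Y i u) (extension k b m' v) = h u (X i (extension k b m' v))"
      using contra'[OF i ext_mem[of m' v], of u] uN m by simp
    also have "\<dots> = h u (extension k b (Suc m') (mult_x i v))" by (simp only: extension_x[OF i])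
    also have "\<dots> = 0" using complementD[of u "Suc m'"] u m mult_x_hpart[OF i v] by simp
    finally show "h (Y i u) (extension k b m' v) = 0" .
  qed
next
  fix w u m assume w: "w permutes {1..n}" and u: "u \<in> complement m"
  have uN: "u \<in> N m" using u complement_subset by blast
  show "W w u \<in> complement m"
  proof (rule complementI[OF W_mem[OF w uN]])
    fix m' v assume m: "m = d + m'" and v: "v \<in> D.V m'"
    note wi = permutes_inv[OF w]
    have vN: "extension k b m' v \<in> N m" using ext_mem[of m' v] m by simp
    have "W (inv_into UNIV w) (W w u) = u"
      using W_comp[OF wi w, of u] W_id[OF uN] permutes_inv_o(2)[OF w] by simp
    then have "h (W w u) (extension k b m' v) = h u (W (inv_into UNIV w) (extension k b m' v))"
      using W_inv[OF wi W_mem[OF w uN] vN] by simp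
    also have "\<dots> = h u (extension k b m' (D.opW (inv_into UNIV w) v))"
      using ext_W[OF wi v, of u] uN m hermitian_sym[OF herm, OF W_mem[OF wi vN] uN]
        hermitian_sym[OF herm, OF ext_mem[of m' "D.opW (inv_into UNIV w) v"], of u] by simp
    also have "\<dots> = 0" using complementD[of u m'] u m D.W_hpart[OF wi v] by simp
    finally show "h (W w u) (extension k b m' v) = 0" .
  qed
next
  fix i l u m v assume "i \<in> {1..n}" "l \<in> {1..n}" "u \<in> complement m" "v \<in> complement m"
  then show "h (Y i (X l u)) v = h (X l (Y i u)) v + (if i = l
        then h u v - of_real c * (\<Sum>s\<in>{1..n} - {i}. h (W (transpose i s) u) v)
        else of_real c * h (W (transpose i l) u) v)"
    using complement_subset[of m] by (intro YX[of i l u m v]) auto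
next
  fix i u assume "i \<in> {1..n}" "u \<in> complement 0"
  then show "Y i u = 0" using complement_subset[of 0] by (intro Y_bottom) auto
next
  fix i u v m assume "i \<in> {1..n}" "u \<in> complement m" "v \<in> complement (Suc m)"
  then show "h (X i u) v = h u (Y i v)"
    using complement_subset[of m] complement_subset[of "Suc m"] by (intro contra) auto
next
  fix w u v m assume "w permutes {1..n}" "u \<in> complement m" "v \<in> complement m"
  then show "h (W w u) (W w v) = h u v" using complement_subset[of m] by (intro W_inv[of w u m v]) auto
next
  fix u m assume "u \<in> complement m"
  then show "W id u = u" using complement_subset[of m] by (intro W_id) auto
qed (simp_all only: X_add X_scale Y_add Y_scale W_add W_scale W_comp XX WX)

end

end

section \<open>Sequences whose generating function is a polynomial over $(1-t)^n$\<close>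

definition rational_character :: "nat \<Rightarrow> (nat \<Rightarrow> int) \<Rightarrow> bool" where
  "rational_character n s \<longleftrightarrow>
     (\<exists>p :: real poly. Abs_fps (\<lambda>m. of_int (s m)) * (1 - fps_X) ^ n = fps_of_poly p)"

lemma rational_character_zero: "rational_character n (\<lambda>m. 0)"
  unfolding rational_character_def
proof
  have "Abs_fps (\<lambda>m. of_int 0 :: real) = 0" by (simp add: fps_eq_iff)
  then show "Abs_fps (\<lambda>m. of_int 0) * (1 - fps_X) ^ n = fps_of_poly (0 :: real poly)" by simp
qed

lemma rational_character_add:
  assumes "rational_character n s" "rational_character n s'"
  shows "rational_character n (\<lambda>m. s m + s' m)"
proof -
  obtain p q where pq: "Abs_fps (\<lambda>m. of_int (s m) :: real) * (1 - fps_X) ^ n = fps_of_poly p"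
    "Abs_fps (\<lambda>m. of_int (s' m) :: real) * (1 - fps_X) ^ n = fps_of_poly q"
    using assms unfolding rational_character_def by blast
  have "Abs_fps (\<lambda>m. of_int (s m + s' m) :: real) = Abs_fps (\<lambda>m. of_int (s m)) + Abs_fps (\<lambda>m. of_int (s' m))"
    by (simp add: fps_eq_iff)
  then show ?thesis
    unfolding rational_character_def using pq
    by (intro exI[of _ "p + q"]) (simp add: distrib_right fps_of_poly_add)
qed

lemma rational_character_scale:
  assumes "rational_character n s"
  shows "rational_character n (\<lambda>m. r * s m)"
proof -
  obtain p where p: "Abs_fps (\<lambda>m. of_int (s m) :: real) * (1 - fps_X) ^ n = fps_of_poly p"
    using assms unfolding rational_character_def by blast
  have "Abs_fps (\<lambda>m. of_int (r * s m) :: real) = fps_const (of_int r) * Abs_fps (\<lambda>m. of_int (s m))"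
    by (simp add: fps_eq_iff)
  then show ?thesis
    unfolding rational_character_def using p
    by (intro exI[of _ "Polynomial.smult (of_int r) p"]) (simp add: mult.assoc fps_of_poly_smult)
qed

lemma rational_character_sum:
  "(\<And>i. i \<in> A \<Longrightarrow> rational_character n (f i)) \<Longrightarrow> rational_character n (\<lambda>m. \<Sum>i\<in>A. f i m)"
  by (induction A rule: infinite_finite_induct) (auto intro: rational_character_zero rational_character_add)

lemma rational_character_shift:
  assumes "rational_character n s"
  shows "rational_character n (\<lambda>m. if m < d then 0 else s (m - d))"
proof -
  obtain p where p: "Abs_fps (\<lambda>m. of_int (s m) :: real) * (1 - fps_X) ^ n = fps_of_poly p"
    using assms unfolding rational_character_def by blast
  have "Abs_fps (\<lambda>m. of_int (if m < d then 0 else s (m - d)) :: real) = fps_X ^ d * Abs_fps (\<lambda>m. of_int (s m))"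
    by (simp add: fps_eq_iff fps_X_power_mult_nth)
  then show ?thesis
    unfolding rational_character_def using p
    by (intro exI[of _ "monom 1 d * p"]) (simp add: mult.assoc fps_of_poly_mult fps_of_poly_monom)
qed

lemma sum_swap_last:
  "(\<Sum>i\<in>A. \<Sum>l\<in>B i. \<Sum>q\<in>C. F i l q) = (\<Sum>q\<in>C. \<Sum>i\<in>A. \<Sum>l\<in>B i. F i l q)"
proof -
  have "(\<Sum>i\<in>A. \<Sum>l\<in>B i. \<Sum>q\<in>C. F i l q) = (\<Sum>i\<in>A. \<Sum>q\<in>C. \<Sum>l\<in>B i. F i l q)"
    by (intro sum.cong refl sum.swap)
  also have "\<dots> = (\<Sum>q\<in>C. \<Sum>i\<in>A. \<Sum>l\<in>B i. F i l q)"
    by (rule sum.swap)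
  finally show ?thesis .
qed

section \<open>Signatures as sums of shifted standard signatures\<close>

context cherednik_form
begin

lemma W_adjoint:
  assumes w: "w permutes {1..n}" and uv: "u \<in> N m" "v \<in> N m"
  shows "h (W w u) v = h u (W (inv_into UNIV w) v)"
proof -
  note wi = permutes_inv[OF w]
  have "W (inv_into UNIV w) (W w u) = u"
    using W_comp[OF wi w, of u] W_id[OF uv(1)] permutes_inv_o(2)[OF w] by simp
  then show ?thesis using W_inv[OF wi W_mem[OF w uv(1)] uv(2)] by simp
qed

text \<open>A basis of \<open>N d\<close> modulo the radical, with its matrices. That it spans is
  expressed dually by the last clause.\<close>

definition bottom_basis where
  "bottom_basis d k b rho beta \<longleftrightarrow> hermitian_rep n k rho beta \<and> (\<forall>j<k. b j \<in> N d) \<and>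
    (\<forall>j<k. \<forall>l<k. h (b j) (b l) = beta j l) \<and>
    (\<forall>w. w permutes {1..n} \<longrightarrow> (\<forall>l<k. \<forall>v\<in>N d. h (W w (b l)) v = (\<Sum>j<k. rho w j l * h (b j) v))) \<and>
    (\<forall>u\<in>N d. (\<forall>j<k. h u (b j) = 0) \<longrightarrow> u \<in> radical d)"

lemma bottom_basisD:
  assumes "bottom_basis d k b rho beta"
  shows "hermitian_rep n k rho beta" "j < k \<Longrightarrow> b j \<in> N d"
    "j < k \<Longrightarrow> l < k \<Longrightarrow> h (b j) (b l) = beta j l"
    "w permutes {1..n} \<Longrightarrow> l < k \<Longrightarrow> v \<in> N d \<Longrightarrow> h (W w (b l)) v = (\<Sum>j<k. rho w j l * h (b j) v)"
    "u \<in> N d \<Longrightarrow> (\<And>j. j < k \<Longrightarrow> h u (b j) = 0) \<Longrightarrow> u \<in> radical d"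
  using assms unfolding bottom_basis_def by blast+

text \<open>An orthogonal family with nonzero norms is chosen; matrix entries are then quotients of
  form values, and the laws of a representation follow by taking adjoints.\<close>

lemma bottom_rep:
  assumes low: "\<And>u v. d \<noteq> 0 \<Longrightarrow> u \<in> N (d - 1) \<Longrightarrow> v \<in> N (d - 1) \<Longrightarrow> h u v = 0"
  shows "\<exists>k b rho beta. bottom_basis d k b rho beta"
proof -
  obtain r where "finite_rank (N d) h r" using rank by blast
  from orthogonal_family_exists[OF herm this] obtain I :: "nat set" and b0 where
    b0: "orthogonal_family (N d) h I b0" "\<forall>i\<in>I. h (b0 i) (b0 i) \<noteq> 0" by blast
  define k where "k = card I"
  have "finite I" using b0(1) unfolding orthogonal_family_def by blast
  then obtain f where f: "bij_betw f {0..<k} I" unfolding k_def using ex_bij_betw_nat_finite by blast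
  define b where "b = b0 \<circ> f"
  have fam: "orthogonal_family (N d) h {0..<k} b"
    unfolding b_def by (rule orthogonal_family_reindex[OF b0(1) f])
  note F = orthogonal_familyD[OF herm fam]
  have bm: "b j \<in> N d" if "j < k" for j using F(2) that by simp
  have orth: "h (b j) (b l) = 0" if "j < k" "l < k" "j \<noteq> l" for j l using F(3) that by simp
  have nz: "h (b j) (b j) \<noteq> 0" if "j < k" for j
    using b0(2) f that unfolding b_def bij_betw_def by auto
  have exp: "h u v = (\<Sum>j<k. h u (b j) / h (b j) (b j) * h (b j) v)" if u: "u \<in> N d" and v: "v \<in> N d" for u v
  proof -
    obtain q where q: "\<And>v. v \<in> N d \<Longrightarrow> h u v = (\<Sum>j\<in>{0..<k}. q j * h (b j) v)" using F(4)[OF u] by blast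
    have "h u (b j) = q j * h (b j) (b j)" if j: "j < k" for j
    proof -
      have "(\<Sum>i\<in>{0..<k}. q i * h (b i) (b j)) = (\<Sum>i\<in>{j}. q i * h (b i) (b j))"
        using orth j by (intro sum.mono_neutral_right) auto
      then show ?thesis using q[OF bm[OF j]] by simp
    qed
    then have "q j = h u (b j) / h (b j) (b j)" if "j < k" for j using nz[OF that] that by simp
    then show ?thesis using q[OF v] by (simp add: lessThan_atLeast0)
  qed
  define rho where "rho w j l = (if j < k then h (W w (b l)) (b j) / h (b j) (b j) else 0)" for w j l
  have W: "h (W w (b l)) v = (\<Sum>j<k. rho w j l * h (b j) v)"
    if "w permutes {1..n}" "l < k" "v \<in> N d" for w l v
    using exp[OF W_mem[OF that(1) bm[OF that(2)]] that(3)] by (simp add: rho_def)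
  define beta where "beta j l = h (b j) (b l)" for j l
  have "dunkl_form n k rho 0 cnj beta"
  proof
    show "rho w j l = 0" if "k \<le> j" for w j l using that by (simp add: rho_def)
    show "rho id j l = (if j = l then 1 else 0)" if "j < k" "l < k" for j l
      using that W_id[OF bm[OF that(2)]] orth[of l j] nz[of l] by (auto simp: rho_def)
    show "rho (v \<circ> w) j l = (\<Sum>q<k. rho v j q * rho w q l)"
      if v: "v permutes {1..n}" and w: "w permutes {1..n}" and jl: "j < k" "l < k" for v w j l
    proof -
      note vi = permutes_inv[OF v]
      have "h (W (v \<circ> w) (b l)) (b j) = h (W w (b l)) (W (inv_into UNIV v) (b j))"
        unfolding W_comp[OF v w] by (rule W_adjoint[OF v W_mem[OF w bm[OF jl(2)]] bm[OF jl(1)]])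
      also have "\<dots> = (\<Sum>q<k. rho w q l * h (b q) (W (inv_into UNIV v) (b j)))"
        by (rule W[OF w jl(2) W_mem[OF vi bm[OF jl(1)]]])
      also have "\<dots> = (\<Sum>q<k. rho w q l * h (W v (b q)) (b j))"
        using W_adjoint[OF v bm bm[OF jl(1)]] by (intro sum.cong) auto
      finally show ?thesis using jl by (simp add: rho_def sum_divide_distrib mult.commute)
    qed
    show "beta l j = cnj (beta j l)" if "j < k" "l < k" for j l
      unfolding beta_def by (rule hermitian_sym[OF herm, OF bm[OF that(1)] bm[OF that(2)]])
    show "(\<Sum>p<k. \<Sum>q<k. rho w p j * beta p q * cnj (rho w q l)) = beta j l"
      if w: "w permutes {1..n}" and jl: "j < k" "l < k" for w j l
    proof -
      have "h (b p) (W w (b l)) = (\<Sum>q<k. cnj (rho w q l) * beta p q)" if p: "p < k" for p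
      proof -
        have "h (b p) (W w (b l)) = cnj (h (W w (b l)) (b p))"
          by (rule hermitian_sym[OF herm, OF W_mem[OF w bm[OF jl(2)]] bm[OF p]])
        also have "\<dots> = (\<Sum>q<k. cnj (rho w q l) * cnj (h (b q) (b p)))"
          unfolding W[OF w jl(2) bm[OF p]] by simp
        also have "\<dots> = (\<Sum>q<k. cnj (rho w q l) * beta p q)"
        proof (intro sum.cong refl)
          fix q assume "q \<in> {..<k}"
          then have "q < k" by simp
          have "h (b p) (b q) = cnj (h (b q) (b p))"
            by (rule hermitian_sym[OF herm, OF bm[OF \<open>q < k\<close>] bm[OF p]])
          then show "cnj (rho w q l) * cnj (h (b q) (b p)) = cnj (rho w q l) * beta p q"
            by (simp add: beta_def)
        qed
        finally show ?thesis .
      qed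
      then have "h (W w (b j)) (W w (b l)) = (\<Sum>p<k. rho w p j * (\<Sum>q<k. cnj (rho w q l) * beta p q))"
        using W[OF w jl(1) W_mem[OF w bm[OF jl(2)]]] by simp
      then show ?thesis
        using W_inv[OF w bm[OF jl(1)] bm[OF jl(2)]] by (simp add: beta_def sum_distrib_left mult_ac)
    qed
  qed auto
  moreover have "e l = 0" if e: "\<forall>l<k. (\<Sum>j<k. e j * beta j l) = 0" and l: "l < k" for e l
  proof -
    have "(\<Sum>j<k. e j * beta j l) = (\<Sum>j\<in>{l}. e j * beta j l)"
      using orth l by (intro sum.mono_neutral_right) (auto simp: beta_def)
    then show ?thesis using e l nz[OF l] by (simp add: beta_def)
  qed
  ultimately have R: "hermitian_rep n k rho beta" unfolding hermitian_rep_def by blast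
  have rad: "u \<in> radical d" if "u \<in> N d" "\<And>j. j < k \<Longrightarrow> h u (b j) = 0" for u
    unfolding radical_def using that exp by simp
  have bb: "h (b j) (b l) = beta j l" for j l by (simp add: beta_def)
  show ?thesis
    unfolding bottom_basis_def
    by (intro exI[of _ k] exI[of _ b] exI[of _ rho] exI[of _ beta] conjI allI impI ballI)
       (use R bm bb W rad in blast)+
qed

text \<open>\<open>f\<close> intertwines \<open>rep_sum\<close> with \<open>Z\<close> modulo the
  radical. As \<open>beta\<close> is nondegenerate, a coefficient vector whose image is in the
  radical is 0, so annihilation modulo the radical becomes exact.\<close>

lemma bottom_roots:
  assumes low: "\<And>u v. d \<noteq> 0 \<Longrightarrow> u \<in> N (d - 1) \<Longrightarrow> v \<in> N (d - 1) \<Longrightarrow> h u v = 0"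
    and zs: "weights zs" "c \<noteq> 0"
    and E: "hermitian_rep n k rho beta" and b: "\<And>j. j < k \<Longrightarrow> b j \<in> N d"
    and bb: "\<And>j l. j < k \<Longrightarrow> l < k \<Longrightarrow> h (b j) (b l) = beta j l"
    and W: "\<And>w l v. w permutes {1..n} \<Longrightarrow> l < k \<Longrightarrow> v \<in> N d \<Longrightarrow> h (W w (b l)) v = (\<Sum>j<k. rho w j l * h (b j) v)"
  shows "rep_roots n k rho (next_roots n c zs d)"
  unfolding rep_roots_def
proof
  interpret D: dunkl_form n k rho 0 cnj beta using E by (simp add: hermitian_rep_def)
  fix e :: "nat \<Rightarrow> complex" assume e: "e \<in> supported_on {..<k}"
  define f where "f e = (\<Sum>j<k. scale (e j) (b j))" for e
  have fN: "f e \<in> N d" for e unfolding f_def using b by (intro N_mem(5) N_mem(3)) auto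
  have fh: "h (f e) v = (\<Sum>j<k. e j * h (b j) v)" if "v \<in> N d" for e v
    unfolding f_def using b that by (intro hermitian_combination_left[OF herm]) auto
  have fz: "f (e - scale_fun z e') = f e - scale z (f e')" for e e' z
    by (simp add: f_def scale_fun_def scale_left_diff_distrib sum_subtractf scale_sum_right)
  have Zf: "h (Z (f e)) v = h (f (rep_sum n k rho e)) v" if v: "v \<in> N d" for e v
  proof -
    have "h (W (transpose i l) (f e)) v = (\<Sum>q<k. \<Sum>j<k. e q * (rho (transpose i l) j q * h (b j) v))"
      if il: "i \<in> {1..n}" "l \<in> {1..n} - {i}" for i l
    proof -
      note p = swap_permutes[OF il]
      have "W (transpose i l) (f e) = (\<Sum>q<k. scale (e q) (W (transpose i l) (b q)))"
        unfolding f_def by (simp only: W_sum[OF p] W_scale[OF p])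
      then have "h (W (transpose i l) (f e)) v = (\<Sum>q<k. e q * h (W (transpose i l) (b q)) v)"
        using hermitian_combination_left[OF herm, of "{..<k}" "\<lambda>q. W (transpose i l) (b q)" d v] W_mem[OF p b] v by simp
      then show ?thesis using W[OF p _ v] by (simp add: sum_distrib_left)
    qed
    then have "h (Z (f e)) v = (\<Sum>i\<in>{1..n}. \<Sum>l\<in>{1..n} - {i}. \<Sum>q<k. \<Sum>j<k. e q * (rho (transpose i l) j q * h (b j) v))"
      unfolding form_Z[OF fN v] by (intro sum.cong refl)
    also have "\<dots> = (\<Sum>q<k. \<Sum>j<k. \<Sum>i\<in>{1..n}. \<Sum>l\<in>{1..n} - {i}. e q * (rho (transpose i l) j q * h (b j) v))"
    proof -
      have "(\<Sum>i\<in>{1..n}. \<Sum>l\<in>{1..n} - {i}. \<Sum>q<k. \<Sum>j<k. e q * (rho (transpose i l) j q * h (b j) v)) =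
          (\<Sum>q<k. \<Sum>i\<in>{1..n}. \<Sum>l\<in>{1..n} - {i}. \<Sum>j<k. e q * (rho (transpose i l) j q * h (b j) v))"
        by (rule sum_swap_last)
      also have "\<dots> = (\<Sum>q<k. \<Sum>j<k. \<Sum>i\<in>{1..n}. \<Sum>l\<in>{1..n} - {i}. e q * (rho (transpose i l) j q * h (b j) v))"
        by (rule sum.cong[OF refl]) (rule sum_swap_last)
      finally show ?thesis .
    qed
    also have "\<dots> = (\<Sum>j<k. \<Sum>q<k. \<Sum>i\<in>{1..n}. \<Sum>l\<in>{1..n} - {i}. e q * (rho (transpose i l) j q * h (b j) v))"
      by (rule sum.swap)
    also have "\<dots> = h (f (rep_sum n k rho e)) v"
      unfolding fh[OF v] rep_sum_def by (simp only: sum_distrib_left sum_distrib_right mult_ac)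
    finally show ?thesis .
  qed
  have rf: "h (roots_op scale Z ys (f e)) v = h (f (roots_op scale_fun (rep_sum n k rho) ys e)) v"
    if "v \<in> N d" for ys v
    using that
  proof (induction ys arbitrary: v)
    case (Cons z ys)
    let ?r = "roots_op scale Z ys (f e)" and ?s = "roots_op scale_fun (rep_sum n k rho) ys e"
    have r: "?r \<in> N d" by (rule roots_op_mem[OF Z_add Z_scale subspace_N Z_mem fN])
    have "h (Z ?r) v = h ?r (Z v)" by (rule Z_adjoint[OF r Cons.prems])
    also have "\<dots> = h (f ?s) (Z v)" by (rule Cons.IH[OF Z_mem[OF Cons.prems]])
    also have "\<dots> = h (Z (f ?s)) v" by (rule Z_adjoint[OF fN Cons.prems, symmetric])
    also have "\<dots> = h (f (rep_sum n k rho ?s)) v" by (rule Zf[OF Cons.prems])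
    finally have 1: "h (Z ?r) v = h (f (rep_sum n k rho ?s)) v" .
    have "h (roots_op scale Z (z # ys) (f e)) v = h (Z ?r) v - z * h ?r v"
      using r Z_mem[OF r] N_mem(3)[OF r] Cons.prems
      by (simp add: hermitian_diff_left[OF herm, of _ d] hermitian_scale_left[OF herm, of _ d])
    also have "\<dots> = h (f (rep_sum n k rho ?s)) v - z * h (f ?s) v" using 1 Cons.IH[OF Cons.prems] by simp
    also have "\<dots> = h (f (rep_sum n k rho ?s) - scale z (f ?s)) v"
      using fN N_mem(3)[OF fN] Cons.prems
      by (simp add: hermitian_diff_left[OF herm, of _ d] hermitian_scale_left[OF herm, of _ d])
    finally show ?case by (simp only: roots_op_simps fz)
  qed simp
  let ?e = "roots_op scale_fun (rep_sum n k rho) (next_roots n c zs d) e"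
  have z: "h (f ?e) v = 0" if "v \<in> N d" for v
    unfolding rf[OF that, symmetric] using weights_next_roots[OF low zs fN] that by (simp add: radical_def)
  have "?e j = 0" if "j < k" for j
  proof -
    have "\<forall>l<k. (\<Sum>j<k. ?e j * beta j l) = 0"
    proof (intro allI impI)
      fix l assume l: "l < k"
      have "(\<Sum>j<k. ?e j * h (b j) (b l)) = 0" using z[OF b[OF l]] fh[OF b[OF l]] by simp
      then show "(\<Sum>j<k. ?e j * beta j l) = 0" using bb l by simp
    qed
    then show ?thesis using E that unfolding hermitian_rep_def by blast
  qed
  moreover have "?e \<in> supported_on {..<k}"
  proof -
    have "roots_op scale_fun (rep_sum n k rho) ys e \<in> supported_on {..<k}" for ys
      by (induction ys) (use e in \<open>auto simp: supported_on_def rep_sum_def scale_fun_def D.rho_zero\<close>)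
    then show ?thesis .
  qed
  ultimately have "?e j = 0" for j by (cases "j < k") (auto simp: supported_on_def)
  then show "?e = 0" by (simp add: fun_eq_iff)
qed

text \<open>If the form vanishes in the degree below \<open>m\<close>, the roots in degree
  \<open>m\<close> are \<open>next_roots\<close>. For \<open>m > D\<close> this list is empty and
  its product of factors the identity, which puts \<open>u\<close> itself in the radical.\<close>

lemma radical_everywhere:
  assumes zs: "weights zs" "c \<noteq> 0" and D: "\<And>d. d > D \<Longrightarrow> next_roots n c zs d = []"
    and low: "\<And>m u v. m \<le> D \<Longrightarrow> u \<in> N m \<Longrightarrow> v \<in> N m \<Longrightarrow> h u v = 0"
  shows "u \<in> N m \<Longrightarrow> v \<in> N m \<Longrightarrow> h u v = 0"
proof (induction m arbitrary: u v rule: less_induct)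
  case (less m)
  show ?case
  proof (cases "m \<le> D")
    case False
    have low': "h u v = 0" if "m \<noteq> 0" "u \<in> N (m - 1)" "v \<in> N (m - 1)" for u v
      by (rule less.IH[OF _ that(2,3)]) (use that(1) in simp)
    have "roots_op scale Z (next_roots n c zs m) u \<in> radical m"
      by (rule weights_next_roots[OF low' zs less.prems(1)])
    then show ?thesis using D[of m] False less.prems by (simp add: radical_def)
  qed (use low less in blast)
qed

end

text \<open>\<open>d\<close> is the lowest degree that may be nonzero. The submodule generated there
  contributes a shifted standard signature, known by \<open>H\<close>, and on the complement the
  form vanishes in degree \<open>d\<close> as well. Beyond degree \<open>D\<close> nothing is
  left.\<close>

theorem rational_character_cherednik_form:
  assumes c: "c \<noteq> 0"
    and D: "\<And>d. d > D \<Longrightarrow> next_roots n c zs d = []"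
    and H: "\<And>d k rho beta. d \<ge> 1 \<Longrightarrow> hermitian_rep n k rho beta \<Longrightarrow>
      rep_roots n k rho (next_roots n c zs d) \<Longrightarrow>
      rational_character n (standard_signature n c k rho beta)"
    and N: "cherednik_form scale n c X Y W N h" "cherednik_form.weights scale n c X Y W N h zs"
    and low: "d \<ge> 1" "\<And>m u v. m < d \<Longrightarrow> u \<in> N m \<Longrightarrow> v \<in> N m \<Longrightarrow> h u v = 0"
  shows "rational_character n (\<lambda>m. complex_space.signature scale (N m) h)"
  using N low
proof (induction "Suc D - d" arbitrary: d N)
  case 0
  interpret cherednik_form scale n c X Y W N h by fact
  have z: "h u v = 0" if uv: "u \<in> N m" "v \<in> N m" for u v m
  proof (rule radical_everywhere[OF 0(3) c D _ uv])
    fix m' u v assume "m' \<le> D" "u \<in> N m'" "v \<in> N m'"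
    moreover have "D < d" using 0(1) by simp
    ultimately show "h u v = 0" by (intro 0(5)[of m']) auto
  qed
  have "signature (N m) h = 0" for m
    by (rule signature_zero[OF herm]) (rule z)
  then show ?case by (simp add: rational_character_zero)
next
  case (Suc r)
  interpret cherednik_form scale n c X Y W N h by fact
  have low: "h u v = 0" if "d \<noteq> 0" "u \<in> N (d - 1)" "v \<in> N (d - 1)" for u v
    by (rule Suc.prems(4)[OF _ that(2,3)]) (use Suc.prems(3) in simp)
  have "\<exists>k b rho beta. bottom_basis d k b rho beta" by (rule bottom_rep) (rule low)
  then obtain k b rho beta where B: "bottom_basis d k b rho beta" by (elim exE)
  note E = bottom_basisD(1)[OF B] and b = bottom_basisD(2)[OF B] and bb = bottom_basisD(3)[OF B]
    and bW = bottom_basisD(4)[OF B] and br = bottom_basisD(5)[OF B]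
  have bY: "h (Y i (b j)) v = 0" if "d \<noteq> 0" "i \<in> {1..n}" "j < k" "v \<in> N (d - 1)" for i j v
  proof -
    have "Suc (d - 1) = d" using that(1) by simp
    then have "Y i (b j) \<in> N (d - 1)" using Y_mem[OF that(2), of "b j" "d - 1"] b[OF that(3)] by simp
    then show ?thesis using low[OF that(1) _ that(4)] by blast
  qed
  note dE = hermitian_rep_dunkl_form[OF E, of c]
  let ?N = "complement d k b"
  have sub: "?N m \<subseteq> N m" for m by (rule complement_subset[OF dE b bb bW bY])
  have cN: "cherednik_form scale n c X Y W ?N h"
    by (rule cherednik_form_complement[OF dE b bb bW bY low])
  interpret C: cherednik_form scale n c X Y W ?N h by (rule cN)
  have "rational_character n (standard_signature n c k rho beta)"
    using H[OF Suc.prems(3) E bottom_roots[OF low Suc.prems(2) c E b bb bW]] by simp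
  moreover have "rational_character n (\<lambda>m. signature (?N m) h)"
  proof (rule Suc.hyps(1)[of "Suc d"])
    show "r = Suc D - Suc d" using Suc.hyps(2) by simp
    show "cherednik_form scale n c X Y W ?N h" by (rule cN)
    \<comment> \<open>\<open>eu\<close> does not involve the spaces \<open>N\<close>, so its roots
      are inherited by the smaller ones.\<close>
    show "C.weights zs"
      unfolding C.weights_def
    proof (intro allI ballI)
      fix m u assume u: "u \<in> ?N m"
      let ?r = "roots_op scale eu (map (\<lambda>z. of_nat (2 * m) - of_real c * z) zs) u"
      have r: "?r \<in> ?N m" by (rule roots_op_mem[OF eu_add eu_scale C.subspace_N C.eu_mem u])
      have "?r \<in> radical m" using Suc.prems(2) u sub[of m] unfolding weights_def by blast
      then have "h ?r v = 0" if "v \<in> ?N m" for v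
        using that sub[of m] unfolding radical_def by blast
      with r show "?r \<in> C.radical m" unfolding C.radical_def by blast
    qed
    \<comment> \<open>In degree \<open>d\<close> the complement is orthogonal to every
      \<open>b j\<close>, the extension of a unit vector, hence lies in the radical.\<close>
    show "h u v = 0" if "m < Suc d" "u \<in> ?N m" "v \<in> ?N m" for m u v
    proof (cases "m = d")
      case True
      have "extension k b 0 (unit_vector (\<lambda>_. 0, j)) = b j" if "j < k" for j
      proof -
        have "extension k b 0 (unit_vector (\<lambda>_. 0, j)) = (\<Sum>l<k. if l = j then b l else 0)"
          unfolding extension_base by (intro sum.cong) (auto simp: unit_vector_def)
        then show ?thesis using that by simp
      qed
      moreover have "(unit_vector (\<lambda>_. 0, j) :: complex vec_poly) \<in> hpart n k 0" if "j < k" for j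
        using that by (auto simp: supported_on_def unit_vector_def monomial_indices_def exponents_def)
      ultimately have "h u (b j) = 0" if "j < k" for j
        using complementD[OF dE b bb bW bY, of u 0 "unit_vector (\<lambda>_. 0, j)"] \<open>u \<in> ?N m\<close> True that by simp
      moreover have uv: "u \<in> N d" "v \<in> N d" using that(2,3) sub[of d] True by auto
      ultimately have "u \<in> radical d" by (intro br)
      then show ?thesis using uv by (simp add: radical_def)
    next
      case False
      then have "m < d" using that(1) by simp
      then show ?thesis using Suc.prems(4)[of m u v] that(2,3) sub[of m] by blast
    qed
  qed simp
  ultimately have "rational_character n (\<lambda>m. signature (?N m) h +
      (if m < d then 0 else standard_signature n c k rho beta (m - d)))"
    by (intro rational_character_add rational_character_shift)
  then show ?case using signature_complement[OF dE b bb bW bY] by simp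
qed

section \<open>Jantzen filtration of a standard module\<close>

lemma (in complex_space) signature_cong:
  assumes "hermitian_on N h" "finite_rank N h r" "\<And>u v. u \<in> N \<Longrightarrow> v \<in> N \<Longrightarrow> h' u v = h u v"
  shows "hermitian_on N h'" "finite_rank N h' r" "signature N h' = signature N h"
proof -
  note S = hermitian_mem[OF assms(1)]
  show h': "hermitian_on N h'"
    unfolding hermitian_on_def
  proof (intro conjI ballI allI)
    show "subspace N" by (rule hermitian_subspace[OF assms(1)])
    show "h' (u + v) w = h' u w + h' v w" if "u \<in> N" "v \<in> N" "w \<in> N" for u v w
      using that S(2) assms(3) hermitian_add_left[OF assms(1)] by simp
    show "h' (scale a u) v = a * h' u v" if "u \<in> N" "v \<in> N" for a u v
      using that S(3) assms(3) hermitian_scale_left[OF assms(1)] by simp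
    show "h' v u = cnj (h' u v)" if "u \<in> N" "v \<in> N" for u v
      unfolding assms(3)[OF that] assms(3)[OF that(2,1)] by (rule hermitian_sym[OF assms(1) that])
  qed
  show "finite_rank N h' r"
    unfolding finite_rank_def
  proof (intro allI impI)
    fix b :: "nat \<Rightarrow> 'v" assume b: "\<forall>i\<le>r. b i \<in> N"
    then obtain q where q: "\<exists>i\<le>r. q i \<noteq> 0" "\<And>v. v \<in> N \<Longrightarrow> h (\<Sum>i\<le>r. scale (q i) (b i)) v = 0"
      using assms(2) unfolding finite_rank_def by blast
    have "(\<Sum>i\<le>r. scale (q i) (b i)) \<in> N" using b S(3) by (intro S(5)) auto
    then show "\<exists>q. (\<exists>i\<le>r. q i \<noteq> 0) \<and> (\<forall>v\<in>N. h' (\<Sum>i\<le>r. scale (q i) (b i)) v = 0)"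
      using q assms(3) by (intro exI[of _ q]) auto
  qed
  show "signature N h' = signature N h"
    by (rule signature_isometry[OF _ _ assms(1) h' assms(2), of "\<lambda>u. u"])
       (use assms(3) complex_space_axioms in auto)
qed

lemma hpart_unique:
  assumes "u \<in> hpart n k m" "u \<in> hpart n k m'" "u p \<noteq> 0"
  shows "m = m'"
proof -
  have "p \<in> monomial_indices n k m" "p \<in> monomial_indices n k m'"
    using assms unfolding supported_on_def by blast+
  then show ?thesis by (auto simp: monomial_indices_def)
qed

text \<open>\<open>cherednik_form\<close> demands one form for all degrees, whereas
  \<open>form\<close> is indexed by the degree. The index is recovered from the first argument,
  where it is unique unless the vector is 0 and the form too.\<close>

definition hdegree :: "nat \<Rightarrow> nat \<Rightarrow> 'r::zero vec_poly \<Rightarrow> nat" where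
  "hdegree n k u = (SOME m. u \<in> hpart n k m)"

lemma (in dunkl_form) form_hdegree:
  assumes "u \<in> V m"
  shows "form (hdegree n k u) u v = form m u v"
proof (cases "\<exists>p. u p \<noteq> 0")
  case True
  have "u \<in> V (hdegree n k u)" unfolding hdegree_def using assms by (rule someI)
  then show ?thesis using hpart_unique[OF _ assms] True by blast
next
  case False
  then have "u = (\<lambda>p. 0)" by auto
  then show ?thesis by (simp add: form_zero_left)
qed

lemma (in dunkl_form) form_W_left:
  assumes w: "w permutes {1..n}" and uv: "u \<in> V m" "v \<in> V m"
  shows "form m (opW w u) v = form m u (opW (inv_into UNIV w) v)"
proof -
  note wi = permutes_inv[OF w]
  have "opW w (opW (inv_into UNIV w) v) = v"
    using W_comp[OF w wi, of v] W_id[OF uv(2)] permutes_inv_o(1)[OF w] by simp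
  then show ?thesis using form_W[OF w uv(1) W_hpart[OF wi uv(2)]] by simp
qed

lemma rep_roots_central:
  assumes "hermitian_rep n k rho beta"
  shows "rep_roots n k rho (central_roots n)"
  unfolding rep_roots_def
proof
  interpret D: dunkl_form n k rho 0 cnj beta using assms by (simp add: hermitian_rep_def)
  fix e :: "nat \<Rightarrow> complex" assume e: "e \<in> supported_on {..<k}"
  let ?W = "\<lambda>w e j. \<Sum>q<k. rho w j q * e q"
  show "roots_op scale_fun (rep_sum n k rho) (central_roots n) e = 0"
  proof (rule fun_space.roots_op_central[where W = ?W])
    show "?W w (u + v) = ?W w u + ?W w v" for w u v
      by (auto simp: fun_eq_iff algebra_simps sum.distrib)
    show "?W w (scale_fun a u) = scale_fun a (?W w u)" for w a u
      by (auto simp: fun_eq_iff scale_fun_def algebra_simps sum_distrib_left)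
    show "?W (v \<circ> w) u = ?W v (?W w u)" if "v permutes {1..n}" "w permutes {1..n}" for v w u
    proof
      fix j
      show "?W (v \<circ> w) u j = ?W v (?W w u) j"
      proof (cases "j < k")
        case True
        have "?W v (?W w u) j = (\<Sum>q<k. \<Sum>l<k. rho v j q * (rho w q l * u l))" by (simp add: sum_distrib_left)
        also have "\<dots> = (\<Sum>l<k. rho (v \<circ> w) j l * u l)"
          by (subst sum.swap) (simp add: D.rho_comp[OF that True] sum_distrib_right mult.assoc)
        finally show ?thesis by simp
      qed (simp add: D.rho_zero)
    qed
    show "rep_sum n k rho u = (\<Sum>i\<in>{1..n}. \<Sum>l\<in>{1..n} - {i}. ?W (transpose i l) u)" for u
      unfolding rep_sum_def fun_eq_iff sum_fun_apply
      by (simp only: sum_distrib_right sum_swap_last) simp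
    show "?W id e = e"
    proof
      fix j
      show "?W id e j = e j"
      proof (cases "j < k")
        case True
        have "(\<Sum>q<k. rho id j q * e q) = (\<Sum>q<k. if q = j then e q else 0)"
          using True by (intro sum.cong) (auto simp: D.rho_id)
        then show ?thesis using True by simp
      qed (use e in \<open>simp add: D.rho_zero supported_on_def\<close>)
    qed
  qed
qed

locale jantzen_setup =
  fixes n k :: nat and rho :: "(nat \<Rightarrow> nat) \<Rightarrow> nat \<Rightarrow> nat \<Rightarrow> complex" and beta :: "nat \<Rightarrow> nat \<Rightarrow> complex"
    and t s :: real
  assumes rep: "hermitian_rep n k rho beta"
begin

text \<open>The parameter runs through \<open>t (s + x)\<close>, where \<open>x\<close> is the polynomial variable.\<close>

definition rhoP where "rhoP w j l = [:rho w j l:]"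
definition betaP where "betaP j l = [:beta j l:]"
definition cP where "cP = [:complex_of_real (t * s), complex_of_real t:]"

lemma const_sum: "(\<Sum>i\<in>A. [:f i:]) = [:\<Sum>i\<in>A. f i:]" for f :: "'a \<Rightarrow> complex"
  by (induction A rule: infinite_finite_induct) auto

lemma cnj_const: "cnj_poly [:a:] = [:cnj a:]"
  by (cases "a = 0") (simp_all add: map_poly_pCons)

sublocale C: dunkl_form n k rho "complex_of_real c" cnj beta for c
  by (rule hermitian_rep_dunkl_form[OF rep])

sublocale P: dunkl_form n k rhoP cP cnj_poly betaP
proof
  interpret D: dunkl_form n k rho 0 cnj beta using rep by (simp add: hermitian_rep_def)
  show "rhoP w j l = 0" if "k \<le> j" for w j l using that by (simp add: rhoP_def D.rho_zero)
  show "rhoP id j l = (if j = l then 1 else 0)" if "j < k" "l < k" for j l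
    using that by (simp add: rhoP_def D.rho_id)
  show "rhoP (v \<circ> w) j l = (\<Sum>q<k. rhoP v j q * rhoP w q l)"
    if "v permutes {1..n}" "w permutes {1..n}" "j < k" "l < k" for v w j l
    using D.rho_comp[OF that] by (simp add: rhoP_def const_sum mult.commute)
  show "cnj_poly cP = cP"
    by (rule poly_eqI) (simp add: cP_def coeff_map_poly coeff_pCons split: nat.split)
  show "betaP l j = cnj_poly (betaP j l)" if "j < k" "l < k" for j l
    unfolding betaP_def cnj_const using D.beta_sym[OF that] by simp
  show "(\<Sum>p<k. \<Sum>q<k. rhoP w p j * betaP p q * cnj_poly (rhoP w q l)) = betaP j l"
    if "w permutes {1..n}" "j < k" "l < k" for w j l
    using D.beta_inv[OF that] by (simp add: rhoP_def betaP_def cnj_const const_sum mult_ac)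
qed simp_all

section \<open>Evaluation of the polynomial family at a real parameter\<close>

abbreviation ev where "ev x \<equiv> eval_vector (complex_of_real x)"

lemma ev_mult_x: "ev x (mult_x i u) = mult_x i (ev x u)"
  by (auto simp: eval_vector_def mult_x_def fun_eq_iff)

lemma ev_div_diff: "ev x (div_diff i l u) = div_diff i l (ev x u)"
  by (auto simp: eval_vector_def div_diff_def fun_eq_iff poly_sum)

lemma ev_W: "ev x (P.opW w u) = C.opW w (ev x u)"
  by (auto simp: eval_vector_def P.opW_def C.opW_def fun_eq_iff poly_sum rhoP_def)

lemma ev_R: "ev x (P.opR w u) = C.opR w (ev x u)"
  by (auto simp: eval_vector_def P.opR_def C.opR_def fun_eq_iff poly_sum rhoP_def)

lemma ev_Y: "ev x (P.opY i u) = dunkl.opY n k rho (complex_of_real (t * (s + x))) i (ev x u)"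
proof
  fix p :: "(nat \<Rightarrow> nat) \<times> nat"
  obtain a j where p: "p = (a, j)" by (cases p)
  have "poly (P.opR (transpose i l) (div_diff i l u) (a, j)) (complex_of_real x) =
      C.opR (transpose i l) (div_diff i l (ev x u)) (a, j)" for l
    using fun_cong[OF ev_R[of x "transpose i l" "div_diff i l u"], of "(a, j)"]
    unfolding ev_div_diff by (simp add: eval_vector_def)
  moreover have "poly cP (complex_of_real x) = complex_of_real (t * (s + x))"
    by (simp add: cP_def algebra_simps)
  ultimately show "ev x (P.opY i u) p = dunkl.opY n k rho (complex_of_real (t * (s + x))) i (ev x u) p"
    by (simp add: p eval_vector_def P.opY_def C.opY_def poly_sum del: of_real_mult of_real_add)
qed

lemma ev_descend: "poly (P.descend m a v q) (complex_of_real x) =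
    dunkl_form.descend n k rho (complex_of_real (t * (s + x))) m a (ev x v) q"
proof (induction m arbitrary: a v)
  case (Suc m)
  show ?case unfolding P.descend.simps C.descend.simps Let_def Suc.IH ev_Y ..
next
  case 0
  show ?case unfolding P.descend.simps(1) C.descend.simps(1) eval_vector_def ..
qed

lemma ev_form: "poly (P.form m u v) (complex_of_real x) = standard_form n (t * (s + x)) k rho beta m (ev x u) (ev x v)"
  unfolding standard_form_def P.form_def C.form_def
  by (simp add: poly_sum case_prod_unfold betaP_def ev_descend) (simp add: eval_vector_def)

lemma ev_hpart: "u \<in> P.V m \<Longrightarrow> ev x u \<in> C.V m"
  by (simp add: supported_on_def eval_vector_def)

lemma poly_hermitian_gram: "poly_hermitian (monomial_indices n k m) (P.gram m)"
  by unfold_locales (rule finite_monomial_indices, rule P.gram_sym)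

lemma eval_form_gram:
  assumes "u \<in> C.V m" "v \<in> C.V m"
  shows "eval_form (monomial_indices n k m) (P.gram m) x u v = standard_form n (t * (s + x)) k rho beta m u v"
proof -
  have "ev x (unit_vector p) = unit_vector p" for p :: "(nat \<Rightarrow> nat) \<times> nat"
    by (auto simp: eval_vector_def unit_vector_def)
  then have "poly (P.gram m p q) (complex_of_real x) = dunkl_form.gram n k rho (complex_of_real (t * (s + x))) cnj beta m p q" for p q
    unfolding P.gram_def ev_form C.gram_def by (simp add: standard_form_def)
  then show ?thesis
    unfolding eval_form_def standard_form_def C.form_eq_matrix_form[OF assms] by simp
qed

lemma signature_gram:
  "fun_space.signature (hpart n k m) (eval_form (monomial_indices n k m) (P.gram m) x) =
   standard_signature n (t * (s + x)) k rho beta m"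
  unfolding standard_signature_def
  by (rule fun_space.signature_cong(3)[OF hermitian_on_standard[OF hermitian_rep_dunkl_form[OF rep]]
        finite_rank_supported_on[OF finite_monomial_indices hermitian_on_standard[OF hermitian_rep_dunkl_form[OF rep]]] eval_form_gram])

section \<open>Layers of the filtration as graded modules\<close>

definition jan :: "nat \<Rightarrow> nat \<Rightarrow> complex poly vec_poly set" where
  "jan r m = poly_hermitian.jantzen (monomial_indices n k m) (P.gram m) r"

definition jan_form :: "nat \<Rightarrow> complex poly vec_poly \<Rightarrow> complex poly vec_poly \<Rightarrow> complex" where
  "jan_form r u v = coeff (P.form (hdegree n k u) u v) r"

lemma jan_iff: "u \<in> jan r m \<longleftrightarrow> u \<in> P.V m \<and> (\<forall>v\<in>P.V m. [:0, 1:] ^ r dvd P.form m u v)"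
  unfolding jan_def poly_hermitian.jantzen_def[OF poly_hermitian_gram]
  using P.form_eq_matrix_form by auto

lemma jan_form_eq: "u \<in> P.V m \<Longrightarrow> jan_form r u v = coeff (P.form m u v) r"
  by (simp add: jan_form_def P.form_hdegree)

lemma jan_form_jantzen_form:
  "u \<in> jan r m \<Longrightarrow> v \<in> jan r m \<Longrightarrow>
    jan_form r u v = poly_hermitian.jantzen_form (monomial_indices n k m) (P.gram m) r u v"
  unfolding poly_hermitian.jantzen_form_def[OF poly_hermitian_gram]
  using jan_form_eq P.form_eq_matrix_form by (auto simp: jan_iff)

lemma jan_cong:
  "poly_space.hermitian_on (jan r m) (jan_form r)"
  "\<exists>q. poly_space.finite_rank (jan r m) (jan_form r) q"
  "poly_space.signature (jan r m) (jan_form r) = poly_space.signature (jan r m)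
     (poly_hermitian.jantzen_form (monomial_indices n k m) (P.gram m) r)"
proof -
  note H = poly_hermitian.hermitian_on_jantzen[OF poly_hermitian_gram, folded jan_def, of r m]
  obtain q where q: "poly_space.finite_rank (jan r m) (poly_hermitian.jantzen_form (monomial_indices n k m) (P.gram m) r) q"
    using poly_hermitian.finite_rank_jantzen[OF poly_hermitian_gram, folded jan_def] by blast
  note C = poly_space.signature_cong[OF H q jan_form_jantzen_form]
  show "poly_space.hermitian_on (jan r m) (jan_form r)" by (rule C(1))
  show "\<exists>q. poly_space.finite_rank (jan r m) (jan_form r) q" by (rule exI, rule C(2))
  show "poly_space.signature (jan r m) (jan_form r) = poly_space.signature (jan r m)
     (poly_hermitian.jantzen_form (monomial_indices n k m) (P.gram m) r)" by (rule C(3))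
qed

lemma jan_form_eval_zero:
  "u \<in> jan r m \<Longrightarrow> ev 0 u = 0 \<Longrightarrow> v \<in> jan r m \<Longrightarrow> jan_form r u v = 0"
  using jan_form_jantzen_form poly_hermitian.jantzen_form_eval_zero[OF poly_hermitian_gram, folded jan_def]
  by simp

lemma jan_W:
  assumes w: "w permutes {1..n}" and u: "u \<in> jan r m"
  shows "P.opW w u \<in> jan r m"
proof -
  have uV: "u \<in> P.V m" using u by (simp add: jan_iff)
  have "[:0, 1:] ^ r dvd P.form m (P.opW w u) v" if "v \<in> P.V m" for v
    using u P.W_hpart[OF permutes_inv[OF w] that] unfolding P.form_W_left[OF w uV that] by (simp add: jan_iff)
  then show ?thesis using P.W_hpart[OF w uV] by (simp add: jan_iff)
qed

text \<open>On step \<open>r\<close> all form values have order at least \<open>r\<close>, so in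
  coefficient \<open>r\<close> the polynomial parameter \<open>cP\<close> acts by its constant term:
  the layer is a module for the parameter \<open>t * s\<close>.\<close>

lemma cherednik_form_jan: "cherednik_form scale_poly n (t * s) mult_x P.opY P.opW (jan r) (jan_form r)"
proof unfold_locales
  have sc: "scale_poly a u = (\<lambda>p. [:a:] * u p)" for a and u :: "complex poly vec_poly"
    by (auto simp: scale_poly_def)
  have V: "u \<in> P.V m" if "u \<in> jan r m" for u m using that by (simp add: jan_iff)
  show "poly_space.hermitian_on (jan r m) (jan_form r)" for m by (rule jan_cong(1))
  show "\<exists>q. poly_space.finite_rank (jan r m) (jan_form r) q" for m by (rule jan_cong(2))
  show "mult_x i (u + v) = mult_x i u + mult_x i v" for i and u v :: "complex poly vec_poly"
    using P.x_add[of i u v] by (simp add: plus_fun_def)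
  show "mult_x i (scale_poly a u) = scale_poly a (mult_x i u)" for i a and u :: "complex poly vec_poly"
    unfolding sc by (rule P.x_scale)
  show "P.opY i (u + v) = P.opY i u + P.opY i v" for i u v
    using P.Y_add[of i u v] by (simp add: plus_fun_def)
  show "P.opY i (scale_poly a u) = scale_poly a (P.opY i u)" for i a u
    unfolding sc by (rule P.Y_scale)
  show "P.opW w (u + v) = P.opW w u + P.opW w v" for w u v
    using P.W_add[of w u v] by (simp add: plus_fun_def)
  show "P.opW w (scale_poly a u) = scale_poly a (P.opW w u)" for w a u
    unfolding sc by (rule P.W_scale)
  show "mult_x i u \<in> jan r (Suc m)" if "i \<in> {1..n}" "u \<in> jan r m" for i u m
    using that mult_x_hpart[OF that(1) V[OF that(2)]] P.form_x_left[OF that(1)] P.Y_hpart[OF that(1)]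
    by (auto simp: jan_iff)
  show "P.opY i u \<in> jan r m" if "i \<in> {1..n}" "u \<in> jan r (Suc m)" for i u m
  proof -
    have "[:0, 1:] ^ r dvd P.form m (P.opY i u) v" if v: "v \<in> P.V m" for v
      using \<open>u \<in> jan r (Suc m)\<close> mult_x_hpart[OF \<open>i \<in> {1..n}\<close> v]
      unfolding P.form_Y_left[OF V[OF \<open>u \<in> jan r (Suc m)\<close>] v \<open>i \<in> {1..n}\<close>] by (simp add: jan_iff)
    then show ?thesis using P.Y_hpart[OF that(1) V[OF that(2)]] by (simp add: jan_iff)
  qed
  show "P.opY i u = 0" if "i \<in> {1..n}" "u \<in> jan r 0" for i u
    using P.Y_hpart_zero[OF that(1) V[OF that(2)]] by (simp add: zero_fun_def)
  show "P.opW w u \<in> jan r m" if "w permutes {1..n}" "u \<in> jan r m" for w u m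
    using that by (rule jan_W)
  show "jan_form r (mult_x i u) v = jan_form r u (P.opY i v)"
    if "i \<in> {1..n}" "u \<in> jan r m" "v \<in> jan r (Suc m)" for i u v m
    using jan_form_eq[OF mult_x_hpart[OF that(1) V[OF that(2)]]] jan_form_eq[OF V[OF that(2)]]
      P.form_x_left[OF that(1) V[OF that(3)]] by simp
  show "jan_form r (P.opW w u) (P.opW w v) = jan_form r u v"
    if "w permutes {1..n}" "u \<in> jan r m" "v \<in> jan r m" for w u v m
    using jan_form_eq[OF P.W_hpart[OF that(1) V[OF that(2)]]] jan_form_eq[OF V[OF that(2)]]
      P.form_W[OF that(1) V[OF that(2)] V[OF that(3)]] by simp
  show "P.opW (w' \<circ> w) u = P.opW w' (P.opW w u)" if "w' permutes {1..n}" "w permutes {1..n}" for w' w u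
    using that by (rule P.W_comp)
  show "P.opW id u = u" if "u \<in> jan r m" for u m using V[OF that] by (rule P.W_id)
  show "mult_x i (mult_x l u) = mult_x l (mult_x i u)" for i l and u :: "complex poly vec_poly"
    by (rule P.mult_x_commute)
  show "P.opW w (mult_x i u) = mult_x (w i) (P.opW w u)" if "w permutes {1..n}" for w i u
    using that by (rule P.W_x)
  fix i l u v m assume i: "i \<in> {1..n}" and l: "l \<in> {1..n}" and u: "u \<in> jan r m" and v: "v \<in> jan r m"
  have cc: "coeff (cP * P.form m x v) r = complex_of_real (t * s) * coeff (P.form m x v) r" if "x \<in> jan r m" for x
  proof -
    have "[:0, 1:] ^ r dvd P.form m x v" using that V[OF v] by (simp add: jan_iff)
    then show ?thesis using coeff_mult_X_dvd[of r "P.form m x v" cP] by (simp add: cP_def)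
  qed
  have Ws: "P.opW (transpose i q) u \<in> jan r m" if "q \<in> {1..n} - {i}" for q
    using that i by (intro jan_W[OF _ u] permutes_swap_id) auto
  have YV: "mult_x l (P.opY i u) \<in> P.V m"
  proof (cases m)
    case 0
    then have "P.opY i u = (\<lambda>p. 0)" using P.Y_hpart_zero[OF i] V[OF u] by simp
    then show ?thesis by (auto simp: supported_on_def mult_x_def)
  next
    case (Suc m')
    then show ?thesis using mult_x_hpart[OF l P.Y_hpart[OF i, of u m']] V[OF u] by simp
  qed
  have "jan_form r (P.opY i (mult_x l u)) v = coeff (P.form m (P.opY i (mult_x l u)) v) r"
    by (rule jan_form_eq[OF P.Y_hpart[OF i mult_x_hpart[OF l V[OF u]]]])
  also have "\<dots> = jan_form r (mult_x l (P.opY i u)) v + coeff (P.form m (P.comm i l u) v) r"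
    unfolding P.YX[OF l] P.form_add_left jan_form_eq[OF YV] by simp
  also have "coeff (P.form m (P.comm i l u) v) r = (if i = l
        then jan_form r u v - of_real (t * s) * (\<Sum>q\<in>{1..n} - {i}. jan_form r (P.opW (transpose i q) u) v)
        else of_real (t * s) * jan_form r (P.opW (transpose i l) u) v)"
  proof (cases "i = l")
    case True
    have "P.form m (P.comm i i u) v = P.form m u v - (\<Sum>q\<in>{1..n} - {i}. cP * P.form m (P.opW (transpose i q) u) v)"
      by (simp add: P.comm_def P.form_diff_left P.form_scale_left P.form_sum_left' sum_distrib_left)
    then have "coeff (P.form m (P.comm i i u) v) r = coeff (P.form m u v) r -
        (\<Sum>q\<in>{1..n} - {i}. complex_of_real (t * s) * coeff (P.form m (P.opW (transpose i q) u) v) r)"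
      using cc[OF Ws] by (simp add: coeff_sum)
    then show ?thesis
      using True jan_form_eq[OF V[OF u]] jan_form_eq[OF V[OF Ws]] by (simp add: sum_distrib_left)
  next
    case False
    then have "l \<in> {1..n} - {i}" using l by auto
    then show ?thesis
      using False cc[OF Ws] jan_form_eq[OF V[OF Ws]] by (simp add: P.comm_def P.form_scale_left)
  qed
  finally show "jan_form r (P.opY i (mult_x l u)) v = jan_form r (mult_x l (P.opY i u)) v + (if i = l
        then jan_form r u v - of_real (t * s) * (\<Sum>q\<in>{1..n} - {i}. jan_form r (P.opW (transpose i q) u) v)
        else of_real (t * s) * jan_form r (P.opW (transpose i l) u) v)" .
qed

text \<open>Evaluated at 0, the Euler operator becomes \<open>A m\<close> by \<open>euler\<close>,
  and its factors become \<open>- c\<close> times those of the class sum on the coefficients, with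
  \<open>c = t * s\<close>. The product therefore vanishes at 0, and such vectors lie in the radical
  of the layer.\<close>

lemma jan_weights:
  assumes zs: "rep_roots n k rho zs"
  shows "cherednik_form.weights scale_poly n (t * s) mult_x P.opY P.opW (jan r) (jan_form r) zs"
proof -
  interpret J: cherednik_form scale_poly n "t * s" mult_x P.opY P.opW "jan r" "jan_form r"
    by (rule cherednik_form_jan)
  let ?c = "complex_of_real (t * s)"
  define A where "A m w = (\<lambda>(a, j). of_nat (2 * m) * w (a, j) - ?c * rep_sum n k rho (\<lambda>q. w (a, q)) j)"
    for m and w :: "complex vec_poly"
  have T: "dunkl.opT n k rho w (a, j) = rep_sum n k rho (\<lambda>q. w (a, q)) j" for w a j
    unfolding C.opT_def C.opR_def rep_sum_def by (simp only: prod.case sum_distrib_right sum_swap_last)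
  have ev_eu: "ev 0 (J.eu u) = A m (ev 0 u)" if "u \<in> P.V m" for u m
  proof
    fix p :: "(nat \<Rightarrow> nat) \<times> nat"
    obtain a j where p: "p = (a, j)" by (cases p)
    have "ev 0 (J.eu u) p = 2 * (\<Sum>i\<in>{1..n}. ev 0 (mult_x i (P.opY i u)) p) -
        ?c * (\<Sum>i\<in>{1..n}. \<Sum>l\<in>{1..n} - {i}. ev 0 (P.opW (transpose i l) u) p)"
      by (simp add: J.eu_def J.Z_def eval_vector_def scale_poly_def sum_fun_apply poly_sum)
    also have "\<dots> = 2 * (\<Sum>i\<in>{1..n}. mult_x i (dunkl.opY n k rho ?c i (ev 0 u)) p) - ?c * C.opZ (ev 0 u) p"
      unfolding ev_mult_x ev_W ev_Y C.opZ_def by simp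
    also have "\<dots> = of_nat (2 * m) * ev 0 u p - ?c * C.opT (ev 0 u) p"
      by (rule C.euler[OF ev_hpart[OF that]])
    finally show "ev 0 (J.eu u) p = A m (ev 0 u) p" unfolding p A_def T by simp
  qed
  have roots_A: "roots_op scale_fun (A m) (map (\<lambda>z. of_nat (2 * m) - ?c * z) ys) w =
      (\<lambda>(a, j). (- ?c) ^ length ys * roots_op scale_fun (rep_sum n k rho) ys (\<lambda>q. w (a, q)) j)" for m ys w
  proof (induction ys)
    case (Cons y ys)
    have "rep_sum n k rho (\<lambda>q. r * e q) j = r * rep_sum n k rho e j" for r e j
      by (simp add: rep_sum_def sum_distrib_left mult_ac)
    then show ?case
      unfolding list.map roots_op_simps Cons
      by (auto simp: A_def scale_fun_def fun_eq_iff algebra_simps)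
  qed auto
  show ?thesis
    unfolding J.weights_def
  proof (intro allI ballI)
    fix m u assume u: "u \<in> jan r m"
    let ?L = "map (\<lambda>z. of_nat (2 * m) - ?c * z) zs"
    have mem: "roots_op scale_poly J.eu ys u \<in> jan r m" for ys
      by (rule poly_space.roots_op_mem[OF J.eu_add J.eu_scale J.subspace_N J.eu_mem u])
    have e: "ev 0 (roots_op scale_poly J.eu ys u) = roots_op scale_fun (A m) ys (ev 0 u)" for ys
    proof (induction ys)
      case (Cons y ys)
      have "roots_op scale_poly J.eu ys u \<in> P.V m" using mem by (simp add: jan_iff)
      then have "ev 0 (J.eu (roots_op scale_poly J.eu ys u)) = A m (roots_op scale_fun (A m) ys (ev 0 u))"
        using ev_eu Cons by simp
      moreover have "ev 0 (f - scale_poly y g) = ev 0 f - scale_fun y (ev 0 g)" for f g :: "complex poly vec_poly"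
        by (auto simp: fun_eq_iff eval_vector_def scale_poly_def scale_fun_def)
      ultimately show ?case by (simp only: roots_op_simps Cons)
    qed simp
    have "(\<lambda>q. ev 0 u (a, q)) \<in> supported_on {..<k}" for a
      using ev_hpart[of u m 0] u by (auto simp: jan_iff supported_on_def monomial_indices_def)
    then have "roots_op scale_fun (rep_sum n k rho) zs (\<lambda>q. ev 0 u (a, q)) = 0" for a
      using zs unfolding rep_roots_def by blast
    then have "ev 0 (roots_op scale_poly J.eu ?L u) = 0"
      unfolding e roots_A by (auto simp: fun_eq_iff)
    from jan_form_eval_zero[OF mem this] mem show "roots_op scale_poly J.eu ?L u \<in> J.radical m"
      unfolding J.radical_def by blast
  qed
qed

text \<open>In degree 0 the form is \<open>beta\<close>, constant in the parameter and
  nondegenerate; order at least 1 therefore forces the value at 0 to vanish. This is why layers of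
  positive index start in positive degree.\<close>

lemma jan_bottom:
  assumes "r \<ge> 1" "u \<in> jan r 0" "v \<in> jan r 0"
  shows "jan_form r u v = 0"
proof (rule jan_form_eval_zero[OF assms(2) _ assms(3)])
  have uV: "u \<in> P.V 0" using assms(2) by (simp add: jan_iff)
  have "\<forall>l<k. (\<Sum>j<k. ev 0 u (\<lambda>_. 0, j) * beta j l) = 0"
  proof (intro allI impI)
    fix l assume l: "l < k"
    let ?v = "unit_vector (\<lambda>_. 0, l) :: complex poly vec_poly"
    have v: "?v \<in> P.V 0" using l by (auto simp: supported_on_def unit_vector_def monomial_indices_def exponents_def)
    have "[:0, 1:] ^ r dvd P.form 0 u ?v" using assms(2) v by (simp add: jan_iff)
    then have "poly (P.form 0 u ?v) 0 = 0" using assms(1) by (auto elim!: dvdE simp: poly_power)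
    then have "standard_form n (t * s) k rho beta 0 (ev 0 u) (ev 0 ?v) = 0"
      using ev_form[of 0 u ?v 0] by simp
    moreover have "ev 0 ?v (\<lambda>_. 0, q) = (if q = l then 1 else 0)" for q
      by (simp add: eval_vector_def unit_vector_def)
    ultimately have "(\<Sum>j<k. \<Sum>q<k. ev 0 u (\<lambda>_. 0, j) * beta j q * (if q = l then 1 else 0)) = 0"
      unfolding standard_form_def C.form_base by (simp only: if_distrib[of cnj] complex_cnj_one complex_cnj_zero)
    moreover have "(\<Sum>q<k. x * beta j q * (if q = l then 1 else 0)) = x * beta j l" for x j
    proof -
      have "(\<Sum>q<k. x * beta j q * (if q = l then 1 else 0)) = (\<Sum>q<k. if q = l then x * beta j l else 0)"
        by (rule sum.cong) auto
      then show ?thesis using l by simp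
    qed
    ultimately show "(\<Sum>j<k. ev 0 u (\<lambda>_. 0, j) * beta j l) = 0" by simp
  qed
  then have z: "ev 0 u (\<lambda>_. 0, j) = 0" if "j < k" for j
    using rep[unfolded hermitian_rep_def, THEN conjunct2, rule_format, of "\<lambda>j. ev 0 u (\<lambda>_. 0, j)"] that by simp
  have "ev 0 u (a, j) = 0" for a j
  proof (rule ccontr)
    assume nz: "ev 0 u (a, j) \<noteq> 0"
    then have "a = (\<lambda>_. 0)" by (rule C.hpart_zeroD[OF ev_hpart[OF uV]])
    moreover have "(a, j) \<in> monomial_indices n k 0" using nz ev_hpart[OF uV] unfolding supported_on_def by blast
    then have "j < k" by (simp add: monomial_indices_def)
    ultimately show False using z nz by simp
  qed
  then show "ev 0 u = 0" by (auto simp: fun_eq_iff)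
qed

abbreviation jan_signature where
  "jan_signature r m \<equiv> poly_space.signature (jan r m) (jan_form r)"

lemma jan_sum_formula:
  "\<exists>d>0. \<exists>K. (\<forall>x. x \<noteq> 0 \<longrightarrow> \<bar>x\<bar> < d \<longrightarrow> standard_signature n (t * (s + x)) k rho beta m =
        (\<Sum>r\<le>K. (if x < 0 then - 1 else 1) ^ r * jan_signature r m)) \<and>
     standard_signature n (t * s) k rho beta m = jan_signature 0 m \<and>
     (\<forall>r>K. \<forall>u\<in>jan r m. \<forall>v\<in>jan r m. jan_form r u v = 0)"
proof -
  note F = poly_hermitian.jantzen_sum_formula[OF poly_hermitian_gram, of m, folded jan_def, unfolded signature_gram]
  then obtain d K where F: "d > 0" "\<And>x. x \<noteq> 0 \<Longrightarrow> \<bar>x\<bar> < d \<Longrightarrow> standard_signature n (t * (s + x)) k rho beta m =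
      (\<Sum>r\<le>K. (if x < 0 then - 1 else 1) ^ r * poly_space.signature (jan r m) (poly_hermitian.jantzen_form (monomial_indices n k m) (P.gram m) r))"
    "standard_signature n (t * (s + 0)) k rho beta m = poly_space.signature (jan 0 m) (poly_hermitian.jantzen_form (monomial_indices n k m) (P.gram m) 0)"
    "\<And>r u v. r > K \<Longrightarrow> u \<in> jan r m \<Longrightarrow> v \<in> jan r m \<Longrightarrow> poly_hermitian.jantzen_form (monomial_indices n k m) (P.gram m) r u v = 0"
    by blast
  show ?thesis
  proof (intro exI[of _ d] exI[of _ K] conjI allI impI ballI)
    show "0 < d" by (rule F(1))
    show "standard_signature n (t * (s + x)) k rho beta m = (\<Sum>r\<le>K. (if x < 0 then - 1 else 1) ^ r * jan_signature r m)"
      if "x \<noteq> 0" "\<bar>x\<bar> < d" for x unfolding jan_cong(3) by (rule F(2)[OF that])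
    show "standard_signature n (t * s) k rho beta m = jan_signature 0 m"
      unfolding jan_cong(3) using F(3) by simp
    show "jan_form r u v = 0" if "r > K" "u \<in> jan r m" "v \<in> jan r m" for r u v
      using F(4)[OF that] jan_form_jantzen_form[OF that(2,3)] by simp
  qed
qed

text \<open>The bound \<open>K\<close> on the number of layers must not depend on the degree
  \<open>m\<close>. By \<open>radical_everywhere\<close> a layer is 0 once it is 0 in the degrees up
  to \<open>D\<close>, so finitely many degrees decide.\<close>

lemma jan_rational:
  assumes c: "t * s \<noteq> 0" and zs: "rep_roots n k rho zs"
    and D: "\<And>d. d > D \<Longrightarrow> next_roots n (t * s) zs d = []"
    and H: "\<And>d k rho beta. d \<ge> 1 \<Longrightarrow> hermitian_rep n k rho beta \<Longrightarrow>
      rep_roots n k rho (next_roots n (t * s) zs d) \<Longrightarrow>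
      rational_character n (standard_signature n (t * s) k rho beta)"
  shows "\<exists>K. (\<forall>r\<ge>1. rational_character n (jan_signature r)) \<and>
    (\<forall>m. \<exists>d>0. \<forall>x. x \<noteq> 0 \<longrightarrow> \<bar>x\<bar> < d \<longrightarrow> standard_signature n (t * (s + x)) k rho beta m =
        (\<Sum>r\<le>K. (if x < 0 then - 1 else 1) ^ r * jan_signature r m))"
proof -
  have rat: "rational_character n (jan_signature r)" if "r \<ge> 1" for r
  proof (rule rational_character_cherednik_form[OF c, where D = D and d = 1,
        OF _ _ cherednik_form_jan jan_weights[OF zs]])
    show "next_roots n (t * s) zs d = []" if "d > D" for d using that by (rule D)
    show "rational_character n (standard_signature n (t * s) k rho beta)"
      if "d \<ge> 1" "hermitian_rep n k rho beta" "rep_roots n k rho (next_roots n (t * s) zs d)"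
      for d k rho beta using that by (rule H)
    show "1 \<le> (1::nat)" ..
    show "jan_form r u v = 0" if "m < 1" "u \<in> jan r m" "v \<in> jan r m" for m u v
      using that jan_bottom[OF \<open>r \<ge> 1\<close>] by simp
  qed
  have "\<forall>m. \<exists>K. \<forall>r>K. \<forall>u\<in>jan r m. \<forall>v\<in>jan r m. jan_form r u v = 0"
    using jan_sum_formula by blast
  from choice[OF this] obtain Kf where Kf: "\<And>m r u v. r > Kf m \<Longrightarrow> u \<in> jan r m \<Longrightarrow> v \<in> jan r m \<Longrightarrow> jan_form r u v = 0"
    by blast
  define K where "K = Max (Kf ` {..D})"
  have K: "Kf m \<le> K" if "m \<le> D" for m unfolding K_def using that by (intro Max_ge) auto
  have zero: "jan_signature r m = 0" if r: "r > K" for r m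
  proof -
    interpret J: cherednik_form scale_poly n "t * s" mult_x P.opY P.opW "jan r" "jan_form r"
      by (rule cherednik_form_jan)
    show ?thesis
    proof (rule poly_space.signature_zero[OF jan_cong(1)])
      fix u v assume uv: "u \<in> jan r m" "v \<in> jan r m"
      show "jan_form r u v = 0"
      proof (rule J.radical_everywhere[OF jan_weights[OF zs] c D _ uv])
        fix m' u v assume "m' \<le> D" "u \<in> jan r m'" "v \<in> jan r m'"
        then show "jan_form r u v = 0" using Kf[of m' r u v] K[of m'] r by auto
      qed
    qed
  qed
  have sum: "\<exists>d>0. \<forall>x. x \<noteq> 0 \<longrightarrow> \<bar>x\<bar> < d \<longrightarrow> standard_signature n (t * (s + x)) k rho beta m =
        (\<Sum>r\<le>K. (if x < 0 then - 1 else 1) ^ r * jan_signature r m)" for m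
  proof -
    obtain d L where d: "d > 0" "\<And>x. x \<noteq> 0 \<Longrightarrow> \<bar>x\<bar> < d \<Longrightarrow> standard_signature n (t * (s + x)) k rho beta m =
        (\<Sum>r\<le>L. (if x < 0 then - 1 else 1) ^ r * jan_signature r m)"
      "\<And>r u v. r > L \<Longrightarrow> u \<in> jan r m \<Longrightarrow> v \<in> jan r m \<Longrightarrow> jan_form r u v = 0"
      using jan_sum_formula[of m] by blast
    have zL: "jan_signature r m = 0" if "r > L" for r
      by (rule poly_space.signature_zero[OF jan_cong(1)]) (rule d(3)[OF that])
    have "(\<Sum>r\<le>L. q ^ r * jan_signature r m) = (\<Sum>r\<le>K. q ^ r * jan_signature r m)" for q :: int
    proof -
      have "(\<Sum>r\<le>L. q ^ r * jan_signature r m) = (\<Sum>r\<le>max K L. q ^ r * jan_signature r m)"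
        using zL by (intro sum.mono_neutral_left) auto
      also have "\<dots> = (\<Sum>r\<le>K. q ^ r * jan_signature r m)"
        using zero by (intro sum.mono_neutral_right) auto
      finally show ?thesis .
    qed
    then show ?thesis using d(1,2) by (intro exI[of _ d]) simp
  qed
  show ?thesis
  proof (rule exI[of _ K], rule conjI)
    show "\<forall>r\<ge>1. rational_character n (jan_signature r)" using rat by simp
  qed (rule allI, rule sum)
qed

end

section \<open>Nondegeneracy away from the walls\<close>

text \<open>The equation that \<open>euler\<close> imposes on a nonzero vector of degree
  \<open>d\<close> killed by all \<open>y\<^sub>i\<close>. It may list parameters at which nothing
  happens, as a central root need not be an eigenvalue; what counts is finiteness on bounded
  segments.\<close>

definition wall :: "nat \<Rightarrow> real \<Rightarrow> bool" where
  "wall n c \<longleftrightarrow> (\<exists>d\<ge>1. \<exists>z\<in>set (central_roots n). \<exists>z'\<in>set (central_roots n).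
     of_nat (2 * d) = complex_of_real c * (z - z'))"

lemma not_wall_zero: "\<not> wall n 0"
  by (auto simp: wall_def)

lemma standard_form_bottom_nondegenerate:
  assumes rep: "hermitian_rep n k rho beta" and u: "u \<in> hpart n k 0"
    and z: "\<And>v. v \<in> hpart n k 0 \<Longrightarrow> standard_form n c k rho beta 0 u v = 0"
  shows "u = 0"
proof -
  interpret D: dunkl_form n k rho "complex_of_real c" cnj beta by (rule hermitian_rep_dunkl_form[OF rep])
  have "(\<Sum>j<k. u (\<lambda>_. 0, j) * beta j l) = 0" if l: "l < k" for l
  proof -
    let ?v = "unit_vector (\<lambda>_. 0, l) :: complex vec_poly"
    have "?v \<in> hpart n k 0" using l by (auto simp: supported_on_def unit_vector_def monomial_indices_def exponents_def)
    then have "(\<Sum>j<k. \<Sum>q<k. u (\<lambda>_. 0, j) * beta j q * cnj (?v (\<lambda>_. 0, q))) = 0"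
      using z[of ?v] unfolding standard_form_def D.form_base by simp
    moreover have "(\<Sum>q<k. u (\<lambda>_. 0, j) * beta j q * cnj (?v (\<lambda>_. 0, q))) = u (\<lambda>_. 0, j) * beta j l" for j
    proof -
      have "(\<Sum>q<k. u (\<lambda>_. 0, j) * beta j q * cnj (?v (\<lambda>_. 0, q))) =
          (\<Sum>q<k. if q = l then u (\<lambda>_. 0, j) * beta j l else 0)"
        by (rule sum.cong) (auto simp: unit_vector_def)
      then show ?thesis using l by simp
    qed
    ultimately show ?thesis by simp
  qed
  then have "u (\<lambda>_. 0, j) = 0" if "j < k" for j
    using rep[unfolded hermitian_rep_def, THEN conjunct2, rule_format, of "\<lambda>j. u (\<lambda>_. 0, j)"] that by simp
  then have "u (a, j) = 0" for a j
    using u D.hpart_zeroD[OF u, of a j] by (cases "j < k") (auto simp: supported_on_def monomial_indices_def)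
  then show ?thesis by (auto simp: fun_eq_iff)
qed

text \<open>By induction a radical vector is killed by all \<open>y\<^sub>i\<close>, since these
  preserve radicals and lower the degree. Then \<open>euler\<close> equates \<open>c T\<close> with
  \<open>c Z + 2 (m + 1)\<close>; both \<open>T\<close> and \<open>Z\<close> are annihilated by the
  central roots, and off the walls the shifted list has no root in common with the original
  one.\<close>

lemma standard_form_nondegenerate:
  assumes rep: "hermitian_rep n k rho beta" and c: "\<not> wall n c"
    and u: "u \<in> hpart n k m" and z: "\<And>v. v \<in> hpart n k m \<Longrightarrow> standard_form n c k rho beta m u v = 0"
  shows "u = 0"
  using u z
proof (induction m arbitrary: u)
  case 0
  then show ?case by (rule standard_form_bottom_nondegenerate[OF rep])
next
  case (Suc m u)
  interpret D: dunkl_form n k rho "complex_of_real c" cnj beta by (rule hermitian_rep_dunkl_form[OF rep])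
  let ?c = "complex_of_real c"
  have Y: "D.opY i u = (\<lambda>p. 0)" if i: "i \<in> {1..n}" for i
  proof -
    have "standard_form n c k rho beta m (D.opY i u) v = 0" if v: "v \<in> hpart n k m" for v
      using Suc.prems(2)[OF mult_x_hpart[OF i v]] D.form_Y_left[OF Suc.prems(1) v i]
      unfolding standard_form_def by simp
    from Suc.IH[OF D.Y_hpart[OF i Suc.prems(1)] this] show ?thesis by (simp add: zero_fun_def)
  qed
  let ?d = "of_nat (2 * Suc m) :: complex"
  \<comment> \<open>The relation between \<open>T\<close> and \<open>Z\<close> is needed for every
    intermediate vector of the products, so it is proved on a subspace stable under
    \<open>Z\<close>.\<close>
  define K where "K = {v \<in> D.V (Suc m). \<forall>i\<in>{1..n}. D.opY i v = (\<lambda>p. 0)}"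
  have uK: "u \<in> K" using Suc.prems(1) Y by (simp add: K_def)
  have euler: "?c * D.opT v p = ?c * D.opZ v p + ?d * v p" if "v \<in> K" for v p
  proof -
    have v: "v \<in> D.V (Suc m)" using that by (simp add: K_def)
    have "(\<Sum>i\<in>{1..n}. mult_x i (D.opY i v) p) = 0"
      using that by (intro sum.neutral) (auto simp: K_def mult_x_def case_prod_unfold)
    then show ?thesis using D.euler[OF v, of p] by (simp add: algebra_simps)
  qed
  have WK: "D.opW (transpose i l) v \<in> K" if il: "i \<in> {1..n}" "l \<in> {1..n}" and v: "v \<in> K" for i l v
  proof -
    have vV: "v \<in> D.V (Suc m)" using v by (simp add: K_def)
    have "D.opY j (D.opW (transpose i l) v) = (\<lambda>p. 0)" if j: "j \<in> {1..n}" for j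
    proof -
      have j': "transpose i l j \<in> {1..n}"
        using il j by (auto simp: transpose_def)
      have "D.opW (transpose i l) (D.opY (transpose i l j) v) = D.opY j (D.opW (transpose i l) v)"
        using D.W_transpose_Y[OF il j' vV] by simp
      moreover have "D.opW w (\<lambda>p. 0) = (\<lambda>p. 0)" for w by (auto simp: D.opW_def)
      moreover have "D.opY (transpose i l j) v = (\<lambda>p. 0)" using v j' by (simp add: K_def)
      ultimately show ?thesis by simp
    qed
    then show ?thesis using D.W_transpose_hpart[OF il vV] by (simp add: K_def)
  qed
  have K: "fun_space.subspace K"
    unfolding fun_space.subspace_def
  proof (intro conjI ballI allI)
    show "0 \<in> K" using D.Y_zero by (simp add: K_def supported_on_def zero_fun_def)
    show "x + y \<in> K" if "x \<in> K" "y \<in> K" for x y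
      using that D.Y_add[of _ x y] by (auto simp: K_def supported_on_def plus_fun_def)
    show "scale_fun a x \<in> K" if "x \<in> K" for a x
      using that D.Y_scale[of _ a x] by (auto simp: K_def supported_on_def scale_fun_def)
  qed
  have Z_sum: "D.opZ v = (\<Sum>i\<in>{1..n}. \<Sum>l\<in>{1..n} - {i}. D.opW (transpose i l) v)" for v
    by (auto simp: D.opZ_def fun_eq_iff sum_fun_apply)
  have ZK: "D.opZ v \<in> K" if "v \<in> K" for v
    unfolding Z_sum by (intro fun_space.subspace_sum[OF K] WK that) auto
  have Wlin: "D.opW w (x + y) = D.opW w x + D.opW w y" "D.opW w (scale_fun a x) = scale_fun a (D.opW w x)" for w x y a
    using D.W_add[of w x y] D.W_scale[of w a x] by (simp_all add: plus_fun_def scale_fun_def)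
  have Z0: "roots_op scale_fun D.opZ (central_roots n) u = 0"
    by (rule fun_space.roots_op_central[where W = D.opW, OF Wlin D.W_comp Z_sum D.W_id[OF Suc.prems(1)]])
  have T: "D.opT w (a, j) = rep_sum n k rho (\<lambda>q. w (a, q)) j" for w a j
    unfolding D.opT_def D.opR_def rep_sum_def by (simp only: prod.case sum_distrib_right sum_swap_last)
  have rT: "roots_op scale_fun D.opT ys w = (\<lambda>(a, j). roots_op scale_fun (rep_sum n k rho) ys (\<lambda>q. w (a, q)) j)" for ys w
  proof (induction ys)
    case (Cons y ys)
    show ?case unfolding roots_op_simps Cons by (auto simp: T scale_fun_def fun_eq_iff)
  qed auto
  have T0: "roots_op scale_fun D.opT (central_roots n) u = 0"
  proof -
    have "(\<lambda>q. u (a, q)) \<in> supported_on {..<k}" for a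
      using Suc.prems(1) by (auto simp: supported_on_def monomial_indices_def)
    then have "roots_op scale_fun (rep_sum n k rho) (central_roots n) (\<lambda>q. u (a, q)) = 0" for a
      using rep_roots_central[OF rep] unfolding rep_roots_def by blast
    then show ?thesis unfolding rT by (auto simp: fun_eq_iff)
  qed
  show "u = 0"
  proof (cases "c = 0")
    case True
    then show ?thesis using euler[OF uK] by (auto simp: fun_eq_iff simp del: of_nat_Suc)
  next
    case False
    let ?ys = "map (\<lambda>z. z - ?d / ?c) (central_roots n)"
    have TZ: "D.opT v p = D.opZ v p + ?d / ?c * v p" if "v \<in> K" for v p
    proof -
      have "?c * D.opT v p = ?c * (D.opZ v p + ?d / ?c * v p)"
        using euler[OF that] False by (simp add: distrib_left)
      then show ?thesis using False by (metis mult_left_cancel of_real_eq_0_iff)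
    qed
    have "roots_op scale_fun D.opT zs u = roots_op scale_fun D.opZ (map (\<lambda>z. z - ?d / ?c) zs) u \<and>
        roots_op scale_fun D.opZ (map (\<lambda>z. z - ?d / ?c) zs) u \<in> K" for zs
    proof (induction zs)
      case (Cons z zs)
      let ?w = "roots_op scale_fun D.opZ (map (\<lambda>z. z - ?d / ?c) zs) u"
      have w: "?w \<in> K" "roots_op scale_fun D.opT zs u = ?w" using Cons by auto
      have "D.opT ?w - scale_fun z ?w = D.opZ ?w - scale_fun (z - ?d / ?c) ?w"
      proof
        fix p
        show "(D.opT ?w - scale_fun z ?w) p = (D.opZ ?w - scale_fun (z - ?d / ?c) ?w) p"
          unfolding fun_diff_def scale_fun_def TZ[OF w(1)] by (simp add: algebra_simps)
      qed
      moreover have "D.opZ ?w - scale_fun (z - ?d / ?c) ?w \<in> K"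
        by (intro fun_space.subspace_diff[OF K] fun_space.subspace_scale[OF K] ZK w(1))
      ultimately show ?case unfolding list.map roots_op_simps w(2) by (rule conjI)
    qed (simp add: uK)
    then have "roots_op scale_fun D.opZ ?ys u = 0" using T0 by simp
    then have "roots_op scale_fun D.opZ (filter (\<lambda>z. z \<in> set ?ys) (central_roots n)) u \<in> {0}"
      using Z0
    proof (intro fun_space.roots_op_filter)
      show "D.opZ (x + y) = D.opZ x + D.opZ y" for x y unfolding Z_sum Wlin by (simp only: sum.distrib)
      show "D.opZ (scale_fun a x) = scale_fun a (D.opZ x)" for a x
        unfolding Z_sum Wlin by (simp only: fun_space.scale_sum_right)
    qed (auto simp: Z_sum fun_space.subspace_def D.opW_def fun_eq_iff sum_fun_apply scale_fun_def)
    \<comment> \<open>A common root \<open>z = z' - 2 (m + 1) / c\<close> would put \<open>c\<close>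
      on a wall.\<close>
    moreover have "filter (\<lambda>z. z \<in> set ?ys) (central_roots n) = []"
    proof -
      have False if z: "z \<in> set (central_roots n)" "z' \<in> set (central_roots n)" "z = z' - ?d / ?c" for z z'
      proof -
        have "?d = ?c * (z' - z)" using False z(3) by simp
        then show False using c z(1,2) unfolding wall_def by (metis le_add1 plus_1_eq_Suc)
      qed
      then show ?thesis by (auto simp: filter_empty_conv)
    qed
    ultimately show ?thesis by simp
  qed
qed

text \<open>\<open>s\<close> is determined by \<open>d\<close> and two roots, and \<open>d\<close>
  is bounded because \<open>s \<le> 1\<close>.\<close>

lemma finite_walls: "finite {s. 0 < s \<and> s \<le> 1 \<and> wall n (t * s)}"
proof -
  let ?C = "set (central_roots n)"
  define B where "B = nat \<lceil>\<Sum>(z, z')\<in>?C \<times> ?C. \<bar>t\<bar> * cmod (z - z')\<rceil>"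
  have "{s. 0 < s \<and> s \<le> 1 \<and> wall n (t * s)} \<subseteq>
      (\<lambda>(d, z, z'). Re (of_nat (2 * d) / (of_real t * (z - z')))) ` ({..B} \<times> ?C \<times> ?C)"
  proof
    fix s assume "s \<in> {s. 0 < s \<and> s \<le> 1 \<and> wall n (t * s)}"
    then obtain d z z' where s: "0 < s" "s \<le> 1" and d: "d \<ge> 1" and z: "z \<in> ?C" "z' \<in> ?C"
      and eq: "of_nat (2 * d) = complex_of_real (t * s) * (z - z')"
      unfolding wall_def by auto
    have "(of_nat (2 * d) :: complex) \<noteq> 0" using d by (simp only: of_nat_eq_0_iff)
    then have nz: "of_real t * (z - z') \<noteq> 0" using eq by auto
    have "complex_of_real s = of_nat (2 * d) / (of_real t * (z - z'))"
      using eq nz by (simp add: field_simps)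
    then have "s = Re (of_nat (2 * d) / (of_real t * (z - z')))" by (metis Re_complex_of_real)
    moreover have "d \<le> B"
    proof -
      have "real d \<le> norm (of_nat (2 * d) :: complex)" by (simp only: norm_of_nat)
      also have "\<dots> = s * (\<bar>t\<bar> * cmod (z - z'))" unfolding eq norm_mult norm_of_real using s by (simp add: abs_mult)
      also have "\<dots> \<le> 1 * (\<bar>t\<bar> * cmod (z - z'))" using s by (intro mult_right_mono) auto
      also have "\<dots> = (\<lambda>(z, z'). \<bar>t\<bar> * cmod (z - z')) (z, z')" by simp
      also have "\<dots> \<le> (\<Sum>(z, z')\<in>?C \<times> ?C. \<bar>t\<bar> * cmod (z - z'))"
        by (rule member_le_sum) (use z in auto)
      finally show ?thesis unfolding B_def by linarith
    qed
    ultimately show "s \<in> (\<lambda>(d, z, z'). Re (of_nat (2 * d) / (of_real t * (z - z')))) ` ({..B} \<times> ?C \<times> ?C)"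
      using z by (intro image_eqI[of _ _ "(d, z, z')"]) auto
  qed
  then show ?thesis by (rule finite_subset) simp
qed

lemma standard_signature_constant:
  assumes rep: "hermitian_rep n k rho beta" and "a \<le> b"
    and w: "\<And>x. a \<le> x \<Longrightarrow> x \<le> b \<Longrightarrow> \<not> wall n (t * x)"
  shows "standard_signature n (t * a) k rho beta m = standard_signature n (t * b) k rho beta m"
proof -
  interpret J: jantzen_setup n k rho beta t 0 by unfold_locales (rule rep)
  have "u = 0" if x: "a \<le> x" "x \<le> b" and u: "u \<in> hpart n k m"
    and z: "\<forall>v\<in>hpart n k m. eval_form (monomial_indices n k m) (J.P.gram m) x u v = 0" for x u
    by (rule standard_form_nondegenerate[OF rep w[OF x] u])
       (use z J.eval_form_gram[OF u, of _ x] in simp)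
  from signature_constant_on_interval[OF J.poly_hermitian_gram assms(2) this]
  show ?thesis unfolding J.signature_gram by simp
qed

section \<open>The parameter zero\<close>

text \<open>The generating function is \<open>1 / (1 - t)\<^sup>n\<close>: exponents with last entry
  0 belong to one variable less, the others arise by increasing the last entry.\<close>

lemma card_exponents_degree:
  "rational_character n (\<lambda>m. int (card {a \<in> exponents n. (\<Sum>i\<in>{1..n}. a i) = m}))"
proof -
  define A where "A n m = {a \<in> exponents n. (\<Sum>i\<in>{1..n}. a i) = m}" for n m :: nat
  define F where "F n = Abs_fps (\<lambda>m. of_nat (card (A n m)) :: real)" for n
  have fin: "finite (A n m)" for n m unfolding A_def by (rule finite_exponents_degree)
  have exp0: "a = (\<lambda>_. 0)" if "a \<in> exponents 0" for a using that by (auto simp: exponents_def)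
  have F0: "F 0 = 1"
  proof -
    have "A 0 m = (if m = 0 then {\<lambda>_. 0} else {})" for m
      using exp0 by (auto simp: A_def exponents_def)
    then show ?thesis by (simp add: F_def fps_eq_iff)
  qed
  have "F (Suc n) * (1 - fps_X) = F n" for n
  proof -
    let ?inc = "\<lambda>a :: nat \<Rightarrow> nat. a(Suc n := Suc (a (Suc n)))"
    have sum: "(\<Sum>i\<in>{1..Suc n}. a i) = (\<Sum>i\<in>{1..n}. a i) + a (Suc n)" for a :: "nat \<Rightarrow> nat" by simp
    have sum_upd: "(\<Sum>i\<in>{1..n}. (a(Suc n := v)) i) = (\<Sum>i\<in>{1..n}. a i)" for a :: "nat \<Rightarrow> nat" and v
      by (rule sum.cong) auto
    have zero: "{a \<in> A (Suc n) m. a (Suc n) = 0} = A n m" for m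
    proof (rule Set.set_eqI)
      fix a
      have "a \<in> exponents n \<longleftrightarrow> a \<in> exponents (Suc n) \<and> a (Suc n) = 0"
        unfolding exponents_def by (auto simp: le_Suc_eq)
      then show "a \<in> {a \<in> A (Suc n) m. a (Suc n) = 0} \<longleftrightarrow> a \<in> A n m"
        unfolding A_def by (auto simp: sum)
    qed
    have pos: "{a \<in> A (Suc n) (Suc m). a (Suc n) \<noteq> 0} = ?inc ` A (Suc n) m" for m
    proof
      show "?inc ` A (Suc n) m \<subseteq> {a \<in> A (Suc n) (Suc m). a (Suc n) \<noteq> 0}"
      proof (rule image_subsetI)
        fix a assume a: "a \<in> A (Suc n) m"
        then have "?inc a \<in> exponents (Suc n)" by (auto simp: A_def exponents_def)
        moreover have "(\<Sum>i\<in>{1..Suc n}. ?inc a i) = Suc m"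
          unfolding sum[of "?inc a"] sum_upd using a by (simp only: A_def mem_Collect_eq sum fun_upd_same) simp
        ultimately show "?inc a \<in> {a \<in> A (Suc n) (Suc m). a (Suc n) \<noteq> 0}"
          unfolding A_def by simp
      qed
      show "{a \<in> A (Suc n) (Suc m). a (Suc n) \<noteq> 0} \<subseteq> ?inc ` A (Suc n) m"
      proof
        fix a assume a: "a \<in> {a \<in> A (Suc n) (Suc m). a (Suc n) \<noteq> 0}"
        let ?b = "a(Suc n := a (Suc n) - 1)"
        have "?b \<in> exponents (Suc n)" using a by (auto simp: A_def exponents_def)
        moreover have "(\<Sum>i\<in>{1..Suc n}. ?b i) = m"
          unfolding sum[of ?b] sum_upd using a by (simp only: A_def mem_Collect_eq sum fun_upd_same) simp
        moreover have "a = ?inc ?b" using a by auto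
        ultimately show "a \<in> ?inc ` A (Suc n) m" unfolding A_def by blast
      qed
    qed
    have inj: "inj_on ?inc S" for S
    proof (rule inj_onI)
      fix a b assume e: "?inc a = ?inc b"
      have "a i = b i" for i using fun_cong[OF e, of i] by (cases "i = Suc n") auto
      then show "a = b" by auto
    qed
    have split: "card (A (Suc n) m) = card (A n m) + card {a \<in> A (Suc n) m. a (Suc n) \<noteq> 0}" for m
    proof -
      have "A (Suc n) m = {a \<in> A (Suc n) m. a (Suc n) = 0} \<union> {a \<in> A (Suc n) m. a (Suc n) \<noteq> 0}" by auto
      then have "card (A (Suc n) m) = card ({a \<in> A (Suc n) m. a (Suc n) = 0} \<union> {a \<in> A (Suc n) m. a (Suc n) \<noteq> 0})"
        by (rule arg_cong)
      also have "\<dots> = card {a \<in> A (Suc n) m. a (Suc n) = 0} + card {a \<in> A (Suc n) m. a (Suc n) \<noteq> 0}"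
        by (rule card_Un_disjoint) (use fin in auto)
      finally show ?thesis unfolding zero .
    qed
    have S: "card (A (Suc n) (Suc m)) = card (A n (Suc m)) + card (A (Suc n) m)" for m
      using split[of "Suc m"] unfolding pos card_image[OF inj] .
    have "{a \<in> A (Suc n) 0. a (Suc n) \<noteq> 0} = {}" unfolding A_def sum by auto
    then have Z: "card (A (Suc n) 0) = card (A n 0)" using split[of 0] by (simp only: card.empty add_0_right)
    show ?thesis
    proof (rule fps_ext)
      fix m
      show "fps_nth (F (Suc n) * (1 - fps_X)) m = fps_nth (F n) m"
        by (cases m) (simp_all add: F_def right_diff_distrib S Z)
    qed
  qed
  then have "F n * (1 - fps_X) ^ n = 1"
  proof (induction n)
    case (Suc n)
    then show ?case by (simp add: mult.assoc[symmetric])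
  qed (simp add: F0)
  then show ?thesis
    unfolding rational_character_def F_def A_def by (intro exI[of _ 1]) simp
qed

text \<open>At parameter 0 the Dunkl operators are partial derivatives, and \<open>y\<^sup>a\<close>
  turns \<open>x\<^sup>a\<close> into the product of the \<open>a\<^sub>i!\<close>.\<close>

lemma descend_zero_parameter:
  assumes D: "dunkl_form n k rho (complex_of_real 0) cnj beta" and "a \<in> exponents n" "(\<Sum>i\<in>{1..n}. a i) = m"
  shows "dunkl_form.descend n k rho (complex_of_real 0) m a v q = of_nat (\<Prod>i\<in>{1..n}. fact (a i)) * v (a, q)"
  using assms(2,3)
proof (induction m arbitrary: a v)
  interpret D: dunkl_form n k rho "complex_of_real 0" cnj beta by fact
  case 0
  then have "a i = 0" if "i \<in> {1..n}" for i using that by simp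
  then have "(\<Prod>i\<in>{1..n}. fact (a i)) = (1::nat)" by (intro prod.neutral) auto
  then show ?case unfolding D.descend.simps(1) by simp
next
  interpret D: dunkl_form n k rho "complex_of_real 0" cnj beta by fact
  case (Suc m)
  define l where "l = (LEAST l. a l \<noteq> 0)"
  obtain i where "a i \<noteq> 0" using Suc.prems(2) by (metis nat.distinct(1) sum.neutral)
  from D.Least_exponent[OF Suc.prems(1) this] have l: "l \<in> {1..n}" "a l \<noteq> 0" by (simp_all add: l_def)
  let ?a = "a(l := a l - 1)"
  have "?a \<in> exponents n" using Suc.prems(1) by (auto simp: exponents_def)
  moreover have "(\<Sum>i\<in>{1..n}. ?a i) = m"
    using sum_degree_upd[OF l(1), of a "a l - 1"] Suc.prems(2) l(2) by linarith
  ultimately have "D.descend (Suc m) a v q = of_nat (\<Prod>i\<in>{1..n}. fact (?a i)) * D.opY l v (?a, q)"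
    using Suc.IH unfolding D.descend.simps Let_def l_def[symmetric] by blast
  also have "D.opY l v (?a, q) = of_nat (a l) * v (a, q)"
  proof -
    have "?a(l := ?a l + 1) = a" "?a l + 1 = a l" using l(2) by auto
    then show ?thesis unfolding D.opY_def prod.case by simp
  qed
  also have "of_nat (\<Prod>i\<in>{1..n}. fact (?a i)) * (of_nat (a l) * v (a, q)) =
      of_nat ((\<Prod>i\<in>{1..n}. fact (?a i)) * a l) * v (a, q)" by simp
  also have "(\<Prod>i\<in>{1..n}. fact (?a i)) * a l = (\<Prod>i\<in>{1..n}. fact (a i))"
  proof -
    have "(\<Prod>i\<in>{1..n}. fact (?a i)) = (fact (a l - 1) * (\<Prod>i\<in>{1..n} - {l}. fact (a i)) :: nat)"
      using prod.remove[OF _ l(1), of "\<lambda>i. fact (?a i) :: nat"] by simp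
    moreover have "(\<Prod>i\<in>{1..n}. fact (a i)) = (fact (a l) * (\<Prod>i\<in>{1..n} - {l}. fact (a i)) :: nat)"
      using prod.remove[OF _ l(1), of "\<lambda>i. fact (a i) :: nat"] by simp
    moreover have "fact (a l) = (fact (a l - 1) * a l :: nat)"
      using l(2) by (metis fact_num_eq_if mult.commute of_nat_id)
    ultimately show ?thesis by simp
  qed
  finally show ?case .
qed

text \<open>Different monomials are orthogonal, so each degree is a sum of positively rescaled
  copies of \<open>beta\<close>, one for each monomial.\<close>

lemma rational_character_parameter_zero:
  assumes rep: "hermitian_rep n k rho beta"
  shows "rational_character n (standard_signature n 0 k rho beta)"
proof -
  note DF = hermitian_rep_dunkl_form[OF rep, of 0]
  interpret D: dunkl_form n k rho "complex_of_real 0" cnj beta by (rule DF)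
  let ?f = "standard_form n 0 k rho beta"
  let ?A = "\<lambda>m. {a \<in> exponents n. (\<Sum>i\<in>{1..n}. a i) = m}"
  note herm = hermitian_on_standard[OF DF]
  obtain I :: "nat set" and b where b: "fun_space.orthogonal_family (hpart n k 0) (?f 0) I b"
    using fun_space.orthogonal_family_exists[OF herm finite_rank_supported_on[OF finite_monomial_indices herm]] by blast
  note bD = fun_space.orthogonal_familyD[OF herm b]
  \<comment> \<open>\<open>slice a u\<close> is the coefficient of \<open>x\<^sup>a\<close>, placed
    in degree 0; \<open>\<beta> (a, i)\<close> below is
    \<open>x\<^sup>a \<otimes> b i\<close>.\<close>
  define slice where "slice a u = (\<lambda>(a' :: nat \<Rightarrow> nat, j). if a' = (\<lambda>_. 0) then u (a, j) else 0)" for a :: "nat \<Rightarrow> nat" and u :: "complex vec_poly"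
  define F where "F a = (\<Prod>i\<in>{1..n}. fact (a i) :: nat)" for a :: "nat \<Rightarrow> nat"
  define \<beta> where "\<beta> = (\<lambda>(a :: nat \<Rightarrow> nat, i) (a', j). if a' = a then b i (\<lambda>_. 0, j) else 0)"
  have slice: "slice a u \<in> hpart n k 0" if "u \<in> hpart n k m" for a u m
    using that by (auto simp: supported_on_def slice_def monomial_indices_def exponents_def)
  have form: "?f m u v = (\<Sum>a\<in>?A m. of_nat (F a) * ?f 0 (slice a u) (slice a v))" for m u v
  proof -
    have mon: "monomial_indices n k m = ?A m \<times> {..<k}" by (auto simp: monomial_indices_def)
    have "?f m u v = (\<Sum>a\<in>?A m. \<Sum>j<k. u (a, j) * (\<Sum>q<k. beta j q * cnj (D.descend m a v q)))"
      unfolding standard_form_def D.form_def mon by (rule sum.cartesian_product[symmetric])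
    also have "\<dots> = (\<Sum>a\<in>?A m. of_nat (F a) * ?f 0 (slice a u) (slice a v))"
    proof (rule sum.cong[OF refl])
      fix a assume a: "a \<in> ?A m"
      have "D.descend m a v q = of_nat (F a) * v (a, q)" for q
        unfolding F_def by (rule descend_zero_parameter[OF DF]) (use a in auto)
      then show "(\<Sum>j<k. u (a, j) * (\<Sum>q<k. beta j q * cnj (D.descend m a v q))) =
          of_nat (F a) * ?f 0 (slice a u) (slice a v)"
        unfolding standard_form_def D.form_base slice_def
        by (simp add: sum_distrib_left mult_ac del: of_nat_prod of_real_0)
    qed
    finally show ?thesis .
  qed
  have slice_b: "slice a' (\<beta> (a, i)) = (if a' = a then b i else 0)" if "i \<in> I" for a a' i
  proof (rule ext)
    fix p :: "(nat \<Rightarrow> nat) \<times> nat"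
    have "b i p = 0" if "fst p \<noteq> (\<lambda>_. 0)"
      using D.hpart_zeroD[OF bD(2)[OF \<open>i \<in> I\<close>], of "fst p" "snd p"] that by auto
    then show "slice a' (\<beta> (a, i)) p = (if a' = a then b i else 0) p"
      by (cases p) (auto simp: slice_def \<beta>_def)
  qed
  have z0: "?f 0 0 v = 0" for v using D.form_zero_left[of 0 v] by (simp add: standard_form_def zero_fun_def)
  have form_b: "?f m (\<beta> (a, i)) v = of_nat (F a) * ?f 0 (b i) (slice a v)" if "a \<in> ?A m" "i \<in> I" for m a i v
  proof -
    have "?f m (\<beta> (a, i)) v = (\<Sum>a'\<in>?A m. if a' = a then of_nat (F a) * ?f 0 (b i) (slice a v) else 0)"
      unfolding form[of m "\<beta> (a, i)"] slice_b[OF that(2)] by (rule sum.cong) (auto simp: z0)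
    then show ?thesis using that(1) finite_exponents_degree[of n m] by simp
  qed
  have \<beta>: "\<beta> (a, i) \<in> hpart n k m" if "a \<in> ?A m" "i \<in> I" for m a i
    using bD(2)[OF that(2)] that(1) by (auto simp: supported_on_def \<beta>_def monomial_indices_def exponents_def split: if_splits)
  have fam: "fun_space.orthogonal_family (hpart n k m) (?f m) (?A m \<times> I) \<beta>" for m
  proof (rule fun_space.orthogonal_familyI[OF herm])
    show "finite (?A m \<times> I)" using finite_exponents_degree bD(1) by (rule finite_cartesian_product)
    show "\<beta> p \<in> hpart n k m" if "p \<in> ?A m \<times> I" for p using \<beta> that by (cases p) auto
    show "?f m (\<beta> p) (\<beta> p') = 0" if p: "p \<in> ?A m \<times> I" "p' \<in> ?A m \<times> I" "p \<noteq> p'" for p p'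
    proof -
      obtain a i a' i' where pp: "p = (a, i)" "p' = (a', i')" by (cases p, cases p') auto
      have "?f m (\<beta> p) (\<beta> p') = of_nat (F a) * ?f 0 (b i) (if a = a' then b i' else 0)"
        unfolding pp using p pp by (subst form_b) (auto simp: slice_b)
      moreover have "?f 0 (b i) 0 = 0"
        using D.form_zero_right[of 0 "b i"] by (simp add: standard_form_def zero_fun_def)
      ultimately show ?thesis using bD(3)[of i i'] p pp by (cases "a = a'") auto
    qed
    fix u :: "complex vec_poly" assume u: "u \<in> hpart n k m"
    have "\<forall>a. \<exists>q. \<forall>v\<in>hpart n k 0. ?f 0 (slice a u) v = (\<Sum>i\<in>I. q i * ?f 0 (b i) v)"
      using bD(4) slice[OF u] by blast
    from choice[OF this] obtain q where q: "\<And>a v. v \<in> hpart n k 0 \<Longrightarrow> ?f 0 (slice a u) v = (\<Sum>i\<in>I. q a i * ?f 0 (b i) v)"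
      by blast
    have "?f m u v = (\<Sum>p\<in>?A m \<times> I. (case p of (a, i) \<Rightarrow> q a i) * ?f m (\<beta> p) v)" if v: "v \<in> hpart n k m" for v
    proof -
      have "?f m u v = (\<Sum>a\<in>?A m. \<Sum>i\<in>I. q a i * ?f m (\<beta> (a, i)) v)"
        unfolding form[of m u v] q[OF slice[OF v]]
      proof (rule sum.cong[OF refl])
        fix a assume a: "a \<in> ?A m"
        show "of_nat (F a) * (\<Sum>i\<in>I. q a i * ?f 0 (b i) (slice a v)) = (\<Sum>i\<in>I. q a i * ?f m (\<beta> (a, i)) v)"
          unfolding sum_distrib_left by (rule sum.cong) (simp_all only: form_b[OF a] mult_ac)
      qed
      then show ?thesis by (simp add: sum.cartesian_product case_prod_unfold)
    qed
    then show "\<exists>q. \<forall>v\<in>hpart n k m. ?f m u v = (\<Sum>p\<in>?A m \<times> I. q p * ?f m (\<beta> p) v)" by blast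
  qed
  have sig: "standard_signature n 0 k rho beta m = (\<Sum>i\<in>I. sign_re (?f 0 (b i) (b i))) * int (card (?A m))" for m
  proof -
    have "standard_signature n 0 k rho beta m = (\<Sum>p\<in>?A m \<times> I. sign_re (?f m (\<beta> p) (\<beta> p)))"
      unfolding standard_signature_def by (rule fun_space.signature_eq[OF herm fun_space.has_signatureI[OF fam]])
    also have "\<dots> = (\<Sum>p\<in>?A m \<times> I. sign_re (?f 0 (b (snd p)) (b (snd p))))"
    proof (rule sum.cong[OF refl])
      fix p assume "p \<in> ?A m \<times> I"
      then obtain a i where p: "p = (a, i)" "a \<in> ?A m" "i \<in> I" by auto
      have "0 < F a" unfolding F_def by (intro prod_pos) simp
      then show "sign_re (?f m (\<beta> p) (\<beta> p)) = sign_re (?f 0 (b (snd p)) (b (snd p)))"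
        unfolding p(1) form_b[OF p(2,3)] slice_b[OF p(3)] by (auto simp: sign_re_def zero_less_mult_iff mult_less_0_iff)
    qed
    also have "\<dots> = (\<Sum>a\<in>?A m. \<Sum>i\<in>I. sign_re (?f 0 (b i) (b i)))"
      unfolding sum.cartesian_product by (rule sum.cong) auto
    finally show ?thesis by (simp add: mult.commute)
  qed
  have "standard_signature n 0 k rho beta = (\<lambda>m. (\<Sum>i\<in>I. sign_re (?f 0 (b i) (b i))) * int (card (?A m)))"
    by (rule ext) (rule sig)
  then show ?thesis using rational_character_scale[OF card_exponents_degree] by simp
qed

section \<open>Crossing the walls\<close>

text \<open>\<open>f\<close> is one sequence for all degrees, while the neighbourhood may shrink
  with \<open>m\<close>: the Jantzen sum formula provides no uniform one. All representations are
  included because layers involve further ones.\<close>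

definition rational_on_left :: "nat \<Rightarrow> real \<Rightarrow> real \<Rightarrow> bool" where
  "rational_on_left n t s \<longleftrightarrow> (\<forall>k rho beta. hermitian_rep n k rho beta \<longrightarrow> (\<exists>f. rational_character n f \<and>
     (\<forall>m. \<exists>d>0. \<forall>x. - d < x \<longrightarrow> x < 0 \<longrightarrow> standard_signature n (t * (s + x)) k rho beta m = f m)))"

text \<open>Roots are complex a priori; the real part of \<open>c z\<close> serves as the quantity
  that drops.\<close>

lemma next_rootsD:
  assumes "z \<in> set (next_roots n c zs d)" "c \<noteq> 0"
  shows "z \<in> set (central_roots n)" "\<exists>z'\<in>set zs. Re (of_real c * z) = Re (of_real c * z') - real (2 * d)"
proof -
  show "z \<in> set (central_roots n)" using assms(1) by (simp add: next_roots_def)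
  obtain z' where z': "z' \<in> set zs" "z = z' - of_nat (2 * d) / of_real c"
    using assms(1) by (auto simp: next_roots_def)
  then have "of_real c * z = of_real c * z' - of_nat (2 * d)" using assms(2) by (simp add: right_diff_distrib)
  then have "Re (of_real c * z) = Re (of_real c * z' - of_nat (2 * d))" by (rule arg_cong)
  then show "\<exists>z'\<in>set zs. Re (of_real c * z) = Re (of_real c * z') - real (2 * d)"
    using z'(1) by auto
qed

lemma standard_signature_empty:
  assumes "hermitian_rep n 0 rho beta"
  shows "standard_signature n c 0 rho beta m = 0"
  unfolding standard_signature_def
proof (rule fun_space.signature_zero)
  interpret D: dunkl_form n 0 rho "complex_of_real c" cnj beta by (rule hermitian_rep_dunkl_form[OF assms])
  show "fun_space.hermitian_on (hpart n 0 m) (standard_form n c 0 rho beta m)"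
    by (rule hermitian_on_standard) (rule hermitian_rep_dunkl_form[OF assms])
  show "standard_form n c 0 rho beta m u v = 0" for u v
    by (simp add: standard_form_def D.form_def monomial_indices_def)
qed

lemma rep_roots_Nil:
  assumes "rep_roots n k rho []"
  shows "k = 0"
proof (rule ccontr)
  assume "k \<noteq> 0"
  then have "(unit_vector 0 :: nat \<Rightarrow> complex) \<in> supported_on {..<k}"
    by (auto simp: supported_on_def unit_vector_def)
  then have "(unit_vector 0 :: nat \<Rightarrow> complex) = 0" using assms by (auto simp: rep_roots_def)
  then have "(unit_vector 0 :: nat \<Rightarrow> complex) 0 = 0" by simp
  then show False by (simp add: unit_vector_def)
qed

text \<open>
  All layers of the Jantzen filtration except the quotient by the radical start in positive degree,
  so the roots of \<open>rep_sum\<close> on the representations in them are smaller (times \<open>c\<close>) than \<open>zs\<close>. As the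
  roots belong to a finite set, the induction on \<open>j\<close> covers everything.
\<close>

lemma rational_at_wall:
  assumes c: "t * s \<noteq> 0" and left: "rational_on_left n t s"
    and rep: "hermitian_rep n k rho beta"
  shows "rational_character n (standard_signature n (t * s) k rho beta)"
proof -
  let ?C = "set (central_roots n)"
  let ?w = "\<lambda>z. Re (complex_of_real (t * s) * z)"
  \<comment> \<open>No central root lies below \<open>\<mu>\<close>, so at \<open>j = 0\<close> the
    list of roots is empty; each passage to a layer lowers the bound on the roots by at least
    2.\<close>
  define \<mu> where "\<mu> = Min (insert 0 (?w ` ?C))"
  have \<mu>: "\<mu> \<le> ?w z" if "z \<in> ?C" for z unfolding \<mu>_def using that by (intro Min_le) auto
  have main: "rational_character n (standard_signature n (t * s) k rho beta)"
    if "hermitian_rep n k rho beta" "rep_roots n k rho zs" "set zs \<subseteq> ?C" "\<And>z. z \<in> set zs \<Longrightarrow> ?w z < \<mu> + real j"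
    for j k rho beta zs
    using that
  proof (induction j arbitrary: k rho beta zs)
    case 0
    have "zs = []"
    proof (cases zs)
      case (Cons z zs')
      then show ?thesis using 0(3) 0(4)[of z] \<mu>[of z] by auto
    qed simp
    then have k: "k = 0" using 0(2) rep_roots_Nil by blast
    have "standard_signature n (t * s) k rho beta = (\<lambda>m. 0)"
      by (rule ext) (use standard_signature_empty 0(1) k in simp)
    then show ?case by (simp add: rational_character_zero)
  next
    case (Suc j)
    interpret J: jantzen_setup n k rho beta t s by unfold_locales (rule Suc.prems(1))
    have next_bound: "?w z < \<mu> + real (Suc j) - real (2 * d)" if z: "z \<in> set (next_roots n (t * s) zs d)" for z d
    proof -
      obtain z' where "z' \<in> set zs" "?w z = ?w z' - real (2 * d)" using next_rootsD(2)[OF z c] by blast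
      then show ?thesis using Suc.prems(4)[of z'] by simp
    qed
    have next_C: "set (next_roots n (t * s) zs d) \<subseteq> ?C" for d using next_rootsD(1)[OF _ c] by blast
    have "\<exists>K. (\<forall>r\<ge>1. rational_character n (J.jan_signature r)) \<and>
      (\<forall>m. \<exists>d>0. \<forall>x. x \<noteq> 0 \<longrightarrow> \<bar>x\<bar> < d \<longrightarrow> standard_signature n (t * (s + x)) k rho beta m =
        (\<Sum>r\<le>K. (if x < 0 then - 1 else 1) ^ r * J.jan_signature r m))"
    proof (rule J.jan_rational[OF c Suc.prems(2)])
      show "next_roots n (t * s) zs d = []" if d: "Suc j < d" for d
      proof (rule ccontr)
        assume "next_roots n (t * s) zs d \<noteq> []"
        then have z: "hd (next_roots n (t * s) zs d) \<in> set (next_roots n (t * s) zs d)" by simp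
        show False using next_bound[OF z] \<mu> next_C[of d] z d by fastforce
      qed
      show "rational_character n (standard_signature n (t * s) k' rho' beta')"
        if d: "1 \<le> d" and "hermitian_rep n k' rho' beta'" "rep_roots n k' rho' (next_roots n (t * s) zs d)"
        for d k' rho' beta'
      proof (rule Suc.IH[OF that(2,3) next_C])
        show "?w z < \<mu> + real j" if "z \<in> set (next_roots n (t * s) zs d)" for z
          using next_bound[OF that] d by simp
      qed
    qed
    then obtain K where K: "\<And>r. r \<ge> 1 \<Longrightarrow> rational_character n (J.jan_signature r)"
      "\<And>m. \<exists>d>0. \<forall>x. x \<noteq> 0 \<longrightarrow> \<bar>x\<bar> < d \<longrightarrow> standard_signature n (t * (s + x)) k rho beta m =
        (\<Sum>r\<le>K. (if x < 0 then - 1 else 1) ^ r * J.jan_signature r m)" by auto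
    obtain f where f: "rational_character n f"
      "\<And>m. \<exists>d>0. \<forall>x. - d < x \<longrightarrow> x < 0 \<longrightarrow> standard_signature n (t * (s + x)) k rho beta m = f m"
      using left Suc.prems(1) unfolding rational_on_left_def by blast
    \<comment> \<open>On the left the sum formula reads
      \<open>f = \<Sum>\<^sub>r (- 1)\<^sup>r J\<^sub>r\<close>, and \<open>J\<^sub>0\<close> is the
      signature at the wall itself; it is solved for \<open>J\<^sub>0\<close>.\<close>
    have "standard_signature n (t * s) k rho beta m = f m + (- 1) * (\<Sum>r\<in>{1..K}. (- 1) ^ r * J.jan_signature r m)" for m
    proof -
      obtain d where d: "d > 0" "\<And>x. x \<noteq> 0 \<Longrightarrow> \<bar>x\<bar> < d \<Longrightarrow> standard_signature n (t * (s + x)) k rho beta m =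
        (\<Sum>r\<le>K. (if x < 0 then - 1 else 1) ^ r * J.jan_signature r m)" using K(2) by blast
      obtain d' where d': "d' > 0" "\<And>x. - d' < x \<Longrightarrow> x < 0 \<Longrightarrow> standard_signature n (t * (s + x)) k rho beta m = f m"
        using f(2) by blast
      \<comment> \<open>A point in both left neighbourhoods.\<close>
      define x where "x = - min d d' / 2"
      have x: "x < 0" "\<bar>x\<bar> < d" "- d' < x" using d(1) d'(1) by (auto simp: x_def min_def)
      have "f m = (\<Sum>r\<le>K. (- 1) ^ r * J.jan_signature r m)"
        using d(2)[of x] d'(2)[of x] x by simp
      also have "\<dots> = J.jan_signature 0 m + (\<Sum>r\<in>{1..K}. (- 1) ^ r * J.jan_signature r m)"
        by (simp add: sum.atLeast_Suc_atMost atMost_atLeast0)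
      moreover have "standard_signature n (t * s) k rho beta m = J.jan_signature 0 m"
        using J.jan_sum_formula[of m] by blast
      ultimately show ?thesis by simp
    qed
    then have "standard_signature n (t * s) k rho beta = (\<lambda>m. f m + (- 1) * (\<Sum>r\<in>{1..K}. (- 1) ^ r * J.jan_signature r m))"
      by (rule ext)
    moreover have "rational_character n (\<lambda>m. f m + (- 1) * (\<Sum>r\<in>{1..K}. (- 1) ^ r * J.jan_signature r m))"
      by (intro rational_character_add[OF f(1)] rational_character_scale rational_character_sum K(1)) simp
    ultimately show ?case by simp
  qed
  \<comment> \<open>The central roots are finitely many, so a single \<open>j\<close> bounds them
    all.\<close>
  obtain j where j: "\<And>z. z \<in> ?C \<Longrightarrow> ?w z < \<mu> + real j"
  proof -
    obtain j where j: "Max (insert 0 (?w ` ?C)) - \<mu> < real j" using reals_Archimedean2 by blast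
    have "?w z < \<mu> + real j" if z: "z \<in> ?C" for z
    proof -
      have "?w z \<le> Max (insert 0 (?w ` ?C))" using z by (intro Max_ge) auto
      then show ?thesis using j by linarith
    qed
    with that show ?thesis by blast
  qed
  show ?thesis by (rule main[OF rep rep_roots_central[OF rep] subset_refl j])
qed

text \<open>The right side carries the same layers with all signs positive. The layer of index 0 has
  the signature at the wall, known from the left side.\<close>

lemma rational_on_right:
  assumes c: "t * s \<noteq> 0" and left: "rational_on_left n t s" and rep: "hermitian_rep n k rho beta"
  shows "\<exists>f. rational_character n f \<and>
    (\<forall>m. \<exists>d>0. \<forall>x. 0 < x \<longrightarrow> x < d \<longrightarrow> standard_signature n (t * (s + x)) k rho beta m = f m)"
proof -
  interpret J: jantzen_setup n k rho beta t s by unfold_locales (rule rep)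
  let ?C = "set (central_roots n)"
  let ?w = "\<lambda>z. Re (complex_of_real (t * s) * z)"
  obtain D where D: "Max (insert 0 (?w ` ?C)) - Min (insert 0 (?w ` ?C)) < real D"
    using reals_Archimedean2 by blast
  have "\<exists>K. (\<forall>r\<ge>1. rational_character n (J.jan_signature r)) \<and>
      (\<forall>m. \<exists>d>0. \<forall>x. x \<noteq> 0 \<longrightarrow> \<bar>x\<bar> < d \<longrightarrow> standard_signature n (t * (s + x)) k rho beta m =
        (\<Sum>r\<le>K. (if x < 0 then - 1 else 1) ^ r * J.jan_signature r m))"
  proof (rule J.jan_rational[OF c rep_roots_central[OF rep]])
    show "next_roots n (t * s) (central_roots n) d = []" if d: "D < d" for d
    proof (rule ccontr)
      assume "next_roots n (t * s) (central_roots n) d \<noteq> []"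
      then have z: "hd (next_roots n (t * s) (central_roots n) d) \<in> set (next_roots n (t * s) (central_roots n) d)" (is "?z \<in> _")
        by simp
      obtain z' where z': "z' \<in> ?C" "?w ?z = ?w z' - real (2 * d)" using next_rootsD(2)[OF z c] by blast
      have "Min (insert 0 (?w ` ?C)) \<le> ?w ?z" using next_rootsD(1)[OF z c] by (intro Min_le) auto
      moreover have "?w z' \<le> Max (insert 0 (?w ` ?C))" using z'(1) by (intro Max_ge) auto
      moreover have "real D \<le> real (2 * d)" using d by simp
      ultimately show False using z'(2) D by linarith
    qed
  qed (rule rational_at_wall[OF c left])
  then obtain K where K: "\<And>r. r \<ge> 1 \<Longrightarrow> rational_character n (J.jan_signature r)"
      "\<And>m. \<exists>d>0. \<forall>x. x \<noteq> 0 \<longrightarrow> \<bar>x\<bar> < d \<longrightarrow> standard_signature n (t * (s + x)) k rho beta m =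
        (\<Sum>r\<le>K. (if x < 0 then - 1 else 1) ^ r * J.jan_signature r m)" by auto
  have "standard_signature n (t * s) k rho beta = J.jan_signature 0"
    by (rule ext) (use J.jan_sum_formula in blast)
  then have "rational_character n (J.jan_signature 0)" using rational_at_wall[OF c left rep] by simp
  then have all: "rational_character n (J.jan_signature r)" for r using K(1)[of r] by (cases r) auto
  show ?thesis
  proof (rule exI, rule conjI, rule_tac[2] allI)
    show "rational_character n (\<lambda>m. \<Sum>r\<le>K. J.jan_signature r m)" by (rule rational_character_sum) (rule all)
    fix m
    obtain d where d: "d > 0" "\<And>x. x \<noteq> 0 \<Longrightarrow> \<bar>x\<bar> < d \<Longrightarrow> standard_signature n (t * (s + x)) k rho beta m =
        (\<Sum>r\<le>K. (if x < 0 then - 1 else 1) ^ r * J.jan_signature r m)" using K(2) by blast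
    show "\<exists>d>0. \<forall>x. 0 < x \<longrightarrow> x < d \<longrightarrow> standard_signature n (t * (s + x)) k rho beta m = (\<Sum>r\<le>K. J.jan_signature r m)"
    proof (intro exI[of _ d] conjI allI impI)
      show "standard_signature n (t * (s + x)) k rho beta m = (\<Sum>r\<le>K. J.jan_signature r m)" if "0 < x" "x < d" for x
        using d(2)[of x] that by simp
    qed (rule d(1))
  qed
qed

text \<open>Induction on the number of walls before \<open>s\<close>. Without any, the signature is
  the one at parameter 0; otherwise it is the one just to the right of the last wall
  \<open>w\<close>, transported by constancy.\<close>

lemma rational_on_left_all:
  assumes "0 < s" "s \<le> 1"
  shows "rational_on_left n t s"
  using assms
proof (induction "card {x. 0 < x \<and> x < s \<and> wall n (t * x)}" arbitrary: s rule: less_induct)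
  case less
  let ?W = "{x. 0 < x \<and> x < s \<and> wall n (t * x)}"
  have fin: "finite ?W" by (rule finite_subset[OF _ finite_walls[of n t]]) (use less.prems in auto)
  show ?case
  proof (cases "?W = {}")
    case True
    show ?thesis
      unfolding rational_on_left_def
    proof (intro allI impI, rule exI, rule conjI, rule rational_character_parameter_zero, assumption, intro allI exI conjI impI)
      fix k rho beta m x assume rep: "hermitian_rep n k rho beta" and x: "- s < x" "x < 0"
      have "\<not> wall n (t * y)" if "0 \<le> y" "y \<le> s + x" for y
        using True that x not_wall_zero by (cases "y = 0") force+
      then show "standard_signature n (t * (s + x)) k rho beta m = standard_signature n 0 k rho beta m"
        using standard_signature_constant[OF rep, of 0 "s + x" t m] x by simp
    qed (rule less.prems(1))
  next
    case False
    define w where "w = Max ?W"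
    have wW: "w \<in> ?W" unfolding w_def using fin False by (rule Max_in)
    have wmax: "x \<le> w" if "x \<in> ?W" for x unfolding w_def using fin that by (rule Max_ge)
    have w: "0 < w" "w < s" "wall n (t * w)" using wW by auto
    have "{x. 0 < x \<and> x < w \<and> wall n (t * x)} \<subset> ?W" using w by auto
    then have lw: "rational_on_left n t w"
      using w less.prems fin by (intro less.hyps psubset_card_mono) auto
    have tw: "t * w \<noteq> 0" using w(3) not_wall_zero by auto
    show ?thesis
      unfolding rational_on_left_def
    proof (intro allI impI)
      fix k rho beta assume rep: "hermitian_rep n k rho beta"
      obtain f where f: "rational_character n f"
        "\<And>m. \<exists>d>0. \<forall>x. 0 < x \<longrightarrow> x < d \<longrightarrow> standard_signature n (t * (w + x)) k rho beta m = f m"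
        using rational_on_right[OF tw lw rep] by blast
      have "standard_signature n (t * (s + x)) k rho beta m = f m" if x: "- (s - w) < x" "x < 0" for x m
      proof -
        obtain d where d: "d > 0" "\<And>x. 0 < x \<Longrightarrow> x < d \<Longrightarrow> standard_signature n (t * (w + x)) k rho beta m = f m"
          using f(2) by blast
        \<comment> \<open>So close to \<open>w\<close> that the value is \<open>f m\<close>, and not
          beyond \<open>s + x\<close>, from which no wall separates it.\<close>
        define y where "y = min (d / 2) (s + x - w)"
        have y: "0 < y" "y < d" "w + y \<le> s + x" using d(1) x by (auto simp: y_def min_def)
        have "standard_signature n (t * (w + y)) k rho beta m = standard_signature n (t * (s + x)) k rho beta m"
        proof (rule standard_signature_constant[OF rep y(3)])
          fix z assume z: "w + y \<le> z" "z \<le> s + x"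
          show "\<not> wall n (t * z)" using wmax[of z] z x y w(1) by auto
        qed
        then show ?thesis using d(2)[OF y(1,2)] by simp
      qed
      then show "\<exists>f. rational_character n f \<and>
          (\<forall>m. \<exists>d>0. \<forall>x. - d < x \<longrightarrow> x < 0 \<longrightarrow> standard_signature n (t * (s + x)) k rho beta m = f m)"
        using f(1) w(2) by (intro exI[of _ f] conjI allI exI[of _ "s - w"]) auto
    qed
  qed
qed

text \<open>The segment from 0 to \<open>c\<close> is traversed by \<open>t * s\<close> with
  \<open>t = c\<close> and \<open>s\<close> running up to 1.\<close>

theorem rational_character_standard_signature:
  assumes "hermitian_rep n k rho beta"
  shows "rational_character n (standard_signature n c k rho beta)"
proof (cases "c = 0")
  case True
  then show ?thesis using rational_character_parameter_zero[OF assms] by simp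
next
  case False
  then show ?thesis using rational_at_wall[OF _ rational_on_left_all[of 1] assms, of c] by simp
qed

section \<open>The Specht module as a matrix representation\<close>

definition specht_basis :: "nat \<Rightarrow> nat list \<Rightarrow> nat \<Rightarrow> (nat \<Rightarrow> tabvec) \<Rightarrow> bool" where
  "specht_basis n \<tau> k e \<longleftrightarrow> (\<forall>j<k. e j \<in> specht n \<tau>) \<and>
     (\<forall>v\<in>specht n \<tau>. \<exists>q. v = (\<Sum>j<k. tab_scale (q j) (e j))) \<and>
     (\<forall>q. (\<Sum>j<k. tab_scale (q j) (e j)) = 0 \<longrightarrow> (\<forall>j<k. q j = 0))"

lemma specht_basisD:
  assumes "specht_basis n \<tau> k e"
  shows "j < k \<Longrightarrow> e j \<in> specht n \<tau>" "v \<in> specht n \<tau> \<Longrightarrow> \<exists>q. v = (\<Sum>j<k. tab_scale (q j) (e j))"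
    "(\<Sum>j<k. tab_scale (q j) (e j)) = 0 \<Longrightarrow> j < k \<Longrightarrow> q j = 0"
  using assms unfolding specht_basis_def by blast+

text \<open>A polytabloid depends only on the restriction of the tableau to the cells, and
  restricted tableaux are finite in number.\<close>

lemma finite_polytabloids: "finite {polytabloid n \<tau> T | T. tableau n \<tau> T}"
proof (rule finite_subset)
  have "finite (cells \<tau>)"
    by (rule finite_subset[of _ "Sigma {..<length \<tau>} (\<lambda>i. {..<\<tau> ! i})"]) (auto simp: cells_def)
  then show "finite (polytabloid n \<tau> ` (cells \<tau> \<rightarrow>\<^sub>E {1..n}))" by (intro finite_imageI finite_PiE) auto
  have inv: "inv_into (cells \<tau>) (restrict T (cells \<tau>)) = inv_into (cells \<tau>) T" for T :: "nat \<times> nat \<Rightarrow> nat"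
  proof
    fix x
    have "(\<lambda>y. y \<in> cells \<tau> \<and> restrict T (cells \<tau>) y = x) = (\<lambda>y. y \<in> cells \<tau> \<and> T y = x)"
      by (auto simp: restrict_def)
    then show "inv_into (cells \<tau>) (restrict T (cells \<tau>)) x = inv_into (cells \<tau>) T x"
      unfolding inv_into_def by (rule arg_cong)
  qed
  have "polytabloid n \<tau> T = polytabloid n \<tau> (restrict T (cells \<tau>))" for T
    unfolding polytabloid_def column_stabilizer_def tabloid_def inv ..
  moreover have "restrict T (cells \<tau>) \<in> cells \<tau> \<rightarrow>\<^sub>E {1..n}" if "tableau n \<tau> T" for T
    using that unfolding tableau_def by (auto dest: bij_betwE)
  ultimately show "{polytabloid n \<tau> T | T. tableau n \<tau> T} \<subseteq> polytabloid n \<tau> ` (cells \<tau> \<rightarrow>\<^sub>E {1..n})"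
    by blast
qed

lemma specht_basis_exists: "\<exists>k e. specht_basis n \<tau> k e"
proof -
  interpret T: vector_space tab_scale by (rule vector_space_tab_scale)
  let ?P = "{polytabloid n \<tau> T | T. tableau n \<tau> T}"
  obtain B where B: "B \<subseteq> ?P" "T.independent B" "?P \<subseteq> T.span B"
    using T.maximal_independent_subset by blast
  have fin: "finite B" using B(1) finite_polytabloids by (rule finite_subset)
  then obtain e where e: "bij_betw e {0..<card B} B" using ex_bij_betw_nat_finite by blast
  then have e: "bij_betw e {..<card B} B" by (simp add: atLeast0LessThan)
  have comb: "(\<Sum>j<card B. tab_scale (q (e j)) (e j)) = (\<Sum>b\<in>B. tab_scale (q b) b)" for q
    by (rule sum.reindex_bij_betw[OF e])
  have span: "specht n \<tau> = T.span B"
  proof -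
    have "T.span ?P \<subseteq> T.span B" using T.span_mono[OF B(3)] T.span_span by simp
    then show ?thesis using T.span_mono[OF B(1)] unfolding specht_def by blast
  qed
  have "specht_basis n \<tau> (card B) e"
    unfolding specht_basis_def
  proof (intro conjI allI impI ballI)
    show "e j \<in> specht n \<tau>" if "j < card B" for j
      unfolding span using that bij_betwE[OF e] by (intro T.span_base) auto
    show "\<exists>q. v = (\<Sum>j<card B. tab_scale (q j) (e j))" if v: "v \<in> specht n \<tau>" for v
    proof -
      obtain q where "v = (\<Sum>b\<in>B. tab_scale (q b) b)"
        using v unfolding span T.span_finite[OF fin] by blast
      then show ?thesis using comb[of q] by (intro exI[of _ "\<lambda>j. q (e j)"]) simp
    qed
    fix q j assume q: "(\<Sum>j<card B. tab_scale (q j) (e j)) = 0" and j: "j < card B"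
    define g where "g = q \<circ> inv_into {..<card B} e"
    have g: "g (e i) = q i" if "i < card B" for i
      unfolding g_def using that bij_betw_imp_inj_on[OF e] by simp
    have "(\<Sum>b\<in>B. tab_scale (g b) b) = 0" unfolding comb[symmetric] using q g by simp
    moreover have "e j \<in> B" using j bij_betwE[OF e] by auto
    ultimately have "g (e j) = 0" using B(2) unfolding T.dependent_finite[OF fin] by blast
    then show "q j = 0" using g[OF j] by simp
  qed
  then show ?thesis by blast
qed

text \<open>Coordinates of the image of \<open>e l\<close>, unique by independence; the value 0 in
  rows from \<open>k\<close> on is what the locale \<open>dunkl\<close> asks for.\<close>

definition specht_rho :: "nat \<Rightarrow> (nat \<Rightarrow> tabvec) \<Rightarrow> (nat \<Rightarrow> nat) \<Rightarrow> nat \<Rightarrow> nat \<Rightarrow> complex" where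
  "specht_rho k e w j l =
     (if j < k then (SOME q. tab_act w (e l) = (\<Sum>j<k. tab_scale (q j) (e j))) j else 0)"

lemma tab_act_combination:
  "tab_act w (\<Sum>j\<in>A. tab_scale (q j) (f j)) = (\<Sum>j\<in>A. tab_scale (q j) (tab_act w (f j)))"
  by (simp add: tab_act_def tab_scale_def fun_eq_iff sum_fun_apply)

lemma tab_combination_collect:
  "(\<Sum>q\<in>A. tab_scale (a q) (\<Sum>j\<in>C. tab_scale (b j q) (f j))) =
   (\<Sum>j\<in>C. tab_scale (\<Sum>q\<in>A. b j q * a q) (f j))"
proof
  fix r
  have "(\<Sum>q\<in>A. \<Sum>j\<in>C. a q * (b j q * f j r)) = (\<Sum>j\<in>C. \<Sum>q\<in>A. a q * (b j q * f j r))"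
    by (rule sum.swap)
  then show "(\<Sum>q\<in>A. tab_scale (a q) (\<Sum>j\<in>C. tab_scale (b j q) (f j))) r =
      (\<Sum>j\<in>C. tab_scale (\<Sum>q\<in>A. b j q * a q) (f j)) r"
    by (simp add: tab_scale_def sum_fun_apply sum_distrib_left sum_distrib_right mult_ac)
qed

context
  fixes n \<tau> k e
  assumes e: "specht_basis n \<tau> k e"
begin

lemma specht_rho:
  assumes "w permutes {1..n}" "l < k"
  shows "tab_act w (e l) = (\<Sum>j<k. tab_scale (specht_rho k e w j l) (e j))"
proof -
  have "\<exists>q. tab_act w (e l) = (\<Sum>j<k. tab_scale (q j) (e j))"
    using specht_basisD(2)[OF e] specht_act[OF assms(1)] specht_basisD(1)[OF e] assms(2) by blast
  from someI_ex[OF this] show ?thesis unfolding specht_rho_def by simp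
qed

lemma specht_combination_eq:
  assumes "(\<Sum>j<k. tab_scale (q j) (e j)) = (\<Sum>j<k. tab_scale (q' j) (e j))" "j < k"
  shows "q j = q' j"
proof -
  have "(\<Sum>j<k. tab_scale (q j - q' j) (e j)) = (\<Sum>j<k. tab_scale (q j) (e j)) - (\<Sum>j<k. tab_scale (q' j) (e j))"
    by (auto simp: tab_scale_def fun_eq_iff sum_fun_apply sum_subtractf algebra_simps)
  then have "(\<Sum>j<k. tab_scale (q j - q' j) (e j)) = 0" using assms(1) by simp
  from specht_basisD(3)[OF e this assms(2)] show ?thesis by simp
qed

lemma dunkl_specht: "dunkl n k (specht_rho k e)"
proof
  show "specht_rho k e w j l = 0" if "k \<le> j" for w j l using that by (simp add: specht_rho_def)
  show "specht_rho k e id j l = (if j = l then 1 else 0)" if "j < k" "l < k" for j l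
  proof -
    have "(\<Sum>j<k. tab_scale (if j = l then 1 else 0) (e j)) = (\<Sum>j<k. if j = l then e j else 0)"
      by (rule sum.cong) (auto simp: tab_scale_def fun_eq_iff)
    also have "\<dots> = tab_act id (e l)" using that(2) by (simp add: tab_act_def)
    also have "\<dots> = (\<Sum>j<k. tab_scale (specht_rho k e id j l) (e j))"
      by (rule specht_rho[OF permutes_id that(2)])
    finally have "(\<Sum>j<k. tab_scale (if j = l then 1 else 0) (e j)) = (\<Sum>j<k. tab_scale (specht_rho k e id j l) (e j))" .
    from specht_combination_eq[OF this that(1)] show ?thesis by (rule sym)
  qed
  fix v w :: "nat \<Rightarrow> nat" and j l assume v: "v permutes {1..n}" and w: "w permutes {1..n}" and jl: "j < k" "l < k"
  have "(\<Sum>j<k. tab_scale (specht_rho k e (v \<circ> w) j l) (e j)) = tab_act v (tab_act w (e l))"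
    unfolding specht_rho[OF permutes_compose[OF w v] jl(2), symmetric] by (simp add: tab_act_def o_assoc)
  also have "\<dots> = (\<Sum>q<k. tab_scale (specht_rho k e w q l) (tab_act v (e q)))"
    unfolding specht_rho[OF w jl(2)] by (rule tab_act_combination)
  also have "\<dots> = (\<Sum>q<k. tab_scale (specht_rho k e w q l) (\<Sum>j<k. tab_scale (specht_rho k e v j q) (e j)))"
    by (intro sum.cong refl arg_cong[of _ _ "tab_scale _"] specht_rho[OF v]) simp
  also have "\<dots> = (\<Sum>j<k. tab_scale (\<Sum>q<k. specht_rho k e v j q * specht_rho k e w q l) (e j))"
    by (rule tab_combination_collect)
  finally show "specht_rho k e (v \<circ> w) j l = (\<Sum>q<k. specht_rho k e v j q * specht_rho k e w q l)"
    by (rule specht_combination_eq[OF _ jl(1)])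
qed

end

section \<open>Standard modules in coordinates\<close>

locale contravariant_module =
  fixes n :: nat and c :: real and \<tau> :: "nat list" and M :: "'m::ab_group_add hc_struct"
    and \<iota> :: "tabvec \<Rightarrow> 'm" and B :: "'m \<Rightarrow> 'm \<Rightarrow> complex" and k :: nat and e :: "nat \<Rightarrow> tabvec"
  assumes SM: "standard_module n c \<tau> M \<iota>" and CF: "contravariant_form n \<tau> M \<iota> B"
    and SB: "specht_basis n \<tau> k e"
begin

abbreviation rho where "rho \<equiv> specht_rho k e"

definition beta where "beta j l = B (\<iota> (e j)) (\<iota> (e l))"

lemma cM: "cherednik_module n c M" and eM: "equivariant_y_null n \<tau> M \<iota>"
  and bij: "bij_betw (tensor_map n M \<iota>) (poly_tensor n \<tau>) UNIV"
  using SM unfolding standard_module_def by auto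

lemmas SBD = specht_basisD[OF SB]
lemmas cMD = cherednik_moduleD[OF cM]

sublocale S: complex_space "scl M"
  by (rule complex_space.intro) (rule cMD(1))

lemma iota_add: "u \<in> specht n \<tau> \<Longrightarrow> v \<in> specht n \<tau> \<Longrightarrow> \<iota> (u + v) = \<iota> u + \<iota> v"
  and iota_scale: "v \<in> specht n \<tau> \<Longrightarrow> \<iota> (tab_scale a v) = scl M a (\<iota> v)"
  and iota_W: "w permutes {1..n} \<Longrightarrow> v \<in> specht n \<tau> \<Longrightarrow> Wop M w (\<iota> v) = \<iota> (tab_act w v)"
  and iota_Y: "i \<in> {1..n} \<Longrightarrow> v \<in> specht n \<tau> \<Longrightarrow> Yop M i (\<iota> v) = 0"
  using eM unfolding equivariant_y_null_def by blast+

lemma specht_combination: "(\<And>j. j < r \<Longrightarrow> f j \<in> specht n \<tau>) \<Longrightarrow> (\<Sum>j<r::nat. tab_scale (q j) (f j)) \<in> specht n \<tau>"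
  by (induction r) (auto intro: specht_zero specht_add specht_scale)

lemma iota_combination:
  assumes "\<And>j. j < r \<Longrightarrow> f j \<in> specht n \<tau>"
  shows "\<iota> (\<Sum>j<r::nat. tab_scale (q j) (f j)) = (\<Sum>j<r. scl M (q j) (\<iota> (f j)))"
  using assms
proof (induction r)
  case 0
  have "tab_scale 0 0 = (0 :: tabvec)" by (simp add: tab_scale_def fun_eq_iff)
  then have "\<iota> 0 = 0" using iota_scale[OF specht_zero, of 0] by simp
  then show ?case by (simp only: lessThan_0 sum.empty)
next
  case (Suc r)
  have "\<iota> ((\<Sum>j<r. tab_scale (q j) (f j)) + tab_scale (q r) (f r)) =
      \<iota> (\<Sum>j<r. tab_scale (q j) (f j)) + \<iota> (tab_scale (q r) (f r))"
    by (rule iota_add[OF specht_combination specht_scale]) (use Suc.prems in auto)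
  also have "\<iota> (tab_scale (q r) (f r)) = scl M (q r) (\<iota> (f r))"
    by (rule iota_scale) (use Suc.prems in auto)
  also have "\<iota> (\<Sum>j<r. tab_scale (q j) (f j)) = (\<Sum>j<r. scl M (q j) (\<iota> (f j)))"
    by (rule Suc.IH) (use Suc.prems in auto)
  finally show ?case by (simp only: sum.lessThan_Suc)
qed

lemma iota_basis: "\<iota> (\<Sum>j<k. tab_scale (q j) (e j)) = (\<Sum>j<k. scl M (q j) (\<iota> (e j)))"
  by (rule iota_combination) (rule SBD(1))

lemma B_linear: "Vector_Spaces.linear (scl M) (*) (\<lambda>u. B u v)"
  and B_sym: "B v u = cnj (B u v)"
  and B_W: "w permutes {1..n} \<Longrightarrow> B (Wop M w u) (Wop M w v) = B u v"
  and B_X: "i \<in> {1..n} \<Longrightarrow> B (Xop M i u) v = B u (Yop M i v)"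
  and B_nondegenerate: "(\<And>v. B u v = 0) \<Longrightarrow> u = 0"
  and B_positive: "x \<in> specht n \<tau> \<Longrightarrow> x \<noteq> 0 \<Longrightarrow> 0 < Re (B (\<iota> x) (\<iota> x))"
  using CF unfolding contravariant_form_def by blast+

lemmas B_add = linear_add[OF B_linear] and B_scale = linear_scl[OF B_linear]
  and B_sum = linear_setsum[OF B_linear] and B_zero = linear_null[OF B_linear]

lemma B_sum_right: "B u (sum f A) = (\<Sum>x\<in>A. B u (f x))"
  by (subst B_sym) (simp add: B_sum B_sym[symmetric])

lemma B_scale_right: "B u (scl M a v) = cnj a * B u v"
  by (subst B_sym) (simp add: B_scale B_sym[symmetric])

lemma B_add_right: "B u (v + w) = B u v + B u w"
  by (subst B_sym) (simp add: B_add B_sym[symmetric])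

lemma B_combination:
  "B (\<Sum>j\<in>A. scl M (q j) (f j)) (\<Sum>l\<in>C. scl M (p l) (g l)) = (\<Sum>j\<in>A. \<Sum>l\<in>C. q j * B (f j) (g l) * cnj (p l))"
  by (simp only: B_sum B_scale) (simp only: B_sum_right B_scale_right sum_distrib_left mult_ac)

lemma B_Y: "i \<in> {1..n} \<Longrightarrow> B (Yop M i u) v = B u (Xop M i v)"
  using B_X[of i v u] B_sym[of "Yop M i u" v] B_sym[of u "Xop M i v"] by simp

lemma hermitian_on_B: "S.subspace N \<Longrightarrow> S.hermitian_on N B"
  unfolding S.hermitian_on_def using B_add B_scale B_sym by blast

lemma beta_positive:
  assumes "j < k" "q j \<noteq> 0"
  shows "0 < Re (\<Sum>j<k. \<Sum>l<k. q j * beta j l * cnj (q l))"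
proof -
  let ?v = "\<Sum>j<k. tab_scale (q j) (e j)"
  have "?v \<noteq> 0" using SBD(3)[of q j] assms by blast
  moreover have "?v \<in> specht n \<tau>" using SBD(1) by (rule specht_combination)
  ultimately have "0 < Re (B (\<iota> ?v) (\<iota> ?v))" by (intro B_positive)
  moreover have "B (\<iota> ?v) (\<iota> ?v) = (\<Sum>j<k. \<Sum>l<k. q j * beta j l * cnj (q l))"
    unfolding iota_basis B_combination beta_def ..
  ultimately show ?thesis by simp
qed

lemma dunkl_form_beta: "dunkl_form n k rho 0 cnj beta"
proof -
  interpret dunkl n k rho 0 using dunkl_specht[OF SB] .
  show ?thesis
  proof
    show "beta l j = cnj (beta j l)" for j l unfolding beta_def by (rule B_sym)
    show "(\<Sum>p<k. \<Sum>q<k. rho w p j * beta p q * cnj (rho w q l)) = beta j l"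
      if w: "w permutes {1..n}" and jl: "j < k" "l < k" for w j l
    proof -
      have W: "Wop M w (\<iota> (e l)) = (\<Sum>p<k. scl M (rho w p l) (\<iota> (e p)))" if "l < k" for l
        unfolding iota_W[OF w SBD(1)[OF that]] specht_rho[OF SB w that] by (rule iota_basis)
      have "beta j l = B (Wop M w (\<iota> (e j))) (Wop M w (\<iota> (e l)))" unfolding beta_def B_W[OF w] ..
      also have "\<dots> = (\<Sum>p<k. \<Sum>q<k. rho w p j * beta p q * cnj (rho w q l))"
        unfolding W[OF jl(1)] W[OF jl(2)] B_combination beta_def ..
      finally show ?thesis ..
    qed
  qed simp_all
qed

sublocale D: dunkl_form n k rho "complex_of_real c" cnj beta
proof -
  interpret dunkl_form n k rho 0 cnj beta by (rule dunkl_form_beta)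
  show "dunkl_form n k rho (complex_of_real c) cnj beta"
    by unfold_locales (auto simp: rho_zero rho_id rho_comp beta_inv intro: beta_sym)
qed

text \<open>Identifies degree \<open>m\<close> of the coordinate model with the part of
  \<open>M\<close> in that degree, so that results on the model transfer.\<close>

definition coord :: "nat \<Rightarrow> complex vec_poly \<Rightarrow> 'm" where
  "coord m u = (\<Sum>p\<in>monomial_indices n k m. scl M (u p) (x_monomial n M (fst p) (\<iota> (e (snd p)))))"

lemma coord_add: "coord m (\<lambda>p. u p + v p) = coord m u + coord m v"
  and coord_scale: "coord m (\<lambda>p. a * u p) = scl M a (coord m u)"
  and coord_zero: "coord m (\<lambda>p. 0) = 0"
  by (simp_all add: coord_def S.scale_left_distrib sum.distrib S.scale_sum_right)

lemma coord_diff: "coord m (\<lambda>p. u p - v p) = coord m u - coord m v"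
  using coord_add[of m "\<lambda>p. u p - v p" v] by (simp add: algebra_simps)

lemma coord_sum: "coord m (\<lambda>p. \<Sum>s\<in>A. f s p) = (\<Sum>s\<in>A. coord m (f s))"
  by (induction A rule: infinite_finite_induct) (simp_all add: coord_zero coord_add)

lemma linX: "i \<in> {1..n} \<Longrightarrow> Vector_Spaces.linear (scl M) (scl M) (Xop M i)"
  and linY: "i \<in> {1..n} \<Longrightarrow> Vector_Spaces.linear (scl M) (scl M) (Yop M i)"
  and linW: "w permutes {1..n} \<Longrightarrow> Vector_Spaces.linear (scl M) (scl M) (Wop M w)"
  by (rule cMD(3), simp, rule cMD(4), simp, rule cMD(2))

lemma coord_base: "coord 0 u = (\<Sum>j<k. scl M (u (\<lambda>_. 0, j)) (\<iota> (e j)))"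
  unfolding coord_def D.monomial_indices_zero
  by (subst sum.reindex) (auto simp: inj_on_def x_monomial_zero_exponent)

lemma coord_x:
  assumes i: "i \<in> {1..n}" and u: "u \<in> D.V m"
  shows "coord (Suc m) (mult_x i u) = Xop M i (coord m u)"
proof -
  let ?M = "monomial_indices n k"
  let ?g = "\<lambda>p :: (nat \<Rightarrow> nat) \<times> nat. ((fst p)(i := Suc (fst p i)), snd p)"
  have g: "?g p \<in> ?M (Suc m)" if p: "p \<in> ?M m" for p
  proof -
    obtain a j where aj: "p = (a, j)" by (cases p)
    have "a \<in> exponents n" "(\<Sum>l\<in>{1..n}. a l) = m" "j < k" using p by (auto simp: aj monomial_indices_def)
    moreover have "(\<Sum>l\<in>{1..n}. (a(i := Suc (a i))) l) = Suc (\<Sum>l\<in>{1..n}. a l)"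
      using sum_degree_upd[OF i, of a "Suc (a i)"] by linarith
    ultimately show ?thesis using i unfolding aj monomial_indices_def by (auto simp: exponents_def)
  qed
  have inj: "inj_on ?g (?M m)"
  proof (rule inj_onI)
    fix p q assume eq: "?g p = ?g q"
    have "fst p l = fst q l" for l using fun_cong[of _ _ l, OF arg_cong[of _ _ fst, OF eq]] by (cases "l = i") auto
    then show "p = q" using eq by (auto simp: prod_eq_iff)
  qed
  have mg: "mult_x i u (?g p) = u p" for p by (cases p) (simp add: mult_x_def)
  have "coord (Suc m) (mult_x i u) =
      (\<Sum>p\<in>?g ` ?M m. scl M (mult_x i u p) (x_monomial n M (fst p) (\<iota> (e (snd p)))))"
    unfolding coord_def
  proof (rule sum.mono_neutral_right[OF finite_monomial_indices])
    show "?g ` ?M m \<subseteq> ?M (Suc m)" using g by blast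
    show "\<forall>p\<in>?M (Suc m) - ?g ` ?M m. scl M (mult_x i u p) (x_monomial n M (fst p) (\<iota> (e (snd p)))) = 0"
    proof
      fix p assume p: "p \<in> ?M (Suc m) - ?g ` ?M m"
      obtain a j where aj: "p = (a, j)" by (cases p)
      have "mult_x i u p = 0"
      proof (rule ccontr)
        assume "mult_x i u p \<noteq> 0"
        then have a: "a i \<noteq> 0" "u (a(i := a i - 1), j) \<noteq> 0" by (auto simp: aj mult_x_def split: if_splits)
        then have "(a(i := a i - 1), j) \<in> ?M m" using u by (auto simp: supported_on_def)
        moreover have "p = ?g (a(i := a i - 1), j)" using a(1) by (simp add: aj)
        ultimately show False using p by blast
      qed
      then show "scl M (mult_x i u p) (x_monomial n M (fst p) (\<iota> (e (snd p)))) = 0" by simp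
    qed
  qed
  also have "\<dots> = (\<Sum>p\<in>?M m. scl M (u p) (Xop M i (x_monomial n M (fst p) (\<iota> (e (snd p))))))"
    unfolding sum.reindex[OF inj] comp_def mg x_monomial_Suc[OF cM i] by simp
  also have "\<dots> = Xop M i (coord m u)"
    unfolding coord_def linear_setsum[OF linX[OF i]] linear_scl[OF linX[OF i]] ..
  finally show ?thesis .
qed

lemma coord_W:
  assumes w: "w permutes {1..n}" and u: "u \<in> D.V m"
  shows "coord m (D.opW w u) = Wop M w (coord m u)"
  using u
proof (induction rule: D.hpart_induct)
  case (base u)
  have W: "Wop M w (\<iota> (e l)) = (\<Sum>p<k. scl M (rho w p l) (\<iota> (e p)))" if "l < k" for l
    unfolding iota_W[OF w SBD(1)[OF that]] specht_rho[OF SB w that] by (rule iota_basis)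
  have "coord 0 (D.opW w u) = (\<Sum>j<k. \<Sum>q<k. scl M (u (\<lambda>_. 0, q)) (scl M (rho w j q) (\<iota> (e j))))"
    unfolding coord_base D.opW_def by (simp add: S.scale_sum_left comp_def mult.commute)
  also have "\<dots> = (\<Sum>q<k. scl M (u (\<lambda>_. 0, q)) (\<Sum>j<k. scl M (rho w j q) (\<iota> (e j))))"
    unfolding S.scale_sum_right by (rule sum.swap)
  also have "\<dots> = Wop M w (coord 0 u)"
    unfolding coord_base linear_setsum[OF linW[OF w]] linear_scl[OF linW[OF w]]
    by (rule sum.cong) (simp_all add: W)
  finally show ?case .
next
  case (add m u v)
  then show ?case by (simp add: D.W_add coord_add linear_add[OF linW[OF w]])
next
  case (step m i u)
  have wi: "w i \<in> {1..n}" using permutes_in_image[OF w] step(1) by simp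
  show ?case
    unfolding D.W_x[OF w] coord_x[OF wi D.W_hpart[OF w step(2)]] coord_x[OF step(1,2)] step(3)
    by (rule W_mult[OF cM w step(1), symmetric])
next
  case (zero m)
  have "D.opW w (\<lambda>p. 0) = (\<lambda>p. 0)" by (auto simp: D.opW_def)
  then show ?case by (simp add: coord_zero linear_null[OF linW[OF w]])
qed

text \<open>The \<open>y\<^sub>i\<close> of any standard module are Dunkl operators: the relations
  and the vanishing on the bottom layer determine them. In degree 0 both sides are 0, so the
  truncated \<open>m - 1\<close> does no harm.\<close>

lemma coord_Y:
  assumes i: "i \<in> {1..n}" and u: "u \<in> D.V m"
  shows "Yop M i (coord m u) = coord (m - 1) (D.opY i u)"
  using u
proof (induction rule: D.hpart_induct)
  case (base u)
  have "Yop M i (coord 0 u) = 0"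
    unfolding coord_base linear_setsum[OF linY[OF i]] linear_scl[OF linY[OF i]]
    by (intro sum.neutral) (auto simp: iota_Y[OF i SBD(1)])
  then show ?case by (simp add: D.Y_hpart_zero[OF i base] coord_zero)
next
  case (add m u v)
  then show ?case by (simp add: D.Y_add coord_add linear_add[OF linY[OF i]])
next
  case (zero m)
  then show ?case by (simp add: coord_zero linear_null[OF linY[OF i]] D.Y_zero)
next
  case (step m l u)
  have XY: "Xop M l (Yop M i (coord m u)) = coord m (mult_x l (D.opY i u))"
  proof (cases m)
    case 0
    then have Y0: "D.opY i u = (\<lambda>p. 0)" using D.Y_hpart_zero[OF i] step(2) by simp
    have "mult_x l (\<lambda>p. 0 :: complex) = (\<lambda>p. 0)" by (auto simp: mult_x_def)
    then show ?thesis unfolding step(3) Y0 by (simp add: coord_zero linear_null[OF linX[OF step(1)]])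
  next
    case (Suc m')
    then show ?thesis
      unfolding step(3) using coord_x[OF step(1) D.Y_hpart[OF i, of u m']] step(2) by simp
  qed
  have Wt: "coord m (D.opW (transpose i s) u) = Wop M (transpose i s) (coord m u)" if "s \<in> {1..n}" for s
    by (rule coord_W[OF permutes_swap_id[OF i that] step(2)])
  have "Yop M i (Xop M l (coord m u)) = Xop M l (Yop M i (coord m u)) + coord m (D.comm i l u)"
  proof (cases "i = l")
    case True
    have "coord m (D.comm i i u) = coord m u - scl M (of_real c) (\<Sum>s\<in>{1..n} - {i}. coord m (D.opW (transpose i s) u))"
      by (simp add: D.comm_def coord_diff coord_scale coord_sum)
    also have "(\<Sum>s\<in>{1..n} - {i}. coord m (D.opW (transpose i s) u)) = (\<Sum>s\<in>{1..n} - {i}. Wop M (transpose i s) (coord m u))"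
      by (rule sum.cong) (simp_all add: Wt)
    finally show ?thesis using YX_equal[OF cM i, of "coord m u"] True by simp
  next
    case False
    then show ?thesis using YX_distinct[OF cM i step(1) False, of "coord m u"] Wt[OF step(1)]
      by (simp add: D.comm_def coord_scale)
  qed
  then show ?case
    unfolding coord_x[OF step(1,2)] D.YX[OF step(1)] XY by (simp add: coord_add)
qed

lemma coord_form:
  assumes u: "u \<in> D.V m" and v: "v \<in> D.V m"
  shows "B (coord m u) (coord m v) = standard_form n c k rho beta m u v"
proof -
  have "\<forall>v\<in>D.V m. B (coord m u) (coord m v) = D.form m u v"
    using u
  proof (induction rule: D.hpart_induct)
    case (base u)
    show ?case
      unfolding coord_base D.form_base B_combination by (simp add: beta_def)
  next
    case (add m u v)
    then show ?case by (simp add: coord_add D.form_add_left B_add)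
  next
    case (step m i u)
    show ?case
    proof
      fix v assume v: "v \<in> D.V (Suc m)"
      have "B (coord (Suc m) (mult_x i u)) (coord (Suc m) v) = B (coord m u) (coord m (D.opY i v))"
        unfolding coord_x[OF step(1,2)] B_X[OF step(1)] coord_Y[OF step(1) v] by simp
      then show "B (coord (Suc m) (mult_x i u)) (coord (Suc m) v) = D.form (Suc m) (mult_x i u) v"
        using step(3) D.Y_hpart[OF step(1) v] D.form_x_left[OF step(1) v] by simp
    qed
  next
    case (zero m)
    then show ?case by (simp add: coord_zero D.form_zero_left B_zero)
  qed
  then show ?thesis using v by (simp add: standard_form_def)
qed

lemma coord_tensor:
  assumes u: "u \<in> D.V m"
  defines "F \<equiv> \<lambda>a. \<Sum>j<k. tab_scale (u (a, j)) (e j)"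
  shows "F \<in> poly_tensor n \<tau>" "tensor_map n M \<iota> F = coord m u" "F a \<noteq> 0 \<Longrightarrow> (\<Sum>i\<in>{1..n}. a i) = m"
proof -
  let ?A = "{a \<in> exponents n. (\<Sum>i\<in>{1..n}. a i) = m}"
  have F0: "F a = 0" if "a \<notin> ?A" for a
  proof -
    have "u (a, j) = 0" for j using u that by (auto simp: supported_on_def monomial_indices_def)
    then show ?thesis by (simp add: F_def tab_scale_def fun_eq_iff sum_fun_apply)
  qed
  then have sub: "{a. F a \<noteq> 0} \<subseteq> ?A" by blast
  have fin: "finite ?A" by (rule finite_exponents_degree)
  have Fs: "F a \<in> specht n \<tau>" for a unfolding F_def using SBD(1) by (rule specht_combination)
  show "F \<in> poly_tensor n \<tau>"
    unfolding poly_tensor_def using finite_subset[OF sub fin] Fs F0 by auto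
  show "(\<Sum>i\<in>{1..n}. a i) = m" if "F a \<noteq> 0" using sub that by blast
  have "tensor_map n M \<iota> F = (\<Sum>a\<in>?A. x_monomial n M a (\<iota> (F a)))"
    by (rule tensor_map_superset[OF cM eM fin sub])
  also have "\<dots> = (\<Sum>a\<in>?A. \<Sum>j<k. scl M (u (a, j)) (x_monomial n M a (\<iota> (e j))))"
  proof (rule sum.cong[OF refl])
    fix a assume "a \<in> ?A"
    have lin: "x_monomial n M a (\<Sum>j<r. scl M (q j) (f j)) = (\<Sum>j<r. scl M (q j) (x_monomial n M a (f j)))" for r :: nat and q f
    proof (induction r)
      case 0
      show ?case using x_monomial_scl[OF cM, of a 0 0] by simp
    next
      case (Suc r)
      then show ?case using x_monomial_add[OF cM] x_monomial_scl[OF cM] by simp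
    qed
    show "x_monomial n M a (\<iota> (F a)) = (\<Sum>j<k. scl M (u (a, j)) (x_monomial n M a (\<iota> (e j))))"
      unfolding F_def iota_basis lin ..
  qed
  also have "\<dots> = coord m u"
  proof -
    have "monomial_indices n k m = ?A \<times> {..<k}" by (auto simp: monomial_indices_def)
    then show ?thesis unfolding coord_def by (simp add: sum.cartesian_product case_prod_unfold)
  qed
  finally show "tensor_map n M \<iota> F = coord m u" .
qed

lemma degree_part_coord: "degree_part n \<tau> M \<iota> m = coord m ` D.V m"
proof
  show "coord m ` D.V m \<subseteq> degree_part n \<tau> M \<iota> m"
  proof (rule image_subsetI)
    fix u :: "complex vec_poly" assume u: "u \<in> D.V m"
    show "coord m u \<in> degree_part n \<tau> M \<iota> m"
      unfolding degree_part_def coord_tensor(2)[OF u, symmetric]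
      using coord_tensor(1,3)[OF u] by blast
  qed
  show "degree_part n \<tau> M \<iota> m \<subseteq> coord m ` D.V m"
  proof
    fix x assume "x \<in> degree_part n \<tau> M \<iota> m"
    then obtain F where F: "F \<in> poly_tensor n \<tau>" "\<And>a. F a \<noteq> 0 \<Longrightarrow> (\<Sum>i\<in>{1..n}. a i) = m" "x = tensor_map n M \<iota> F"
      unfolding degree_part_def by blast
    have "\<forall>a. \<exists>q. F a = (\<Sum>j<k. tab_scale (q j) (e j))" using SBD(2) F(1) by (auto simp: poly_tensor_def)
    from choice[OF this] obtain q where q: "\<And>a. F a = (\<Sum>j<k. tab_scale (q a j) (e j))" by blast
    define u where "u = (\<lambda>(a, j). if (a, j) \<in> monomial_indices n k m then q a j else 0)"
    have u: "u \<in> D.V m" by (auto simp: supported_on_def u_def)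
    have "(\<lambda>a. \<Sum>j<k. tab_scale (u (a, j)) (e j)) = F"
    proof
      fix a
      show "(\<Sum>j<k. tab_scale (u (a, j)) (e j)) = F a"
      proof (cases "a \<in> exponents n \<and> (\<Sum>i\<in>{1..n}. a i) = m")
        case True
        then show ?thesis unfolding q by (intro sum.cong) (auto simp: u_def monomial_indices_def)
      next
        case False
        then have "F a = 0" using F(1,2) by (auto simp: poly_tensor_def)
        moreover have "u (a, j) = 0" for j using False by (auto simp: u_def monomial_indices_def)
        ultimately show ?thesis by (simp add: tab_scale_def fun_eq_iff sum_fun_apply)
      qed
    qed
    then have "x = coord m u" using coord_tensor(2)[OF u] F(3) by simp
    then show "x \<in> coord m ` D.V m" using u by blast
  qed
qed

lemma coord_eq_zero:
  assumes u: "u \<in> D.V m" and z: "coord m u = 0"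
  shows "u = 0"
proof -
  let ?F = "\<lambda>a. \<Sum>j<k. tab_scale (u (a, j)) (e j)"
  have 0: "(\<lambda>p. 0 :: complex) \<in> D.V m" by (simp add: supported_on_def)
  have "tensor_map n M \<iota> ?F = tensor_map n M \<iota> (\<lambda>a. \<Sum>j<k. tab_scale 0 (e j))"
    using coord_tensor(2)[OF u] coord_tensor(2)[OF 0] z coord_zero by simp
  then have "?F = (\<lambda>a. \<Sum>j<k. tab_scale 0 (e j))"
    using bij coord_tensor(1)[OF u] coord_tensor(1)[OF 0] by (auto simp: bij_betw_def dest: inj_onD)
  then have z': "(\<Sum>j<k. tab_scale (u (a, j)) (e j)) = 0" for a
    by (auto simp: tab_scale_def fun_eq_iff sum_fun_apply)
  have "u (a, j) = 0" if "j < k" for a j using SBD(3)[of "\<lambda>j. u (a, j)", OF z' that] .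
  moreover have "u (a, j) = 0" if "\<not> j < k" for a j using u that by (auto simp: supported_on_def monomial_indices_def)
  ultimately have "u (a, j) = 0" for a j by blast
  then show ?thesis by (auto simp: fun_eq_iff)
qed

lemma coord_orthogonal_bottom:
  assumes "u \<in> D.V m" "0 < m" and v: "v \<in> specht n \<tau>"
  shows "B (coord m u) (\<iota> v) = 0"
  using assms(1,2)
proof (induction rule: D.hpart_induct)
  case (step m i u)
  show ?case unfolding coord_x[OF step(1,2)] B_X[OF step(1)] iota_Y[OF step(1) v]
    using B_sym[of 0 "coord m u"] B_zero by simp
qed (simp_all add: coord_add coord_zero B_add B_zero)

text \<open>Nondegeneracy of \<open>B\<close> concerns all of \<open>M\<close>, so the radical in
  degree \<open>m\<close> must also be shown orthogonal to the other degrees. The induction is on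
  the second vector, for all \<open>m\<close> together: \<open>Xop M i w\<close> is traded for
  \<open>D.opY i u\<close>, again in a radical, until the bottom layer is reached.\<close>

lemma form_nondegenerate:
  assumes "u \<in> D.V m" "\<And>v. v \<in> D.V m \<Longrightarrow> standard_form n c k rho beta m u v = 0"
  shows "u = 0"
proof (rule coord_eq_zero[OF assms(1)])
  have "\<forall>m u. u \<in> D.V m \<longrightarrow> (\<forall>v\<in>D.V m. D.form m u v = 0) \<longrightarrow> B (coord m u) w = 0" for w
  proof (induction w rule: standard_module_induct[OF SM])
    case 1
    show ?case using B_sym[of 0] B_zero by simp
  next
    case (2 w w')
    then show ?case by (simp add: B_add_right)
  next
    case (3 x)
    show ?case
    proof (intro allI impI)
      fix m u assume u: "u \<in> D.V m" and z: "\<forall>v\<in>D.V m. D.form m u v = 0"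
      show "B (coord m u) (\<iota> x) = 0"
      proof (cases "m = 0")
        case True
        obtain q where q: "x = (\<Sum>j<k. tab_scale (q j) (e j))" using SBD(2)[OF 3] by blast
        define v where "v = (\<lambda>(a :: nat \<Rightarrow> nat, j). if a = (\<lambda>_. 0) \<and> j < k then q j else 0)"
        have v: "v \<in> D.V 0" by (auto simp: v_def supported_on_def monomial_indices_def exponents_def)
        have "\<iota> x = coord 0 v" unfolding coord_base q iota_basis by (simp add: v_def)
        then show ?thesis using coord_form[of u 0 v] u v z True by (simp add: standard_form_def)
      qed (use coord_orthogonal_bottom u 3 in simp)
    qed
  next
    case (4 i w)
    show ?case
    proof (intro allI impI)
      fix m u assume u: "u \<in> D.V m" and z: "\<forall>v\<in>D.V m. D.form m u v = 0"
      have e: "B (coord m u) (Xop M i w) = B (coord (m - 1) (D.opY i u)) w"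
        using B_Y[OF 4(1), of "coord m u" w] coord_Y[OF 4(1) u] by simp
      show "B (coord m u) (Xop M i w) = 0"
      proof (cases m)
        case 0
        then show ?thesis unfolding e using D.Y_hpart_zero[OF 4(1)] u by (simp add: coord_zero B_zero)
      next
        case (Suc m')
        then have uS: "u \<in> D.V (Suc m')" using u by simp
        have "D.form m' (D.opY i u) v = 0" if v: "v \<in> D.V m'" for v
          using z Suc mult_x_hpart[OF 4(1) v] D.form_Y_left[OF uS v 4(1)] by simp
        then show ?thesis unfolding e using 4(2) D.Y_hpart[OF 4(1) uS] Suc by simp
      qed
    qed
  qed
  then show "coord m u = 0" using assms by (intro B_nondegenerate) (auto simp: standard_form_def)
qed

lemma signature_degree_part:
  "S.subspace (degree_part n \<tau> M \<iota> m)" (is ?A)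
  "S.signature (degree_part n \<tau> M \<iota> m) B = standard_signature n c k rho beta m" (is ?B)
proof -
  show sub: ?A
    unfolding S.subspace_def degree_part_coord
  proof (intro conjI ballI allI)
    show "0 \<in> coord m ` D.V m"
      by (rule image_eqI[of _ _ "\<lambda>p. 0"]) (auto simp: coord_zero supported_on_def)
  next
    fix x y assume "x \<in> coord m ` D.V m" "y \<in> coord m ` D.V m"
    then obtain u v where "u \<in> D.V m" "v \<in> D.V m" "x = coord m u" "y = coord m v" by blast
    then show "x + y \<in> coord m ` D.V m"
      by (intro image_eqI[of _ _ "\<lambda>p. u p + v p"]) (auto simp: coord_add supported_on_def)
  next
    fix r x assume "x \<in> coord m ` D.V m"
    then obtain u where "u \<in> D.V m" "x = coord m u" by blast
    then show "scl M r x \<in> coord m ` D.V m"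
      by (intro image_eqI[of _ _ "\<lambda>p. r * u p"]) (auto simp: coord_scale supported_on_def)
  qed
  show ?B
    unfolding standard_signature_def
  proof (rule signature_isometry[where f = "coord m"])
    show "complex_space (scale_fun :: complex \<Rightarrow> ((nat \<Rightarrow> nat) \<times> nat \<Rightarrow> complex) \<Rightarrow> _)"
      by (rule complex_space_scale_fun)
    show "complex_space (scl M)" by unfold_locales
    show st: "fun_space.hermitian_on (hpart n k m) (standard_form n c k rho beta m)"
      by (rule hermitian_on_standard) unfold_locales
    show "S.hermitian_on (degree_part n \<tau> M \<iota> m) B" by (rule hermitian_on_B[OF sub])
    show "fun_space.finite_rank (hpart n k m) (standard_form n c k rho beta m) (card (monomial_indices n k m))"
      by (rule finite_rank_supported_on[OF finite_monomial_indices st])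
    show "B (coord m u) (coord m v) = standard_form n c k rho beta m u v"
      if "u \<in> hpart n k m" "v \<in> hpart n k m" for u v by (rule coord_form[OF that])
  qed (auto simp: degree_part_coord)
qed

end

section \<open>Independence of the form on the Specht module\<close>

definition positive_rep ::
  "nat \<Rightarrow> nat \<Rightarrow> ((nat \<Rightarrow> nat) \<Rightarrow> nat \<Rightarrow> nat \<Rightarrow> complex) \<Rightarrow> (nat \<Rightarrow> nat \<Rightarrow> complex) \<Rightarrow> bool" where
  "positive_rep n k rho beta \<longleftrightarrow> dunkl_form n k rho 0 cnj beta \<and>
     (\<forall>q. (\<exists>j<k. q j \<noteq> 0) \<longrightarrow> 0 < Re (\<Sum>j<k. \<Sum>l<k. q j * beta j l * cnj (q l)))"

lemma positive_rep_hermitian_rep: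
  assumes "positive_rep n k rho beta"
  shows "hermitian_rep n k rho beta"
  unfolding hermitian_rep_def
proof (intro conjI allI impI)
  show "dunkl_form n k rho 0 cnj beta" using assms by (simp add: positive_rep_def)
  fix q j assume z: "\<forall>l<k. (\<Sum>j<k. q j * beta j l) = 0" and j: "j < k"
  have "(\<Sum>j<k. \<Sum>l<k. q j * beta j l * cnj (q l)) = (\<Sum>l<k. (\<Sum>j<k. q j * beta j l) * cnj (q l))"
    unfolding sum_distrib_right by (rule sum.swap)
  also have "\<dots> = 0" using z by (intro sum.neutral) auto
  finally have z: "(\<Sum>j<k. \<Sum>l<k. q j * beta j l * cnj (q l)) = 0" .
  show "q j = 0"
  proof (rule ccontr)
    assume "q j \<noteq> 0"
    then have "0 < Re (\<Sum>j<k. \<Sum>l<k. q j * beta j l * cnj (q l))"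
      using assms j unfolding positive_rep_def by blast
    then show False unfolding z by simp
  qed
qed

lemma positive_rep_convex:
  assumes "positive_rep n k rho b0" "positive_rep n k rho b1" and x: "0 \<le> x" "x \<le> 1"
  shows "positive_rep n k rho (\<lambda>j l. of_real (1 - x) * b0 j l + of_real x * b1 j l)"
proof -
  interpret D0: dunkl_form n k rho 0 cnj b0 using assms(1) by (simp add: positive_rep_def)
  interpret D1: dunkl_form n k rho 0 cnj b1 using assms(2) by (simp add: positive_rep_def)
  have lin: "(\<Sum>j<k. \<Sum>l<k. f j * (of_real (1 - x) * b0 j l + of_real x * b1 j l) * g l) =
      of_real (1 - x) * (\<Sum>j<k. \<Sum>l<k. f j * b0 j l * g l) + of_real x * (\<Sum>j<k. \<Sum>l<k. f j * b1 j l * g l)" for f g :: "nat \<Rightarrow> complex"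
    unfolding sum_distrib_left sum.distrib[symmetric] by (intro sum.cong refl) (simp add: algebra_simps)
  show ?thesis
    unfolding positive_rep_def
  proof (intro conjI allI impI)
    show "dunkl_form n k rho 0 cnj (\<lambda>j l. of_real (1 - x) * b0 j l + of_real x * b1 j l)"
    proof
      show "of_real (1 - x) * b0 l j + of_real x * b1 l j = cnj (of_real (1 - x) * b0 j l + of_real x * b1 j l)"
        if "j < k" "l < k" for j l using D0.beta_sym[OF that] D1.beta_sym[OF that] by simp
      show "(\<Sum>p<k. \<Sum>q<k. rho w p j * (of_real (1 - x) * b0 p q + of_real x * b1 p q) * cnj (rho w q l)) =
          of_real (1 - x) * b0 j l + of_real x * b1 j l"
        if "w permutes {1..n}" "j < k" "l < k" for w j l
        unfolding lin D0.beta_inv[OF that] D1.beta_inv[OF that] ..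
    qed simp_all
    fix q :: "nat \<Rightarrow> complex" assume "\<exists>j<k. q j \<noteq> 0"
    then have p: "0 < Re (\<Sum>j<k. \<Sum>l<k. q j * b0 j l * cnj (q l))" "0 < Re (\<Sum>j<k. \<Sum>l<k. q j * b1 j l * cnj (q l))"
      using assms(1,2) unfolding positive_rep_def by blast+
    have "Re (of_real (1 - x) * z0 + of_real x * z1) > 0" if "0 < Re z0" "0 < Re z1" for z0 z1
    proof (cases "x = 0")
      case False
      then have "0 < x * Re z1" "0 \<le> (1 - x) * Re z0" using that x by simp_all
      then show ?thesis by simp
    qed (use that in simp)
    from this[OF p] show "0 < Re (\<Sum>j<k. \<Sum>l<k. q j * (of_real (1 - x) * b0 j l + of_real x * b1 j l) * cnj (q l))"
      unfolding lin .
  qed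
qed

text \<open>By induction a radical vector of the \<open>b1\<close> form is killed by all
  \<open>y\<^sub>i\<close>. This property does not mention the form, and in positive degree it puts
  the vector in the radical of the \<open>b0\<close> form as well.\<close>

lemma standard_form_nondegenerate_transfer:
  assumes "hermitian_rep n k rho b0" "hermitian_rep n k rho b1"
    and nd: "\<And>m u. u \<in> hpart n k m \<Longrightarrow> (\<And>v. v \<in> hpart n k m \<Longrightarrow> standard_form n c k rho b0 m u v = 0) \<Longrightarrow> u = 0"
    and "u \<in> hpart n k m" "\<And>v. v \<in> hpart n k m \<Longrightarrow> standard_form n c k rho b1 m u v = 0"
  shows "u = 0"
  using assms(4,5)
proof (induction m arbitrary: u)
  case 0
  then show ?case by (rule standard_form_bottom_nondegenerate[OF assms(2)])
next
  case (Suc m u)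
  interpret D0: dunkl_form n k rho "complex_of_real c" cnj b0 by (rule hermitian_rep_dunkl_form[OF assms(1)])
  interpret D1: dunkl_form n k rho "complex_of_real c" cnj b1 by (rule hermitian_rep_dunkl_form[OF assms(2)])
  have Y: "D0.opY i u = 0" if i: "i \<in> {1..n}" for i
  proof (rule Suc.IH[OF D0.Y_hpart[OF i Suc.prems(1)]])
    fix v :: "complex vec_poly" assume v: "v \<in> hpart n k m"
    show "standard_form n c k rho b1 m (D0.opY i u) v = 0"
      using Suc.prems(2)[OF mult_x_hpart[OF i v]] D1.form_Y_left[OF Suc.prems(1) v i]
      unfolding standard_form_def by simp
  qed
  have "\<forall>u\<in>hpart n k m'. (\<forall>i\<in>{1..n}. D0.opY i u = 0) \<longrightarrow> m' \<noteq> 0 \<longrightarrow> D0.form m' v u = 0"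
    if "v \<in> hpart n k m'" for m' v
    using that
  proof (induction rule: D0.hpart_induct)
    case (step m i v)
    then show ?case using D0.form_x_left[OF step(1)] D0.form_zero_right by (simp add: zero_fun_def)
  qed (simp_all add: D0.form_add_left D0.form_zero_left)
  then have "standard_form n c k rho b0 (Suc m) u v = 0" if "v \<in> hpart n k (Suc m)" for v
    using that Suc.prems(1) Y D0.form_sym[OF that Suc.prems(1)] unfolding standard_form_def by simp
  then show ?case by (rule nd[OF Suc.prems(1)])
qed

text \<open>The segment between two positive invariant forms stays positive, hence by transfer from
  \<open>b0\<close> nondegenerate in all degrees, so signatures are constant along it. Thus the
  choice of \<open>B\<close> does not affect the signature character.\<close>

lemma standard_signature_positive_rep:
  assumes b0: "positive_rep n k rho b0" and b1: "positive_rep n k rho b1"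
    and nd: "\<And>m u. u \<in> hpart n k m \<Longrightarrow> (\<And>v. v \<in> hpart n k m \<Longrightarrow> standard_form n c k rho b0 m u v = 0) \<Longrightarrow> u = 0"
  shows "standard_signature n c k rho b0 m = standard_signature n c k rho b1 m"
proof -
  note h0 = positive_rep_hermitian_rep[OF b0] and h1 = positive_rep_hermitian_rep[OF b1]
  note d0 = hermitian_rep_dunkl_form[OF h0, of c] and d1 = hermitian_rep_dunkl_form[OF h1, of c]
  interpret D0: dunkl_form n k rho "complex_of_real c" cnj b0 by (rule d0)
  interpret D1: dunkl_form n k rho "complex_of_real c" cnj b1 by (rule d1)
  let ?I = "monomial_indices n k m"
  define G where "G p q = [:D0.gram m p q, D1.gram m p q - D0.gram m p q:]" for p q
  have G: "poly_hermitian ?I G"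
  proof
    show "finite ?I" by (rule finite_monomial_indices)
    show "G q p = cnj_poly (G p q)" if "p \<in> ?I" "q \<in> ?I" for p q
      unfolding G_def D0.gram_sym[OF that] D1.gram_sym[OF that]
      by (rule poly_eqI) (simp add: coeff_map_poly coeff_pCons split: nat.split)
  qed
  have ev: "eval_form ?I G x u v = of_real (1 - x) * standard_form n c k rho b0 m u v + of_real x * standard_form n c k rho b1 m u v"
    if "u \<in> hpart n k m" "v \<in> hpart n k m" for x u v
    unfolding standard_form_def D0.form_eq_matrix_form[OF that] D1.form_eq_matrix_form[OF that]
      eval_form_def matrix_form_def sum_distrib_left sum.distrib[symmetric]
    by (intro sum.cong refl) (simp add: G_def algebra_simps)
  have mix: "standard_form n c k rho (\<lambda>j l. of_real (1 - x) * b0 j l + of_real x * b1 j l) m u v =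
      of_real (1 - x) * standard_form n c k rho b0 m u v + of_real x * standard_form n c k rho b1 m u v"
    if x: "0 \<le> x" "x \<le> 1" for x u v
  proof -
    interpret Dx: dunkl_form n k rho "complex_of_real c" cnj "\<lambda>j l. of_real (1 - x) * b0 j l + of_real x * b1 j l"
      by (rule hermitian_rep_dunkl_form[OF positive_rep_hermitian_rep[OF positive_rep_convex[OF b0 b1 x]]])
    have inner: "(\<Sum>q<k. (y * b0 j q + z * b1 j q) * g q) = y * (\<Sum>q<k. b0 j q * g q) + z * (\<Sum>q<k. b1 j q * g q)"
      for y z :: complex and g j
      unfolding sum_distrib_left sum.distrib[symmetric] by (rule sum.cong) (simp_all add: algebra_simps)
    show ?thesis
      unfolding standard_form_def D0.form_def D1.form_def Dx.form_def sum_distrib_left[of _ _ "monomial_indices n k m"]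
        sum.distrib[symmetric]
    proof (rule sum.cong[OF refl])
      fix p :: "(nat \<Rightarrow> nat) \<times> nat"
      obtain a j where p: "p = (a, j)" by (cases p)
      have "u' * (y * s + z * t) = y * (u' * s) + z * (u' * t)" for u' y z s t :: complex
        by (simp add: algebra_simps)
      then show "(case p of (a, j) \<Rightarrow> u (a, j) * (\<Sum>q<k. (of_real (1 - x) * b0 j q + of_real x * b1 j q) * cnj (D0.descend m a v q))) =
          of_real (1 - x) * (case p of (a, j) \<Rightarrow> u (a, j) * (\<Sum>q<k. b0 j q * cnj (D0.descend m a v q))) +
          of_real x * (case p of (a, j) \<Rightarrow> u (a, j) * (\<Sum>q<k. b1 j q * cnj (D0.descend m a v q)))"
        unfolding p prod.case inner by this
    qed
  qed
  have "u = 0" if x: "0 \<le> x" "x \<le> 1" and u: "u \<in> hpart n k m"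
    and z: "\<forall>v\<in>hpart n k m. eval_form ?I G x u v = 0" for x u
  proof (rule standard_form_nondegenerate_transfer[OF h0 positive_rep_hermitian_rep[OF positive_rep_convex[OF b0 b1 x]] nd u])
    show "standard_form n c k rho (\<lambda>j l. of_real (1 - x) * b0 j l + of_real x * b1 j l) m u v = 0"
      if "v \<in> hpart n k m" for v using z ev[OF u that, of x] that unfolding mix[OF x] by simp
  qed
  from signature_constant_on_interval[OF G zero_le_one this]
  have "fun_space.signature (hpart n k m) (eval_form ?I G 0) = fun_space.signature (hpart n k m) (eval_form ?I G 1)" .
  moreover have "fun_space.signature (hpart n k m) (eval_form ?I G 0) = standard_signature n c k rho b0 m"
    unfolding standard_signature_def
    by (rule fun_space.signature_cong(3)[OF hermitian_on_standard[OF d0] finite_rank_supported_on[OF finite_monomial_indices hermitian_on_standard[OF d0]]])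
       (use ev[of _ _ 0] in simp)
  moreover have "fun_space.signature (hpart n k m) (eval_form ?I G 1) = standard_signature n c k rho b1 m"
    unfolding standard_signature_def
    by (rule fun_space.signature_cong(3)[OF hermitian_on_standard[OF d1] finite_rank_supported_on[OF finite_monomial_indices hermitian_on_standard[OF d1]]])
       (use ev[of _ _ 1] in simp)
  ultimately show ?thesis by simp
qed

section \<open>The spectral theorem and signatures of Hermitian matrices\<close>

context complex_space
begin

text \<open>The iterates of \<open>u\<close> under \<open>T\<close> are dependent by the rank bound,
  so a product of linear factors kills \<open>u\<close>; the last nonzero partial product is an
  eigenvector.\<close>

lemma eigenvector_exists:
  assumes h: "hermitian_on N h" and pos: "\<And>u. u \<in> N \<Longrightarrow> u \<noteq> 0 \<Longrightarrow> h u u \<noteq> 0" and r: "finite_rank N h r"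
    and T: "\<And>u. u \<in> N \<Longrightarrow> T u \<in> N" "\<And>u v. T (u + v) = T u + T v" "\<And>a u. T (scale a u) = scale a (T u)"
    and u: "u \<in> N" "u \<noteq> 0"
  shows "\<exists>w d. w \<in> N \<and> w \<noteq> 0 \<and> T w = scale d w"
proof -
  have TN: "(T ^^ i) u \<in> N" for i by (induction i) (use T(1) u(1) in auto)
  obtain q where q: "\<exists>i\<le>r. q i \<noteq> 0" "\<forall>v\<in>N. h (\<Sum>i\<le>r. scale (q i) ((T ^^ i) u)) v = 0"
    using r[unfolded finite_rank_def, rule_format, of "\<lambda>i. (T ^^ i) u"] TN by auto
  have "(\<Sum>i\<le>r. scale (q i) ((T ^^ i) u)) \<in> N"
    using TN hermitian_mem(3)[OF h] by (intro hermitian_mem(5)[OF h]) auto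
  then have z: "(\<Sum>i\<le>r. scale (q i) ((T ^^ i) u)) = 0" using pos q(2) by blast
  define Q where "Q = (\<Sum>i\<le>r. monom (q i) i)"
  have "coeff Q i = q i" if "i \<le> r" for i using that by (simp add: Q_def coeff_sum)
  then have "Q \<noteq> 0" using q(1) by auto
  then have lc: "lead_coeff Q \<noteq> 0" by simp
  obtain zs where zs: "Polynomial.smult (lead_coeff Q) (\<Prod>z\<leftarrow>zs. [:- z, 1:]) = Q"
    using fundamental_theorem_algebra_factorized by blast
  have "poly_op T Q u = 0"
    unfolding Q_def using z by (simp add: poly_op_sum[OF T(2,3)] poly_op_monom[OF T(2,3)])
  then have "scale (lead_coeff Q) (roots_op scale T zs u) = 0"
    using poly_op_smult[OF T(2,3), of "lead_coeff Q" "\<Prod>z\<leftarrow>zs. [:- z, 1:]" u]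
    unfolding zs poly_op_prod[OF T(2,3)] by simp
  then have "roots_op scale T zs u = 0" using lc by simp
  then show ?thesis
  proof (induction zs)
    case Nil
    then show ?case using u by simp
  next
    case (Cons z zs)
    let ?w = "roots_op scale T zs u"
    have "?w \<in> N" by (rule roots_op_mem[OF T(2,3) hermitian_subspace[OF h] T(1) u(1)])
    moreover have "T ?w = scale z ?w" using Cons.prems by simp
    ultimately show ?case using Cons.IH by blast
  qed
qed

text \<open>Splitting off an eigenvector lowers the rank by \<open>finite_rank_perp\<close>, and
  self-adjointness keeps its complement stable.\<close>

theorem spectral_theorem:
  assumes "hermitian_on N h" "\<And>u. u \<in> N \<Longrightarrow> u \<noteq> 0 \<Longrightarrow> h u u \<noteq> 0" "finite_rank N h r"
    and "\<And>u. u \<in> N \<Longrightarrow> T u \<in> N" "\<And>u v. u \<in> N \<Longrightarrow> v \<in> N \<Longrightarrow> h (T u) v = h u (T v)"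
    and T: "\<And>u v. T (u + v) = T u + T v" "\<And>a u. T (scale a u) = scale a (T u)"
  shows "\<exists>(I :: nat set) b d. orthogonal_family N h I b \<and> (\<forall>i\<in>I. b i \<noteq> 0 \<and> T (b i) = scale (d i) (b i))"
  using assms(1-5)
proof (induction r arbitrary: N)
  case (0 N)
  have "u = 0" if u: "u \<in> N" for u
  proof (rule ccontr)
    assume "u \<noteq> 0"
    then have "h u u \<noteq> 0" using 0(2) u by blast
    moreover obtain q where "q (0::nat) \<noteq> 0" "h (scale (q 0) u) u = 0"
      using 0(3)[unfolded finite_rank_def, rule_format, of "\<lambda>_. u"] u by auto
    ultimately show False using hermitian_scale_left[OF 0(1) u u] by simp
  qed
  then have "h u v = 0" if "u \<in> N" "v \<in> N" for u v
    using that hermitian_zero_left[OF 0(1) that(2)] by metis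
  then have "orthogonal_family N h ({} :: nat set) b" for b
    by (intro orthogonal_familyI[OF 0(1)]) auto
  then show ?case by blast
next
  case (Suc r N)
  show ?case
  proof (cases "\<forall>u\<in>N. u = 0")
    case True
    then have "h u v = 0" if "u \<in> N" "v \<in> N" for u v
      using that hermitian_zero_left[OF Suc(2) that(2)] by metis
    then have "orthogonal_family N h ({} :: nat set) b" for b
      by (intro orthogonal_familyI[OF Suc(2)]) auto
    then show ?thesis by blast
  next
    case False
    then obtain u where "u \<in> N" "u \<noteq> 0" by blast
    from eigenvector_exists[OF Suc(2,3,4,5) T this]
    obtain w d0 where w: "w \<in> N" "w \<noteq> 0" "T w = scale d0 w" by blast
    have ww: "h w w \<noteq> 0" using Suc(3) w by blast
    let ?P = "perp N h {w}"
    have sub: "?P \<subseteq> N" by (auto simp: perp_def)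
    have "\<exists>(I :: nat set) b d. orthogonal_family ?P h I b \<and> (\<forall>i\<in>I. b i \<noteq> 0 \<and> T (b i) = scale (d i) (b i))"
    proof (rule Suc.IH)
      show "hermitian_on ?P h" using w by (intro hermitian_on_perp[OF Suc(2)]) auto
      show "finite_rank ?P h r" by (rule finite_rank_perp[OF Suc(2) w(1) ww Suc(4)])
      show "h u u \<noteq> 0" if "u \<in> ?P" "u \<noteq> 0" for u using Suc(3) that sub by blast
      show "h (T u) v = h u (T v)" if "u \<in> ?P" "v \<in> ?P" for u v using Suc(6) that sub by blast
      show "T u \<in> ?P" if u: "u \<in> ?P" for u
      proof -
        have uN: "u \<in> N" "h u w = 0" using u by (auto simp: perp_def)
        have "h (T u) w = cnj d0 * h u w"
          unfolding Suc(6)[OF uN(1) w(1)] w(3) by (rule hermitian_scale_right[OF Suc(2) w(1) uN(1)])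
        then show ?thesis using Suc(5)[OF uN(1)] uN(2) by (simp add: perp_def)
      qed
    qed
    then obtain I :: "nat set" and b d where
      b: "orthogonal_family ?P h I b" "\<And>i. i \<in> I \<Longrightarrow> b i \<noteq> 0 \<and> T (b i) = scale (d i) (b i)" by blast
    have "finite I" using b(1) unfolding orthogonal_family_def by blast
    then obtain i where i: "i \<notin> I" using ex_new_if_finite infinite_UNIV_nat by blast
    have "\<forall>j\<in>insert i I. (b(i := w)) j \<noteq> 0 \<and> T ((b(i := w)) j) = scale ((d(i := d0)) j) ((b(i := w)) j)"
      using b(2) w i by auto
    with orthogonal_family_insert[OF Suc(2) w(1) ww b(1) i] show ?thesis
      by (intro exI[of _ "insert i I"] exI[of _ "b(i := w)"] exI[of _ "d(i := d0)"] conjI)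
  qed
qed

end

definition matrix_eigenbasis :: "nat \<Rightarrow> complex mat \<Rightarrow> (nat \<Rightarrow> nat \<Rightarrow> complex) \<Rightarrow> (nat \<Rightarrow> real) \<Rightarrow> bool" where
  "matrix_eigenbasis N A b d \<longleftrightarrow>
    (\<forall>j<N. \<forall>l<N. (\<Sum>i<N. b j i * cnj (b l i)) = (if j = l then (\<Sum>i<N. b j i * cnj (b j i)) else 0)) \<and>
    (\<forall>j<N. 0 < Re (\<Sum>i<N. b j i * cnj (b j i)) \<and> Im (\<Sum>i<N. b j i * cnj (b j i)) = 0) \<and>
    (\<forall>j<N. \<forall>i<N. (\<Sum>l<N. A $$ (i, l) * b j l) = complex_of_real (d j) * b j i) \<and>
    (\<forall>f. \<exists>q. \<forall>i<N. f i = (\<Sum>j<N. q j * b j i))"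

lemma matrix_eigenbasisD:
  assumes "matrix_eigenbasis N A b d"
  shows "j < N \<Longrightarrow> l < N \<Longrightarrow> (\<Sum>i<N. b j i * cnj (b l i)) = (if j = l then (\<Sum>i<N. b j i * cnj (b j i)) else 0)"
    "j < N \<Longrightarrow> 0 < Re (\<Sum>i<N. b j i * cnj (b j i))"
    "j < N \<Longrightarrow> Im (\<Sum>i<N. b j i * cnj (b j i)) = 0"
    "j < N \<Longrightarrow> i < N \<Longrightarrow> (\<Sum>l<N. A $$ (i, l) * b j l) = complex_of_real (d j) * b j i"
    "\<exists>q. \<forall>i<N. f i = (\<Sum>j<N. q j * b j i)"
  using assms unfolding matrix_eigenbasis_def by blast+

lemma hermitian_matrix_eigenbasis:
  assumes A: "A \<in> carrier_mat N N" and sym: "\<And>i j. i < N \<Longrightarrow> j < N \<Longrightarrow> A $$ (j, i) = cnj (A $$ (i, j))"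
  shows "\<exists>b d. matrix_eigenbasis N A b d"
proof -
  let ?V = "supported_on {..<N} :: (nat \<Rightarrow> complex) set"
  define h where "h f g = (\<Sum>i<N. f i * cnj (g i))" for f g :: "nat \<Rightarrow> complex"
  define T where "T f i = (if i < N then \<Sum>l<N. A $$ (i, l) * f l else 0)" for f :: "nat \<Rightarrow> complex" and i
  have herm: "fun_space.hermitian_on ?V h"
  proof -
    have "fun_space.subspace ?V" by (auto simp: fun_space.subspace_def supported_on_def scale_fun_def)
    moreover have "h (u + v) w = h u w + h v w" "h (scale_fun a u) w = a * h u w" "h w u = cnj (h u w)" for u v w a
      by (simp_all add: h_def scale_fun_def sum.distrib sum_distrib_left algebra_simps)
    ultimately show ?thesis unfolding fun_space.hermitian_on_def by blast
  qed
  have hpos: "0 < Re (h u u)" "Im (h u u) = 0" if u: "u \<in> ?V" "u \<noteq> 0" for u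
  proof -
    have hh: "h u u = of_real (\<Sum>i<N. (cmod (u i))\<^sup>2)"
      unfolding h_def of_real_sum by (rule sum.cong) (simp_all only: complex_norm_square)
    obtain i where i: "u i \<noteq> 0" using u(2) by (auto simp: fun_eq_iff)
    then have "i < N" using u(1) by (auto simp: supported_on_def)
    then have "0 < (\<Sum>i<N. (cmod (u i))\<^sup>2)" using i by (intro sum_pos2[of _ i]) auto
    then show "0 < Re (h u u)" "Im (h u u) = 0" unfolding hh by simp_all
  qed
  have adj: "h (T u) v = h u (T v)" for u v
  proof -
    have "h (T u) v = (\<Sum>i<N. \<Sum>l<N. A $$ (i, l) * u l * cnj (v i))"
      by (simp add: h_def T_def sum_distrib_right)
    also have "\<dots> = (\<Sum>l<N. \<Sum>i<N. A $$ (i, l) * u l * cnj (v i))" by (rule sum.swap)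
    also have "\<dots> = (\<Sum>l<N. \<Sum>i<N. u l * cnj (A $$ (l, i) * v i))"
    proof (intro sum.cong refl)
      fix l i assume "l \<in> {..<N}" "i \<in> {..<N}"
      then have "A $$ (i, l) = cnj (A $$ (l, i))" using sym[of l i] by simp
      then show "A $$ (i, l) * u l * cnj (v i) = u l * cnj (A $$ (l, i) * v i)" by simp
    qed
    also have "\<dots> = h u (T v)" by (simp add: h_def T_def sum_distrib_left)
    finally show ?thesis .
  qed
  have "\<exists>(I :: nat set) b d. fun_space.orthogonal_family ?V h I b \<and> (\<forall>i\<in>I. b i \<noteq> 0 \<and> T (b i) = scale_fun (d i) (b i))"
  proof (rule fun_space.spectral_theorem[OF herm])
    show "fun_space.finite_rank ?V h (card {..<N})" by (rule finite_rank_supported_on[OF _ herm]) simp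
    show "h u u \<noteq> 0" if "u \<in> ?V" "u \<noteq> 0" for u using hpos(1)[OF that] by auto
    show "T u \<in> ?V" if "u \<in> ?V" for u by (simp add: supported_on_def T_def)
    show "T (u + v) = T u + T v" for u v by (auto simp: T_def fun_eq_iff sum.distrib algebra_simps)
    show "T (scale_fun a u) = scale_fun a (T u)" for a u
      by (auto simp: T_def scale_fun_def fun_eq_iff sum_distrib_left mult_ac)
  qed (rule adj)
  then obtain I :: "nat set" and b d where fam: "fun_space.orthogonal_family ?V h I b"
    and b: "\<And>i. i \<in> I \<Longrightarrow> b i \<noteq> 0" "\<And>i. i \<in> I \<Longrightarrow> T (b i) = scale_fun (d i) (b i)" by blast
  note F = fun_space.orthogonal_familyD[OF herm fam]
  have nz: "h (b j) (b j) \<noteq> 0" if "j \<in> I" for j using hpos(1)[OF F(2)[OF that] b(1)[OF that]] by auto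
  have dreal: "d j = complex_of_real (Re (d j))" if "j \<in> I" for j
  proof -
    have "d j * h (b j) (b j) = h (T (b j)) (b j)" unfolding b(2)[OF that] by (simp add: h_def scale_fun_def sum_distrib_left mult_ac)
    also have "\<dots> = h (b j) (T (b j))" by (rule adj)
    also have "\<dots> = cnj (d j) * h (b j) (b j)" unfolding b(2)[OF that] by (simp add: h_def scale_fun_def sum_distrib_left mult_ac)
    finally have "d j = cnj (d j)" using nz[OF that] by simp
    then show ?thesis by (simp add: complex_eq_iff)
  qed
  have unit: "unit_vector i \<in> ?V" "h u (unit_vector i) = u i" if "i < N" for i u
  proof -
    have "h u (unit_vector i) = (\<Sum>l<N. if l = i then u i else 0)"
      unfolding h_def by (rule sum.cong) (auto simp: unit_vector_def)
    then show "h u (unit_vector i) = u i" using that by simp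
    show "unit_vector i \<in> ?V" using that by (auto simp: supported_on_def unit_vector_def)
  qed
  have expand: "\<exists>q. (\<forall>i<N. u i = (\<Sum>j\<in>I. q j * b j i)) \<and> (\<forall>j\<in>I. q j * h (b j) (b j) = h u (b j))" if u: "u \<in> ?V" for u
  proof -
    obtain q where q: "\<And>v. v \<in> ?V \<Longrightarrow> h u v = (\<Sum>j\<in>I. q j * h (b j) v)" using F(4)[OF u] by blast
    have "u i = (\<Sum>j\<in>I. q j * b j i)" if "i < N" for i using q[OF unit(1)[OF that]] unit(2)[OF that] by simp
    moreover have "q j * h (b j) (b j) = h u (b j)" if j: "j \<in> I" for j
    proof -
      have "h u (b j) = (\<Sum>l\<in>I. if l = j then q j * h (b j) (b j) else 0)"
        unfolding q[OF F(2)[OF j]] by (rule sum.cong) (auto simp: F(3)[OF _ j])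
      then show ?thesis using F(1) j by simp
    qed
    ultimately show ?thesis by blast
  qed
  \<comment> \<open>Expanding each unit vector gives
    \<open>1 = \<Sum>\<^sub>j |b j i|\<^sup>2 / h (b j) (b j)\<close>; summed over \<open>i\<close>
    the left side is \<open>N\<close>, while each \<open>j\<close> contributes 1 on the
    right.\<close>
  have card: "card I = N"
  proof -
    have 1: "1 = (\<Sum>j\<in>I. cnj (b j i) / h (b j) (b j) * b j i)" if i: "i < N" for i
    proof -
      obtain q where q: "\<And>l. l < N \<Longrightarrow> unit_vector i l = (\<Sum>j\<in>I. q j * b j l)"
        "\<And>j. j \<in> I \<Longrightarrow> q j * h (b j) (b j) = h (unit_vector i) (b j)"
        using expand[OF unit(1)[OF i]] by blast
      have "h (unit_vector i) (b j) = cnj (h (b j) (unit_vector i))" for j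
        by (simp add: h_def mult.commute)
      then have "q j = cnj (b j i) / h (b j) (b j)" if "j \<in> I" for j
        using q(2)[OF that] unit(2)[OF i] nz[OF that] by (simp add: field_simps)
      moreover have "(\<Sum>j\<in>I. q j * b j i) = 1" using q(1)[OF i] by (simp add: unit_vector_def)
      ultimately show ?thesis by simp
    qed
    have "complex_of_nat N = (\<Sum>i<N. 1)" by simp
    also have "\<dots> = (\<Sum>i<N. \<Sum>j\<in>I. cnj (b j i) / h (b j) (b j) * b j i)" by (rule sum.cong) (use 1 in auto)
    also have "\<dots> = (\<Sum>j\<in>I. \<Sum>i<N. cnj (b j i) / h (b j) (b j) * b j i)" by (rule sum.swap)
    also have "\<dots> = (\<Sum>j\<in>I. 1)"
    proof (rule sum.cong[OF refl])
      fix j assume j: "j \<in> I"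
      have "(\<Sum>i<N. cnj (b j i) / h (b j) (b j) * b j i) = h (b j) (b j) / h (b j) (b j)"
        unfolding h_def[of "b j" "b j"] sum_divide_distrib by (rule sum.cong) (simp_all add: mult.commute)
      then show "(\<Sum>i<N. cnj (b j i) / h (b j) (b j) * b j i) = 1" using nz[OF j] by simp
    qed
    also have "\<dots> = complex_of_nat (card I)" by simp
    finally show ?thesis using of_nat_eq_iff by metis
  qed
  obtain f where "bij_betw f {0..<card I} I" using ex_bij_betw_nat_finite[OF F(1)] by blast
  then have f: "bij_betw f {..<N} I" by (simp add: card atLeast0LessThan)
  have fI: "f j \<in> I" if "j < N" for j using bij_betwE[OF f] that by auto
  have finj: "f j = f l \<longleftrightarrow> j = l" if "j < N" "l < N" for j l
    using bij_betw_imp_inj_on[OF f] that by (auto dest: inj_onD)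
  show ?thesis
  proof (rule exI[of _ "b \<circ> f"], rule exI[of _ "\<lambda>j. Re (d (f j))"], unfold matrix_eigenbasis_def, intro conjI allI impI)
    show "(\<Sum>i<N. (b \<circ> f) j i * cnj ((b \<circ> f) l i)) = (if j = l then \<Sum>i<N. (b \<circ> f) j i * cnj ((b \<circ> f) j i) else 0)"
      if "j < N" "l < N" for j l
      using F(3)[OF fI[OF that(1)] fI[OF that(2)]] finj[OF that] by (auto simp: h_def)
    show "0 < Re (\<Sum>i<N. (b \<circ> f) j i * cnj ((b \<circ> f) j i))" "Im (\<Sum>i<N. (b \<circ> f) j i * cnj ((b \<circ> f) j i)) = 0"
      if "j < N" for j using hpos[OF F(2)[OF fI[OF that]] b(1)[OF fI[OF that]]] by (simp_all only: h_def comp_def)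
    show "(\<Sum>l<N. A $$ (i, l) * (b \<circ> f) j l) = complex_of_real (Re (d (f j))) * (b \<circ> f) j i" if "j < N" "i < N" for i j
      using fun_cong[OF b(2)[OF fI[OF that(1)]], of i] that(2) dreal[OF fI[OF that(1)]] by (simp add: T_def scale_fun_def)
    show "\<exists>q. \<forall>i<N. g i = (\<Sum>j<N. q j * (b \<circ> f) j i)" for g
    proof -
      have "(\<lambda>i. if i < N then g i else 0) \<in> ?V" by (simp add: supported_on_def)
      from expand[OF this] obtain q where q: "\<And>i. i < N \<Longrightarrow> g i = (\<Sum>j\<in>I. q j * b j i)" by auto
      have "(\<Sum>j\<in>I. q j * b j i) = (\<Sum>j<N. q (f j) * b (f j) i)" for i
        by (rule sum.reindex_bij_betw[OF f, symmetric])
      then show ?thesis using q by (intro exI[of _ "\<lambda>j. q (f j)"]) simp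
    qed
  qed
qed

section \<open>From eigenbases to signatures of Gram matrices\<close>

lemma order_prod_linear:
  "finite I \<Longrightarrow> order a (\<Prod>j\<in>I. [:- d j, 1:]) = card {j \<in> I. d j = (a :: complex)}"
proof (induction rule: finite_induct)
  case (insert j I)
  have nz: "[:- d j, 1:] * (\<Prod>j\<in>I. [:- d j, 1:]) \<noteq> 0"
    by (rule no_zero_divisors) (use insert(1) in \<open>simp_all add: prod_zero_iff\<close>)
  have "order a [:- d j, 1:] = (if d j = a then 1 else 0)"
    using order_power_n_n[of a 1] by (auto intro: order_0I)
  moreover have "{i \<in> insert j I. d i = a} = (if d j = a then insert j {i \<in> I. d i = a} else {i \<in> I. d i = a})" by auto
  moreover have "order a (\<Prod>j\<in>insert j I. [:- d j, 1:]) = order a [:- d j, 1:] + order a (\<Prod>j\<in>I. [:- d j, 1:])"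
    unfolding prod.insert[OF insert(1,2)] by (rule order_mult[OF nz])
  ultimately show ?case using insert by (simp del: prod.insert)
qed simp

lemma matrix_signature_diagonal:
  assumes A: "A \<in> carrier_mat N N" and cp: "char_poly A = (\<Prod>j<N. [:- complex_of_real (d j), 1:])"
  shows "matrix_signature A = (\<Sum>j<N. sign_re (complex_of_real (d j)))"
proof -
  have ev: "eigenvalue A (complex_of_real l) \<longleftrightarrow> l \<in> d ` {..<N}" for l
    unfolding eigenvalue_root_char_poly[OF A] cp poly_prod by auto
  have ord: "order (complex_of_real l) (char_poly A) = card {j \<in> {..<N}. d j = l}" for l
    unfolding cp order_prod_linear[OF finite_lessThan] by simp
  have "(\<Sum>l | P l \<and> eigenvalue A (complex_of_real l). int (order (complex_of_real l) (char_poly A))) =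
      int (card {j \<in> {..<N}. P (d j)})" for P
  proof -
    let ?S = "{j \<in> {..<N}. P (d j)}"
    have L: "{l. P l \<and> eigenvalue A (complex_of_real l)} = d ` ?S" unfolding ev by auto
    have "int (card {j \<in> {..<N}. d j = l}) = (\<Sum>j\<in>{j \<in> ?S. d j = l}. 1)" if "l \<in> d ` ?S" for l
    proof -
      have "{j \<in> {..<N}. d j = l} = {j \<in> ?S. d j = l}" using that by auto
      then show ?thesis by simp
    qed
    then have "(\<Sum>l\<in>d ` ?S. int (card {j \<in> {..<N}. d j = l})) = (\<Sum>l\<in>d ` ?S. \<Sum>j\<in>{j \<in> ?S. d j = l}. 1)"
      by (rule sum.cong[OF refl])
    also have "\<dots> = (\<Sum>j\<in>?S. 1)" by (rule sum.group) auto
    finally show ?thesis unfolding L ord by simp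
  qed
  then show ?thesis
    unfolding matrix_signature_def sum_sign_re[OF finite_lessThan] by simp
qed

text \<open>The orthogonality relations present the inverse of the matrix \<open>P\<close> of
  eigenvectors, so \<open>A\<close> is similar to the diagonal matrix \<open>D\<close>.\<close>

lemma char_poly_eigenbasis:
  assumes A: "A \<in> carrier_mat N N"
    and orth: "\<And>j l. j < N \<Longrightarrow> l < N \<Longrightarrow> (\<Sum>i<N. b j i * cnj (b l i)) = (if j = l then s j else 0)"
    and nz: "\<And>j. j < N \<Longrightarrow> s j \<noteq> 0"
    and eig: "\<And>j i. j < N \<Longrightarrow> i < N \<Longrightarrow> (\<Sum>l<N. A $$ (i, l) * b j l) = d j * b j i"
  shows "char_poly A = (\<Prod>j<N. [:- d j, 1:])"
proof -
  define P where "P = mat N N (\<lambda>(i, j). b j i)"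
  define Q where "Q = mat N N (\<lambda>(j, i). cnj (b j i) / s j)"
  define D where "D = mat N N (\<lambda>(i, j). if i = j then d j else 0)"
  have car: "P \<in> carrier_mat N N" "Q \<in> carrier_mat N N" "D \<in> carrier_mat N N"
    by (auto simp: P_def Q_def D_def)
  have QP: "Q * P = 1\<^sub>m N"
  proof (rule eq_matI)
    fix j l assume "j < dim_row (1\<^sub>m N)" "l < dim_col (1\<^sub>m N)"
    then have jl: "j < N" "l < N" by auto
    have "(Q * P) $$ (j, l) = (\<Sum>i<N. cnj (b j i) / s j * b l i)"
      using jl by (simp add: P_def Q_def scalar_prod_def atLeast0LessThan)
    also have "\<dots> = (\<Sum>i<N. b l i * cnj (b j i)) / s j" unfolding sum_divide_distrib by (rule sum.cong) simp_all
    finally show "(Q * P) $$ (j, l) = 1\<^sub>m N $$ (j, l)" using orth[OF jl(2,1)] nz jl by simp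
  qed (use car in auto)
  have PQ: "P * Q = 1\<^sub>m N" by (rule mat_mult_left_right_inverse[OF car(2,1) QP])
  have AP: "A * P = P * D"
  proof (rule eq_matI)
    fix i j assume "i < dim_row (P * D)" "j < dim_col (P * D)"
    then have ij: "i < N" "j < N" using car by auto
    have "(A * P) $$ (i, j) = (\<Sum>l<N. A $$ (i, l) * b j l)"
      using ij A by (simp add: P_def scalar_prod_def atLeast0LessThan)
    moreover have "(P * D) $$ (i, j) = (\<Sum>l<N. b l i * (if l = j then d j else 0))"
      using ij by (simp add: P_def D_def scalar_prod_def atLeast0LessThan cong: if_cong)
    moreover have "(\<Sum>l<N. b l i * (if l = j then d j else 0)) = (\<Sum>l<N. if l = j then d j * b j i else 0)"
      by (rule sum.cong) auto
    ultimately show "(A * P) $$ (i, j) = (P * D) $$ (i, j)" using eig[OF ij(2,1)] ij by simp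
  qed (use car A in auto)
  have "A = A * (P * Q)" unfolding PQ using A by simp
  also have "\<dots> = A * P * Q" using assoc_mult_mat[OF A car(1,2)] by simp
  also have "\<dots> = P * D * Q" unfolding AP ..
  finally have APDQ: "A = P * D * Q" .
  have "similar_mat_wit A D P Q"
    unfolding similar_mat_wit_def Let_def
  proof (intro conjI)
    have "dim_row A = N" using A by simp
    then show "{A, D, P, Q} \<subseteq> carrier_mat (dim_row A) (dim_row A)" "P * Q = 1\<^sub>m (dim_row A)" "Q * P = 1\<^sub>m (dim_row A)"
      using A car PQ QP by simp_all
  qed (rule APDQ)
  then have "similar_mat A D" unfolding similar_mat_def by blast
  then have "char_poly A = char_poly D" by (rule char_poly_similar)
  also have "\<dots> = (\<Prod>a\<leftarrow>diag_mat D. [:- a, 1:])"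
    by (rule char_poly_upper_triangular[OF car(3)]) (auto simp: upper_triangular_def D_def)
  also have "diag_mat D = map d [0..<N]" using car(3) by (auto simp: diag_mat_def D_def)
  also have "(\<Prod>a\<leftarrow>map d [0..<N]. [:- a, 1:]) = (\<Prod>j<N. [:- d j, 1:])"
    using prod.distinct_set_conv_list[of "[0..<N]" "\<lambda>j. [:- d j, 1:]"] by (simp add: comp_def atLeast0LessThan)
  finally show ?thesis .
qed

context complex_space
begin

text \<open>Sylvester's law for an arbitrary basis, so the one picked by \<open>SOME\<close> in
  \<open>form_signature\<close> is as good as any. Eigenvectors of the Gram matrix yield an
  orthogonal family whose norms are the eigenvalues times positive numbers.\<close>

theorem matrix_signature_gram_matrix:
  assumes herm: "hermitian_on V h" and bs: "basis_list scale V bs"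
  shows "matrix_signature (gram_matrix h bs) = signature V h"
proof -
  define N where "N = length bs"
  have V: "span (set bs) = V" and dist: "distinct bs" using bs by (auto simp: basis_list_def)
  have bsV: "bs ! i \<in> V" if "i < N" for i using that V span_base[of "bs ! i" "set bs"] by (auto simp: N_def)
  let ?A = "gram_matrix h bs"
  have A: "?A \<in> carrier_mat N N" by (simp add: gram_matrix_def N_def)
  have Aij: "?A $$ (i, j) = h (bs ! i) (bs ! j)" if "i < N" "j < N" for i j
    using that by (simp add: gram_matrix_def N_def)
  have "?A $$ (j, i) = cnj (?A $$ (i, j))" if "i < N" "j < N" for i j
    unfolding Aij[OF that] Aij[OF that(2,1)] by (rule hermitian_sym[OF herm bsV[OF that(1)] bsV[OF that(2)]])
  then obtain b d where bd: "matrix_eigenbasis N ?A b d" using hermitian_matrix_eigenbasis[OF A] by blast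
  note orth = matrix_eigenbasisD(1)[OF bd] and pos = matrix_eigenbasisD(2,3)[OF bd]
    and eig = matrix_eigenbasisD(4)[OF bd] and complete = matrix_eigenbasisD(5)[OF bd]
  define s where "s j = (\<Sum>i<N. b j i * cnj (b j i))" for j
  have s: "0 < Re (s j)" "Im (s j) = 0" "s j \<noteq> 0" if "j < N" for j using pos[OF that] unfolding s_def by (auto simp del: Re_sum Im_sum)
  have cp: "char_poly ?A = (\<Prod>j<N. [:- complex_of_real (d j), 1:])"
    by (rule char_poly_eigenbasis[OF A orth[folded s_def] s(3) eig])
  \<comment> \<open>Conjugated, since the form is linear in its first argument while the eigenvector
    equation contracts the second index of the Gram matrix.\<close>
  define \<beta> where "\<beta> j = (\<Sum>i<N. scale (cnj (b j i)) (bs ! i))" for j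
  have \<beta>V: "\<beta> j \<in> V" for j
    unfolding \<beta>_def by (rule hermitian_mem(5)[OF herm]) (use bsV hermitian_mem(3)[OF herm] in auto)
  have form: "h (\<beta> j) (\<beta> l) = (if j = l then of_real (d j) * s j else 0)" if "j < N" "l < N" for j l
  proof -
    have "h (\<beta> j) v = (\<Sum>i<N. cnj (b j i) * h (bs ! i) v)" if "v \<in> V" for v
      unfolding \<beta>_def using bsV that by (intro hermitian_combination_left[OF herm]) auto
    moreover have "h (bs ! i) (\<beta> l) = (\<Sum>i'<N. ?A $$ (i, i') * b l i')" if i: "i < N" for i
    proof -
      have "h (bs ! i) (\<beta> l) = (\<Sum>i'<N. cnj (cnj (b l i')) * h (bs ! i) (bs ! i'))"
        unfolding \<beta>_def using bsV i by (intro hermitian_combination_right[OF herm]) auto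
      then show ?thesis using Aij[OF i] by (simp add: mult.commute)
    qed
    ultimately have "h (\<beta> j) (\<beta> l) = (\<Sum>i<N. cnj (b j i) * (of_real (d l) * b l i))"
      using eig[OF that(2)] \<beta>V by simp
    also have "\<dots> = of_real (d l) * (\<Sum>i<N. b l i * cnj (b j i))"
      unfolding sum_distrib_left by (rule sum.cong) simp_all
    finally show ?thesis using orth[OF that(2,1)] by (auto simp: s_def)
  qed
  have fam: "orthogonal_family V h {..<N} \<beta>"
  proof (rule orthogonal_familyI[OF herm])
    show "h (\<beta> i) (\<beta> j) = 0" if "i \<in> {..<N}" "j \<in> {..<N}" "i \<noteq> j" for i j using form that by simp
    fix u assume u: "u \<in> V"
    obtain p where p: "u = (\<Sum>v\<in>set bs. scale (p v) v)"
      using u unfolding V[symmetric] span_finite[OF finite_set] by blast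
    have "bij_betw (\<lambda>i. bs ! i) {..<N} (set bs)" using bij_betw_nth[OF dist] by (simp add: N_def)
    from sum.reindex_bij_betw[OF this, of "\<lambda>v. scale (p v) v"]
    have u_eq: "u = (\<Sum>i<N. scale (p (bs ! i)) (bs ! i))" unfolding p by simp
    obtain q where q: "\<And>i. i < N \<Longrightarrow> cnj (p (bs ! i)) = (\<Sum>j<N. q j * b j i)"
      using complete[of "\<lambda>i. cnj (p (bs ! i))"] by blast
    have pq: "p (bs ! i) = (\<Sum>j<N. cnj (q j) * cnj (b j i))" if "i < N" for i
    proof -
      have "p (bs ! i) = cnj (cnj (p (bs ! i)))" by simp
      also have "\<dots> = (\<Sum>j<N. cnj (q j) * cnj (b j i))" unfolding q[OF that] by simp
      finally show ?thesis .
    qed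
    have "u = (\<Sum>i<N. \<Sum>j<N. scale (cnj (q j) * cnj (b j i)) (bs ! i))"
      unfolding u_eq by (rule sum.cong[OF refl]) (simp add: pq scale_sum_left)
    also have "\<dots> = (\<Sum>j<N. scale (cnj (q j)) (\<beta> j))"
      unfolding \<beta>_def scale_sum_right scale_scale by (rule sum.swap)
    finally have "h u v = (\<Sum>j<N. cnj (q j) * h (\<beta> j) v)" if "v \<in> V" for v
      using that \<beta>V hermitian_combination_left[OF herm, of "{..<N}" \<beta> v "\<lambda>j. cnj (q j)"] by simp
    then show "\<exists>q. \<forall>v\<in>V. h u v = (\<Sum>j\<in>{..<N}. q j * h (\<beta> j) v)"
      by (intro exI[of _ "\<lambda>j. cnj (q j)"] ballI)
  qed (use \<beta>V in auto)
  have "signature V h = (\<Sum>j<N. sign_re (h (\<beta> j) (\<beta> j)))"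
    by (rule signature_eq[OF herm has_signatureI[OF fam]])
  also have "\<dots> = (\<Sum>j<N. sign_re (complex_of_real (d j)))"
  proof (rule sum.cong[OF refl])
    fix j assume "j \<in> {..<N}"
    then have "0 < Re (s j)" "h (\<beta> j) (\<beta> j) = of_real (d j) * s j" using form s(1) by simp_all
    then show "sign_re (h (\<beta> j) (\<beta> j)) = sign_re (complex_of_real (d j))"
      by (simp add: sign_re_def zero_less_mult_iff mult_less_0_iff)
  qed
  finally show ?thesis using matrix_signature_diagonal[OF A cp] by simp
qed

lemma basis_list_exists:
  assumes V: "subspace V" and S: "finite S" "V \<subseteq> span S"
  shows "\<exists>bs. basis_list scale V bs"
proof -
  obtain B where B: "B \<subseteq> V" "independent B" "V \<subseteq> span B" using maximal_independent_subset by blast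
  have "finite B" using independent_span_bound[OF S(1) B(2)] B(1) S(2) by blast
  then obtain bs where bs: "set bs = B" "distinct bs" using finite_distinct_list by blast
  have "span B = V" using B(1,3) span_minimal[OF _ V] by blast
  then show ?thesis using bs B(2) unfolding basis_list_def by blast
qed

end

section \<open>The signature character\<close>

context contravariant_module
begin

lemma positive_rep_beta: "positive_rep n k rho beta"
  unfolding positive_rep_def using dunkl_form_beta beta_positive by blast

lemma form_signature_degree_part:
  "form_signature (scl M) B (degree_part n \<tau> M \<iota> m) = standard_signature n c k rho beta m"
proof -
  let ?S = "(\<lambda>p. x_monomial n M (fst p) (\<iota> (e (snd p)))) ` monomial_indices n k m"
  have "coord m u \<in> S.span ?S" for u
    unfolding coord_def by (intro S.span_sum S.span_scale S.span_base imageI)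
  then have "degree_part n \<tau> M \<iota> m \<subseteq> S.span ?S" unfolding degree_part_coord by blast
  from S.basis_list_exists[OF signature_degree_part(1) _ this] finite_monomial_indices
  have "\<exists>bs. basis_list (scl M) (degree_part n \<tau> M \<iota> m) bs" by blast
  then have "basis_list (scl M) (degree_part n \<tau> M \<iota> m) (SOME bs. basis_list (scl M) (degree_part n \<tau> M \<iota> m) bs)"
    by (rule someI_ex)
  then have "form_signature (scl M) B (degree_part n \<tau> M \<iota> m) = S.signature (degree_part n \<tau> M \<iota> m) B"
    unfolding form_signature_def
    by (rule S.matrix_signature_gram_matrix[OF hermitian_on_B[OF signature_degree_part(1)]])
  then show ?thesis unfolding signature_degree_part(2) .
qed

end

lemma signature_character_eq:
  assumes p: "Abs_fps (\<lambda>m. of_int (standard_signature n c k (specht_rho k e) b m)) * (1 - fps_X) ^ n = fps_of_poly p"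
    and b: "positive_rep n k (specht_rho k e) b" and C: "contravariant_module n c \<tau> M \<iota> B k e"
  shows "signature_character n \<tau> M \<iota> B = fps_of_poly p / (1 - fps_X) ^ n"
proof -
  interpret C: contravariant_module n c \<tau> M \<iota> B k e by fact
  have "standard_signature n c k C.rho C.beta m = standard_signature n c k C.rho b m" for m
  proof (rule standard_signature_positive_rep[OF C.positive_rep_beta b])
    fix m u assume "u \<in> hpart n k m" "\<And>v. v \<in> hpart n k m \<Longrightarrow> standard_form n c k C.rho C.beta m u v = 0"
    then show "u = 0" by (rule C.form_nondegenerate)
  qed
  then have "signature_character n \<tau> M \<iota> B = Abs_fps (\<lambda>m. of_int (standard_signature n c k C.rho b m))"
    unfolding signature_character_def C.form_signature_degree_part by simp
  \<comment> \<open>Division of power series undoes multiplication only by a nonzero factor.\<close>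
  moreover have "(1 - fps_X :: real fps) ^ n \<noteq> 0"
  proof -
    have "(1 - fps_X :: real fps) \<noteq> 0"
    proof
      assume "(1 - fps_X :: real fps) = 0"
      from arg_cong[OF this, of "\<lambda>f. fps_nth f 0"] show False by simp
    qed
    then show ?thesis by (rule power_not_zero)
  qed
  ultimately show ?thesis
    unfolding p[symmetric] by (simp only: nonzero_mult_div_cancel_right not_False_eq_True)
qed

text \<open>\<open>p\<close> must be chosen before the module and the form. If the type carries no
  such pair, any \<open>p\<close> serves; otherwise one pair provides \<open>p\<close>. Every other
  pair has the same matrices \<open>specht_rho k e\<close>, which come from the Specht module alone,
  and its form on the bottom layer is again positive.\<close>

theorem corollary1p3:
  fixes n :: nat and c :: real and \<tau> :: "nat list"
  assumes "n \<ge> 2"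
    and "is_partition n \<tau>"
    and "\<not> (\<exists>r m :: int. coprime r m \<and> 2 \<le> m \<and> m \<le> int n \<and> c = of_int r / of_int m)"
  shows "\<exists>p :: real poly.
    \<forall>(M :: 'm::ab_group_add hc_struct) \<iota> B.
      standard_module n c \<tau> M \<iota> \<longrightarrow> contravariant_form n \<tau> M \<iota> B \<longrightarrow>
      signature_character n \<tau> M \<iota> B = fps_of_poly p / (1 - fps_X) ^ n"
proof (cases "\<exists>(M :: 'm hc_struct) \<iota> B. standard_module n c \<tau> M \<iota> \<and> contravariant_form n \<tau> M \<iota> B")
  case True
  then obtain M :: "'m hc_struct" and \<iota> B where M: "standard_module n c \<tau> M \<iota>" "contravariant_form n \<tau> M \<iota> B" by blast
  obtain k e where e: "specht_basis n \<tau> k e" using specht_basis_exists by blast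
  interpret C: contravariant_module n c \<tau> M \<iota> B k e by unfold_locales (fact M e)+
  from rational_character_standard_signature[OF positive_rep_hermitian_rep[OF C.positive_rep_beta]]
  obtain p :: "real poly" where
    p: "Abs_fps (\<lambda>m. of_int (standard_signature n c k C.rho C.beta m)) * (1 - fps_X) ^ n = fps_of_poly p"
    unfolding rational_character_def by blast
  show ?thesis
  proof (intro exI[of _ p] allI impI)
    fix M' :: "'m hc_struct" and \<iota>' B'
    assume "standard_module n c \<tau> M' \<iota>'" "contravariant_form n \<tau> M' \<iota>' B'"
    then have "contravariant_module n c \<tau> M' \<iota>' B' k e" using e by (rule contravariant_module.intro)
    then show "signature_character n \<tau> M' \<iota>' B' = fps_of_poly p / (1 - fps_X) ^ n"
      by (rule signature_character_eq[OF p C.positive_rep_beta])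
  qed
qed blast

end
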